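(* Let $S$ be a compact manifold with volume form $\mu_S$, let $M$ be a manifold with $\dim S\le\dim M$, and let $\mathcal O$ be a compact Lie group with Lie algebra $\mathfrak o$. Then the group $\mathcal{A}ut(S\times\mathcal O)=\mathrm{Diff}(S)\,\circledS\,\mathcal F(S,\mathcal O)$, acting by the cotangent lifted right action, acts transitively on the level sets of the momentum map $\mathbf J_L:T^*Q_{KK}\to\mathfrak X(M)^*\times\mathcal F(M,\mathfrak o)^*$, $$\langle\mathbf J_L(\mathbf P_{\mathbf Q},\kappa_\gamma),(\mathbf u,\nu)\rangle=\int_S\big(\mathbf P_{\mathbf Q}\cdot(\mathbf u\circ\mathbf Q)+\langle\kappa_\gamma\gamma^{-1},\nu\circ\mathbf Q\rangle\big)\mu_S,\qquad (\mathbf u,\nu)\in\mathfrak X(M)\times\mathcal F(M,\mathfrak o),$$ restricted to $T^*Q_{KK}^\times$.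
   Context: All finite dimensional manifolds are smooth, Hausdorff, paracompact, without boundary; all maps are smooth. $\mathcal F(X,Y)$ is the space of smooth maps $X\to Y$, $\mathfrak X(M)$ the space of smooth vector fields; $\mathfrak X(M)^*$ and $\mathcal F(M,\mathfrak o)^*$ are distributional duals. $Q_{KK}=\mathrm{Emb}(S,M)\times\mathcal F(S,\mathcal O)$, identified with the space $\mathrm{Emb}_{\mathcal O}(S\times\mathcal O,M\times\mathcal O)$ of $\mathcal O$-equivariant embeddings via $(\mathbf Q,\gamma)\mapsto[(x,g)\mapsto(\mathbf Q(x),\gamma(x)g)]$. Tangent vectors at $(\mathbf Q,\gamma)$ are pairs $(\mathbf V_{\mathbf Q},v_\gamma)$ of smooth maps $S\to TM$, $S\to T\mathcal O$ covering $\mathbf Q,\gamma$. The (regular) cotangent space $T^*_{(\mathbf Q,\gamma)}Q_{KK}$ consists of pairs $(\mathbf P_{\mathbf Q},\kappa_\gamma)$ of smooth maps $\mathbf P_{\mathbf Q}:S\to T^*M$, $\kappa_\gamma:S\to T^*\mathcal O$ covering $\mathbf Q,\gamma$, with pairing $\int_S(\mathbf P_{\mathbf Q}\cdot\mathbf V_{\mathbf Q}+\kappa_\gamma\cdot v_\gamma)\mu_S$. $T^*Q_{KK}^\times\subset T^*Q_{KK}$ is the open subset of those $(\mathbf P_{\mathbf Q},\kappa_\gamma)$ such that for every $x\in S$ the pair $(\mathbf P_{\mathbf Q}(x),\kappa_\gamma(x))\in T^*_{\mathbf Q(x)}M\times T^*_{\gamma(x)}\mathcal O$ is non-zero. $\kappa_\gamma\gamma^{-1}\in\mathcal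 F(S,\mathfrak o^* )$ is defined by $\langle\kappa_\gamma\gamma^{-1},\xi\rangle=\langle\kappa_\gamma,\xi\gamma\rangle$ for $\xi\in\mathfrak o$. The group law of $\mathcal{A}ut(S\times\mathcal O)$ is $(\psi_1,b_1)(\psi_2,b_2)=(\psi_1\circ\psi_2,(b_1\circ\psi_2)b_2)$. It acts on $Q_{KK}$ from the right by $(\mathbf Q,\gamma)(\psi,b)=(\mathbf Q\circ\psi,(\gamma\circ\psi)b)$, and on $T^*Q_{KK}$ (preserving $T^*Q_{KK}^\times$) by the cotangent lift of this action, i.e. $\langle\alpha\cdot h,v\rangle=\langle\alpha,v\cdot h^{-1}\rangle$, where the tangent lift is $(\mathbf V_{\mathbf Q},v_\gamma)\cdot(\psi,b)=(\mathbf V_{\mathbf Q}\circ\psi,(v_\gamma\circ\psi)b)$. *)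

theory Defs
  imports "HOL-Analysis.Analysis" "HOL-Algebra.Group"
begin

section \<open>Smooth functions on open subsets of Euclidean space\<close>

primrec C_on :: "nat \<Rightarrow> ('e::euclidean_space \<Rightarrow> 'f::real_normed_vector) \<Rightarrow> 'e set \<Rightarrow> bool" where
  "C_on 0 f W \<longleftrightarrow> continuous_on W f"
| "C_on (Suc k) f W \<longleftrightarrow>
     (\<forall>x\<in>W. f differentiable (at x)) \<and> (\<forall>v. C_on k (\<lambda>x. frechet_derivative f (at x) v) W)"

definition smooth_on_open :: "'e set \<Rightarrow> ('e::euclidean_space \<Rightarrow> 'f::real_normed_vector) \<Rightarrow> bool" where
  "smooth_on_open W f \<longleftrightarrow> (\<forall>k. C_on k f W)"

section \<open>Manifolds\<close>

text \<open>
  Charts take values in the coordinate subspace \<open>span B\<close> of a Euclidean space \<open>'e\<close>, where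
  \<open>B \<subseteq> Basis\<close> is the field \<open>axes\<close>; the dimension of the manifold is \<open>card B\<close>. Since
  \<open>DIM('e) > 0\<close> for every Euclidean space type, modelling on all of \<open>'e\<close> would exclude manifolds of
  dimension 0 (finite groups, finite sets). A function on a relatively open subset of \<open>span B\<close>
  is smooth iff its composition with the orthogonal projection onto \<open>span B\<close> is smooth on the
  (open) preimage.

  A chart is a pair \<open>(U, \<phi>)\<close>; values of \<open>\<phi>\<close> outside \<open>U\<close> are irrelevant. The atlas need not be
  maximal.
\<close>

record ('a, 'e) manifold_struct =
  man_top :: "'a topology"
  axes :: "'e set"
  atlas :: "('a set \<times> ('a \<Rightarrow> 'e)) set"

abbreviation points :: "('a, 'e, 'z) manifold_struct_scheme \<Rightarrow> 'a set" where
  "points M \<equiv> topspace (man_top M)"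

definition man_dim :: "('a, 'e) manifold_struct \<Rightarrow> nat" where
  "man_dim M = card (axes M)"

definition axes_proj :: "'e set \<Rightarrow> 'e \<Rightarrow> 'e::euclidean_space" where
  "axes_proj B y = (\<Sum>b\<in>B. (y \<bullet> b) *\<^sub>R b)"

definition local_rep :: "'e set \<Rightarrow> 'a set \<times> ('a \<Rightarrow> 'e::euclidean_space) \<Rightarrow> ('a \<Rightarrow> 'f) \<Rightarrow> 'e \<Rightarrow> 'f" where
  "local_rep B c f = (\<lambda>y. f (inv_into (fst c) (snd c) (axes_proj B y)))"

definition smooth_in_chart ::
  "'e set \<Rightarrow> 'a set \<times> ('a \<Rightarrow> 'e::euclidean_space) \<Rightarrow> 'a set \<Rightarrow> ('a \<Rightarrow> 'f::real_normed_vector) \<Rightarrow> bool" where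
  "smooth_in_chart B c W f \<longleftrightarrow>
     smooth_on_open {y. axes_proj B y \<in> snd c ` (fst c \<inter> W)} (local_rep B c f)"

definition paracompact_space :: "'a topology \<Rightarrow> bool" where
  "paracompact_space X \<longleftrightarrow>
     (\<forall>\<U>. (\<forall>U\<in>\<U>. openin X U) \<and> \<Union>\<U> = topspace X \<longrightarrow>
       (\<exists>\<V>. (\<forall>V\<in>\<V>. openin X V \<and> (\<exists>U\<in>\<U>. V \<subseteq> U)) \<and> \<Union>\<V> = topspace X \<and> locally_finite_in X \<V>))"

definition smooth_manifold :: "('a, 'e::euclidean_space) manifold_struct \<Rightarrow> bool" where
  "smooth_manifold M \<longleftrightarrow>
     Hausdorff_space (man_top M) \<and> paracompact_space (man_top M) \<and>
     axes M \<subseteq> Basis \<and>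
     (\<forall>(U, \<phi>)\<in>atlas M.
        openin (man_top M) U \<and>
        openin (top_of_set (span (axes M))) (\<phi> ` U) \<and>
        homeomorphic_map (subtopology (man_top M) U) (top_of_set (\<phi> ` U)) \<phi>) \<and>
     (\<Union>(U, \<phi>)\<in>atlas M. U) = points M \<and>
     (\<forall>c\<in>atlas M. \<forall>(V, \<psi>)\<in>atlas M. smooth_in_chart (axes M) c V \<psi>)"

definition smooth_fun_on ::
  "('a, 'e::euclidean_space) manifold_struct \<Rightarrow> 'a set \<Rightarrow> ('a \<Rightarrow> 'f::real_normed_vector) \<Rightarrow> bool" where
  "smooth_fun_on M W f \<longleftrightarrow> (\<forall>c\<in>atlas M. smooth_in_chart (axes M) c W f)"

definition smooth_map ::
  "('a, 'e::euclidean_space) manifold_struct \<Rightarrow> ('b, 'f::euclidean_space) manifold_struct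
    \<Rightarrow> ('a \<Rightarrow> 'b) \<Rightarrow> bool" where
  "smooth_map M N F \<longleftrightarrow>
     continuous_map (man_top M) (man_top N) F \<and>
     (\<forall>(V, \<psi>)\<in>atlas N. smooth_fun_on M {x \<in> points M. F x \<in> V} (\<psi> \<circ> F))"

text \<open>
  The elements of spaces of maps, and of sections along a map, are taken extensional, so that
  equality of functions is equality on the carrier.
\<close>

definition smooth_maps ::
  "('a, 'e::euclidean_space) manifold_struct \<Rightarrow> ('b, 'f::euclidean_space) manifold_struct
    \<Rightarrow> ('a \<Rightarrow> 'b) set" where
  "smooth_maps M N = {F \<in> extensional (points M). smooth_map M N F}"

definition prod_manifold ::
  "('a, 'e::euclidean_space) manifold_struct \<Rightarrow> ('b, 'f::euclidean_space) manifold_struct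
    \<Rightarrow> ('a \<times> 'b, 'e \<times> 'f) manifold_struct" where
  "prod_manifold M N =
     \<lparr> man_top = prod_topology (man_top M) (man_top N),
       axes = (\<lambda>b. (b, 0)) ` axes M \<union> (\<lambda>b. (0, b)) ` axes N,
       atlas = (\<lambda>((U, \<phi>), (V, \<psi>)). (U \<times> V, map_prod \<phi> \<psi>)) ` (atlas M \<times> atlas N) \<rparr>"

section \<open>Tangent and cotangent vectors\<close>

definition smooth_funs :: "('a, 'e::euclidean_space) manifold_struct \<Rightarrow> ('a \<Rightarrow> real) set" where
  "smooth_funs M = {f. smooth_fun_on M (points M) f}"

type_synonym 'a tangent = "('a \<Rightarrow> real) \<Rightarrow> real"
type_synonym 'a cotangent = "'a tangent \<Rightarrow> real"

text \<open>
  Tangent vectors at \<open>p\<close> are derivations at \<open>p\<close> of the algebra of smooth functions, set to zero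
  outside it. (The Leibniz rule forces the value to depend only on the restriction of the function
  to the points of the manifold.)
\<close>

definition tangent_space :: "('a, 'e::euclidean_space) manifold_struct \<Rightarrow> 'a \<Rightarrow> 'a tangent set" where
  "tangent_space M p = {v.
     (\<forall>f\<in>smooth_funs M. \<forall>g\<in>smooth_funs M. \<forall>s t.
        v (\<lambda>x. s * f x + t * g x) = s * v f + t * v g) \<and>
     (\<forall>f\<in>smooth_funs M. \<forall>g\<in>smooth_funs M.
        v (\<lambda>x. f x * g x) = f p * v g + g p * v f) \<and>
     (\<forall>f. f \<notin> smooth_funs M \<longrightarrow> v f = 0)}"

definition cotangent_space :: "('a, 'e::euclidean_space) manifold_struct \<Rightarrow> 'a \<Rightarrow> 'a cotangent set" where
  "cotangent_space M p = {l.
     (\<forall>v\<in>tangent_space M p. \<forall>w\<in>tangent_space M p. \<forall>s t.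
        l (\<lambda>f. s * v f + t * w f) = s * l v + t * l w) \<and>
     (\<forall>v. v \<notin> tangent_space M p \<longrightarrow> l v = 0)}"

definition coord_vector ::
  "('a, 'e::euclidean_space) manifold_struct \<Rightarrow> 'a set \<times> ('a \<Rightarrow> 'e) \<Rightarrow> 'a \<Rightarrow> 'e \<Rightarrow> 'a tangent" where
  "coord_vector M c p b = (\<lambda>f.
     if f \<in> smooth_funs M
     then frechet_derivative (local_rep (axes M) c f) (at (snd c p)) b
     else 0)"

definition differential ::
  "('b, 'f::euclidean_space) manifold_struct \<Rightarrow> ('a \<Rightarrow> 'b) \<Rightarrow> 'a tangent \<Rightarrow> 'b tangent" where
  "differential N F v = (\<lambda>f. if f \<in> smooth_funs N then v (\<lambda>x. f (F x)) else 0)"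

text \<open>
  Smooth maps from \<open>S\<close> to \<open>TM\<close>, respectively \<open>T\<^sup>*M\<close>, covering \<open>Q\<close>: smoothness is that of the
  components in the bundle charts of \<open>TM\<close> and \<open>T\<^sup>*M\<close> induced by the charts of \<open>M\<close>.
\<close>

definition vector_fields_along ::
  "('a, 'e::euclidean_space) manifold_struct \<Rightarrow> ('b, 'f::euclidean_space) manifold_struct
    \<Rightarrow> ('a \<Rightarrow> 'b) \<Rightarrow> ('a \<Rightarrow> 'b tangent) set" where
  "vector_fields_along S M Q = {V \<in> extensional (points S).
     (\<forall>x\<in>points S. V x \<in> tangent_space M (Q x)) \<and>
     (\<forall>c\<in>atlas M. \<exists>w.
        (\<forall>b\<in>axes M. smooth_fun_on S {x \<in> points S. Q x \<in> fst c} (w b)) \<and>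
        (\<forall>x\<in>points S. Q x \<in> fst c \<longrightarrow>
           V x = (\<lambda>f. \<Sum>b\<in>axes M. w b x * coord_vector M c (Q x) b f)))}"

definition covector_fields_along ::
  "('a, 'e::euclidean_space) manifold_struct \<Rightarrow> ('b, 'f::euclidean_space) manifold_struct
    \<Rightarrow> ('a \<Rightarrow> 'b) \<Rightarrow> ('a \<Rightarrow> 'b cotangent) set" where
  "covector_fields_along S M Q = {P \<in> extensional (points S).
     (\<forall>x\<in>points S. P x \<in> cotangent_space M (Q x)) \<and>
     (\<forall>c\<in>atlas M. \<forall>b\<in>axes M.
        smooth_fun_on S {x \<in> points S. Q x \<in> fst c} (\<lambda>x. P x (coord_vector M c (Q x) b)))}"

abbreviation vector_fields :: "('a, 'e::euclidean_space) manifold_struct \<Rightarrow> ('a \<Rightarrow> 'a tangent) set" where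
  "vector_fields M \<equiv> vector_fields_along M M (\<lambda>x. x)"

definition embeddings ::
  "('a, 'e::euclidean_space) manifold_struct \<Rightarrow> ('b, 'f::euclidean_space) manifold_struct
    \<Rightarrow> ('a \<Rightarrow> 'b) set" where
  "embeddings S M = {Q \<in> smooth_maps S M.
     embedding_map (man_top S) (man_top M) Q \<and>
     (\<forall>x\<in>points S. inj_on (differential M Q) (tangent_space S x))}"

definition diffeos :: "('a, 'e::euclidean_space) manifold_struct \<Rightarrow> ('a \<Rightarrow> 'a) set" where
  "diffeos S = {\<psi> \<in> smooth_maps S S.
     bij_betw \<psi> (points S) (points S) \<and> smooth_map S S (inv_into (points S) \<psi>)}"

section \<open>Volume forms and integration\<close>

text \<open>
  An \<open>n\<close>-form on an \<open>n\<close>-dimensional manifold is evaluated on \<open>n\<close>-tuples of tangent vectors indexed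
  by the \<open>n\<close>-element set \<open>axes S\<close> rather than by \<open>{..<n}\<close>, which avoids an enumeration of the axes.
\<close>

definition tangent_tuples ::
  "('a, 'e::euclidean_space) manifold_struct \<Rightarrow> 'a \<Rightarrow> ('e \<Rightarrow> 'a tangent) set" where
  "tangent_tuples S x = {v. \<forall>b\<in>axes S. v b \<in> tangent_space S x}"

definition volume_form ::
  "('a, 'e::euclidean_space) manifold_struct \<Rightarrow> ('a \<Rightarrow> ('e \<Rightarrow> 'a tangent) \<Rightarrow> real) \<Rightarrow> bool" where
  "volume_form S \<mu> \<longleftrightarrow>
     (\<forall>x\<in>points S.
        (\<forall>v\<in>tangent_tuples S x. \<forall>w\<in>tangent_tuples S x.
           (\<forall>b\<in>axes S. v b = w b) \<longrightarrow> \<mu> x v = \<mu> x w) \<and>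
        (\<forall>v\<in>tangent_tuples S x. \<forall>b\<in>axes S.
           \<forall>u\<in>tangent_space S x. \<forall>w\<in>tangent_space S x. \<forall>s t.
             \<mu> x (v(b := (\<lambda>f. s * u f + t * w f))) = s * \<mu> x (v(b := u)) + t * \<mu> x (v(b := w))) \<and>
        (\<forall>v\<in>tangent_tuples S x. \<forall>b\<in>axes S. \<forall>b'\<in>axes S.
           b \<noteq> b' \<and> v b = v b' \<longrightarrow> \<mu> x v = 0) \<and>
        (\<exists>v\<in>tangent_tuples S x. \<mu> x v \<noteq> 0)) \<and>
     (\<forall>c\<in>atlas S. smooth_fun_on S (fst c) (\<lambda>x. \<mu> x (coord_vector S c x)))"

definition axes_lborel :: "'e set \<Rightarrow> 'e::euclidean_space measure" where
  "axes_lborel B = distr (Pi\<^sub>M B (\<lambda>_. lborel)) borel (\<lambda>t. \<Sum>b\<in>B. t b *\<^sub>R b)"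

text \<open>
  \<open>S\<close> carries the orientation given by \<open>\<mu>\<close>. In a positively oriented chart the coefficient of \<open>\<mu>\<close>
  is its absolute value, so \<open>\<integral>\<^sub>S f \<mu>\<close> is the integral of \<open>f\<close> against the Borel measure with density
  \<open>\<bar>\<mu>(\<partial>\<^sub>1, \<dots>, \<partial>\<^sub>n)\<bar>\<close> with respect to Lebesgue measure in every chart. This measure is unique on a compact \<open>S\<close>.
\<close>

definition volume_measure ::
  "('a, 'e::euclidean_space) manifold_struct \<Rightarrow> ('a \<Rightarrow> ('e \<Rightarrow> 'a tangent) \<Rightarrow> real) \<Rightarrow> 'a measure" where
  "volume_measure S \<mu> = (THE m.
     sets m = sigma_sets (points S) {U. openin (man_top S) U} \<and>
     (\<forall>(U, \<phi>)\<in>atlas S. \<forall>A\<in>sets m. A \<subseteq> U \<longrightarrow>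
        emeasure m A =
          (\<integral>\<^sup>+ y. ennreal \<bar>let x = inv_into U \<phi> y in \<mu> x (coord_vector S (U, \<phi>) x)\<bar> * indicator (\<phi> ` A) y
             \<partial>axes_lborel (axes S))))"

definition form_integral ::
  "('a, 'e::euclidean_space) manifold_struct \<Rightarrow> ('a \<Rightarrow> ('e \<Rightarrow> 'a tangent) \<Rightarrow> real)
    \<Rightarrow> ('a \<Rightarrow> real) \<Rightarrow> real" where
  "form_integral S \<mu> f = (LINT x|volume_measure S \<mu>. f x)"

section \<open>Lie groups\<close>

record ('g, 'e) lie_struct = "'g monoid" +
  lie_man :: "('g, 'e) manifold_struct"

definition lie_group :: "('g, 'e::euclidean_space) lie_struct \<Rightarrow> bool" where
  "lie_group G \<longleftrightarrow>
     group G \<and> smooth_manifold (lie_man G) \<and> points (lie_man G) = carrier G \<and>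
     smooth_map (prod_manifold (lie_man G) (lie_man G)) (lie_man G) (\<lambda>(g, h). g \<otimes>\<^bsub>G\<^esub> h) \<and>
     smooth_map (lie_man G) (lie_man G) (\<lambda>g. inv\<^bsub>G\<^esub> g)"

definition lie_algebra :: "('g, 'e::euclidean_space) lie_struct \<Rightarrow> 'g tangent set" where
  "lie_algebra G = tangent_space (lie_man G) \<one>\<^bsub>G\<^esub>"

definition right_translate :: "('g, 'e::euclidean_space) lie_struct \<Rightarrow> 'g tangent \<Rightarrow> 'g \<Rightarrow> 'g tangent" where
  "right_translate G v g = differential (lie_man G) (\<lambda>k. k \<otimes>\<^bsub>G\<^esub> g) v"

text \<open>The element \<open>l g\<^sup>-\<^sup>1\<close> of the dual of the Lie algebra, for a covector \<open>l\<close> at \<open>g\<close>.\<close>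

definition right_trivialize :: "('g, 'e::euclidean_space) lie_struct \<Rightarrow> 'g cotangent \<Rightarrow> 'g \<Rightarrow> 'g cotangent" where
  "right_trivialize G l g = (\<lambda>\<xi>. if \<xi> \<in> lie_algebra G then l (right_translate G \<xi> g) else 0)"

text \<open>
  A smooth function with values in the Lie algebra is a smooth map into the tangent bundle covering
  the constant map to the identity.
\<close>

definition lie_algebra_maps ::
  "('a, 'e::euclidean_space) manifold_struct \<Rightarrow> ('g, 'f::euclidean_space) lie_struct
    \<Rightarrow> ('a \<Rightarrow> 'g tangent) set" where
  "lie_algebra_maps M G = vector_fields_along M (lie_man G) (\<lambda>_. \<one>\<^bsub>G\<^esub>)"

section \<open>The Kaluza-Klein configuration space and its regular cotangent bundle\<close>

definition Q_KK ::
  "('s, 'es::euclidean_space) manifold_struct \<Rightarrow> ('m, 'em::euclidean_space) manifold_struct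
    \<Rightarrow> ('g, 'eg::euclidean_space) lie_struct \<Rightarrow> (('s \<Rightarrow> 'm) \<times> ('s \<Rightarrow> 'g)) set" where
  "Q_KK S M G = embeddings S M \<times> smooth_maps S (lie_man G)"

definition tangent_Q ::
  "('s, 'es::euclidean_space) manifold_struct \<Rightarrow> ('m, 'em::euclidean_space) manifold_struct
    \<Rightarrow> ('g, 'eg::euclidean_space) lie_struct \<Rightarrow> ('s \<Rightarrow> 'm) \<times> ('s \<Rightarrow> 'g)
    \<Rightarrow> (('s \<Rightarrow> 'm tangent) \<times> ('s \<Rightarrow> 'g tangent)) set" where
  "tangent_Q S M G q =
     vector_fields_along S M (fst q) \<times> vector_fields_along S (lie_man G) (snd q)"

definition cotangent_Q ::
  "('s, 'es::euclidean_space) manifold_struct \<Rightarrow> ('m, 'em::euclidean_space) manifold_struct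
    \<Rightarrow> ('g, 'eg::euclidean_space) lie_struct \<Rightarrow> ('s \<Rightarrow> 'm) \<times> ('s \<Rightarrow> 'g)
    \<Rightarrow> (('s \<Rightarrow> 'm cotangent) \<times> ('s \<Rightarrow> 'g cotangent)) set" where
  "cotangent_Q S M G q =
     covector_fields_along S M (fst q) \<times> covector_fields_along S (lie_man G) (snd q)"

text \<open>Elements of the cotangent bundle carry their base point: \<open>((Q, \<gamma>), (P, \<kappa>))\<close>.\<close>

type_synonym ('s, 'm, 'g) cotangent_KK =
  "(('s \<Rightarrow> 'm) \<times> ('s \<Rightarrow> 'g)) \<times> (('s \<Rightarrow> 'm cotangent) \<times> ('s \<Rightarrow> 'g cotangent))"

definition cotangent_bundle_Q ::
  "('s, 'es::euclidean_space) manifold_struct \<Rightarrow> ('m, 'em::euclidean_space) manifold_struct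
    \<Rightarrow> ('g, 'eg::euclidean_space) lie_struct \<Rightarrow> ('s, 'm, 'g) cotangent_KK set" where
  "cotangent_bundle_Q S M G = (SIGMA q : Q_KK S M G. cotangent_Q S M G q)"

definition cotangent_bundle_Q_nz ::
  "('s, 'es::euclidean_space) manifold_struct \<Rightarrow> ('m, 'em::euclidean_space) manifold_struct
    \<Rightarrow> ('g, 'eg::euclidean_space) lie_struct \<Rightarrow> ('s, 'm, 'g) cotangent_KK set" where
  "cotangent_bundle_Q_nz S M G =
     {(q, (P, \<kappa>)) \<in> cotangent_bundle_Q S M G.
        \<forall>x\<in>points S. P x \<noteq> (\<lambda>_. 0) \<or> \<kappa> x \<noteq> (\<lambda>_. 0)}"

definition pairing_Q ::
  "('s, 'es::euclidean_space) manifold_struct \<Rightarrow> ('s \<Rightarrow> ('es \<Rightarrow> 's tangent) \<Rightarrow> real)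
    \<Rightarrow> ('s \<Rightarrow> 'm cotangent) \<times> ('s \<Rightarrow> 'g cotangent)
    \<Rightarrow> ('s \<Rightarrow> 'm tangent) \<times> ('s \<Rightarrow> 'g tangent) \<Rightarrow> real" where
  "pairing_Q S \<mu> = (\<lambda>(P, \<kappa>) (V, v). form_integral S \<mu> (\<lambda>x. P x (V x) + \<kappa> x (v x)))"

section \<open>The automorphism group and its actions\<close>

definition aut_group ::
  "('s, 'es::euclidean_space) manifold_struct \<Rightarrow> ('g, 'eg::euclidean_space) lie_struct
    \<Rightarrow> (('s \<Rightarrow> 's) \<times> ('s \<Rightarrow> 'g)) monoid" where
  "aut_group S G =
     \<lparr> carrier = diffeos S \<times> smooth_maps S (lie_man G),
       mult = (\<lambda>(\<psi>1, b1) (\<psi>2, b2).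
         (\<lambda>x\<in>points S. \<psi>1 (\<psi>2 x), \<lambda>x\<in>points S. b1 (\<psi>2 x) \<otimes>\<^bsub>G\<^esub> b2 x)),
       one = (\<lambda>x\<in>points S. x, \<lambda>x\<in>points S. \<one>\<^bsub>G\<^esub>) \<rparr>"

definition act_Q ::
  "('s, 'es::euclidean_space) manifold_struct \<Rightarrow> ('g, 'eg::euclidean_space) lie_struct
    \<Rightarrow> ('s \<Rightarrow> 'm) \<times> ('s \<Rightarrow> 'g) \<Rightarrow> ('s \<Rightarrow> 's) \<times> ('s \<Rightarrow> 'g) \<Rightarrow> ('s \<Rightarrow> 'm) \<times> ('s \<Rightarrow> 'g)" where
  "act_Q S G = (\<lambda>(Q, \<gamma>) (\<psi>, b).
     (\<lambda>x\<in>points S. Q (\<psi> x), \<lambda>x\<in>points S. \<gamma> (\<psi> x) \<otimes>\<^bsub>G\<^esub> b x))"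

definition tangent_act_Q ::
  "('s, 'es::euclidean_space) manifold_struct \<Rightarrow> ('g, 'eg::euclidean_space) lie_struct
    \<Rightarrow> ('s \<Rightarrow> 'm tangent) \<times> ('s \<Rightarrow> 'g tangent) \<Rightarrow> ('s \<Rightarrow> 's) \<times> ('s \<Rightarrow> 'g)
    \<Rightarrow> ('s \<Rightarrow> 'm tangent) \<times> ('s \<Rightarrow> 'g tangent)" where
  "tangent_act_Q S G = (\<lambda>(V, v) (\<psi>, b).
     (\<lambda>x\<in>points S. V (\<psi> x), \<lambda>x\<in>points S. right_translate G (v (\<psi> x)) (b x)))"

text \<open>
  The cotangent lift \<open>\<alpha> \<cdot> h\<close> of \<open>\<alpha> = (q, a)\<close> is the regular covector at \<open>q \<cdot> h\<close> with
  \<open>\<langle>\<alpha> \<cdot> h, v\<rangle> = \<langle>\<alpha>, v \<cdot> h\<^sup>-\<^sup>1\<rangle>\<close> for all tangent vectors \<open>v\<close> at \<open>q \<cdot> h\<close>.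
\<close>

definition cotangent_act_Q ::
  "('s, 'es::euclidean_space) manifold_struct \<Rightarrow> ('s \<Rightarrow> ('es \<Rightarrow> 's tangent) \<Rightarrow> real)
    \<Rightarrow> ('m, 'em::euclidean_space) manifold_struct \<Rightarrow> ('g, 'eg::euclidean_space) lie_struct
    \<Rightarrow> ('s, 'm, 'g) cotangent_KK \<Rightarrow> ('s \<Rightarrow> 's) \<times> ('s \<Rightarrow> 'g) \<Rightarrow> ('s, 'm, 'g) cotangent_KK" where
  "cotangent_act_Q S \<mu> M G = (\<lambda>(q, a) h.
     (act_Q S G q h,
      THE a'. a' \<in> cotangent_Q S M G (act_Q S G q h) \<and>
        (\<forall>v\<in>tangent_Q S M G (act_Q S G q h).
           pairing_Q S \<mu> a' v =
           pairing_Q S \<mu> a (tangent_act_Q S G v (inv\<^bsub>aut_group S G\<^esub> h)))))"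

definition right_action :: "'h monoid \<Rightarrow> 'x set \<Rightarrow> ('x \<Rightarrow> 'h \<Rightarrow> 'x) \<Rightarrow> bool" where
  "right_action H X act \<longleftrightarrow>
     group H \<and>
     (\<forall>x\<in>X. \<forall>h\<in>carrier H. act x h \<in> X) \<and>
     (\<forall>x\<in>X. act x \<one>\<^bsub>H\<^esub> = x) \<and>
     (\<forall>x\<in>X. \<forall>h\<in>carrier H. \<forall>k\<in>carrier H. act x (h \<otimes>\<^bsub>H\<^esub> k) = act (act x h) k)"

definition transitive_right_action :: "'h monoid \<Rightarrow> 'x set \<Rightarrow> ('x \<Rightarrow> 'h \<Rightarrow> 'x) \<Rightarrow> bool" where
  "transitive_right_action H X act \<longleftrightarrow>
     right_action H X act \<and> (\<forall>x\<in>X. \<forall>y\<in>X. \<exists>h\<in>carrier H. act x h = y)"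

section \<open>The momentum map\<close>

text \<open>
  Values of the momentum map are functionals on the product of the vector fields and the Lie algebra
  valued functions on \<open>M\<close>, represented as extensional functions on that product.
\<close>

definition momentum_map_L ::
  "('s, 'es::euclidean_space) manifold_struct \<Rightarrow> ('s \<Rightarrow> ('es \<Rightarrow> 's tangent) \<Rightarrow> real)
    \<Rightarrow> ('m, 'em::euclidean_space) manifold_struct \<Rightarrow> ('g, 'eg::euclidean_space) lie_struct
    \<Rightarrow> ('s, 'm, 'g) cotangent_KK \<Rightarrow> ('m \<Rightarrow> 'm tangent) \<times> ('m \<Rightarrow> 'g tangent) \<Rightarrow> real" where
  "momentum_map_L S \<mu> M G = (\<lambda>((Q, \<gamma>), (P, \<kappa>)).
     \<lambda>(u, \<nu>)\<in>vector_fields M \<times> lie_algebra_maps M G.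
       form_integral S \<mu> (\<lambda>x. P x (u (Q x)) + right_trivialize G (\<kappa> x) (\<gamma> x) (\<nu> (Q x))))"

end

theory Submission
  imports Defs
begin

text \<open>
  Let \<open>(q, a)\<close> and \<open>(q', a')\<close>, with \<open>q = (Q, \<gamma>)\<close> and \<open>q' = (Q', \<gamma>')\<close>, have the same momentum. Testing the
  momentum on pairs \<open>(u, \<nu>)\<close> concentrated near \<open>Q x\<close> detects every non-zero value of \<open>a\<close>: since \<open>Q\<close> is a
  topological embedding, a bump function on \<open>M\<close> localizes the integral over \<open>S\<close> near \<open>x\<close>. Because \<open>a\<close>
  vanishes nowhere, \<open>Q(S)\<close> is the support of the momentum, so \<open>Q(S) = Q'(S)\<close>, and
  \<open>\<psi> = Q\<^sup>-\<^sup>1 \<circ> Q'\<close> is a diffeomorphism of \<open>S\<close> by the inverse function theorem. With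
  \<open>b = (\<gamma> \<circ> \<psi>)\<^sup>-\<^sup>1 \<gamma>'\<close> this gives \<open>q (\<psi>, b) = q'\<close>. The momentum is invariant under the action, and the same
  localization argument shows that it is injective on each cotangent space, whence \<open>a (\<psi>, b) = a'\<close>.

  The cotangent lift is defined by a definite description. A covector field with the required pairings
  is \<open>x \<mapsto> j x (a (\<psi> x))\<close>, right translated by \<open>b x\<close> in the second component, where \<open>j\<close> is the Jacobian
  of \<open>\<psi>\<close> with respect to \<open>\<mu>\<close>; so its smoothness and the change of variables on \<open>S\<close> are needed. Uniqueness
  is again the localization argument. The measure of \<open>\<mu>\<close> is a definite description, too; it exists because
  the densities in different charts agree by the change of variables theorem.
\<close>

section \<open>Differential calculus on Euclidean spaces\<close>

section \<open>Smooth functions near a point\<close>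

text \<open>Invariance and injectivity of the momentum rest on one family of tangent vectors, the
  \<open>generator\<close> of a test pair at q. Test pairs are infinitesimal automorphisms of the
  product of M with the group. These act from the left and commute with the right action of
  \<open>aut_group\<close>, so the right action carries generators to generators and preserves the
  pairings with them. Generators already separate covectors at q; hence uniqueness of the lifted
  covector and injectivity of the momentum on a cotangent space are a single argument. The laws of
  the lifted action also follow from this uniqueness, rather than from a chain rule for Jacobians.

  The encoding shapes the preparations. Tangent vectors are derivations of globally defined
  functions, so their coordinates come from Hadamard's lemma and from extending germs, and smooth
  fields are recognized by their action on functions. Charts take values in a coordinate subspace,
  so local representatives are composed with the projection onto it, and integrals over it are
  compared with integrals over the whole space.\<close>

lemma C_on_transfer:
  assumes "open W" "\<And>x. x \<in> W \<Longrightarrow> f x = g x" "C_on k f W"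
  shows "C_on k g W"
  using assms(2,3)
proof (induction k arbitrary: f g)
  case 0
  then show ?case by (simp cong: continuous_on_cong)
next
  case (Suc k)
  have d: "(g has_derivative frechet_derivative f (at x)) (at x)" if "x \<in> W" for x
    using Suc.prems(2) that
    by (intro has_derivative_transform_within_open[OF _ \<open>open W\<close> that Suc.prems(1)])
       (auto simp: frechet_derivative_works[symmetric])
  have e: "frechet_derivative f (at x) = frechet_derivative g (at x)" if "x \<in> W" for x
    using frechet_derivative_at[OF d[OF that]] .
  have "C_on k (\<lambda>x. frechet_derivative g (at x) v) W" for v
    by (rule Suc.IH[where f = "\<lambda>x. frechet_derivative f (at x) v"]) (use e Suc.prems in auto)
  then show ?case using d by (auto simp: differentiable_def)
qed

lemma C_on_subset: "C_on k f W \<Longrightarrow> U \<subseteq> W \<Longrightarrow> C_on k f U"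
  by (induction k arbitrary: f) (auto intro: continuous_on_subset)

text \<open>\<open>C_on\<close> takes derivatives with \<open>at x\<close> and not within the set,
  so they do not depend on the set. The induction only has to localize continuity at its
  bottom.\<close>

lemma C_on_local:
  assumes "open W" "\<And>x. x \<in> W \<Longrightarrow> \<exists>U. open U \<and> x \<in> U \<and> C_on k f U"
  shows "C_on k f W"
  using assms(2)
proof (induction k arbitrary: f)
  case 0
  have "isCont f x" if "x \<in> W" for x
    using 0[OF that] continuous_on_eq_continuous_at by auto
  then show ?case by (simp add: continuous_at_imp_continuous_on)
next
  case (Suc k)
  have "C_on k (\<lambda>x. frechet_derivative f (at x) v) W" for v
    by (rule Suc.IH) (use Suc.prems in fastforce)
  moreover have "f differentiable at x" if "x \<in> W" for x using Suc.prems that by fastforce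
  ultimately show ?case by auto
qed

lemma C_on_SucD: "C_on (Suc k) f W \<Longrightarrow> C_on k f W"
proof (induction k arbitrary: f)
  case 0
  then show ?case
    by (auto intro!: continuous_at_imp_continuous_on differentiable_imp_continuous_within)
next
  case (Suc k)
  have "C_on (Suc k) (\<lambda>x. frechet_derivative f (at x) v) W" for v using Suc.prems by simp
  then have "C_on k (\<lambda>x. frechet_derivative f (at x) v) W" for v using Suc.IH by blast
  then show ?case using Suc.prems by simp
qed

lemma C_on_const: "C_on k (\<lambda>x. c) W"
  by (induction k arbitrary: c) (auto simp: frechet_derivative_const)

lemma C_on_bounded_linear:
  assumes "bounded_linear f" shows "C_on k f W"
proof (cases k)
  case 0
  then show ?thesis by (auto intro: linear_continuous_on assms)
next
  case (Suc n)
  have "(f has_derivative f) (at x)" for x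
    using assms by (simp add: bounded_linear_imp_has_derivative)
  then have "f differentiable at x" "frechet_derivative f (at x) = f" for x
    by (auto simp: differentiable_def frechet_derivative_at[symmetric])
  then show ?thesis by (simp add: Suc C_on_const)
qed

text \<open>Uniqueness of derivatives lets any explicit formula \<open>f'\<close> stand in for the
  choice operator \<open>frechet_derivative\<close>. Most closure properties below are proved
  through this rule.\<close>

lemma C_on_SucI:
  assumes "open W" "\<And>x. x \<in> W \<Longrightarrow> (f has_derivative f' x) (at x)"
    "\<And>v. C_on k (\<lambda>x. f' x v) W"
  shows "C_on (Suc k) f W"
proof -
  have e: "f' x = frechet_derivative f (at x)" if "x \<in> W" for x
    using frechet_derivative_at[OF assms(2)[OF that]] .
  have "C_on k (\<lambda>x. frechet_derivative f (at x) v) W" for v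
    by (rule C_on_transfer[OF assms(1) _ assms(3)[of v]]) (use e in auto)
  then show ?thesis using assms(2) by (auto simp: differentiable_def)
qed

lemma C_on_has_derivative:
  assumes "C_on (Suc k) f W" "x \<in> W"
  shows "(f has_derivative frechet_derivative f (at x)) (at x)"
  using assms by (simp add: frechet_derivative_works[symmetric])

lemma C_on_add:
  assumes "open W" "C_on k f W" "C_on k g W"
  shows "C_on k (\<lambda>x. f x + g x) W"
  using assms(2,3)
proof (induction k arbitrary: f g)
  case 0
  then show ?case by (auto intro: continuous_on_add)
next
  case (Suc k)
  show ?case
    by (rule C_on_SucI[OF assms(1), where
          f' = "\<lambda>x v. frechet_derivative f (at x) v + frechet_derivative g (at x) v"])
       (use Suc.prems in \<open>auto intro!: has_derivative_add Suc.IH simp: frechet_derivative_works[symmetric]\<close>)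
qed

text \<open>Each term of the product rule pairs a derivative with an undifferentiated factor, and
  \<open>C_on_SucD\<close> lowers the latter to order k, where the induction hypothesis applies. A
  general bilinear product covers scalar multiples, inner products and real products at
  once.\<close>

lemma C_on_bilinear:
  assumes "open W" "bounded_bilinear prd" "C_on k f W" "C_on k g W"
  shows "C_on k (\<lambda>x. prd (f x) (g x)) W"
  using assms(3,4)
proof (induction k arbitrary: f g)
  case 0
  then show ?case using assms(2) by (auto intro: bounded_bilinear.continuous_on)
next
  case (Suc k)
  have "C_on k f W" "C_on k g W" using Suc.prems C_on_SucD by blast+
  then show ?case
    by (intro C_on_SucI[OF assms(1), where
          f' = "\<lambda>x v. prd (f x) (frechet_derivative g (at x) v) + prd (frechet_derivative f (at x) v) (g x)"])
       (use Suc.prems in \<open>auto intro!: bounded_bilinear.FDERIV[OF assms(2)] C_on_add[OF assms(1)] Suc.IH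
         simp: frechet_derivative_works[symmetric]\<close>)
qed

lemma C_on_sum:
  assumes "open W" "\<And>i. i \<in> I \<Longrightarrow> C_on k (f i) W"
  shows "C_on k (\<lambda>x. \<Sum>i\<in>I. f i x) W"
proof (cases "finite I")
  case True
  then show ?thesis using assms(2)
    by induction (auto intro: C_on_const C_on_add assms(1))
qed (auto intro: C_on_const)

lemma linear_Basis_expansion:
  fixes f :: "'a::euclidean_space \<Rightarrow> 'b::real_vector"
  assumes "linear f"
  shows "f v = (\<Sum>b\<in>Basis. (v \<bullet> b) *\<^sub>R f b)"
proof -
  have "f v = f (\<Sum>b\<in>Basis. (v \<bullet> b) *\<^sub>R b)" by (simp add: euclidean_representation)
  also have "\<dots> = (\<Sum>b\<in>Basis. (v \<bullet> b) *\<^sub>R f b)"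
    using assms by (simp add: linear_sum linear_scale)
  finally show ?thesis .
qed

text \<open>The chain rule evaluates the derivative of g on the moving vector
  \<open>?Df x v\<close>, whereas \<open>C_on\<close> controls it only in fixed directions.
  Expanding the moving vector in the standard basis leaves a finite sum of products of controlled
  functions.\<close>

lemma C_on_compose:
  fixes f :: "'a::euclidean_space \<Rightarrow> 'b::euclidean_space" and g :: "'b \<Rightarrow> 'c::real_normed_vector"
  assumes "open W" "open V" "f ` W \<subseteq> V" "C_on k g V" "C_on k f W"
  shows "C_on k (\<lambda>x. g (f x)) W"
  using assms(4,5)
proof (induction k arbitrary: g)
  case 0
  then show ?case using assms(3) by (auto intro: continuous_on_compose2)
next
  case (Suc k)
  let ?Df = "\<lambda>x. frechet_derivative f (at x)" and ?Dg = "\<lambda>x. frechet_derivative g (at x)"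
  have dg: "(g has_derivative ?Dg y) (at y)" if "y \<in> V" for y
    using C_on_has_derivative Suc.prems(1) that by blast
  have df: "(f has_derivative ?Df y) (at y)" if "y \<in> W" for y
    using C_on_has_derivative Suc.prems(2) that by blast
  have d: "((\<lambda>x. g (f x)) has_derivative (\<lambda>v. \<Sum>b\<in>Basis. (?Df x v \<bullet> b) *\<^sub>R ?Dg (f x) b)) (at x)"
    if x: "x \<in> W" for x
  proof -
    have fx: "f x \<in> V" using x assms(3) by auto
    have "((\<lambda>x. g (f x)) has_derivative (\<lambda>v. ?Dg (f x) (?Df x v))) (at x)"
      using has_derivative_compose[OF df[OF x] dg[OF fx]] .
    moreover have "?Dg (f x) (?Df x v) = (\<Sum>b\<in>Basis. (?Df x v \<bullet> b) *\<^sub>R ?Dg (f x) b)" for v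
      by (rule linear_Basis_expansion) (use dg[OF fx] has_derivative_linear in blast)
    ultimately show ?thesis by simp
  qed
  have f: "C_on k f W" using Suc.prems C_on_SucD by blast
  have "C_on k (\<lambda>x. \<Sum>b\<in>Basis. (?Df x v \<bullet> b) *\<^sub>R ?Dg (f x) b) W" for v
  proof (intro C_on_sum[OF assms(1)] C_on_bilinear[OF assms(1) bounded_bilinear_scaleR])
    fix b :: 'b
    show "C_on k (\<lambda>x. ?Df x v \<bullet> b) W"
      by (rule C_on_bilinear[OF assms(1) bounded_bilinear_inner _ C_on_const]) (use Suc.prems in simp)
    show "C_on k (\<lambda>x. ?Dg (f x) b) W"
      by (rule Suc.IH) (use Suc.prems f in auto)
  qed
  then show ?case using C_on_SucI[OF assms(1) d] by blast
qed

text \<open>Smoothness as a property of the germ at a point: the closure rules need not carry a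
  common open set, and equality near the point suffices for transfer.\<close>

definition smooth_at :: "('e::euclidean_space \<Rightarrow> 'f::real_normed_vector) \<Rightarrow> 'e \<Rightarrow> bool" where
  "smooth_at f x \<longleftrightarrow> (\<exists>W. open W \<and> x \<in> W \<and> smooth_on_open W f)"

lemma smooth_on_open_iff_smooth_at:
  assumes "open W"
  shows "smooth_on_open W f \<longleftrightarrow> (\<forall>x\<in>W. smooth_at f x)"
proof
  assume "smooth_on_open W f"
  then show "\<forall>x\<in>W. smooth_at f x" unfolding smooth_at_def using assms by blast
next
  assume *: "\<forall>x\<in>W. smooth_at f x"
  show "smooth_on_open W f"
    unfolding smooth_on_open_def
  proof
    fix k show "C_on k f W"
      by (rule C_on_local[OF assms]) (use * in \<open>unfold smooth_at_def smooth_on_open_def, blast\<close>)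
  qed
qed

lemma smooth_atE2:
  assumes "smooth_at f x" "smooth_at g x"
  obtains W where "open W" "x \<in> W" "\<And>k. C_on k f W" "\<And>k. C_on k g W"
proof -
  obtain U V where "open U" "x \<in> U" "\<And>k. C_on k f U" "open V" "x \<in> V" "\<And>k. C_on k g V"
    using assms unfolding smooth_at_def smooth_on_open_def by blast
  then show ?thesis
    by (intro that[of "U \<inter> V"]) (auto intro: C_on_subset)
qed

lemma smooth_atI: "open W \<Longrightarrow> x \<in> W \<Longrightarrow> (\<And>k. C_on k f W) \<Longrightarrow> smooth_at f x"
  unfolding smooth_at_def smooth_on_open_def by blast

lemma smooth_at_eventually:
  assumes "smooth_at f x" shows "eventually (smooth_at f) (nhds x)"
  using assms unfolding smooth_at_def eventually_nhds by blast

lemma smooth_at_cong: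
  assumes "smooth_at f x" "eventually (\<lambda>y. f y = g y) (nhds x)"
  shows "smooth_at g x"
proof -
  obtain W where W: "open W" "x \<in> W" "\<And>k. C_on k f W" using smooth_atE2[OF assms(1) assms(1)] by metis
  obtain V where V: "open V" "x \<in> V" "\<And>y. y \<in> V \<Longrightarrow> f y = g y"
    using assms(2) unfolding eventually_nhds by blast
  have WV: "open (W \<inter> V)" using W V by blast
  have "C_on k g (W \<inter> V)" for k
    by (rule C_on_transfer[OF WV, of f]) (use V in \<open>auto intro: C_on_subset[OF W(3)]\<close>)
  then show ?thesis using W V by (intro smooth_atI[OF WV]) auto
qed

named_theorems smooth_intros

lemma smooth_at_const [smooth_intros]: "smooth_at (\<lambda>x. c) x"
  by (rule smooth_atI[of UNIV]) (auto intro: C_on_const)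

lemma smooth_at_bounded_linear: "bounded_linear f \<Longrightarrow> smooth_at f x"
  by (rule smooth_atI[of UNIV]) (auto intro: C_on_bounded_linear)

lemma smooth_at_id [smooth_intros]: "smooth_at (\<lambda>x. x) x"
  by (rule smooth_at_bounded_linear) (rule bounded_linear_ident)

lemma smooth_at_add [smooth_intros]:
  assumes "smooth_at f x" "smooth_at g x" shows "smooth_at (\<lambda>x. f x + g x) x"
proof -
  obtain W where "open W" "x \<in> W" "\<And>k. C_on k f W" "\<And>k. C_on k g W"
    by (rule smooth_atE2[OF assms]) blast
  then show ?thesis by (intro smooth_atI[of W] C_on_add) auto
qed

lemma smooth_at_bilinear:
  assumes "bounded_bilinear prd" "smooth_at f x" "smooth_at g x"
  shows "smooth_at (\<lambda>x. prd (f x) (g x)) x"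
proof -
  obtain W where "open W" "x \<in> W" "\<And>k. C_on k f W" "\<And>k. C_on k g W"
    by (rule smooth_atE2[OF assms(2,3)]) blast
  then show ?thesis using C_on_bilinear[OF _ assms(1)] by (intro smooth_atI[of W]) blast+
qed

lemmas smooth_at_scaleR [smooth_intros] = smooth_at_bilinear[OF bounded_bilinear_scaleR]
lemmas smooth_at_inner [smooth_intros] = smooth_at_bilinear[OF bounded_bilinear_inner]

lemma smooth_at_mult [smooth_intros]:
  fixes f g :: "_ \<Rightarrow> real"
  shows "smooth_at f x \<Longrightarrow> smooth_at g x \<Longrightarrow> smooth_at (\<lambda>x. f x * g x) x"
  by (rule smooth_at_bilinear[OF bounded_bilinear_mult])

lemma smooth_at_uminus [smooth_intros]: "smooth_at f x \<Longrightarrow> smooth_at (\<lambda>x. - f x) x"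
  using smooth_at_scaleR[OF smooth_at_const[of "-1"], of f] by simp

lemma smooth_at_diff [smooth_intros]:
  "smooth_at f x \<Longrightarrow> smooth_at g x \<Longrightarrow> smooth_at (\<lambda>x. f x - g x) x"
  using smooth_at_add[of f x "\<lambda>x. - g x"] smooth_at_uminus[of g] by simp

lemma smooth_at_sum [smooth_intros]:
  assumes "\<And>i. i \<in> I \<Longrightarrow> smooth_at (f i) x"
  shows "smooth_at (\<lambda>x. \<Sum>i\<in>I. f i x) x"
proof (cases "finite I")
  case True
  then show ?thesis using assms by induction (auto intro: smooth_intros)
qed (auto intro: smooth_intros)

lemma smooth_at_prod [smooth_intros]:
  fixes f :: "'i \<Rightarrow> 'a::euclidean_space \<Rightarrow> real"
  assumes "\<And>i. i \<in> I \<Longrightarrow> smooth_at (f i) x"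
  shows "smooth_at (\<lambda>x. \<Prod>i\<in>I. f i x) x"
proof (cases "finite I")
  case True
  then show ?thesis using assms by induction (auto intro: smooth_intros)
qed (auto intro: smooth_intros)

lemma smooth_at_isCont: "smooth_at f x \<Longrightarrow> isCont f x"
  unfolding smooth_at_def smooth_on_open_def
  using C_on.simps(1) continuous_on_eq_continuous_at by blast

lemma smooth_at_has_derivative:
  "smooth_at f x \<Longrightarrow> (f has_derivative frechet_derivative f (at x)) (at x)"
  unfolding smooth_at_def smooth_on_open_def using C_on_has_derivative by blast

lemma smooth_at_derivative:
  "smooth_at f x \<Longrightarrow> smooth_at (\<lambda>y. frechet_derivative f (at y) v) x"
  unfolding smooth_at_def smooth_on_open_def using C_on.simps(2) by blast

lemma smooth_at_compose:
  fixes f :: "'a::euclidean_space \<Rightarrow> 'b::euclidean_space"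
  assumes "smooth_at g (f x)" "smooth_at f x"
  shows "smooth_at (\<lambda>y. g (f y)) x"
proof -
  obtain V where V: "open V" "f x \<in> V" "\<And>k. C_on k g V" using smooth_atE2[OF assms(1) assms(1)] by metis
  obtain W where W: "open W" "x \<in> W" "\<And>k. C_on k f W" using smooth_atE2[OF assms(2) assms(2)] by metis
  have o: "open (W \<inter> f -` V)"
    using W(1) V(1) W(3)[of 0] by (simp add: continuous_open_preimage)
  show ?thesis
  proof (rule smooth_atI[OF o])
    show "x \<in> W \<inter> f -` V" using V W by auto
    show "C_on k (\<lambda>y. g (f y)) (W \<inter> f -` V)" for k
      by (rule C_on_compose[OF o V(1) _ V(3)]) (auto intro: C_on_subset[OF W(3)])
  qed
qed

lemma smooth_at_Pair [smooth_intros]: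
  fixes f :: "'a::euclidean_space \<Rightarrow> 'b::euclidean_space" and g :: "'a \<Rightarrow> 'c::euclidean_space"
  assumes "smooth_at f x" "smooth_at g x"
  shows "smooth_at (\<lambda>x. (f x, g x)) x"
proof -
  have "smooth_at (\<lambda>z::'b. (z, 0::'c)) (f x)" "smooth_at (\<lambda>z::'c. (0::'b, z)) (g x)"
    by (auto intro!: smooth_at_bounded_linear bounded_linear_Pair bounded_linear_ident bounded_linear_zero)
  then have "smooth_at (\<lambda>y. (f y, 0) + (0, g y)) x"
    using assms by (intro smooth_at_add) (auto intro: smooth_at_compose)
  then show ?thesis by simp
qed

section \<open>Inverses and bump functions\<close>

text \<open>The derivative of the reciprocal is a product of reciprocals, so the induction closes on
  the same function.\<close>

lemma C_on_inverse: "C_on k inverse (UNIV - {0::real})"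
proof (induction k)
  case 0
  then show ?case by (auto intro!: continuous_on_inverse continuous_on_id)
next
  case (Suc k)
  have o: "open (UNIV - {0::real})" by (simp add: open_delete)
  show ?case
  proof (rule C_on_SucI[OF o, where f' = "\<lambda>x v. (- v) * (inverse x * inverse x)"])
    show "C_on k (\<lambda>x. (- v) * (inverse x * inverse x)) (UNIV - {0})" for v :: real
      by (intro C_on_bilinear[OF o bounded_bilinear_mult] C_on_const Suc.IH)
  qed (auto intro!: derivative_eq_intros)
qed

lemma smooth_at_inverse [smooth_intros]:
  fixes f :: "'a::euclidean_space \<Rightarrow> real"
  assumes "smooth_at f x" "f x \<noteq> 0"
  shows "smooth_at (\<lambda>y. inverse (f y)) x"
proof -
  have "smooth_at inverse (f x)"
    by (rule smooth_atI[of "UNIV - {0}"]) (use assms C_on_inverse in \<open>auto simp: open_delete\<close>)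
  then show ?thesis using assms smooth_at_compose by blast
qed

lemma smooth_at_divide [smooth_intros]:
  fixes f :: "'a::euclidean_space \<Rightarrow> real"
  assumes "smooth_at f x" "smooth_at g x" "g x \<noteq> 0"
  shows "smooth_at (\<lambda>y. f y / g y) x"
  unfolding divide_inverse using assms by (intro smooth_intros)

text \<open>The sign of f is constant near a point where f does not vanish, so there the absolute
  value is a constant multiple of f.\<close>

lemma smooth_at_abs:
  fixes f :: "'a::euclidean_space \<Rightarrow> real"
  assumes "smooth_at f x" "f x \<noteq> 0"
  shows "smooth_at (\<lambda>y. \<bar>f y\<bar>) x"
proof (rule smooth_at_cong)
  show "smooth_at (\<lambda>y. sgn (f x) * f y) x" using assms by (intro smooth_intros)
  have "isCont f x" using assms smooth_at_isCont by blast
  \<comment> \<open>The ball of radius \<open>\<bar>f x\<bar>\<close> around \<open>f x\<close> is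
    the largest one that avoids 0 and hence excludes a change of sign.\<close>
  then have "eventually (\<lambda>y. dist (f y) (f x) < \<bar>f x\<bar>) (at x)"
    using assms(2) by (auto simp: isCont_def tendsto_iff)
  then have "eventually (\<lambda>y. dist (f y) (f x) < \<bar>f x\<bar>) (nhds x)"
    using assms(2) by (auto simp: eventually_at_filter elim!: eventually_mono)
  then show "eventually (\<lambda>y. sgn (f x) * f y = \<bar>f y\<bar>) (nhds x)"
    by (rule eventually_mono) (auto simp: dist_real_def sgn_if abs_if split: if_splits)
qed

text \<open>The classical flat function exp(-1/t), multiplied by negative powers of t. The whole
  family is needed because it is closed under differentiation up to linear combinations; bump
  functions are built from n = 0.\<close>

definition flat_fun :: "nat \<Rightarrow> real \<Rightarrow> real" where
  "flat_fun n t = (if t \<le> 0 then 0 else inverse t ^ n * exp (- inverse t))"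

lemma flat_fun_tendsto_0: "(flat_fun n \<longlongrightarrow> 0) (at 0)"
proof -
  have "((\<lambda>s::real. s ^ n / exp s) \<longlongrightarrow> 0) at_top" by (rule tendsto_power_div_exp_0)
  then have "((\<lambda>t::real. inverse t ^ n / exp (inverse t)) \<longlongrightarrow> 0) (at_right 0)"
    by (rule filterlim_compose) (rule filterlim_inverse_at_top_right)
  moreover have "eventually (\<lambda>t. inverse t ^ n / exp (inverse t) = flat_fun n t) (at_right 0)"
    by (auto simp: flat_fun_def eventually_at_filter exp_minus field_simps)
  ultimately have r: "(flat_fun n \<longlongrightarrow> 0) (at_right 0)"
    by (rule Lim_transform_eventually)
  have "(flat_fun n \<longlongrightarrow> 0) (at_left 0)"
    by (rule tendsto_eventually) (auto simp: flat_fun_def eventually_at_filter)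
  with r show ?thesis using filterlim_split_at by blast
qed

lemma flat_fun_derivative:
  "(flat_fun n has_real_derivative (flat_fun (n + 2) t - real n * flat_fun (n + 1) t)) (at t)"
proof -
  consider "t < 0" | "t = 0" | "t > 0" by linarith
  then show ?thesis
  proof cases
    case 1
    have "((\<lambda>t. 0) has_real_derivative 0) (at t)" by simp
    then have "(flat_fun n has_real_derivative 0) (at t)"
      by (rule has_field_derivative_transform_within_open[of _ _ _ "{..<0}"]) (use 1 in \<open>auto simp: flat_fun_def\<close>)
    then show ?thesis using 1 by (simp add: flat_fun_def)
  next
    case 2
    \<comment> \<open>Dividing by h raises the power by one, so the difference quotient at 0 is
      \<open>flat_fun (n + 1)\<close>, which tends to 0.\<close>
    have "((\<lambda>h. (flat_fun n (0 + h) - flat_fun n 0) / h) \<longlongrightarrow> 0) (at 0)"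
      by (rule Lim_transform_eventually[OF flat_fun_tendsto_0[of "n+1"]])
        (auto simp: flat_fun_def eventually_at_filter field_simps)
    then show ?thesis using 2 by (simp add: DERIV_def flat_fun_def)
  next
    case 3
    have "((\<lambda>t. inverse t ^ n * exp (- inverse t)) has_real_derivative
        (inverse t ^ (n + 2) - real n * inverse t ^ (n + 1)) * exp (- inverse t)) (at t)"
    proof -
      have "((\<lambda>t. inverse t ^ n) has_real_derivative - (real n * inverse t ^ (n + 1))) (at t)"
      proof (cases n)
        case (Suc m)
        have "((\<lambda>t. inverse t ^ n) has_real_derivative
            real n * (- (inverse t ^ Suc (Suc 0)) * inverse t ^ (n - Suc 0))) (at t)"
          using 3 by (intro DERIV_power DERIV_inverse) simp
        then show ?thesis by (rule DERIV_cong) (simp add: Suc algebra_simps)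
      qed simp
      moreover have "((\<lambda>t. exp (- inverse t)) has_real_derivative exp (- inverse t) * inverse t ^ 2) (at t)"
        using 3 by (auto intro!: derivative_eq_intros simp: power2_eq_square)
      ultimately show ?thesis
        by (rule DERIV_cong[OF DERIV_mult]) (simp add: algebra_simps power2_eq_square)
    qed
    then have "(flat_fun n has_real_derivative
        (inverse t ^ (n + 2) - real n * inverse t ^ (n + 1)) * exp (- inverse t)) (at t)"
      by (rule has_field_derivative_transform_within_open[of _ _ _ "{0<..}"]) (use 3 in \<open>auto simp: flat_fun_def\<close>)
    then show ?thesis using 3 by (simp add: flat_fun_def algebra_simps)
  qed
qed

lemma C_on_flat_fun: "C_on k (flat_fun n) UNIV"
proof (induction k arbitrary: n)
  case 0
  then show ?case
    using DERIV_isCont[OF flat_fun_derivative] by (auto intro!: continuous_at_imp_continuous_on)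
next
  case (Suc k)
  show ?case
  proof (rule C_on_SucI[where f' = "\<lambda>t v. (flat_fun (n + 2) t + (- real n) * flat_fun (n + 1) t) * v"])
    show "(flat_fun n has_derivative (\<lambda>v. (flat_fun (n + 2) t + - real n * flat_fun (n + 1) t) * v)) (at t)" for t
      using flat_fun_derivative[of n t] by (simp add: has_field_derivative_def)
    show "C_on k (\<lambda>t. (flat_fun (n + 2) t + - real n * flat_fun (n + 1) t) * v) UNIV" for v
      by (intro C_on_bilinear[OF _ bounded_bilinear_mult] C_on_add C_on_const Suc.IH open_UNIV)
  qed simp
qed

lemma smooth_at_flat_fun: "smooth_at (flat_fun 0) x"
  by (rule smooth_atI[of UNIV]) (auto intro: C_on_flat_fun)

lemma flat_fun_0: "flat_fun 0 t \<ge> 0" "flat_fun 0 t > 0 \<longleftrightarrow> t > 0" "flat_fun 0 t = 0 \<longleftrightarrow> t \<le> 0"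
  by (auto simp: flat_fun_def)

lemma bump_exists:
  fixes p :: "'e::euclidean_space"
  assumes "r > 0"
  obtains ch :: "'e \<Rightarrow> real" where "\<And>y. smooth_at ch y" "\<And>y. dist p y < r \<Longrightarrow> ch y = 1"
    "\<And>y. dist p y \<ge> 2 * r \<Longrightarrow> ch y = 0" "\<And>y. 0 \<le> ch y"
proof -
  \<comment> \<open>The squared distance is smooth everywhere, while the distance itself is not
    smooth at p.\<close>
  define q where "q y = (y - p) \<bullet> (y - p)" for y
  have q: "q y = (dist p y)\<^sup>2" for y
    by (simp add: q_def dist_norm norm_minus_commute[of p] power2_norm_eq_inner)
  define a where "a y = flat_fun 0 ((2 * r)\<^sup>2 - q y)" for y
  define b where "b y = flat_fun 0 (q y - r\<^sup>2)" for y
  have "r\<^sup>2 > 0" "r\<^sup>2 < (2 * r)\<^sup>2" using assms by (simp_all add: power2_eq_square)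
  then have "(2 * r)\<^sup>2 - q y > 0 \<or> q y - r\<^sup>2 > 0" for y by linarith
  then have "a y > 0 \<or> b y > 0" for y by (simp add: a_def b_def flat_fun_0(2))
  moreover have "a y \<ge> 0" "b y \<ge> 0" for y by (auto simp: a_def b_def flat_fun_0)
  ultimately have pos: "a y + b y > 0" for y
    by (metis add_nonneg_pos add_pos_nonneg)
  have sq: "smooth_at q y" for y unfolding q_def by (intro smooth_intros)
  have sm: "smooth_at a y" "smooth_at b y" for y unfolding a_def b_def
    by (intro smooth_at_compose[OF smooth_at_flat_fun] smooth_intros sq)+
  show ?thesis
  proof (rule that[of "\<lambda>y. a y / (a y + b y)"])
    show "smooth_at (\<lambda>y. a y / (a y + b y)) y" for y
      using pos[of y] by (intro smooth_intros sm) simp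
    show "a y / (a y + b y) = 1" if "dist p y < r" for y
    proof -
      have "q y \<le> r\<^sup>2" using that unfolding q by (simp add: power_mono)
      then have "b y = 0" by (simp add: b_def flat_fun_0)
      then show ?thesis using pos[of y] by simp
    qed
    show "a y / (a y + b y) = 0" if "dist p y \<ge> 2 * r" for y
    proof -
      have "q y \<ge> (2 * r)\<^sup>2" using that assms unfolding q by (intro power_mono) auto
      then show ?thesis by (simp add: a_def flat_fun_0)
    qed
    show "0 \<le> a y / (a y + b y)" for y
      using pos[of y] flat_fun_0 by (simp add: a_def)
  qed
qed

section \<open>Hadamard's lemma\<close>

text \<open>Differentiation under the integral sign. Since p + t (y - p) has derivative t in y,
  every differentiation brings out a factor t; the power \<open>t ^ j\<close> is carried along to
  make the induction go through.\<close>

lemma C_on_segment_integral: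
  fixes p :: "'e::euclidean_space" and h :: "'e \<Rightarrow> real"
  assumes "\<And>k. C_on k h (ball p r)"
  shows "C_on k (\<lambda>y. integral (cbox 0 1) (\<lambda>t::real. t ^ j * h (p + t *\<^sub>R (y - p)))) (ball p r)"
  using assms
proof (induction k arbitrary: j h)
  let ?B = "ball p r"
  have in_ball: "p + t *\<^sub>R (y - p) \<in> ?B" if "y \<in> ?B" "t \<in> cbox 0 1" for y and t :: real
  proof -
    have "dist p (p + t *\<^sub>R (y - p)) = \<bar>t\<bar> * dist p y"
      by (simp add: dist_norm norm_minus_commute)
    also have "\<dots> \<le> 1 * dist p y" using that by (intro mult_right_mono) auto
    finally show ?thesis using that by auto
  qed
  have cont: "continuous_on (?B \<times> cbox 0 1) (\<lambda>(y, t). t ^ j * h (p + t *\<^sub>R (y - p)))"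
    if "continuous_on ?B h" for j and h :: "'e \<Rightarrow> real"
    unfolding split_beta
    by (intro continuous_intros continuous_on_compose2[OF that]) (use in_ball in auto)
  {
    case 0
    have "continuous_on ?B h" using 0[of 0] by simp
    from integral_continuous_on_param[OF cont[OF this, of j]]
    show ?case by simp
  next
    case (Suc k)
    let ?D = "\<lambda>v y. frechet_derivative h (at y) v"
    have D: "\<And>k. C_on k (?D v) ?B" for v using Suc.prems C_on.simps(2) by blast
    have dh: "(h has_derivative frechet_derivative h (at y)) (at y)" if "y \<in> ?B" for y
      using C_on_has_derivative Suc.prems that by blast
    have lin: "bounded_linear (frechet_derivative h (at y))" if "y \<in> ?B" for y
      using dh[OF that] has_derivative_bounded_linear by blast
    \<comment> \<open>The Leibniz rule takes the derivative of the integrand as a family of bounded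
      linear maps; its continuity is checked on each vector separately.\<close>
    define fx where "fx y t = Blinfun (\<lambda>v. t ^ Suc j * ?D v (p + t *\<^sub>R (y - p)))" for y and t :: real
    have fx: "blinfun_apply (fx y t) v = t ^ Suc j * ?D v (p + t *\<^sub>R (y - p))"
      if "y \<in> ?B" "t \<in> cbox 0 1" for y t v
      unfolding fx_def using lin[OF in_ball[OF that]]
      by (subst bounded_linear_Blinfun_apply) (auto intro: bounded_linear_const_mult)
    have "((\<lambda>y. integral (cbox 0 1) (\<lambda>t::real. t ^ j * h (p + t *\<^sub>R (y - p)))) has_derivative
        integral (cbox 0 1) (fx x)) (at x within ?B)" if x: "x \<in> ?B" for x
    proof (rule leibniz_rule[OF _ _ _ x])
      fix y t assume yt: "y \<in> ?B" "t \<in> cbox (0::real) 1"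
      have "((\<lambda>y. p + t *\<^sub>R (y - p)) has_derivative (\<lambda>v. t *\<^sub>R v)) (at y within ?B)"
        by (auto intro!: derivative_eq_intros)
      then have "((\<lambda>y. h (p + t *\<^sub>R (y - p))) has_derivative
          (\<lambda>v. ?D (t *\<^sub>R v) (p + t *\<^sub>R (y - p)))) (at y within ?B)"
        using has_derivative_compose dh[OF in_ball[OF yt]] by fast
      then have "((\<lambda>y. t ^ j * h (p + t *\<^sub>R (y - p))) has_derivative
          (\<lambda>v. t ^ j * ?D (t *\<^sub>R v) (p + t *\<^sub>R (y - p)))) (at y within ?B)"
        by (rule has_derivative_mult_right)
      moreover have "t ^ j * ?D (t *\<^sub>R v) (p + t *\<^sub>R (y - p)) = blinfun_apply (fx y t) v" for v
        using linear_scale[OF bounded_linear.linear[OF lin[OF in_ball[OF yt]]]]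
        by (simp add: fx[OF yt])
      ultimately show "((\<lambda>y. t ^ j * h (p + t *\<^sub>R (y - p))) has_derivative blinfun_apply (fx y t)) (at y within ?B)"
        by simp
    next
      fix y assume y: "y \<in> ?B"
      have "continuous_on ?B h" using Suc.prems[of 0] by simp
      note c = cont[OF this, of j]
      have "continuous_on (cbox 0 1) (\<lambda>t. t ^ j * h (p + t *\<^sub>R (y - p)))"
        using continuous_on_compose2[OF c, of "cbox 0 1" "\<lambda>t. (y, t)"] y
        by (simp add: continuous_on_Pair image_subset_iff)
      then show "(\<lambda>t. t ^ j * h (p + t *\<^sub>R (y - p))) integrable_on cbox 0 1"
        by (rule integrable_continuous)
    next
      show "continuous_on (?B \<times> cbox 0 1) (\<lambda>(y, t). fx y t)"
      proof (rule continuous_on_blinfun_componentwise)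
        fix v :: 'e
        have "continuous_on ?B (?D v)" using D[of 0 v] by simp
        from cont[OF this, of "Suc j"]
        show "continuous_on (?B \<times> cbox 0 1) (\<lambda>x. blinfun_apply (case x of (y, t) \<Rightarrow> fx y t) v)"
          by (rule continuous_on_eq) (auto simp: fx)
      qed
    qed (simp add: convex_ball)
    note der_within = this
    have der: "((\<lambda>y. integral (cbox 0 1) (\<lambda>t::real. t ^ j * h (p + t *\<^sub>R (y - p)))) has_derivative
        integral (cbox 0 1) (fx x)) (at x)" if x: "x \<in> ?B" for x
      using der_within[OF x] by (simp only: at_within_open[OF x open_ball])
    have int: "fx x integrable_on cbox 0 1" if x: "x \<in> ?B" for x
    proof (rule integrable_continuous, rule continuous_on_blinfun_componentwise)
      fix v :: 'e
      have "continuous_on ?B (?D v)" using D[of 0 v] by simp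
      note c = cont[OF this, of "Suc j"]
      have "continuous_on (cbox 0 1) (\<lambda>t. t ^ Suc j * ?D v (p + t *\<^sub>R (x - p)))"
        using continuous_on_compose2[OF c, of "cbox 0 1" "\<lambda>t. (x, t)"] x
        by (simp add: continuous_on_Pair image_subset_iff)
      then show "continuous_on (cbox 0 1) (\<lambda>t. blinfun_apply (fx x t) v)"
        by (rule continuous_on_eq) (rule fx[OF x, symmetric])
    qed
    have val: "integral (cbox 0 1) (\<lambda>t. t ^ Suc j * ?D v (p + t *\<^sub>R (x - p))) =
        blinfun_apply (integral (cbox 0 1) (fx x)) v" if x: "x \<in> ?B" for x v
      unfolding blinfun_apply_integral[OF int[OF x]]
      by (rule integral_cong) (simp add: fx[OF x])
    show ?case
    proof (rule C_on_SucI[OF open_ball der])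
      show "C_on k (\<lambda>x. blinfun_apply (integral (cbox 0 1) (fx x)) v) ?B" for v
        by (rule C_on_transfer[OF open_ball val Suc.IH[OF D]])
    qed
  }
qed

text \<open>The derivative is integrated along the segment from p to y, and y - p is expanded in the
  basis; \<open>g b\<close> is the average of the derivative in direction b. This reduces a
  derivation at p to the partial derivatives at p.\<close>

lemma hadamard:
  fixes p :: "'e::euclidean_space" and f :: "'e \<Rightarrow> real"
  assumes "smooth_at f p"
  obtains g :: "'e \<Rightarrow> 'e \<Rightarrow> real" where
    "\<And>b. smooth_at (g b) p" "\<And>b. g b p = frechet_derivative f (at p) b"
    "eventually (\<lambda>y. f y = f p + (\<Sum>b\<in>Basis. ((y - p) \<bullet> b) * g b y)) (nhds p)"
proof -
  obtain W where W: "open W" "p \<in> W" "\<And>k. C_on k f W" using smooth_atE2[OF assms assms] by metis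
  then obtain r where r: "r > 0" "ball p r \<subseteq> W" using open_contains_ball by blast
  have C: "C_on k f (ball p r)" for k using C_on_subset[OF W(3) r(2)] .
  have df: "(f has_derivative frechet_derivative f (at y)) (at y)" if "y \<in> ball p r" for y
    using C_on_has_derivative C that by blast
  define g where "g b y = integral (cbox 0 1) (\<lambda>t::real. t ^ 0 * frechet_derivative f (at (p + t *\<^sub>R (y - p))) b)" for b y
  show ?thesis
  proof (rule that[of g])
    have "C_on k (\<lambda>y. frechet_derivative f (at y) b) (ball p r)" for k b
      using C[of "Suc k"] by simp
    from C_on_segment_integral[OF this, where j = 0] show "smooth_at (g b) p" for b
      unfolding g_def using r(1) by (intro smooth_atI[OF open_ball, of _ p r]) auto
    show "g b p = frechet_derivative f (at p) b" for b
      by (simp add: g_def)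
    have "f y = f p + (\<Sum>b\<in>Basis. ((y - p) \<bullet> b) * g b y)" if y: "y \<in> ball p r" for y
    proof -
      have ib: "p + t *\<^sub>R (y - p) \<in> ball p r" if "t \<in> {0..1}" for t
      proof -
        have "dist p (p + t *\<^sub>R (y - p)) = \<bar>t\<bar> * dist p y"
          by (simp add: dist_norm norm_minus_commute)
        also have "\<dots> \<le> 1 * dist p y" using that by (intro mult_right_mono) auto
        finally show ?thesis using y by auto
      qed
      let ?d = "\<lambda>t b. frechet_derivative f (at (p + t *\<^sub>R (y - p))) b"
      have "((\<lambda>t. f (p + t *\<^sub>R (y - p))) has_vector_derivative ?d t (y - p)) (at t within {0..1})"
        if "t \<in> {0..1}" for t
      proof -
        have "((\<lambda>t. p + t *\<^sub>R (y - p)) has_vector_derivative (y - p)) (at t within {0..1})"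
          by (auto intro!: derivative_eq_intros)
        from vector_derivative_diff_chain_within[OF this has_derivative_at_withinI[OF df[OF ib[OF that]]]]
        show ?thesis by (simp add: o_def)
      qed
      then have "((\<lambda>t. ?d t (y - p)) has_integral
          f (p + 1 *\<^sub>R (y - p)) - f (p + 0 *\<^sub>R (y - p))) {0..1}"
        by (intro fundamental_theorem_of_calculus) auto
      then have "f y - f p = integral {0..1} (\<lambda>t. ?d t (y - p))" by (simp add: integral_unique)
      also have "\<dots> = integral {0..1} (\<lambda>t. \<Sum>b\<in>Basis. ((y - p) \<bullet> b) * ?d t b)"
      proof (rule integral_cong)
        fix t :: real assume "t \<in> {0..1}"
        then have "linear (?d t)" using df[OF ib] has_derivative_linear by blast
        from linear_Basis_expansion[OF this, of "y - p"]
        show "?d t (y - p) = (\<Sum>b\<in>Basis. ((y - p) \<bullet> b) * ?d t b)" by simp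
      qed
      also have "\<dots> = (\<Sum>b\<in>Basis. ((y - p) \<bullet> b) * integral {0..1} (\<lambda>t. ?d t b))"
      proof (subst integral_sum)
        fix b :: 'e
        have "continuous_on (ball p r) (\<lambda>y. frechet_derivative f (at y) b)"
          using C[of "Suc 0"] by simp
        then have "continuous_on {0..1} (\<lambda>t. ?d t b)"
          by (rule continuous_on_compose2) (use ib in \<open>auto intro!: continuous_intros\<close>)
        then show "(\<lambda>t. ((y - p) \<bullet> b) * ?d t b) integrable_on {0..1}"
          by (intro integrable_continuous_interval continuous_intros)
      qed auto
      finally show ?thesis by (simp add: g_def)
    qed
    note expansion = this
    have "eventually (\<lambda>y. y \<in> ball p r) (nhds p)"
      using r(1) by (intro eventually_nhds_in_open) auto
    then show "eventually (\<lambda>y. f y = f p + (\<Sum>b\<in>Basis. ((y - p) \<bullet> b) * g b y)) (nhds p)"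
      by (rule eventually_mono) (rule expansion)
  qed
qed

section \<open>The inverse function theorem for smooth functions\<close>

text \<open>Solving the system for all y amounts to inverting the map (y, u) \<mapsto> (y, L y u).
  Its derivative at (y0, w y0) is block triangular with invertible diagonal blocks, so the inverse
  is differentiable, and w is its second component along y \<mapsto> (y, r y).\<close>

lemma differentiable_linear_solve:
  fixes A :: "'e::euclidean_space \<Rightarrow> 'e \<Rightarrow> 'e" and w r :: "'e \<Rightarrow> 'e"
  assumes V: "open V" "y0 \<in> V"
    and A: "\<And>b y. y \<in> V \<Longrightarrow> (\<lambda>y. A y b) differentiable (at y)"
    and r: "r differentiable (at y0)"
    and solve: "\<And>y. y \<in> V \<Longrightarrow> (\<Sum>b\<in>Basis. (w y \<bullet> b) *\<^sub>R A y b) = r y"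
    and inj: "\<And>y u. y \<in> V \<Longrightarrow> (\<Sum>b\<in>Basis. (u \<bullet> b) *\<^sub>R A y b) = 0 \<Longrightarrow> u = 0"
  shows "w differentiable (at y0)"
proof -
  define L where "L y u = (\<Sum>b\<in>Basis. (u \<bullet> b) *\<^sub>R A y b)" for y u
  have L: "linear (L y)" for y
    unfolding L_def by (intro linear_compose_sum ballI) (auto simp: linear_iff inner_add_left scaleR_left_distrib)
  have Linj: "inj (L y)" if "y \<in> V" for y
    using inj[OF that] by (simp add: linear_injective_0[OF L] L_def)
  define K where "K y = inv_into UNIV (L y)" for y
  have K: "linear (K y)" "K y (L y u) = u" "L y (K y u) = u" if "y \<in> V" for y u
  proof -
    show "K y (L y u) = u" using Linj[OF that] by (simp add: K_def)
    have "surj (L y)" using L Linj[OF that] linear_injective_imp_surjective by blast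
    then show "L y (K y u) = u" by (simp add: K_def surj_f_inv_f)
    show "linear (K y)"
      by (metis K_def L Linj inj_linear_imp_inv_linear that)
  qed
  have Aderiv: "((\<lambda>y. A y b) has_derivative frechet_derivative (\<lambda>y. A y b) (at y)) (at y)" if "y \<in> V" for b y
    using A[OF that] frechet_derivative_works by blast
  define DA where "DA y u h = (\<Sum>b\<in>Basis. (u \<bullet> b) *\<^sub>R frechet_derivative (\<lambda>y. A y b) (at y) h)" for y u h
  define \<Psi> where "\<Psi> = (\<lambda>(y, u). (y, L y u))"
  define \<Phi> where "\<Phi> = (\<lambda>(y, z). (y, K y z))"
  have deriv: "(\<Psi> has_derivative (\<lambda>(h, k). (h, DA y u h + L y k))) (at (y, u))" if "y \<in> V" for y u
  proof -
    have Af: "((\<lambda>x. A (fst x) b) has_derivative (\<lambda>x. frechet_derivative (\<lambda>y. A y b) (at y) (fst x))) (at (y, u))" for b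
      using has_derivative_compose[of fst fst "(y, u)" UNIV "\<lambda>y. A y b"] Aderiv[OF that]
      by (simp add: has_derivative_fst)
    have "((\<lambda>x. L (fst x) (snd x)) has_derivative (\<lambda>x. DA y u (fst x) + L y (snd x))) (at (y, u))"
      unfolding L_def DA_def sum.distrib[symmetric]
      by (rule has_derivative_eq_rhs[OF has_derivative_sum[OF has_derivative_scaleR[OF _ Af]]])
         (auto intro!: derivative_eq_intros)
    then have "((\<lambda>x. (fst x, L (fst x) (snd x))) has_derivative (\<lambda>x. (fst x, DA y u (fst x) + L y (snd x)))) (at (y, u))"
      by (intro has_derivative_Pair has_derivative_fst[OF has_derivative_ident])
    then show ?thesis by (simp add: \<Psi>_def case_prod_unfold)
  qed
  have "(\<Phi> has_derivative (\<lambda>(h, k). (h, K y0 (k - DA y0 (w y0) h)))) (at (\<Psi> (y0, w y0)))"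
  proof (rule has_derivative_inverse_strong[where S = "V \<times> UNIV" and f = \<Psi> and x = "(y0, w y0)" and f' = "\<lambda>(h, k). (h, DA y0 (w y0) h + L y0 k)"])
    show "continuous_on (V \<times> UNIV) \<Psi>"
    proof (intro continuous_at_imp_continuous_on ballI)
      fix x assume "x \<in> V \<times> (UNIV :: 'e set)"
      then obtain y u where "x = (y, u)" "y \<in> V" by auto
      then show "isCont \<Psi> x" using has_derivative_continuous[OF deriv[of y u]] by simp
    qed
    show "\<Phi> (\<Psi> x) = x" if "x \<in> V \<times> UNIV" for x
      using that K by (auto simp: \<Phi>_def \<Psi>_def)
    show "(\<Psi> has_derivative (\<lambda>(h, k). (h, DA y0 (w y0) h + L y0 k))) (at (y0, w y0))"
      using deriv V by blast
    show "(\<lambda>(h, k). (h, DA y0 (w y0) h + L y0 k)) \<circ> (\<lambda>(h, k). (h, K y0 (k - DA y0 (w y0) h))) = id"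
      using K[OF V(2)] by (auto simp: fun_eq_iff)
  qed (use V in \<open>auto intro: open_Times\<close>)
  moreover have "\<Psi> (y0, w y0) = (y0, r y0)" using solve[OF V(2)] by (simp add: \<Psi>_def L_def)
  ultimately have "\<Phi> differentiable (at (y0, r y0))" by (auto simp: differentiable_def)
  moreover have "(\<lambda>y. (y, r y)) differentiable (at y0)"
    using r by (auto simp: differentiable_def intro!: has_derivative_Pair has_derivative_ident)
  ultimately have "(\<lambda>y. \<Phi> (y, r y)) differentiable (at y0)"
    using differentiable_chain_at[of "\<lambda>y. (y, r y)" y0 \<Phi>] by (simp add: o_def)
  then have "(\<lambda>y. K y (r y)) differentiable (at y0)"
    unfolding \<Phi>_def differentiable_def using has_derivative_snd by fastforce
  moreover have "K y (r y) = w y" if "y \<in> V" for y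
    using K(2)[OF that, of "w y"] solve[OF that] by (simp add: L_def)
  ultimately show ?thesis
    unfolding differentiable_def using has_derivative_transform_within_open[OF _ V] by blast
qed

text \<open>Invariance of domain takes the place of a norm estimate for inverse matrices: (y, u)
  \<mapsto> (y, A y u) is continuous and injective on an open set of equal dimension, hence a
  homeomorphism onto its image.\<close>

lemma continuous_linear_solve:
  fixes A :: "'e::euclidean_space \<Rightarrow> 'e \<Rightarrow> 'e" and w r :: "'e \<Rightarrow> 'e"
  assumes V: "open V"
    and A: "\<And>b. continuous_on V (\<lambda>y. A y b)"
    and r: "continuous_on V r"
    and solve: "\<And>y. y \<in> V \<Longrightarrow> (\<Sum>b\<in>Basis. (w y \<bullet> b) *\<^sub>R A y b) = r y"
    and inj: "\<And>y u. y \<in> V \<Longrightarrow> (\<Sum>b\<in>Basis. (u \<bullet> b) *\<^sub>R A y b) = 0 \<Longrightarrow> u = 0"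
  shows "continuous_on V w"
proof -
  define \<Psi> where "\<Psi> = (\<lambda>x. (fst x, \<Sum>b\<in>Basis. (snd x \<bullet> b) *\<^sub>R A (fst x) b))"
  have c: "continuous_on (V \<times> UNIV) \<Psi>"
    unfolding \<Psi>_def
    by (intro continuous_intros continuous_on_compose2[OF A]) auto
  have i: "inj_on \<Psi> (V \<times> UNIV)"
  proof (rule inj_onI)
    fix x x' assume xx: "x \<in> V \<times> UNIV" "x' \<in> V \<times> UNIV" "\<Psi> x = \<Psi> x'"
    then have f: "fst x = fst x'" "fst x \<in> V" by (auto simp: \<Psi>_def)
    have "(\<Sum>b\<in>Basis. ((snd x - snd x') \<bullet> b) *\<^sub>R A (fst x) b) = 0"
      using xx(3) f by (simp add: \<Psi>_def inner_diff_left scaleR_left_diff_distrib sum_subtractf)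
    then have "snd x - snd x' = 0" by (rule inj[OF f(2)])
    then show "x = x'" using f(1) by (auto intro: prod_eqI)
  qed
  obtain \<Phi> where h: "homeomorphism (V \<times> UNIV) (\<Psi> ` (V \<times> UNIV)) \<Psi> \<Phi>"
    using invariance_of_domain_homeomorphism[OF open_Times[OF V open_UNIV] c _ i] by auto
  have wr: "\<Psi> (y, w y) = (y, r y)" if "y \<in> V" for y using solve[OF that] by (simp add: \<Psi>_def)
  have eq: "w y = snd (\<Phi> (y, r y))" if "y \<in> V" for y
    using homeomorphism_apply1[OF h, of "(y, w y)"] that wr[OF that] by simp
  have "continuous_on V (\<lambda>y. \<Phi> (y, r y))"
  proof (rule continuous_on_compose2[OF homeomorphism_cont2[OF h]])
    show "(\<lambda>y. (y, r y)) ` V \<subseteq> \<Psi> ` (V \<times> UNIV)"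
    proof
      fix z assume "z \<in> (\<lambda>y. (y, r y)) ` V"
      then obtain y where "y \<in> V" "z = \<Psi> (y, w y)" using wr by auto
      then show "z \<in> \<Psi> ` (V \<times> UNIV)" by blast
    qed
  qed (intro continuous_intros r)
  then have "continuous_on V (\<lambda>y. snd (\<Phi> (y, r y)))" by (rule continuous_on_snd)
  then show ?thesis by (simp add: eq cong: continuous_on_cong)
qed

text \<open>Differentiating A w = r gives A w' = r' - A' w. The derivative of w thus solves a system
  with the same matrix, and the right-hand side involves only w itself, which is already known to
  order k.\<close>

lemma C_on_linear_solve:
  fixes A :: "'e::euclidean_space \<Rightarrow> 'e \<Rightarrow> 'e" and w r :: "'e \<Rightarrow> 'e"
  assumes V: "open V"
    and A: "\<And>b. C_on k (\<lambda>y. A y b) V"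
    and r: "C_on k r V"
    and solve: "\<And>y. y \<in> V \<Longrightarrow> (\<Sum>b\<in>Basis. (w y \<bullet> b) *\<^sub>R A y b) = r y"
    and inj: "\<And>y u. y \<in> V \<Longrightarrow> (\<Sum>b\<in>Basis. (u \<bullet> b) *\<^sub>R A y b) = 0 \<Longrightarrow> u = 0"
  shows "C_on k w V"
  using A r solve
proof (induction k arbitrary: r w)
  case 0
  show ?case
    unfolding C_on.simps
  proof (rule continuous_linear_solve[OF V, of A r w])
    show "continuous_on V (\<lambda>y. A y b)" for b using 0(1)[of b] by (simp only: C_on.simps)
    show "continuous_on V r" using 0(2) by (simp only: C_on.simps)
  qed (fact 0(3) inj)+
next
  case (Suc k)
  note Sol = Suc.prems(3)
  have diff: "w differentiable (at y)" if "y \<in> V" for y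
  proof (rule differentiable_linear_solve[OF V that, of A r w])
    show "(\<lambda>y. A y b) differentiable at y" if "y \<in> V" for b y using Suc.prems(1)[of b] that by simp
    show "r differentiable at y" using Suc.prems(2) that by simp
  qed (fact Sol inj)+
  let ?D = "\<lambda>f y. frechet_derivative f (at y)"
  have dw: "(w has_derivative ?D w y) (at y)" if "y \<in> V" for y
    using diff[OF that] frechet_derivative_works by blast
  have dA: "((\<lambda>y. A y b) has_derivative ?D (\<lambda>y. A y b) y) (at y)" if "y \<in> V" for y b
    using C_on_has_derivative Suc.prems(1) that by blast
  have dr: "(r has_derivative ?D r y) (at y)" if "y \<in> V" for y
    using C_on_has_derivative Suc.prems(2) that by blast
  have w: "C_on k w V"
  proof (rule Suc.IH[of r w])
    show "C_on k (\<lambda>y. A y b) V" for b using Suc.prems(1)[of b] by (rule C_on_SucD)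
    show "C_on k r V" using Suc.prems(2) by (rule C_on_SucD)
  qed (rule Sol)
  define r' where "r' v y = ?D r y v - (\<Sum>b\<in>Basis. (w y \<bullet> b) *\<^sub>R ?D (\<lambda>y. A y b) y v)" for v y
  have eq: "(\<Sum>b\<in>Basis. (?D w y v \<bullet> b) *\<^sub>R A y b) = r' v y" if y: "y \<in> V" for y v
  proof -
    have "((\<lambda>y. \<Sum>b\<in>Basis. (w y \<bullet> b) *\<^sub>R A y b) has_derivative
        (\<lambda>v. \<Sum>b\<in>Basis. (w y \<bullet> b) *\<^sub>R ?D (\<lambda>y. A y b) y v + (?D w y v \<bullet> b) *\<^sub>R A y b)) (at y)"
      by (intro has_derivative_sum has_derivative_scaleR has_derivative_inner_left dw dA y)
    moreover have "((\<lambda>y. \<Sum>b\<in>Basis. (w y \<bullet> b) *\<^sub>R A y b) has_derivative ?D r y) (at y)"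
      by (rule has_derivative_transform_within_open[OF dr[OF y] V y]) (simp add: Sol)
    ultimately have "(\<lambda>v. \<Sum>b\<in>Basis. (w y \<bullet> b) *\<^sub>R ?D (\<lambda>y. A y b) y v + (?D w y v \<bullet> b) *\<^sub>R A y b) = ?D r y"
      using has_derivative_unique by blast
    from fun_cong[OF this, of v] show ?thesis by (simp add: r'_def sum.distrib algebra_simps)
  qed
  have r': "C_on k (r' v) V" for v
  proof -
    have *: "C_on k (\<lambda>y. (w y \<bullet> b) *\<^sub>R ?D (\<lambda>y. A y b) y v) V" for b
      by (rule C_on_bilinear[OF V bounded_bilinear_scaleR C_on_bilinear[OF V bounded_bilinear_inner w C_on_const]])
         (use Suc.prems in simp)
    have "C_on k (\<lambda>y. ?D r y v + (-1) *\<^sub>R (\<Sum>b\<in>Basis. (w y \<bullet> b) *\<^sub>R ?D (\<lambda>y. A y b) y v)) V"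
      by (rule C_on_add[OF V _ C_on_bilinear[OF V bounded_bilinear_scaleR C_on_const C_on_sum[OF V *]]])
         (use Suc.prems in simp)
    then show ?thesis by (simp add: r'_def[abs_def])
  qed
  show ?case
  proof (rule C_on_SucI[OF V dw])
    show "C_on k (\<lambda>y. ?D w y v) V" for v
    proof (rule Suc.IH[of "r' v" "\<lambda>y. ?D w y v"])
      show "C_on k (\<lambda>y. A y b) V" for b using Suc.prems(1)[of b] by (rule C_on_SucD)
    qed (rule r' eq, assumption?)+
  qed
qed

text \<open>The inverse function theorem gives a differentiable g whose derivative g' v solves the
  linear system with matrix \<Theta>'(g y). If g has order k, so does this matrix, hence g', hence g
  has order k + 1. Callers normalize \<Theta> to have the identity as derivative.\<close>

lemma smooth_local_inverse:
  fixes \<Theta> :: "'e::euclidean_space \<Rightarrow> 'e"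
  assumes "smooth_at \<Theta> y0" "(\<Theta> has_derivative id) (at y0)"
  obtains g where "smooth_at g (\<Theta> y0)" "eventually (\<lambda>y. g (\<Theta> y) = y) (nhds y0)"
proof -
  obtain U where U: "open U" "y0 \<in> U" "\<And>k. C_on k \<Theta> U"
    using smooth_atE2[OF assms(1) assms(1)] by metis
  define f' where "f' x = Blinfun (frechet_derivative \<Theta> (at x))" for x
  have d: "(\<Theta> has_derivative frechet_derivative \<Theta> (at x)) (at x)" if "x \<in> U" for x
    using C_on_has_derivative U(3) that by blast
  have f': "blinfun_apply (f' x) = frechet_derivative \<Theta> (at x)" if "x \<in> U" for x
    unfolding f'_def using d[OF that] has_derivative_bounded_linear bounded_linear_Blinfun_apply by blast
  have C: "C_on k (\<lambda>x. frechet_derivative \<Theta> (at x) v) U" for k v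
    using U(3)[of "Suc k"] by simp
  have "continuous_on U f'"
  proof (rule continuous_on_blinfun_componentwise)
    show "continuous_on U (\<lambda>x. blinfun_apply (f' x) v)" for v
      using C[of 0 v] by (simp add: f' cong: continuous_on_cong)
  qed
  moreover have "id_blinfun o\<^sub>L f' y0 = id_blinfun"
  proof -
    have "frechet_derivative \<Theta> (at y0) = id" using frechet_derivative_at[OF assms(2)] by simp
    then show ?thesis using f'[OF U(2)] by (intro blinfun_eqI) simp
  qed
  ultimately obtain U' V g g' where UV: "open U'" "U' \<subseteq> U" "y0 \<in> U'" "open V" "\<Theta> y0 \<in> V"
    and hom: "homeomorphism U' V \<Theta> g"
    and g: "\<And>y. y \<in> V \<Longrightarrow> (g has_derivative (g' y)) (at y)"
      "\<And>y. y \<in> V \<Longrightarrow> g' y = inv_into UNIV (blinfun_apply (f'(g y)))"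
      "\<And>y. y \<in> V \<Longrightarrow> bij (blinfun_apply (f'(g y)))"
    using inverse_function_theorem[OF U(1) _ _ U(2), of \<Theta> f' id_blinfun] d f' by metis
  have gV: "g y \<in> U'" "g y \<in> U" if "y \<in> V" for y
    using hom UV(2) that by (auto simp: homeomorphism_def)
  have lin: "linear (frechet_derivative \<Theta> (at (g y)))" if "y \<in> V" for y
    using d[OF gV(2)[OF that]] has_derivative_linear by blast
  have ex: "frechet_derivative \<Theta> (at (g y)) u = (\<Sum>b\<in>Basis. (u \<bullet> b) *\<^sub>R frechet_derivative \<Theta> (at (g y)) b)"
    if "y \<in> V" for y u
    by (rule linear_Basis_expansion[OF lin[OF that]])
  have bij: "bij (frechet_derivative \<Theta> (at (g y)))" if "y \<in> V" for y
    using g(3)[OF that] f'[OF gV(2)[OF that]] by simp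
  have "C_on k g V" for k
  proof (induction k)
    case 0
    then show ?case using hom by (simp add: homeomorphism_def)
  next
    case (Suc k)
    show ?case
    proof (rule C_on_SucI[OF UV(4) g(1)])
      fix v
      show "C_on k (\<lambda>y. g' y v) V"
      proof (rule C_on_linear_solve[where A = "\<lambda>y b. frechet_derivative \<Theta> (at (g y)) b" and r = "\<lambda>_. v"])
        show "C_on k (\<lambda>y. frechet_derivative \<Theta> (at (g y)) b) V" for b
          by (rule C_on_compose[OF UV(4) U(1) _ C Suc.IH]) (use gV in auto)
        show "(\<Sum>b\<in>Basis. (g' y v \<bullet> b) *\<^sub>R frechet_derivative \<Theta> (at (g y)) b) = v" if "y \<in> V" for y
          unfolding ex[OF that, symmetric] g(2)[OF that] f'[OF gV(2)[OF that]]
          using bij[OF that] by (simp add: bij_is_surj surj_f_inv_f)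
        show "u = 0" if "y \<in> V" "(\<Sum>b\<in>Basis. (u \<bullet> b) *\<^sub>R frechet_derivative \<Theta> (at (g y)) b) = 0" for y u
          using that bij[OF that(1)] lin[OF that(1)]
          unfolding ex[OF that(1), symmetric] by (metis bij_is_inj linear_injective_0)
      qed (auto intro: C_on_const UV)
    qed
  qed
  then have "smooth_at g (\<Theta> y0)" using UV by (intro smooth_atI) auto
  moreover have "eventually (\<lambda>y. g (\<Theta> y) = y) (nhds y0)"
    by (rule eventually_mono[OF eventually_nhds_in_open[OF UV(1,3)]])
       (use hom in \<open>auto simp: homeomorphism_def\<close>)
  ultimately show ?thesis using that by blast
qed

section \<open>Determinants and integration on coordinate subspaces\<close>

section \<open>Determinants relative to a set of axes\<close>

text \<open>The Leibniz formula with rows and columns indexed by the axes themselves. For B empty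
  its value is 1, which is the correct convention for manifolds of dimension 0.\<close>

definition det_axes :: "'e set \<Rightarrow> ('e::euclidean_space \<Rightarrow> 'e) \<Rightarrow> real" where
  "det_axes B a = (\<Sum>p | p permutes B. of_int (sign p) * (\<Prod>b\<in>B. a b \<bullet> p b))"

text \<open>
  Multilinear forms are evaluated on families of vectors indexed by \<open>B\<close>, so that an alternating form of top
  degree on \<open>span B\<close> is a function of a matrix with rows \<open>a b\<close>.
\<close>

locale alternating_form =
  fixes B :: "'e::euclidean_space set" and W :: "('e \<Rightarrow> 'e) \<Rightarrow> real"
  assumes B: "B \<subseteq> Basis"
    and lin: "\<And>a b u w s t. b \<in> B \<Longrightarrow>
      W (a(b := s *\<^sub>R u + t *\<^sub>R w)) = s * W (a(b := u)) + t * W (a(b := w))"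
    and alt: "\<And>a b b'. b \<in> B \<Longrightarrow> b' \<in> B \<Longrightarrow> b \<noteq> b' \<Longrightarrow> a b = a b' \<Longrightarrow> W a = 0"
    and proj: "\<And>a a'. (\<And>b. b \<in> B \<Longrightarrow> axes_proj B (a b) = axes_proj B (a' b)) \<Longrightarrow> W a = W a'"
begin

lemma finite_B: "finite B" using B finite_Basis finite_subset by blast

lemma axes_proj_inner: "c \<in> B \<Longrightarrow> axes_proj B y \<bullet> c = y \<bullet> c"
  using B finite_B unfolding axes_proj_def inner_sum_left inner_scaleR_left
  by (subst sum.remove[of _ c]) (auto simp: inner_Basis subset_eq intro!: sum.neutral)

lemma axes_proj_idem: "axes_proj B (axes_proj B y) = axes_proj B y"
  by (subst (1 3) axes_proj_def) (simp add: axes_proj_inner cong: sum.cong)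

lemma W_zero: "b \<in> B \<Longrightarrow> W (a(b := 0)) = 0"
  using lin[of b a 0 0 0 0] by simp

lemma W_add: "b \<in> B \<Longrightarrow> W (a(b := u + w)) = W (a(b := u)) + W (a(b := w))"
  using lin[of b a 1 u 1 w] by simp

lemma W_scale: "b \<in> B \<Longrightarrow> W (a(b := s *\<^sub>R u)) = s * W (a(b := u))"
  using lin[of b a s u 0 u] by simp

lemma W_sum: "finite C \<Longrightarrow> b \<in> B \<Longrightarrow> W (a(b := \<Sum>c\<in>C. k c *\<^sub>R u c)) = (\<Sum>c\<in>C. k c * W (a(b := u c)))"
  by (induction C rule: finite_induct) (simp_all add: W_zero W_add W_scale)

lemma W_swap:
  assumes "b \<in> B" "c \<in> B" "b \<noteq> c"
  shows "W (a(b := v, c := u)) = - W (a(b := u, c := v))"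
proof -
  have "0 = W (a(b := u + v, c := u + v))" by (rule alt[symmetric, of b c]) (use assms in auto)
  also have "\<dots> = W ((a(c := u + v))(b := u)) + W ((a(c := u + v))(b := v))"
    using W_add[OF assms(1), of "a(c := u + v)" u v] assms(3) by (simp add: fun_upd_twist)
  also have "\<dots> = W (a(b := u, c := u)) + W (a(b := u, c := v)) + (W (a(b := v, c := u)) + W (a(b := v, c := v)))"
    using W_add[OF assms(2), of "a(b := u)" u v] W_add[OF assms(2), of "a(b := v)" u v] assms(3)
    by (simp add: fun_upd_twist)
  also have "W (a(b := u, c := u)) = 0" by (rule alt[of b c]) (use assms in auto)
  also have "W (a(b := v, c := v)) = 0" by (rule alt[of b c]) (use assms in auto)
  finally show ?thesis by linarith
qed

lemma W_permute:
  assumes "p permutes B"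
  shows "W (a \<circ> p) = of_int (sign p) * W a"
  using assms finite_B
proof (induction p arbitrary: a rule: permutes_induct)
  case id
  then show ?case by simp
next
  case (swap b c p)
  have "W (a \<circ> (Transposition.transpose b c \<circ> p)) = of_int (sign p) * W (a \<circ> Transposition.transpose b c)"
    using swap.IH[of "a \<circ> Transposition.transpose b c"] by (simp only: o_assoc)
  also have "a \<circ> Transposition.transpose b c = a(b := a c, c := a b)"
    by (auto simp: Transposition.transpose_def)
  also have "W \<dots> = - W (a(b := a b, c := a c))"
    using W_swap[of b c a "a c" "a b"] swap by simp
  finally have "W (a \<circ> (Transposition.transpose b c \<circ> p)) = - (of_int (sign p) * W a)"
    by (simp only: fun_upd_triv mult_minus_right)
  moreover have "sign (Transposition.transpose b c \<circ> p) = - sign p"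
    using swap by (subst sign_compose)
      (auto simp: sign_swap_id permutation_swap_id permutes_imp_permutation[OF finite_B])
  ultimately show ?case by (simp only: of_int_minus mult_minus_left)
qed

text \<open>The rows in C are expanded one at a time, and a function from C to B records the basis
  vector chosen in each row. The assumption \<open>proj\<close> allows a row to be replaced by its
  projection, so that the sum over B is a complete expansion.\<close>

lemma W_expand:
  assumes "C \<subseteq> B"
  shows "W a = (\<Sum>f\<in>C \<rightarrow>\<^sub>E B. (\<Prod>b\<in>C. a b \<bullet> f b) * W (\<lambda>b. if b \<in> C then f b else a b))"
  using finite_subset[OF assms finite_B] assms
proof (induction C rule: finite_induct)
  case empty
  then show ?case by simp
next
  case (insert x C)
  then have x: "x \<in> B" "x \<notin> C" by auto
  let ?v = "\<lambda>f b. if b \<in> C then f b else a b"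
  let ?g = "\<lambda>(y, f). f(x := y)"
  have row: "W (?v f) = (\<Sum>c\<in>B. (a x \<bullet> c) * W ((?v f)(x := c)))" for f
  proof -
    have "W (?v f) = W ((?v f)(x := \<Sum>c\<in>B. (a x \<bullet> c) *\<^sub>R c))"
      by (rule proj) (use x in \<open>auto simp: axes_proj_def[symmetric] axes_proj_idem\<close>)
    then show ?thesis using W_sum[OF finite_B x(1)] by simp
  qed
  have "W a = (\<Sum>f\<in>C \<rightarrow>\<^sub>E B. (\<Prod>b\<in>C. a b \<bullet> f b) * W (?v f))"
    using insert by simp
  also have "\<dots> = (\<Sum>f\<in>C \<rightarrow>\<^sub>E B. \<Sum>c\<in>B. (a x \<bullet> c) * (\<Prod>b\<in>C. a b \<bullet> f b) * W ((?v f)(x := c)))"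
    by (subst row) (simp add: sum_distrib_left mult_ac)
  also have "\<dots> = (\<Sum>(c, f)\<in>B \<times> (C \<rightarrow>\<^sub>E B). (a x \<bullet> c) * (\<Prod>b\<in>C. a b \<bullet> f b) * W ((?v f)(x := c)))"
    by (subst sum.swap) (simp add: sum.cartesian_product)
  also have "\<dots> = (\<Sum>z\<in>B \<times> (C \<rightarrow>\<^sub>E B). (\<Prod>b\<in>insert x C. a b \<bullet> (?g z) b) *
      W (\<lambda>b. if b \<in> insert x C then (?g z) b else a b))"
  proof (rule sum.cong[OF refl], clarify)
    fix c f assume "c \<in> B" "f \<in> C \<rightarrow>\<^sub>E B"
    have "(\<Prod>b\<in>insert x C. a b \<bullet> (f(x := c)) b) = (a x \<bullet> c) * (\<Prod>b\<in>C. a b \<bullet> (f(x := c)) b)"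
      using insert x by simp
    also have "(\<Prod>b\<in>C. a b \<bullet> (f(x := c)) b) = (\<Prod>b\<in>C. a b \<bullet> f b)"
      by (rule prod.cong) (use x in auto)
    finally have *: "(\<Prod>b\<in>insert x C. a b \<bullet> (f(x := c)) b) = (a x \<bullet> c) * (\<Prod>b\<in>C. a b \<bullet> f b)" .
    have "(?v f)(x := c) = (\<lambda>b. if b \<in> insert x C then (f(x := c)) b else a b)" by auto
    then show "(a x \<bullet> c) * (\<Prod>b\<in>C. a b \<bullet> f b) * W ((?v f)(x := c)) =
        (\<Prod>b\<in>insert x C. a b \<bullet> (f(x := c)) b) * W (\<lambda>b. if b \<in> insert x C then (f(x := c)) b else a b)"
      using * by simp
  qed
  also have "\<dots> = (\<Sum>f\<in>insert x C \<rightarrow>\<^sub>E B. (\<Prod>b\<in>insert x C. a b \<bullet> f b) *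
      W (\<lambda>b. if b \<in> insert x C then f b else a b))"
    unfolding PiE_insert_eq by (subst sum.reindex[OF inj_combinator[OF x(2)]]) (simp add: o_def)
  finally show ?case .
qed

text \<open>Uniqueness of the determinant. In the full expansion, choices that repeat a vector
  vanish, and the remaining ones are permutations of B, each contributing its sign.\<close>

lemma W_det: "W a = det_axes B a * W (\<lambda>b. b)"
proof -
  let ?t = "\<lambda>f. (\<Prod>b\<in>B. a b \<bullet> f b) * W (\<lambda>b. if b \<in> B then f b else a b)"
  let ?P = "{f \<in> B \<rightarrow>\<^sub>E B. inj_on f B}"
  have "W a = sum ?t (B \<rightarrow>\<^sub>E B)" by (rule W_expand) simp
  also have "\<dots> = sum ?t ?P"
  proof (rule sum.mono_neutral_right)
    show "\<forall>f\<in>(B \<rightarrow>\<^sub>E B) - ?P. ?t f = 0"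
      by (auto simp: inj_on_def intro: alt)
  qed (auto intro: finite_PiE finite_B)
  \<comment> \<open>An injective self-map of the finite set B is a bijection. Restriction to B and
    extension by the identity translate between extensional functions and permutations.\<close>
  also have "\<dots> = (\<Sum>p | p permutes B. ?t (restrict p B))"
  proof (rule sum.reindex_bij_betw[symmetric])
    show "bij_betw (\<lambda>p. restrict p B) {p. p permutes B} ?P"
    proof (rule bij_betw_byWitness[where f' = "\<lambda>f b. if b \<in> B then f b else b"])
      show "(\<lambda>p. restrict p B) ` {p. p permutes B} \<subseteq> ?P"
        by (auto simp: permutes_in_image inj_on_restrict_eq permutes_inj_on)
      show "(\<lambda>f b. if b \<in> B then f b else b) ` ?P \<subseteq> {p. p permutes B}"
      proof clarify
        fix f assume f: "f \<in> B \<rightarrow>\<^sub>E B" "inj_on f B"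
        have "f ` B \<subseteq> B" using f by auto
        then have "bij_betw f B B" using f(2) finite_B by (simp add: bij_betw_def endo_inj_surj)
        then have "bij_betw (\<lambda>b. if b \<in> B then f b else b) B B" by (rule bij_betw_cong[THEN iffD1, rotated]) simp
        then show "(\<lambda>b. if b \<in> B then f b else b) permutes B" by (rule bij_imp_permutes) simp
      qed
    qed (auto simp: permutes_def fun_eq_iff PiE_iff extensional_def)
  qed
  also have "\<dots> = (\<Sum>p | p permutes B. (of_int (sign p) * (\<Prod>b\<in>B. a b \<bullet> p b)) * W (\<lambda>b. b))"
  proof (rule sum.cong[OF refl], clarify)
    fix p assume p: "p permutes B"
    have "W (\<lambda>b. if b \<in> B then restrict p B b else a b) = W ((\<lambda>b. b) \<circ> p)"
      by (rule proj) auto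
    also have "\<dots> = of_int (sign p) * W (\<lambda>b. b)" by (rule W_permute[OF p])
    moreover have "(\<Prod>b\<in>B. a b \<bullet> restrict p B b) = (\<Prod>b\<in>B. a b \<bullet> p b)"
      by (rule prod.cong) auto
    ultimately show "?t (restrict p B) = (of_int (sign p) * (\<Prod>b\<in>B. a b \<bullet> p b)) * W (\<lambda>b. b)"
      by simp
  qed
  finally show ?thesis by (simp add: det_axes_def sum_distrib_right)
qed

end

section \<open>Change of variables on Euclidean spaces\<close>

text \<open>
  The library states the change of variables theorem for \<open>real ^ 'n\<close> with a well-ordered index type;
  the type of indices of the standard basis transports it to any Euclidean space.
\<close>

typedef (overloaded) ('e::euclidean_space) basis_index = "{..<DIM('e)}"
  by (rule exI[of _ 0]) simp

instance basis_index :: (euclidean_space) finite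
proof
  show "finite (UNIV :: 'a basis_index set)"
    using type_definition.univ[OF type_definition_basis_index] by (metis finite_imageI finite_lessThan)
qed

instantiation basis_index :: (euclidean_space) linorder
begin

definition "i \<le> j \<longleftrightarrow> Rep_basis_index i \<le> Rep_basis_index j"
definition "i < j \<longleftrightarrow> Rep_basis_index i < Rep_basis_index j"

instance
  by standard (auto simp: less_eq_basis_index_def less_basis_index_def Rep_basis_index_inject)

end

instance basis_index :: (euclidean_space) wellorder
proof
  fix P :: "'a basis_index \<Rightarrow> bool" and a
  assume *: "\<And>x. (\<And>y. y < x \<Longrightarrow> P y) \<Longrightarrow> P x"
  show "P a"
    by (induction a rule: measure_induct_rule[where f = Rep_basis_index]) (auto simp: less_basis_index_def intro: *)
qed

lemma card_basis_index: "CARD(('e::euclidean_space) basis_index) = DIM('e)"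
  using type_definition.card[OF type_definition_basis_index] by simp

text \<open>A bridge between the gauge integral, in which the change of variables theorem is stated,
  and the nonnegative Lebesgue integral. The value \<infinity> in the non-integrable case makes
  equalities of integrals available without integrability hypotheses.\<close>

lemma nn_integral_eq_if_integrable:
  fixes f :: "'a::euclidean_space \<Rightarrow> real"
  assumes "\<And>x. x \<in> S \<Longrightarrow> 0 \<le> f x" "(\<lambda>x. indicator S x * f x) \<in> borel_measurable borel"
  shows "(\<integral>\<^sup>+ x. ennreal (indicator S x * f x) \<partial>lborel) = (if f absolutely_integrable_on S then ennreal (integral S f) else \<infinity>)"
proof (cases "f integrable_on S")
  case True
  then have "(f has_integral integral S f) S" by (rule integrable_integral)
  from nn_integral_has_integral_lebesgue[OF assms(1) this]
  show ?thesis using True absolutely_integrable_on_iff_nonneg[of S f] assms(1) by simp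
next
  case False
  have "(\<integral>\<^sup>+ x. ennreal (indicator S x * f x) \<partial>lborel) = \<infinity>"
  proof (rule ccontr)
    assume "(\<integral>\<^sup>+ x. ennreal (indicator S x * f x) \<partial>lborel) \<noteq> \<infinity>"
    then obtain r where r: "0 \<le> r" "(\<integral>\<^sup>+ x. ennreal (indicator S x * f x) \<partial>lborel) = ennreal r"
      by (cases "\<integral>\<^sup>+ x. ennreal (indicator S x * f x) \<partial>lborel") auto
    have "((\<lambda>x. indicator S x * f x) has_integral r) UNIV"
      by (rule nn_integral_has_integral[OF assms(2) _ r(2) r(1)]) (use assms(1) in \<open>auto simp: indicator_def\<close>)
    moreover have "(\<lambda>x. indicator S x * f x) = (\<lambda>x. if x \<in> S then f x else 0)" by (auto simp: indicator_def)
    ultimately have "(f has_integral r) S" by (simp add: has_integral_restrict_UNIV)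
    then show False using False by blast
  qed
  then show ?thesis using False absolutely_integrable_on_iff_nonneg[of S f] assms(1) by simp
qed

lemma nn_integral_change_of_variables_cart:
  fixes h :: "real^'n::{finite,wellorder} \<Rightarrow> real" and g :: "real^'n::_ \<Rightarrow> real^'n::_"
  assumes S: "S \<in> sets borel"
    and der: "\<And>x. x \<in> S \<Longrightarrow> (g has_derivative g' x) (at x)" and inj: "inj_on g S"
    and h: "\<And>x. 0 \<le> h x"
    and m1: "(\<lambda>x. indicator (g ` S) x * h x) \<in> borel_measurable borel"
    and m2: "(\<lambda>x. indicator S x * (\<bar>det (matrix (g' x))\<bar> * h (g x))) \<in> borel_measurable borel"
  shows "(\<integral>\<^sup>+ x. ennreal (indicator (g ` S) x * h x) \<partial>lborel) =
    (\<integral>\<^sup>+ x. ennreal (indicator S x * (\<bar>det (matrix (g' x))\<bar> * h (g x))) \<partial>lborel)"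
proof -
  let ?j = "\<lambda>x. \<bar>det (matrix (g' x))\<bar> * h (g x)"
  \<comment> \<open>The theorem is stated for vector-valued functions, so h is viewed as a function
    into \<open>real^1\<close>. Its equivalence holds for every value b and therefore gives both
    integrability and the value.\<close>
  let ?H = "\<lambda>x. (vec (h x)) :: real^1"
  have cov: "(\<lambda>x. \<bar>det (matrix (g' x))\<bar> *\<^sub>R ?H (g x)) absolutely_integrable_on S \<and>
           integral S (\<lambda>x. \<bar>det (matrix (g' x))\<bar> *\<^sub>R ?H (g x)) = b
     \<longleftrightarrow> ?H absolutely_integrable_on (g ` S) \<and> integral (g ` S) ?H = b" for b
    by (rule has_absolute_integral_change_of_variables[OF _ has_derivative_at_withinI[OF der] inj])
       (use S in auto)
  have vec: "(\<lambda>x. \<bar>det (matrix (g' x))\<bar> *\<^sub>R ?H (g x)) = (\<lambda>x. vec (?j x))"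
    by (auto simp: vec_eq_iff)
  have "?j absolutely_integrable_on S \<and> integral S ?j = b
     \<longleftrightarrow> h absolutely_integrable_on (g ` S) \<and> integral (g ` S) h = b" for b
    using cov[of "vec b"] unfolding vec
    by (simp add: absolutely_integrable_on_1_iff integral_on_1_eq vec_eq_iff)
  then have "?j absolutely_integrable_on S \<longleftrightarrow> h absolutely_integrable_on (g ` S)"
    "?j absolutely_integrable_on S \<Longrightarrow> integral S ?j = integral (g ` S) h" by blast+
  then show ?thesis
    by (subst (1 2) nn_integral_eq_if_integrable) (use h m1 m2 in auto)
qed

text \<open>Everything is transported along the linear isometry T that sends the coordinate axes to
  the standard basis. T maps boxes to boxes with the same side lengths, so it preserves Lebesgue
  measure, and conjugation by T turns \<open>det\<close> into \<open>det_axes Basis\<close>.\<close>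

lemma nn_integral_change_of_variables:
  fixes h :: "'e::euclidean_space \<Rightarrow> real" and g :: "'e \<Rightarrow> 'e"
  assumes S: "S \<in> sets borel"
    and der: "\<And>x. x \<in> S \<Longrightarrow> (g has_derivative g' x) (at x)" and inj: "inj_on g S"
    and h: "\<And>x. 0 \<le> h x"
    and m1: "(\<lambda>x. indicator (g ` S) x * h x) \<in> borel_measurable borel"
    and m2: "(\<lambda>x. indicator S x * (\<bar>det_axes Basis (g' x)\<bar> * h (g x))) \<in> borel_measurable borel"
  shows "(\<integral>\<^sup>+ x. ennreal (indicator (g ` S) x * h x) \<partial>lborel) =
    (\<integral>\<^sup>+ x. ennreal (indicator S x * (\<bar>det_axes Basis (g' x)\<bar> * h (g x))) \<partial>lborel)"
proof -
  obtain \<beta> :: "'e basis_index \<Rightarrow> 'e" where \<beta>: "bij_betw \<beta> UNIV Basis"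
    using finite_same_card_bij[of "UNIV :: 'e basis_index set" "Basis :: 'e set"] card_basis_index by auto
  have \<beta>B: "\<beta> i \<in> Basis" for i using \<beta> bij_betwE by blast
  have \<beta>_eq: "\<beta> i = \<beta> j \<longleftrightarrow> i = j" for i j using \<beta> by (metis UNIV_I bij_betw_inv_into_left)
  have \<beta>_inner: "\<beta> i \<bullet> \<beta> j = (if i = j then 1 else 0)" for i j
    using \<beta>B \<beta>_eq by (simp add: inner_Basis)
  define T :: "real ^ 'e basis_index \<Rightarrow> 'e" where "T x = (\<Sum>i\<in>UNIV. (x $ i) *\<^sub>R \<beta> i)" for x
  define T' :: "'e \<Rightarrow> real ^ 'e basis_index" where "T' y = (\<chi> i. y \<bullet> \<beta> i)" for y
  have T_inner: "T x \<bullet> \<beta> i = x $ i" for x i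
    by (simp add: T_def inner_sum_left \<beta>_inner if_distrib cong: if_cong)
  have T'T: "T' (T x) = x" for x by (simp add: T'_def T_inner vec_eq_iff)
  have TT': "T (T' y) = y" for y
  proof -
    have "T (T' y) = (\<Sum>b\<in>Basis. (y \<bullet> b) *\<^sub>R b)"
      unfolding T_def T'_def by (simp add: sum.reindex_bij_betw[OF \<beta>, of "\<lambda>b. (y \<bullet> b) *\<^sub>R b"])
    then show ?thesis by (simp add: euclidean_representation)
  qed
  have linT: "linear T" unfolding T_def
    by (intro linear_compose_sum ballI) (auto simp: linear_iff scaleR_left_distrib)
  have linT': "linear T'" unfolding T'_def by (auto simp: linear_iff vec_eq_iff inner_add_left)
  have dT: "(T has_derivative T) F" and dT': "(T' has_derivative T') F'" for F F'
    using linT linT' by (auto intro: linear_imp_has_derivative)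
  have mT [measurable]: "T \<in> borel \<rightarrow>\<^sub>M borel" and mT' [measurable]: "T' \<in> borel \<rightarrow>\<^sub>M borel"
    using linT linT' by (auto intro!: borel_measurable_continuous_onI linear_continuous_on simp: linear_conv_bounded_linear)
  have distr: "distr lborel borel T = lborel"
  proof (rule lborel_eqI[symmetric])
    fix l u :: 'e assume lu: "\<And>b. b \<in> Basis \<Longrightarrow> l \<bullet> b \<le> u \<bullet> b"
    have all: "(\<forall>b\<in>Basis. P b) \<longleftrightarrow> (\<forall>i. P (\<beta> i))" for P
      using \<beta> unfolding bij_betw_def by (metis rangeE rangeI)
    have "T -` box l u = box (T' l) (T' u)"
      by (auto simp: box_def all T_inner Basis_vec_def inner_axis inner_axis' T'_def)
    then have "emeasure (distr lborel borel T) (box l u) = emeasure lborel (box (T' l) (T' u))"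
      by (subst emeasure_distr) auto
    also have "\<dots> = ennreal (\<Prod>b\<in>Basis. (T' u - T' l) \<bullet> b)"
    proof (subst emeasure_lborel_box)
      show "T' l \<bullet> b \<le> T' u \<bullet> b" if "b \<in> Basis" for b
        using that lu \<beta>B by (auto simp: Basis_vec_def inner_axis inner_axis' T'_def)
    qed simp
    also have "(\<Prod>b\<in>Basis. (T' u - T' l) \<bullet> b) = (\<Prod>i\<in>UNIV. (u - l) \<bullet> \<beta> i)"
    proof -
      have "(Basis :: (real ^ 'e basis_index) set) = range (\<lambda>i. axis i 1)" by (auto simp: Basis_vec_def)
      moreover have "inj (\<lambda>i :: 'e basis_index. axis i (1::real))" by (auto simp: inj_on_def axis_eq_axis)
      ultimately have "(\<Prod>b\<in>Basis. (T' u - T' l) \<bullet> b) =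
          (\<Prod>i\<in>UNIV. (T' u - T' l) \<bullet> axis i (1::real))"
        using prod.reindex[of "\<lambda>i. axis i (1::real)" UNIV "\<lambda>b. (T' u - T' l) \<bullet> b"] by (simp only: o_def)
      then show ?thesis by (simp add: inner_axis T'_def inner_diff_left)
    qed
    also have "\<dots> = (\<Prod>b\<in>Basis. (u - l) \<bullet> b)"
      by (rule prod.reindex_bij_betw[OF \<beta>])
    finally show "emeasure (distr lborel borel T) (box l u) = (\<Prod>b\<in>Basis. (u - l) \<bullet> b)" .
  qed simp
  have det: "det (matrix (\<lambda>x. T' (L (T x)))) = det_axes Basis L" for L
  proof -
    have T_axis: "T (axis i 1) = \<beta> i" for i
    proof (rule euclidean_eqI)
      fix b :: 'e assume "b \<in> Basis"
      then obtain j where "b = \<beta> j" using \<beta> by (auto simp: bij_betw_def)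
      then show "T (axis i 1) \<bullet> b = \<beta> i \<bullet> b" by (simp add: T_inner \<beta>_inner axis_def)
    qed
    let ?f = "\<lambda>p. map_permutation UNIV \<beta> p"
    have eq: "?f = (\<lambda>p x. if x \<in> Basis then \<beta> (p (inv_into UNIV \<beta> x)) else x)"
      using \<beta> by (auto simp: map_permutation_def restrict_id_def bij_betw_def fun_eq_iff)
    have bij: "bij_betw ?f {p. p permutes UNIV} {p. p permutes Basis}"
      unfolding eq using bij_betw_permutations[OF \<beta>] by simp
    have "det_axes Basis L = (\<Sum>p | p permutes UNIV. of_int (sign (?f p)) * (\<Prod>b\<in>Basis. L b \<bullet> ?f p b))"
      unfolding det_axes_def by (rule sum.reindex_bij_betw[OF bij, symmetric])
    also have "\<dots> = (\<Sum>p | p permutes UNIV. of_int (sign p) * (\<Prod>i\<in>UNIV. L (\<beta> i) \<bullet> \<beta> (p i)))"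
    proof (rule sum.cong[OF refl], clarify)
      fix p :: "'e basis_index \<Rightarrow> 'e basis_index" assume p: "p permutes UNIV"
      have "(\<Prod>b\<in>Basis. L b \<bullet> ?f p b) = (\<Prod>i\<in>UNIV. L (\<beta> i) \<bullet> ?f p (\<beta> i))"
        by (rule prod.reindex_bij_betw[OF \<beta>, symmetric])
      also have "\<dots> = (\<Prod>i\<in>UNIV. L (\<beta> i) \<bullet> \<beta> (p i))"
        using \<beta>B bij_betw_imp_inj_on[OF \<beta>] by (simp add: eq)
      finally show "of_int (sign (?f p)) * (\<Prod>b\<in>Basis. L b \<bullet> ?f p b) = of_int (sign p) * (\<Prod>i\<in>UNIV. L (\<beta> i) \<bullet> \<beta> (p i))"
        using sign_map_permutation[OF bij_betw_imp_inj_on[OF \<beta>] p] by simp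
    qed
    \<comment> \<open>The images of the basis vectors are the columns of \<open>matrix\<close> but
      the rows in \<open>det_axes\<close>; the determinant does not change under
      transposition.\<close>
    also have "\<dots> = det (Finite_Cartesian_Product.transpose (matrix (\<lambda>x. T' (L (T x)))))"
      by (simp add: det_def Finite_Cartesian_Product.transpose_def matrix_def T'_def T_axis)
    finally show ?thesis by simp
  qed
  let ?k = "\<lambda>x. h (T x)" and ?g = "\<lambda>x. T' (g (T x))" and ?g' = "\<lambda>x v. T' (g' (T x) (T v))"
  have S': "T -` S \<in> sets borel" using measurable_sets[OF mT S] by simp
  have im: "?g ` (T -` S) = T -` (g ` S)"
  proof (intro equalityI subsetI)
    fix z assume "z \<in> T -` (g ` S)"
    then obtain x where x: "x \<in> S" "T z = g x" by auto
    then have "z = ?g (T' x)" using T'T[of z] by (simp add: TT')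
    then show "z \<in> ?g ` (T -` S)" using x by (intro image_eqI[of _ _ "T' x"]) (simp_all add: TT')
  qed (auto simp: TT')
  have ind1: "indicator (?g ` (T -` S)) x = indicator (g ` S) (T x)" for x :: "real ^ 'e basis_index"
    unfolding im by (simp add: indicator_def)
  have ind2: "indicator (T -` S) x = indicator S (T x)" for x by (simp add: indicator_def)
  have "(\<integral>\<^sup>+ x. ennreal (indicator (?g ` (T -` S)) x * ?k x) \<partial>lborel) =
      (\<integral>\<^sup>+ x. ennreal (indicator (T -` S) x * (\<bar>det (matrix (?g' x))\<bar> * ?k (?g x))) \<partial>lborel)"
  proof (rule nn_integral_change_of_variables_cart[OF S'])
    show "(?g has_derivative ?g' x) (at x)" if "x \<in> T -` S" for x
      using has_derivative_compose[OF has_derivative_compose[OF dT der] dT'] that by simp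
    show "inj_on ?g (T -` S)"
      using inj TT' T'T by (auto simp: inj_on_def) (metis)
    show "(\<lambda>x. indicator (?g ` (T -` S)) x * ?k x) \<in> borel_measurable borel"
      unfolding ind1 using measurable_compose[OF mT m1] by simp
    show "(\<lambda>x. indicator (T -` S) x * (\<bar>det (matrix (?g' x))\<bar> * ?k (?g x))) \<in> borel_measurable borel"
      unfolding ind2 det using measurable_compose[OF mT m2] by (simp add: TT')
  qed (rule h)
  then have *: "(\<integral>\<^sup>+ x. ennreal (indicator (g ` S) (T x) * h (T x)) \<partial>lborel) =
      (\<integral>\<^sup>+ x. ennreal (indicator S (T x) * (\<bar>det_axes Basis (g' (T x))\<bar> * h (g (T x)))) \<partial>lborel)"
    unfolding ind1 ind2 det TT' .
  have "(\<integral>\<^sup>+ x. ennreal (F x) \<partial>lborel) = (\<integral>\<^sup>+ x. ennreal (F (T x)) \<partial>lborel)"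
    if "F \<in> borel_measurable borel" for F :: "'e \<Rightarrow> real"
    by (subst distr[symmetric], subst nn_integral_distr) (use that in auto)
  from this[OF m1] this[OF m2] show ?thesis using * by simp
qed

text \<open>Fubini's theorem: the remaining axes run over a unit cube, which has volume 1.
  Statements about the measure on \<open>span B\<close> thereby become statements about Lebesgue
  measure on the whole space.\<close>

lemma nn_integral_axes_lborel:
  fixes B :: "'e::euclidean_space set" and u :: "'e \<Rightarrow> ennreal"
  assumes B: "B \<subseteq> Basis" and u [measurable]: "u \<in> borel_measurable borel"
  shows "(\<integral>\<^sup>+ y. u y \<partial>axes_lborel B) =
    (\<integral>\<^sup>+ y. u (axes_proj B y) * indicator {y. \<forall>b\<in>Basis - B. y \<bullet> b \<in> {0..1}} y \<partial>lborel)"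
proof -
  interpret product_sigma_finite "\<lambda>_::'e. lborel :: real measure" by standard
  let ?C = "Basis - B"
  have fin: "finite B" "finite ?C" "B \<inter> ?C = {}" "B \<union> ?C = Basis" using B finite_subset[OF B finite_Basis] by auto
  define P where "P = (\<lambda>t :: 'e \<Rightarrow> real. \<Sum>b\<in>Basis. t b *\<^sub>R b)"
  define R where "R = (\<lambda>t :: 'e \<Rightarrow> real. \<Sum>b\<in>B. t b *\<^sub>R b)"
  define F where "F t = u (R t) * indicator (PiE ?C (\<lambda>_. {0..1::real})) (restrict t ?C)" for t :: "'e \<Rightarrow> real"
  have P [measurable]: "P \<in> borel_measurable (Pi\<^sub>M Basis (\<lambda>_. lborel))" unfolding P_def by measurable
  have R [measurable]: "R \<in> borel_measurable (Pi\<^sub>M B (\<lambda>_. lborel))" unfolding R_def by measurable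
  have R' [measurable]: "R \<in> borel_measurable (Pi\<^sub>M Basis (\<lambda>_. lborel))"
    unfolding R_def using B by (intro borel_measurable_sum borel_measurable_scaleR measurable_component_singleton) auto
  have Pi: "P t \<bullet> b = t b" if "b \<in> Basis" for t b
    using that unfolding P_def inner_sum_left by (subst sum.remove[of _ b]) (auto simp: inner_Basis intro!: sum.neutral)
  have proj: "axes_proj B (P t) = R t" for t
    unfolding axes_proj_def R_def using Pi B by (intro sum.cong) auto
  have mp [measurable]: "(\<lambda>y. axes_proj B y) \<in> borel_measurable borel" unfolding axes_proj_def by measurable
  have cl: "{y :: 'e. \<forall>b\<in>?C. y \<bullet> b \<in> {0..1}} \<in> sets borel"
  proof -
    have "{y :: 'e. \<forall>b\<in>?C. y \<bullet> b \<in> {0..1}} = (\<Inter>b\<in>?C. {y. y \<bullet> b \<in> {0..1}})" by auto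
    moreover have "closed {y :: 'e. y \<bullet> b \<in> {0..1}}" for b
      using continuous_closed_vimage[of "{0..1::real}" "\<lambda>y. y \<bullet> b"] by (simp add: vimage_def)
    ultimately have "closed {y :: 'e. \<forall>b\<in>?C. y \<bullet> b \<in> {0..1}}" by auto
    then show ?thesis by (rule borel_closed)
  qed
  have "(\<integral>\<^sup>+ y. u (axes_proj B y) * indicator {y. \<forall>b\<in>?C. y \<bullet> b \<in> {0..1}} y \<partial>lborel) =
     (\<integral>\<^sup>+ t. u (axes_proj B (P t)) * indicator {y. \<forall>b\<in>?C. y \<bullet> b \<in> {0..1}} (P t) \<partial>Pi\<^sub>M Basis (\<lambda>_. lborel))"
    unfolding lborel_eq[where 'a = 'e] P_def[symmetric]
    by (subst nn_integral_distr) (use cl in measurable)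
  also have "\<dots> = (\<integral>\<^sup>+ t. F t \<partial>Pi\<^sub>M Basis (\<lambda>_. lborel))"
    by (rule nn_integral_cong) (auto simp: F_def proj indicator_def Pi PiE_iff)
  also have "\<dots> = (\<integral>\<^sup>+ x. (\<integral>\<^sup>+ y. F (merge B ?C (x, y)) \<partial>Pi\<^sub>M ?C (\<lambda>_. lborel)) \<partial>Pi\<^sub>M B (\<lambda>_. lborel))"
  proof -
    have m: "(\<lambda>t. restrict t ?C) \<in> Pi\<^sub>M Basis (\<lambda>_. lborel) \<rightarrow>\<^sub>M Pi\<^sub>M ?C (\<lambda>_. lborel :: real measure)"
      by (rule measurable_restrict_subset) auto
    have s: "PiE ?C (\<lambda>_. {0..1::real}) \<in> sets (Pi\<^sub>M ?C (\<lambda>_. lborel :: real measure))"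
      by (rule sets_PiM_I_finite) (use fin in auto)
    have "F \<in> borel_measurable (Pi\<^sub>M Basis (\<lambda>_. lborel))"
      unfolding F_def using borel_measurable_indicator[OF s] measurable_compose[OF m]
      by (intro borel_measurable_times_ennreal measurable_compose[OF R' u] measurable_compose[OF m]) auto
    then show ?thesis using product_nn_integral_fold[of B ?C F] fin by simp
  qed
  also have "\<dots> = (\<integral>\<^sup>+ x. u (R x) \<partial>Pi\<^sub>M B (\<lambda>_. lborel))"
  proof (rule nn_integral_cong)
    fix x
    have s: "PiE ?C (\<lambda>_. {0..1::real}) \<in> sets (Pi\<^sub>M ?C (\<lambda>_. lborel :: real measure))"
      by (rule sets_PiM_I_finite) (use fin in auto)
    have "(\<integral>\<^sup>+ y. F (merge B ?C (x, y)) \<partial>Pi\<^sub>M ?C (\<lambda>_. lborel)) =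
        (\<integral>\<^sup>+ y. u (R x) * indicator (PiE ?C (\<lambda>_. {0..1::real})) y \<partial>Pi\<^sub>M ?C (\<lambda>_. lborel))"
    proof (rule nn_integral_cong)
      fix y assume y: "y \<in> space (Pi\<^sub>M ?C (\<lambda>_. lborel :: real measure))"
      have "R (merge B ?C (x, y)) = R x" unfolding R_def by (rule sum.cong) (auto simp: merge_def)
      moreover have "restrict (merge B ?C (x, y)) ?C = y"
        using y by (auto simp: merge_def space_PiM PiE_def extensional_def fun_eq_iff)
      ultimately show "F (merge B ?C (x, y)) = u (R x) * indicator (PiE ?C (\<lambda>_. {0..1::real})) y"
        by (simp add: F_def)
    qed
    also have "\<dots> = u (R x) * emeasure (Pi\<^sub>M ?C (\<lambda>_. lborel)) (PiE ?C (\<lambda>_. {0..1::real}))"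
      by (rule nn_integral_cmult_indicator[OF s])
    also have "emeasure (Pi\<^sub>M ?C (\<lambda>_. lborel)) (PiE ?C (\<lambda>_. {0..1::real})) = (\<Prod>i\<in>?C. emeasure lborel {0..1::real})"
      by (rule emeasure_PiM) (use fin in auto)
    finally show "(\<integral>\<^sup>+ y. F (merge B ?C (x, y)) \<partial>Pi\<^sub>M ?C (\<lambda>_. lborel)) = u (R x)" by simp
  qed
  also have "\<dots> = (\<integral>\<^sup>+ y. u y \<partial>axes_lborel B)"
    unfolding axes_lborel_def R_def[symmetric] by (subst nn_integral_distr) auto
  finally show ?thesis ..
qed

lemma axes_proj_simps:
  assumes B: "B \<subseteq> Basis"
  shows "c \<in> B \<Longrightarrow> axes_proj B y \<bullet> c = y \<bullet> c" "c \<in> Basis \<Longrightarrow> c \<notin> B \<Longrightarrow> axes_proj B y \<bullet> c = 0"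
    "linear (axes_proj B)" "axes_proj B (axes_proj B y) = axes_proj B y"
    "axes_proj B y \<in> span B" "y \<in> span B \<Longrightarrow> axes_proj B y = y" "b \<in> B \<Longrightarrow> axes_proj B b = b"
proof -
  have fin: "finite B" using B finite_subset[OF B finite_Basis] by auto
  show in_B: "c \<in> B \<Longrightarrow> axes_proj B y \<bullet> c = y \<bullet> c" for c y
    unfolding axes_proj_def inner_sum_left inner_scaleR_left
    using B fin by (subst sum.remove[of _ c]) (auto simp: inner_Basis subset_eq intro!: sum.neutral)
  show "c \<in> Basis \<Longrightarrow> c \<notin> B \<Longrightarrow> axes_proj B y \<bullet> c = 0"
    unfolding axes_proj_def inner_sum_left inner_scaleR_left
    using B by (intro sum.neutral) (auto simp: inner_Basis subset_eq)
  show lin: "linear (axes_proj B)"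
    unfolding axes_proj_def[abs_def] by (intro linear_compose_sum ballI) (auto simp: linear_iff inner_add_left scaleR_left_distrib)
  show "axes_proj B (axes_proj B y) = axes_proj B y"
    by (subst (1 3) axes_proj_def) (simp add: in_B cong: sum.cong)
  show "axes_proj B y \<in> span B"
    unfolding axes_proj_def by (intro span_sum span_scale span_base)
  have b: "axes_proj B b = b" if "b \<in> B" for b
    unfolding axes_proj_def using that B fin
    by (subst sum.remove[of _ b]) (auto simp: inner_Basis subset_eq intro!: sum.neutral split: if_splits)
  then show "b \<in> B \<Longrightarrow> axes_proj B b = b" by simp
  show "axes_proj B y = y" if "y \<in> span B"
    using that by (rule linear_eq_on_span[OF lin linear_ident b, rotated])
qed

lemma borel_measurable_axes_proj [measurable]: "axes_proj B \<in> borel_measurable borel"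
  unfolding axes_proj_def[abs_def] by measurable

text \<open>The extended map is block diagonal with an identity block. A permutation that moves an
  axis outside B contributes a factor 0, so only the permutations of B survive.\<close>

lemma det_axes_extend:
  fixes L :: "'e::euclidean_space \<Rightarrow> 'e"
  assumes B: "B \<subseteq> Basis" and L: "\<And>b. b \<in> B \<Longrightarrow> L b \<in> span B" "L 0 = 0"
  shows "det_axes Basis (\<lambda>v. L (axes_proj B v) + (v - axes_proj B v)) = det_axes B L"
proof -
  note P = axes_proj_simps[OF B]
  let ?L = "\<lambda>v. L (axes_proj B v) + (v - axes_proj B v)"
  have fin: "finite B" using B finite_subset[OF B finite_Basis] by auto
  have in_B: "?L b = L b" if "b \<in> B" for b using P(7)[OF that] by simp
  have out_B: "?L b = b" if "b \<in> Basis - B" for b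
  proof -
    have "axes_proj B b = 0"
      using that B unfolding axes_proj_def by (intro sum.neutral) (auto simp: inner_Basis)
    then show ?thesis using L(2) by simp
  qed
  have "det_axes Basis ?L = (\<Sum>p | p permutes B. of_int (sign p) * (\<Prod>b\<in>Basis. ?L b \<bullet> p b))"
    unfolding det_axes_def
  proof (rule sum.mono_neutral_right)
    show "{p. p permutes B} \<subseteq> {p. p permutes Basis}" using B permutes_subset by blast
    show "\<forall>p\<in>{p. p permutes Basis} - {p. p permutes B}. real_of_int (sign p) * (\<Prod>b\<in>Basis. ?L b \<bullet> p b) = 0"
    proof (rule ballI)
      fix p assume "p \<in> {p. p permutes Basis} - {p. p permutes B}"
      then have p: "p permutes Basis" "\<not> p permutes B" by auto
      have "\<exists>b\<in>Basis. b \<notin> B \<and> p b \<noteq> b"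
        using p unfolding permutes_def by auto
      then obtain b where b: "b \<in> Basis - B" "p b \<noteq> b" by blast
      then have "?L b \<bullet> p b = 0" using permutes_in_image[OF p(1), of b] by (simp add: out_B inner_Basis)
      then show "real_of_int (sign p) * (\<Prod>b\<in>Basis. ?L b \<bullet> p b) = 0"
        using b(1) by (auto simp: prod_zero_iff)
    qed
  qed (simp add: finite_permutations)
  also have "\<dots> = det_axes B L"
    unfolding det_axes_def
  proof (rule sum.cong[OF refl], clarify)
    fix p assume p: "p permutes B"
    have "(\<Prod>b\<in>Basis. ?L b \<bullet> p b) = (\<Prod>b\<in>B. ?L b \<bullet> p b) * (\<Prod>b\<in>Basis - B. ?L b \<bullet> p b)"
      using prod.subset_diff[OF B finite_Basis] by (simp add: mult.commute)
    also have "(\<Prod>b\<in>Basis - B. ?L b \<bullet> p b) = 1"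
      by (rule prod.neutral) (use p in \<open>auto simp: out_B permutes_not_in inner_Basis\<close>)
    also have "(\<Prod>b\<in>B. ?L b \<bullet> p b) = (\<Prod>b\<in>B. L b \<bullet> p b)"
      by (rule prod.cong) (simp_all add: in_B)
    finally show "of_int (sign p) * (\<Prod>b\<in>Basis. ?L b \<bullet> p b) = of_int (sign p) * (\<Prod>b\<in>B. L b \<bullet> p b)"
      by simp
  qed
  finally show ?thesis .
qed

text \<open>
  The change of variables on \<open>span B\<close> is reduced to the one on the whole space by extending the map by the
  identity in the directions of the remaining axes and restricting these to the unit cube.
\<close>

lemma nn_integral_axes_change_of_variables:
  fixes h :: "'e::euclidean_space \<Rightarrow> real" and g :: "'e \<Rightarrow> 'e"
  assumes B: "B \<subseteq> Basis"
    and S: "S \<in> sets borel" "S \<subseteq> span B" "g ` S \<subseteq> span B"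
    and der: "\<And>x. x \<in> S \<Longrightarrow> (g has_derivative g' x) (at x)" and inj: "inj_on g S"
    and g': "\<And>x b. x \<in> S \<Longrightarrow> b \<in> B \<Longrightarrow> g' x b \<in> span B"
    and h: "\<And>x. 0 \<le> h x"
    and m1: "(\<lambda>x. indicator (g ` S) x * h x) \<in> borel_measurable borel"
    and m2: "(\<lambda>x. indicator S x * (\<bar>det_axes B (g' x)\<bar> * h (g x))) \<in> borel_measurable borel"
  shows "(\<integral>\<^sup>+ x. ennreal (indicator (g ` S) x * h x) \<partial>axes_lborel B) =
    (\<integral>\<^sup>+ x. ennreal (indicator S x * (\<bar>det_axes B (g' x)\<bar> * h (g x))) \<partial>axes_lborel B)"
proof -
  note P = axes_proj_simps[OF B]
  let ?p = "axes_proj B"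
  define K where "K = {y :: 'e. \<forall>b\<in>Basis - B. y \<bullet> b \<in> {0..1}}"
  define T where "T = {y \<in> K. ?p y \<in> S}"
  define G where "G y = g (?p y) + (y - ?p y)" for y
  define G' where "G' y v = g' (?p y) (?p v) + (v - ?p v)" for y v
  have K [measurable]: "K \<in> sets borel"
  proof -
    have "K = (\<Inter>b\<in>Basis - B. {y. y \<bullet> b \<in> {0..1}})" by (auto simp: K_def)
    moreover have "closed {y :: 'e. y \<bullet> b \<in> {0..1}}" for b
      using continuous_closed_vimage[of "{0..1::real}" "\<lambda>y. y \<bullet> b"] by (simp add: vimage_def)
    ultimately have "closed K" by auto
    then show ?thesis by (rule borel_closed)
  qed
  have "?p -` S \<in> sets borel" using measurable_sets[OF borel_measurable_axes_proj S(1)] by simp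
  moreover have "T = K \<inter> ?p -` S" by (auto simp: T_def)
  ultimately have T: "T \<in> sets borel" using K by simp
  have pz: "?p (u + v) = ?p u + ?p v" "?p (u - v) = ?p u - ?p v" for u v
    using P(3) by (simp_all add: linear_add linear_diff)
  have pG: "?p (G y) = g (?p y)" if "?p y \<in> S" for y
    using S(3) that P(6)[of "g (?p y)"] by (auto simp: G_def pz P(4))
  \<comment> \<open>Since g has values in \<open>span B\<close>, the map G leaves the coordinates
    along the remaining axes unchanged and so respects the cube.\<close>
  have GK: "G y \<in> K \<longleftrightarrow> y \<in> K" if "?p y \<in> S" for y
  proof -
    have "G y \<bullet> b = y \<bullet> b" if b: "b \<in> Basis - B" for b
    proof -
      have "?p (g (?p y)) \<bullet> b = 0" using b P(2) by blast
      moreover have "?p (g (?p y)) = g (?p y)" using S(3) \<open>?p y \<in> S\<close> P(6) by blast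
      ultimately show ?thesis using b P(2)[of b y] by (simp add: G_def inner_add_left inner_diff_left)
    qed
    then show ?thesis by (simp add: K_def)
  qed
  have im: "z \<in> G ` T \<longleftrightarrow> z \<in> K \<and> ?p z \<in> g ` S" for z
  proof
    assume "z \<in> G ` T"
    then show "z \<in> K \<and> ?p z \<in> g ` S" using GK pG by (auto simp: T_def)
  next
    assume z: "z \<in> K \<and> ?p z \<in> g ` S"
    then obtain x where x: "x \<in> S" "?p z = g x" by auto
    define y where "y = x + (z - ?p z)"
    have "?p (z - ?p z) = 0" by (simp add: pz P(4))
    then have py: "?p y = x" using x(1) S(2) P(6) unfolding y_def pz(1) by auto
    then have "G y = z" using x by (simp add: G_def y_def)
    then show "z \<in> G ` T" using GK[of y] py x z by (auto simp: T_def)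
  qed
  have "inj_on G T"
  proof (rule inj_onI)
    fix x y assume xy: "x \<in> T" "y \<in> T" "G x = G y"
    then have "g (?p x) = g (?p y)" using pG by (metis (mono_tags, lifting) T_def mem_Collect_eq)
    then have e: "?p x = ?p y" using inj xy by (auto simp: T_def inj_on_def)
    then show "x = y" using xy(3) by (simp add: G_def)
  qed
  have dp: "(?p has_derivative ?p) (at y)" for y
    by (rule linear_imp_has_derivative[OF P(3)])
  have dG: "(G has_derivative G' y) (at y)" if "y \<in> T" for y
    unfolding G_def[abs_def] G'_def[abs_def]
    by (rule has_derivative_add[OF has_derivative_compose[OF dp der] has_derivative_diff[OF has_derivative_ident dp]])
       (use that in \<open>auto simp: T_def\<close>)
  have detG: "det_axes Basis (G' y) = det_axes B (g' (?p y))" if "y \<in> T" for y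
    unfolding G'_def
  proof (rule det_axes_extend[OF B])
    show "g' (?p y) b \<in> span B" if "b \<in> B" for b using g' that \<open>y \<in> T\<close> by (auto simp: T_def)
    show "g' (?p y) 0 = 0" using der[of "?p y"] that by (simp add: T_def linear_0 has_derivative_linear)
  qed
  have ind: "indicator T y = (indicator S (?p y) * indicator K y :: real)"
    "indicator (G ` T) y = (indicator (g ` S) (?p y) * indicator K y :: real)" for y
    using im by (auto simp: T_def indicator_def)
  have m1': "(\<lambda>y. indicator (g ` S) (?p y) * h (?p y)) \<in> borel_measurable borel"
    using measurable_compose[OF borel_measurable_axes_proj m1] .
  have m2': "(\<lambda>y. indicator S (?p y) * (\<bar>det_axes B (g' (?p y))\<bar> * h (g (?p y)))) \<in> borel_measurable borel"
    using measurable_compose[OF borel_measurable_axes_proj m2] .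
  have e1: "indicator (G ` T) y * h (?p y) = indicator K y * (indicator (g ` S) (?p y) * h (?p y))" for y
    unfolding ind by simp
  have e2: "indicator T y * (\<bar>det_axes Basis (G' y)\<bar> * h (?p (G y))) =
      indicator K y * (indicator S (?p y) * (\<bar>det_axes B (g' (?p y))\<bar> * h (g (?p y))))" for y
    using detG[of y] pG[of y] by (auto simp: indicator_def T_def)
  have "(\<integral>\<^sup>+ x. ennreal (indicator (G ` T) x * h (?p x)) \<partial>lborel) =
    (\<integral>\<^sup>+ x. ennreal (indicator T x * (\<bar>det_axes Basis (G' x)\<bar> * h (?p (G x)))) \<partial>lborel)"
    by (rule nn_integral_change_of_variables[OF T dG \<open>inj_on G T\<close> h])
       (use m1' m2' in \<open>auto simp: e1 e2 intro!: borel_measurable_times\<close>)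
  moreover have "(\<integral>\<^sup>+ x. ennreal (u x) \<partial>axes_lborel B) = (\<integral>\<^sup>+ y. ennreal (indicator K y * u (?p y)) \<partial>lborel)"
    if "u \<in> borel_measurable borel" for u :: "'e \<Rightarrow> real"
  proof -
    have "(\<lambda>x. ennreal (u x)) \<in> borel_measurable borel" using that by simp
    from nn_integral_axes_lborel[OF B this] show ?thesis
      unfolding K_def[symmetric] by (simp only:) (auto simp: indicator_def intro!: nn_integral_cong)
  qed
  ultimately show ?thesis using m1 m2 by (simp add: e1 e2)
qed

section \<open>Smooth functions, smooth maps, tangent vectors and covectors on manifolds\<close>

section \<open>Smooth functions on a manifold near a point\<close>

lemma eventually_nhdsinI:
  "openin X W \<Longrightarrow> x \<in> W \<Longrightarrow> (\<And>z. z \<in> W \<Longrightarrow> P z) \<Longrightarrow> eventually P (nhdsin X x)"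
  unfolding eventually_nhdsin by blast

lemma eventually_nhdsinE:
  assumes "eventually P (nhdsin X x)" "x \<in> topspace X"
  obtains W where "openin X W" "x \<in> W" "\<And>z. z \<in> W \<Longrightarrow> P z"
  using assms unfolding eventually_nhdsin by blast

lemma eventually_nhdsin_self: "eventually P (nhdsin X x) \<Longrightarrow> x \<in> topspace X \<Longrightarrow> P x"
  unfolding eventually_nhdsin by blast

lemma eventually_nhdsin_continuous_map:
  assumes "continuous_map X Y f" "x \<in> topspace X" "eventually P (nhdsin Y (f x))"
  shows "eventually (\<lambda>z. P (f z)) (nhdsin X x)"
proof -
  have "f x \<in> topspace Y" using assms by (auto simp: continuous_map_def)
  then obtain W where W: "openin Y W" "f x \<in> W" "\<And>z. z \<in> W \<Longrightarrow> P z"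
    using eventually_nhdsinE[OF assms(3)] by blast
  show ?thesis
    by (rule eventually_nhdsinI[OF openin_continuous_map_preimage[OF assms(1) W(1)]]) (use W assms(2) in auto)
qed

lemma eventually_nhdsin_in: "openin X W \<Longrightarrow> x \<in> W \<Longrightarrow> eventually (\<lambda>z. z \<in> W) (nhdsin X x)"
  by (rule eventually_nhdsinI)

lemma openin_eventually:
  assumes "A \<subseteq> topspace X" "\<And>x. x \<in> A \<Longrightarrow> eventually (\<lambda>z. z \<in> A) (nhdsin X x)"
  shows "openin X A"
proof (subst openin_subopen, rule ballI)
  fix x assume x: "x \<in> A"
  obtain W where "openin X W" "x \<in> W" "\<And>z. z \<in> W \<Longrightarrow> z \<in> A"
    by (rule eventually_nhdsinE[OF assms(2)[OF x]]) (use x assms(1) in auto)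
  then show "\<exists>T. openin X T \<and> x \<in> T \<and> T \<subseteq> A" by blast
qed

text \<open>Asks for one chart around x only; \<open>smooth_fun_at_iff\<close> shows independence of
  the chart. The predicate also implies that x is a point of the manifold.\<close>

definition smooth_fun_at :: "('a, 'e::euclidean_space) manifold_struct \<Rightarrow> ('a \<Rightarrow> 'f::real_normed_vector) \<Rightarrow> 'a \<Rightarrow> bool" where
  "smooth_fun_at M f x \<longleftrightarrow> (\<exists>c\<in>atlas M. x \<in> fst c \<and> smooth_at (local_rep (axes M) c f) (snd c x))"

text \<open>The inverse chart preceded by the projection onto the axes. It is thereby defined on an
  open subset of the full Euclidean space, \<open>chart_dom\<close>, where derivatives make sense
  even if the manifold has smaller dimension.\<close>

abbreviation param :: "('a, 'e::euclidean_space) manifold_struct \<Rightarrow> 'a set \<times> ('a \<Rightarrow> 'e) \<Rightarrow> 'e \<Rightarrow> 'a" where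
  "param M c y \<equiv> inv_into (fst c) (snd c) (axes_proj (axes M) y)"

definition chart_dom :: "('a, 'e::euclidean_space) manifold_struct \<Rightarrow> 'a set \<times> ('a \<Rightarrow> 'e) \<Rightarrow> 'e set" where
  "chart_dom M c = {y. axes_proj (axes M) y \<in> snd c ` fst c}"

lemma atlas_cover:
  assumes "smooth_manifold M" "x \<in> points M"
  obtains c where "c \<in> atlas M" "x \<in> fst c"
proof -
  have "(\<Union>(U, \<phi>)\<in>atlas M. U) = points M" using assms by (simp add: smooth_manifold_def)
  then obtain c where "c \<in> atlas M" "x \<in> (case c of (U, \<phi>) \<Rightarrow> U)" using assms(2) by blast
  then show ?thesis using that by (cases c) auto
qed

context
  fixes M :: "('a, 'e::euclidean_space) manifold_struct" and c
  assumes M: "smooth_manifold M" and c: "c \<in> atlas M"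
begin

lemma axes_subset: "axes M \<subseteq> Basis" using M by (simp add: smooth_manifold_def)

lemma chart_open: "openin (man_top M) (fst c)"
  by (cases c) (use M c in \<open>fastforce simp: smooth_manifold_def\<close>)

lemma chart_points: "x \<in> fst c \<Longrightarrow> x \<in> points M"
  using openin_subset[OF chart_open] by blast

lemma chart_homeo: "homeomorphic_map (subtopology (man_top M) (fst c)) (top_of_set (snd c ` fst c)) (snd c)"
  by (cases c) (use M c in \<open>fastforce simp: smooth_manifold_def\<close>)

lemma chart_image_open: "openin (top_of_set (span (axes M))) (snd c ` fst c)"
  by (cases c) (use M c in \<open>fastforce simp: smooth_manifold_def\<close>)

lemma chart_inj: "inj_on (snd c) (fst c)"
  using chart_homeo openin_subset[OF chart_open]
  by (simp add: homeomorphic_map_def Int_absorb1)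

lemma chart_span: "x \<in> fst c \<Longrightarrow> snd c x \<in> span (axes M)"
  using openin_subset[OF chart_image_open] by auto

lemma chart_proj: "x \<in> fst c \<Longrightarrow> axes_proj (axes M) (snd c x) = snd c x"
  by (rule axes_proj_simps(6)[OF axes_subset chart_span])

lemma param_chart: "x \<in> fst c \<Longrightarrow> param M c (snd c x) = x"
  by (simp add: chart_proj chart_inj)

lemma param_in: "y \<in> chart_dom M c \<Longrightarrow> param M c y \<in> fst c"
  by (auto simp: chart_dom_def inv_into_into)

lemma chart_param: "y \<in> chart_dom M c \<Longrightarrow> snd c (param M c y) = axes_proj (axes M) y"
  by (auto simp: chart_dom_def f_inv_into_f)

lemma chart_in_dom: "x \<in> fst c \<Longrightarrow> snd c x \<in> chart_dom M c"
  by (simp add: chart_dom_def chart_proj)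

lemma param_proj: "param M c (axes_proj (axes M) y) = param M c y"
  by (simp add: axes_proj_simps(4)[OF axes_subset])

text \<open>Chart images are open only relative to the span of the axes. Their preimages under the
  continuous projection are open in the whole space.\<close>

lemma open_chart_preimage:
  assumes "openin (man_top M) W"
  shows "open {y. axes_proj (axes M) y \<in> snd c ` (fst c \<inter> W)}"
proof -
  have "openin (subtopology (man_top M) (fst c)) (fst c \<inter> W)"
    using assms by (simp add: openin_subtopology_Int2)
  then have "openin (top_of_set (snd c ` fst c)) (snd c ` (fst c \<inter> W))"
    using chart_homeo homeomorphic_map_openness openin_subset by blast
  then have "openin (top_of_set (span (axes M))) (snd c ` (fst c \<inter> W))"
    using chart_image_open openin_trans by blast
  then obtain T where T: "open T" "snd c ` (fst c \<inter> W) = span (axes M) \<inter> T"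
    by (auto simp: openin_open)
  have "{y. axes_proj (axes M) y \<in> snd c ` (fst c \<inter> W)} = axes_proj (axes M) -` T"
    unfolding T(2) using axes_proj_simps(5)[OF axes_subset] by auto
  moreover have "continuous_on UNIV (axes_proj (axes M))"
    using axes_proj_simps(3)[OF axes_subset] by (intro linear_continuous_on) (simp add: linear_linear)
  ultimately show ?thesis using T(1) by (simp add: open_vimage)
qed

lemma chart_preimage_iff:
  "axes_proj (axes M) y \<in> snd c ` (fst c \<inter> W) \<longleftrightarrow> y \<in> chart_dom M c \<and> param M c y \<in> W"
proof
  assume "axes_proj (axes M) y \<in> snd c ` (fst c \<inter> W)"
  then obtain x where x: "x \<in> fst c" "x \<in> W" "axes_proj (axes M) y = snd c x" by auto
  then have "param M c y = x" using chart_inj by simp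
  then show "y \<in> chart_dom M c \<and> param M c y \<in> W" using x by (auto simp: chart_dom_def)
next
  assume "y \<in> chart_dom M c \<and> param M c y \<in> W"
  then show "axes_proj (axes M) y \<in> snd c ` (fst c \<inter> W)"
    using param_in[of y] chart_param[of y] by (intro image_eqI[of _ _ "param M c y"]) simp_all
qed

lemma open_chart_dom: "open (chart_dom M c)"
proof -
  have "chart_dom M c = {y. axes_proj (axes M) y \<in> snd c ` (fst c \<inter> points M)}"
    using chart_preimage_iff[of _ "points M"] param_in chart_points by auto
  then show ?thesis using open_chart_preimage[OF openin_topspace] by simp
qed

lemma eventually_param:
  assumes "eventually P (nhdsin (man_top M) (param M c y))" "y \<in> chart_dom M c"
  shows "eventually (\<lambda>z. P (param M c z)) (nhds y)"
proof -
  obtain W where W: "openin (man_top M) W" "param M c y \<in> W" "\<And>z. z \<in> W \<Longrightarrow> P z"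
    using eventually_nhdsinE[OF assms(1)] chart_points param_in assms(2) by blast
  show ?thesis
    unfolding eventually_nhds
    using open_chart_preimage[OF W(1)] chart_preimage_iff W assms(2)
    by (intro exI[of _ "{y. axes_proj (axes M) y \<in> snd c ` (fst c \<inter> W)}"]) auto
qed

lemma eventually_in_chart: "x \<in> fst c \<Longrightarrow> eventually (\<lambda>z. z \<in> fst c) (nhdsin (man_top M) x)"
  by (rule eventually_nhdsin_in[OF chart_open])

lemma eventually_in_chart_dom: "y \<in> chart_dom M c \<Longrightarrow> eventually (\<lambda>y. y \<in> chart_dom M c) (nhds y)"
  by (rule eventually_nhds_in_open[OF open_chart_dom])

lemma eventually_chart:
  assumes "x \<in> fst c" "eventually P (nhds (snd c x))"
  shows "eventually (\<lambda>z. P (snd c z)) (nhdsin (man_top M) x)"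
proof -
  obtain T where T: "open T" "snd c x \<in> T" "\<And>z. z \<in> T \<Longrightarrow> P z"
    using assms(2) unfolding eventually_nhds by blast
  have "continuous_map (subtopology (man_top M) (fst c)) euclidean (snd c)"
    by (rule continuous_map_into_fulltopology[OF homeomorphic_imp_continuous_map[OF chart_homeo]])
  then have "openin (subtopology (man_top M) (fst c)) {z \<in> topspace (subtopology (man_top M) (fst c)). snd c z \<in> T}"
    by (rule openin_continuous_map_preimage) (simp add: T(1))
  then have "openin (man_top M) {z \<in> topspace (subtopology (man_top M) (fst c)). snd c z \<in> T}"
    by (rule openin_trans_full[OF _ chart_open])
  then show ?thesis
    by (rule eventually_nhdsinI) (use assms T chart_points in auto)
qed

lemma local_rep_proj: "local_rep (axes M) c f (axes_proj (axes M) y) = local_rep (axes M) c f y"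
  by (simp add: local_rep_def param_proj)

lemma local_rep_chart: "x \<in> fst c \<Longrightarrow> local_rep (axes M) c f (snd c x) = f x"
  by (simp add: local_rep_def param_chart)

lemma local_rep_cong:
  assumes "x \<in> fst c" "eventually (\<lambda>z. f z = g z) (nhdsin (man_top M) x)"
  shows "eventually (\<lambda>y. local_rep (axes M) c f y = local_rep (axes M) c g y) (nhds (snd c x))"
  using eventually_param[of "\<lambda>z. f z = g z" "snd c x"] assms chart_in_dom
  by (simp add: param_chart local_rep_def)

lemma smooth_at_proj: "smooth_at (axes_proj (axes M)) y"
  using axes_proj_simps(3)[OF axes_subset] by (simp add: smooth_at_bounded_linear linear_linear)

lemma smooth_at_local_rep_proj:
  assumes "smooth_at (local_rep (axes M) c f) (axes_proj (axes M) y)"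
  shows "smooth_at (local_rep (axes M) c f) y"
  using smooth_at_compose[OF assms smooth_at_proj] by (simp add: local_rep_proj)

end

lemma smooth_at_transition:
  assumes M: "smooth_manifold M" and c: "c \<in> atlas M" "x \<in> fst c" and d: "d \<in> atlas M" "x \<in> fst d"
  shows "smooth_at (local_rep (axes M) c (snd d)) (snd c x)"
proof -
  have "smooth_in_chart (axes M) c (fst d) (snd d)"
    using M c(1) d(1) by (auto simp: smooth_manifold_def split: prod.splits)
  then have "smooth_on_open {y. axes_proj (axes M) y \<in> snd c ` (fst c \<inter> fst d)} (local_rep (axes M) c (snd d))"
    by (simp add: smooth_in_chart_def)
  moreover have "snd c x \<in> {y. axes_proj (axes M) y \<in> snd c ` (fst c \<inter> fst d)}"
    using c d chart_proj[OF M c(1)] by auto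
  ultimately show ?thesis
    using smooth_on_open_iff_smooth_at[OF open_chart_preimage[OF M c(1) chart_open[OF M d(1)]]] by blast
qed

text \<open>Near x the representative in chart c is the representative in chart d composed with the
  transition function, which is smooth by compatibility of the atlas.\<close>

lemma smooth_fun_at_iff:
  assumes M: "smooth_manifold M" and c: "c \<in> atlas M" "x \<in> fst c"
  shows "smooth_fun_at M f x \<longleftrightarrow> smooth_at (local_rep (axes M) c f) (snd c x)"
proof
  assume "smooth_fun_at M f x"
  then obtain d where d: "d \<in> atlas M" "x \<in> fst d" "smooth_at (local_rep (axes M) d f) (snd d x)"
    by (auto simp: smooth_fun_at_def)
  have "smooth_at (\<lambda>y. local_rep (axes M) d f (local_rep (axes M) c (snd d) y)) (snd c x)"
    by (rule smooth_at_compose)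
      (use d c smooth_at_transition[OF M c d(1,2)] in \<open>auto simp: local_rep_chart[OF M]\<close>)
  then show "smooth_at (local_rep (axes M) c f) (snd c x)"
  proof (rule smooth_at_cong)
    have "eventually (\<lambda>y. param M c y \<in> fst d) (nhds (snd c x))"
      using eventually_param[OF M c(1), of "\<lambda>z. z \<in> fst d" "snd c x"] chart_in_dom[OF M c]
        eventually_in_chart[OF M d(1,2)] by (simp add: param_chart[OF M c])
    then show "eventually (\<lambda>y. local_rep (axes M) d f (local_rep (axes M) c (snd d) y) = local_rep (axes M) c f y) (nhds (snd c x))"
      by (rule eventually_mono) (simp add: local_rep_def param_chart[OF M d(1)])
  qed
next
  assume "smooth_at (local_rep (axes M) c f) (snd c x)"
  then show "smooth_fun_at M f x" unfolding smooth_fun_at_def using c by blast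
qed

text \<open>Replaces the quantification over all charts and their full coordinate domains by one
  condition per point of W.\<close>

lemma smooth_fun_on_iff:
  assumes M: "smooth_manifold M" and W: "openin (man_top M) W"
  shows "smooth_fun_on M W f \<longleftrightarrow> (\<forall>x\<in>W. smooth_fun_at M f x)"
proof -
  have *: "smooth_in_chart (axes M) c W f \<longleftrightarrow>
    (\<forall>y\<in>chart_dom M c. param M c y \<in> W \<longrightarrow> smooth_at (local_rep (axes M) c f) y)" if c: "c \<in> atlas M" for c
    unfolding smooth_in_chart_def smooth_on_open_iff_smooth_at[OF open_chart_preimage[OF M c W]]
    by (auto simp: chart_preimage_iff[OF M c])
  show ?thesis
  proof
    assume L: "smooth_fun_on M W f"
    show "\<forall>x\<in>W. smooth_fun_at M f x"
    proof
      fix x assume x: "x \<in> W"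
      then obtain c where c: "c \<in> atlas M" "x \<in> fst c"
        using atlas_cover[OF M] openin_subset[OF W] by blast
      then have "smooth_at (local_rep (axes M) c f) (snd c x)"
        using L x chart_in_dom[OF M c] param_chart[OF M c] by (auto simp: smooth_fun_on_def *)
      then show "smooth_fun_at M f x" using smooth_fun_at_iff[OF M c] by blast
    qed
  next
    assume R: "\<forall>x\<in>W. smooth_fun_at M f x"
    show "smooth_fun_on M W f"
      unfolding smooth_fun_on_def
    proof
      fix c assume c: "c \<in> atlas M"
      show "smooth_in_chart (axes M) c W f"
        unfolding *[OF c]
      proof (intro ballI impI)
        fix y assume y: "y \<in> chart_dom M c" "param M c y \<in> W"
        then have "smooth_at (local_rep (axes M) c f) (snd c (param M c y))"
          using R smooth_fun_at_iff[OF M c param_in[OF M c y(1)]] by blast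
        \<comment> \<open>Here y may lie off the span of the axes. The representative depends only
          on the projection of y, so smoothness at the projection is enough.\<close>
        then show "smooth_at (local_rep (axes M) c f) y"
          unfolding chart_param[OF M c y(1)] by (rule smooth_at_local_rep_proj[OF M c])
      qed
    qed
  qed
qed

lemma smooth_funs_iff:
  assumes "smooth_manifold M"
  shows "f \<in> smooth_funs M \<longleftrightarrow> (\<forall>x\<in>points M. smooth_fun_at M f x)"
  by (simp add: smooth_funs_def smooth_fun_on_iff[OF assms openin_topspace])

lemma smooth_fun_at_points: "smooth_manifold M \<Longrightarrow> smooth_fun_at M f x \<Longrightarrow> x \<in> points M"
  unfolding smooth_fun_at_def by (auto intro: chart_points)

lemma smooth_fun_at_cong:
  assumes M: "smooth_manifold M" and f: "smooth_fun_at M f x" and eq: "eventually (\<lambda>z. f z = g z) (nhdsin (man_top M) x)"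
  shows "smooth_fun_at M g x"
proof -
  obtain c where c: "c \<in> atlas M" "x \<in> fst c" using f by (auto simp: smooth_fun_at_def)
  show ?thesis
    using f smooth_at_cong[OF _ local_rep_cong[OF M c eq]] by (simp add: smooth_fun_at_iff[OF M c])
qed

lemma smooth_fun_at_chart:
  assumes M: "smooth_manifold M" and c: "c \<in> atlas M" "x \<in> fst c"
  shows "smooth_fun_at M (snd c) x"
  using smooth_at_transition[OF M c c] smooth_fun_at_iff[OF M c] by blast

lemma smooth_fun_at_compose:
  fixes f :: "'a \<Rightarrow> 'f::euclidean_space"
  assumes M: "smooth_manifold M" and f: "smooth_fun_at M f x" and h: "smooth_at h (f x)"
  shows "smooth_fun_at M (\<lambda>z. h (f z)) x"
proof -
  obtain c where c: "c \<in> atlas M" "x \<in> fst c" using f by (auto simp: smooth_fun_at_def)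
  have "smooth_at (\<lambda>y. h (local_rep (axes M) c f y)) (snd c x)"
    by (rule smooth_at_compose) (use f h in \<open>auto simp: smooth_fun_at_iff[OF M c] local_rep_chart[OF M c]\<close>)
  then show ?thesis by (simp add: smooth_fun_at_iff[OF M c] local_rep_def)
qed

lemma smooth_fun_at_compose_chart:
  assumes M: "smooth_manifold M" and c: "c \<in> atlas M" "x \<in> fst c" and h: "smooth_at h (snd c x)"
  shows "smooth_fun_at M (\<lambda>z. h (snd c z)) x"
  by (rule smooth_fun_at_compose[OF M smooth_fun_at_chart[OF M c] h])

lemma smooth_fun_at_const [smooth_intros]:
  assumes M: "smooth_manifold M" and x: "x \<in> points M"
  shows "smooth_fun_at M (\<lambda>z. k) x"
proof -
  obtain c where c: "c \<in> atlas M" "x \<in> fst c" using atlas_cover[OF M x] .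
  show ?thesis by (simp add: smooth_fun_at_iff[OF M c] local_rep_def smooth_at_const)
qed

lemma smooth_fun_at_add [smooth_intros]:
  assumes M: "smooth_manifold M" and f: "smooth_fun_at M f x" "smooth_fun_at M g x"
  shows "smooth_fun_at M (\<lambda>z. f z + g z) x"
proof -
  obtain c where c: "c \<in> atlas M" "x \<in> fst c" using f by (auto simp: smooth_fun_at_def)
  show ?thesis using f smooth_at_add[of "local_rep (axes M) c f" "snd c x" "local_rep (axes M) c g"]
    by (simp add: smooth_fun_at_iff[OF M c] local_rep_def)
qed

lemma smooth_fun_at_mult [smooth_intros]:
  fixes f g :: "'a \<Rightarrow> real"
  assumes M: "smooth_manifold M" and f: "smooth_fun_at M f x" "smooth_fun_at M g x"
  shows "smooth_fun_at M (\<lambda>z. f z * g z) x"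
proof -
  obtain c where c: "c \<in> atlas M" "x \<in> fst c" using f by (auto simp: smooth_fun_at_def)
  show ?thesis using f smooth_at_mult[of "local_rep (axes M) c f" "snd c x" "local_rep (axes M) c g"]
    by (simp add: smooth_fun_at_iff[OF M c] local_rep_def)
qed

lemma smooth_fun_at_Pair [smooth_intros]:
  fixes f :: "'a \<Rightarrow> 'f::euclidean_space" and g :: "'a \<Rightarrow> 'g::euclidean_space"
  assumes M: "smooth_manifold M" and f: "smooth_fun_at M f x" "smooth_fun_at M g x"
  shows "smooth_fun_at M (\<lambda>z. (f z, g z)) x"
proof -
  obtain c where c: "c \<in> atlas M" "x \<in> fst c" using f by (auto simp: smooth_fun_at_def)
  show ?thesis using f smooth_at_Pair[of "local_rep (axes M) c f" "snd c x" "local_rep (axes M) c g"]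
    by (simp add: smooth_fun_at_iff[OF M c] local_rep_def)
qed

lemma smooth_fun_at_sum [smooth_intros]:
  assumes M: "smooth_manifold M" and x: "x \<in> points M" and f: "\<And>i. i \<in> I \<Longrightarrow> smooth_fun_at M (f i) x"
  shows "smooth_fun_at M (\<lambda>z. \<Sum>i\<in>I. f i z) x"
proof -
  obtain c where c: "c \<in> atlas M" "x \<in> fst c" using atlas_cover[OF M x] .
  show ?thesis using f smooth_at_sum[of I "\<lambda>i. local_rep (axes M) c (f i)" "snd c x"]
    by (simp add: smooth_fun_at_iff[OF M c] local_rep_def)
qed

lemma smooth_fun_at_eventually:
  assumes M: "smooth_manifold M" and f: "smooth_fun_at M f x"
  shows "eventually (smooth_fun_at M f) (nhdsin (man_top M) x)"
proof -
  obtain c where c: "c \<in> atlas M" "x \<in> fst c" using f by (auto simp: smooth_fun_at_def)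
  have "eventually (smooth_at (local_rep (axes M) c f)) (nhds (snd c x))"
    using f smooth_at_eventually by (simp add: smooth_fun_at_iff[OF M c])
  then have "eventually (\<lambda>z. smooth_at (local_rep (axes M) c f) (snd c z)) (nhdsin (man_top M) x)"
    by (rule eventually_chart[OF M c])
  then show ?thesis
    by (rule eventually_elim2[OF _ eventually_in_chart[OF M c]]) (simp add: smooth_fun_at_iff[OF M c(1)])
qed

lemma smooth_fun_at_continuous:
  assumes M: "smooth_manifold M" and f: "smooth_fun_at M f x" and P: "eventually P (nhds (f x))"
  shows "eventually (\<lambda>z. P (f z)) (nhdsin (man_top M) x)"
proof -
  obtain c where c: "c \<in> atlas M" "x \<in> fst c" using f by (auto simp: smooth_fun_at_def)
  have "isCont (local_rep (axes M) c f) (snd c x)"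
    using f smooth_at_isCont by (auto simp: smooth_fun_at_iff[OF M c])
  then have "eventually (\<lambda>y. P (local_rep (axes M) c f y)) (nhds (snd c x))"
    using P local_rep_chart[OF M c, of f] eventually_compose_filterlim
    by (metis isCont_def tendsto_at_iff_tendsto_nhds)
  then have "eventually (\<lambda>z. P (local_rep (axes M) c f (snd c z))) (nhdsin (man_top M) x)"
    by (rule eventually_chart[OF M c])
  then show ?thesis
    by (rule eventually_elim2[OF _ eventually_in_chart[OF M c]]) (simp add: local_rep_chart[OF M c(1)])
qed

lemma smooth_imp_continuous_map:
  fixes f :: "'a \<Rightarrow> 'f::real_normed_vector"
  assumes M: "smooth_manifold M" and f: "\<And>x. x \<in> points M \<Longrightarrow> smooth_fun_at M f x"
  shows "continuous_map (man_top M) euclidean f"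
  unfolding continuous_map_def
proof (intro conjI allI impI)
  fix U :: "'f set" assume U: "openin euclidean U"
  show "openin (man_top M) {x \<in> points M. f x \<in> U}"
  proof (rule openin_eventually)
    fix x assume x: "x \<in> {x \<in> points M. f x \<in> U}"
    have "eventually (\<lambda>z. f z \<in> U) (nhdsin (man_top M) x)"
      by (rule smooth_fun_at_continuous[OF M f]) (use x U in \<open>auto simp: eventually_nhds_in_open\<close>)
    then show "eventually (\<lambda>z. z \<in> {x \<in> points M. f x \<in> U}) (nhdsin (man_top M) x)"
      by (rule eventually_elim2[OF _ eventually_nhdsin_in[OF openin_topspace]]) (use x in auto)
  qed auto
qed auto

section \<open>Smooth maps between manifolds\<close>

lemma smooth_map_iff:
  assumes M: "smooth_manifold M" and N: "smooth_manifold N"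
  shows "smooth_map M N F \<longleftrightarrow> continuous_map (man_top M) (man_top N) F \<and>
    (\<forall>x\<in>points M. \<forall>c\<in>atlas N. F x \<in> fst c \<longrightarrow> smooth_fun_at M (\<lambda>z. snd c (F z)) x)"
proof (cases "continuous_map (man_top M) (man_top N) F")
  case True
  have "smooth_fun_on M {x \<in> points M. F x \<in> fst c} (snd c \<circ> F) \<longleftrightarrow>
    (\<forall>x\<in>points M. F x \<in> fst c \<longrightarrow> smooth_fun_at M (\<lambda>z. snd c (F z)) x)" if "c \<in> atlas N" for c
    using smooth_fun_on_iff[OF M openin_continuous_map_preimage[OF True chart_open[OF N that]]]
    by (auto simp: o_def)
  then show ?thesis using True unfolding smooth_map_def case_prod_unfold by blast
qed (simp add: smooth_map_def)

lemma smooth_map_continuous: "smooth_map M N F \<Longrightarrow> continuous_map (man_top M) (man_top N) F"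
  by (simp add: smooth_map_def)

lemma smooth_map_points: "smooth_map M N F \<Longrightarrow> x \<in> points M \<Longrightarrow> F x \<in> points N"
  using smooth_map_continuous continuous_map_image_subset_topspace by blast

lemma smooth_fun_at_comp_chart:
  assumes M: "smooth_manifold M" and N: "smooth_manifold N"
    and F: "continuous_map (man_top M) (man_top N) F" and x: "x \<in> points M"
    and c: "c \<in> atlas N" "F x \<in> fst c" and s: "smooth_fun_at M (\<lambda>z. snd c (F z)) x"
    and g: "smooth_fun_at N g (F x)"
  shows "smooth_fun_at M (\<lambda>z. g (F z)) x"
proof (rule smooth_fun_at_cong[OF M])
  show "smooth_fun_at M (\<lambda>z. local_rep (axes N) c g (snd c (F z))) x"
    by (rule smooth_fun_at_compose[OF M s]) (use g in \<open>simp add: smooth_fun_at_iff[OF N c]\<close>)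
  show "eventually (\<lambda>z. local_rep (axes N) c g (snd c (F z)) = g (F z)) (nhdsin (man_top M) x)"
    by (rule eventually_mono[OF eventually_nhdsin_continuous_map[OF F x eventually_in_chart[OF N c]]])
      (simp add: local_rep_chart[OF N c(1)])
qed

lemma smooth_mapI:
  assumes M: "smooth_manifold M" and N: "smooth_manifold N"
    and F: "continuous_map (man_top M) (man_top N) F"
    and "\<And>x. x \<in> points M \<Longrightarrow> \<exists>c\<in>atlas N. F x \<in> fst c \<and> smooth_fun_at M (\<lambda>z. snd c (F z)) x"
  shows "smooth_map M N F"
  unfolding smooth_map_iff[OF M N]
  using assms smooth_fun_at_comp_chart[OF M N F] smooth_fun_at_chart[OF N] by blast

lemma smooth_map_compose_fun:
  assumes M: "smooth_manifold M" and N: "smooth_manifold N"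
    and F: "smooth_map M N F" and x: "x \<in> points M" and g: "smooth_fun_at N g (F x)"
  shows "smooth_fun_at M (\<lambda>z. g (F z)) x"
proof -
  obtain c where c: "c \<in> atlas N" "F x \<in> fst c" using g by (auto simp: smooth_fun_at_def)
  show ?thesis
    by (rule smooth_fun_at_comp_chart[OF M N smooth_map_continuous[OF F] x c _ g])
      (use F x c in \<open>auto simp: smooth_map_iff[OF M N]\<close>)
qed

lemma smooth_map_compose:
  assumes M: "smooth_manifold M" and N: "smooth_manifold N" and L: "smooth_manifold L"
    and F: "smooth_map M N F" and G: "smooth_map N L G"
  shows "smooth_map M L (\<lambda>x. G (F x))"
proof (rule smooth_mapI[OF M L])
  show c: "continuous_map (man_top M) (man_top L) (\<lambda>x. G (F x))"
    using continuous_map_compose[OF smooth_map_continuous[OF F] smooth_map_continuous[OF G]] by (simp add: o_def)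
  fix x assume x: "x \<in> points M"
  then have y: "F x \<in> points N" using smooth_map_points[OF F] by blast
  obtain c where "c \<in> atlas L" "G (F x) \<in> fst c" using atlas_cover[OF L smooth_map_points[OF G y]] .
  moreover from this have "smooth_fun_at M (\<lambda>z. snd c (G (F z))) x"
    using smooth_map_compose_fun[OF M N F x] G y by (auto simp: smooth_map_iff[OF N L])
  ultimately show "\<exists>c\<in>atlas L. G (F x) \<in> fst c \<and> smooth_fun_at M (\<lambda>z. snd c (G (F z))) x" by blast
qed

lemma smooth_map_cong:
  assumes M: "smooth_manifold M" and N: "smooth_manifold N"
    and F: "smooth_map M N F" and eq: "\<And>x. x \<in> points M \<Longrightarrow> F x = G x"
  shows "smooth_map M N G"
proof (rule smooth_mapI[OF M N])
  show "continuous_map (man_top M) (man_top N) G"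
    using continuous_map_eq[OF smooth_map_continuous[OF F] eq] .
  fix x assume x: "x \<in> points M"
  obtain c where c: "c \<in> atlas N" "F x \<in> fst c" using atlas_cover[OF N smooth_map_points[OF F x]] .
  have "smooth_fun_at M (\<lambda>z. snd c (F z)) x" using F x c by (auto simp: smooth_map_iff[OF M N])
  then have "smooth_fun_at M (\<lambda>z. snd c (G z)) x"
    by (rule smooth_fun_at_cong[OF M])
      (use eq in \<open>auto intro!: eventually_mono[OF eventually_nhdsin_in[OF openin_topspace x]]\<close>)
  then show "\<exists>c\<in>atlas N. G x \<in> fst c \<and> smooth_fun_at M (\<lambda>z. snd c (G z)) x" using c eq[OF x] by auto
qed

lemma smooth_map_id: "smooth_manifold M \<Longrightarrow> smooth_map M M (\<lambda>x. x)"
  by (rule smooth_mapI) (auto intro: smooth_fun_at_chart elim: atlas_cover)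

lemma smooth_map_const:
  assumes "smooth_manifold M" "smooth_manifold N" "p \<in> points N"
  shows "smooth_map M N (\<lambda>x. p)"
proof (rule smooth_mapI[OF assms(1,2)])
  obtain c where "c \<in> atlas N" "p \<in> fst c" using atlas_cover[OF assms(2,3)] .
  then show "\<exists>c\<in>atlas N. p \<in> fst c \<and> smooth_fun_at M (\<lambda>z. snd c p) x" if "x \<in> points M" for x
    using smooth_fun_at_const[OF assms(1) that] by blast
qed (simp add: assms(3))

section \<open>Bump functions and extension of germs\<close>

text \<open>A Euclidean bump function in a chart, extended by zero. The set A is the image of a
  compact ball and is closed because M is Hausdorff; this is what makes the extension smooth at
  points outside the chart.\<close>

lemma manifold_bump_exists:
  assumes M: "smooth_manifold M" and W: "openin (man_top M) W" "p \<in> W"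
  obtains ch :: "'a \<Rightarrow> real" and A where "ch \<in> smooth_funs M" "\<And>x. 0 \<le> ch x"
    "eventually (\<lambda>x. ch x = 1) (nhdsin (man_top M) p)"
    "closedin (man_top M) A" "A \<subseteq> W" "\<And>x. x \<notin> A \<Longrightarrow> ch x = 0"
proof -
  have p: "p \<in> points M" using W openin_subset by blast
  obtain c where c: "c \<in> atlas M" "p \<in> fst c" using atlas_cover[OF M p] .
  define D where "D = {y. axes_proj (axes M) y \<in> snd c ` (fst c \<inter> W)}"
  have D: "open D" unfolding D_def by (rule open_chart_preimage[OF M c(1) W(1)])
  have D_iff: "y \<in> D \<longleftrightarrow> y \<in> chart_dom M c \<and> param M c y \<in> W" for y
    unfolding D_def using chart_preimage_iff[OF M c(1)] by simp
  have "snd c p \<in> D" using c W by (simp add: D_iff chart_in_dom[OF M] param_chart[OF M])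
  then obtain e where e: "e > 0" "cball (snd c p) e \<subseteq> D" using D open_contains_cball by blast
  \<comment> \<open>The bump function vanishes from radius 2 r on, so 2 r = e places its support in
    the closed ball that is known to lie in D.\<close>
  define r where "r = e / 2"
  obtain bp :: "'b \<Rightarrow> real" where bp: "\<And>y. smooth_at bp y" "\<And>y. dist (snd c p) y < r \<Longrightarrow> bp y = 1"
    "\<And>y. dist (snd c p) y \<ge> 2 * r \<Longrightarrow> bp y = 0" "\<And>y. 0 \<le> bp y"
    using bump_exists[of r "snd c p"] e(1) by (auto simp: r_def)
  define ch where "ch x = (if x \<in> fst c then bp (snd c x) else 0)" for x
  define A where "A = param M c ` cball (snd c p) e"
  have "continuous_map (top_of_set (cball (snd c p) e)) (man_top M) (param M c)"
    unfolding continuous_map_def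
  proof (intro conjI allI impI)
    show "param M c \<in> topspace (top_of_set (cball (snd c p) e)) \<rightarrow> points M"
      using e(2) D_iff param_in[OF M c(1)] chart_points[OF M c(1)] by auto
    fix U assume U: "openin (man_top M) U"
    have "{y \<in> topspace (top_of_set (cball (snd c p) e)). param M c y \<in> U} =
      cball (snd c p) e \<inter> {y. axes_proj (axes M) y \<in> snd c ` (fst c \<inter> U)}"
      using e(2) D_iff chart_preimage_iff[OF M c(1), of _ U] by auto
    then show "openin (top_of_set (cball (snd c p) e)) {y \<in> topspace (top_of_set (cball (snd c p) e)). param M c y \<in> U}"
      using open_chart_preimage[OF M c(1) U] by (simp add: openin_open_Int)
  qed
  then have "compactin (man_top M) A"
    unfolding A_def by (rule image_compactin[rotated]) (simp add: compactin_subtopology)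
  then have A: "closedin (man_top M) A"
    using M by (simp add: smooth_manifold_def compactin_imp_closedin)
  have A_sub: "A \<subseteq> W" "A \<subseteq> fst c" using e(2) D_iff param_in[OF M c(1)] by (auto simp: A_def)
  have zero: "ch x = 0" if "x \<notin> A" for x
  proof (cases "x \<in> fst c")
    case True
    have "snd c x \<notin> cball (snd c p) e" using that param_chart[OF M c(1) True] unfolding A_def by (metis image_eqI)
    then show ?thesis using bp(3)[of "snd c x"] True by (simp add: ch_def r_def)
  qed (simp add: ch_def)
  have "smooth_fun_at M ch x" if x: "x \<in> points M" for x
  proof (cases "x \<in> fst c")
    case True
    show ?thesis
      by (rule smooth_fun_at_cong[OF M smooth_fun_at_compose_chart[OF M c(1) True bp(1)]])
        (rule eventually_mono[OF eventually_in_chart[OF M c(1) True]], simp add: ch_def)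
  next
    case False
    have "openin (man_top M) (points M - A)" using A by (simp add: openin_diff)
    then have "eventually (\<lambda>z. z \<in> points M - A) (nhdsin (man_top M) x)"
      by (rule eventually_nhdsin_in) (use False A_sub x in auto)
    then have "eventually (\<lambda>z. 0 = ch z) (nhdsin (man_top M) x)"
      by (rule eventually_mono) (simp add: zero)
    then show ?thesis by (rule smooth_fun_at_cong[OF M smooth_fun_at_const[OF M x]])
  qed
  then have "ch \<in> smooth_funs M" by (simp add: smooth_funs_iff[OF M])
  moreover have "eventually (\<lambda>x. ch x = 1) (nhdsin (man_top M) p)"
  proof -
    have "eventually (\<lambda>y. y \<in> ball (snd c p) r) (nhds (snd c p))"
      using e(1) by (intro eventually_nhds_in_open) (auto simp: r_def)
    from eventually_chart[OF M c this] eventually_in_chart[OF M c]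
    show ?thesis by (rule eventually_elim2) (simp add: ch_def bp(2))
  qed
  moreover have "0 \<le> ch x" for x by (simp add: ch_def bp(4))
  ultimately show ?thesis using that[of ch A] A A_sub zero by blast
qed

text \<open>W and the complement of the closed set A are open and cover the manifold. The extension
  is a product of smooth functions on the former and zero on the latter.\<close>

lemma smooth_extend_by_zero:
  fixes f ch :: "'a \<Rightarrow> real"
  assumes M: "smooth_manifold M" and W: "openin (man_top M) W" and f: "\<And>x. x \<in> W \<Longrightarrow> smooth_fun_at M f x"
    and ch: "ch \<in> smooth_funs M" and A: "closedin (man_top M) A" "A \<subseteq> W" "\<And>x. x \<notin> A \<Longrightarrow> ch x = 0"
  shows "(\<lambda>x. if x \<in> W then ch x * f x else 0) \<in> smooth_funs M"
  unfolding smooth_funs_iff[OF M]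
proof
  fix x assume x: "x \<in> points M"
  have chx: "smooth_fun_at M ch x" using ch x smooth_funs_iff[OF M] by blast
  show "smooth_fun_at M (\<lambda>x. if x \<in> W then ch x * f x else 0) x"
  proof (cases "x \<in> W")
    case True
    show ?thesis
      by (rule smooth_fun_at_cong[OF M smooth_fun_at_mult[OF M chx f[OF True]]])
        (rule eventually_mono[OF eventually_nhdsin_in[OF W True]], simp)
  next
    case False
    have "openin (man_top M) (points M - A)" using A by (simp add: openin_diff)
    then have "eventually (\<lambda>z. z \<in> points M - A) (nhdsin (man_top M) x)"
      by (rule eventually_nhdsin_in) (use False A x in auto)
    then have "eventually (\<lambda>z. 0 = (if z \<in> W then ch z * f z else 0)) (nhdsin (man_top M) x)"
      by (rule eventually_mono) (simp add: A(3))
    then show ?thesis by (rule smooth_fun_at_cong[OF M smooth_fun_at_const[OF M x]])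
  qed
qed

text \<open>Derivations act on globally defined functions, so local data such as coordinates enter
  only through global functions with the same germ.\<close>

lemma extend_germ:
  fixes f :: "'a \<Rightarrow> real"
  assumes M: "smooth_manifold M" and f: "smooth_fun_at M f p"
  obtains g where "g \<in> smooth_funs M" "eventually (\<lambda>x. g x = f x) (nhdsin (man_top M) p)"
proof -
  obtain W where W: "openin (man_top M) W" "p \<in> W" "\<And>x. x \<in> W \<Longrightarrow> smooth_fun_at M f x"
    using eventually_nhdsinE[OF smooth_fun_at_eventually[OF M f] smooth_fun_at_points[OF M f]] by blast
  obtain ch :: "'a \<Rightarrow> real" and A where ch: "ch \<in> smooth_funs M" "eventually (\<lambda>x. ch x = 1) (nhdsin (man_top M) p)"
    "closedin (man_top M) A" "A \<subseteq> W" "\<And>x. x \<notin> A \<Longrightarrow> ch x = 0"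
    using manifold_bump_exists[OF M W(1,2)] by metis
  show ?thesis
  proof (rule that)
    show "(\<lambda>x. if x \<in> W then ch x * f x else 0) \<in> smooth_funs M"
      by (rule smooth_extend_by_zero[OF M W(1,3) ch(1,3-5)])
    show "eventually (\<lambda>x. (if x \<in> W then ch x * f x else 0) = f x) (nhdsin (man_top M) p)"
      by (rule eventually_elim2[OF ch(2) eventually_nhdsin_in[OF W(1,2)]]) simp
  qed
qed

section \<open>Tangent vectors\<close>

lemma smooth_funs_const: "smooth_manifold M \<Longrightarrow> (\<lambda>x. k) \<in> smooth_funs M"
  by (simp add: smooth_funs_iff smooth_fun_at_const)

lemma smooth_funs_mult: "smooth_manifold M \<Longrightarrow> f \<in> smooth_funs M \<Longrightarrow> g \<in> smooth_funs M \<Longrightarrow> (\<lambda>x. f x * g x) \<in> smooth_funs M"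
  by (simp add: smooth_funs_iff smooth_fun_at_mult)

lemma smooth_funs_add: "smooth_manifold M \<Longrightarrow> f \<in> smooth_funs M \<Longrightarrow> g \<in> smooth_funs M \<Longrightarrow> (\<lambda>x. f x + g x) \<in> smooth_funs M"
  by (simp add: smooth_funs_iff smooth_fun_at_add)

lemma smooth_funs_sum: "smooth_manifold M \<Longrightarrow> (\<And>i. i \<in> I \<Longrightarrow> f i \<in> smooth_funs M) \<Longrightarrow> (\<lambda>x. \<Sum>i\<in>I. f i x) \<in> smooth_funs M"
  by (simp add: smooth_funs_iff smooth_fun_at_sum)

lemma smooth_funs_lincomb:
  "smooth_manifold M \<Longrightarrow> f \<in> smooth_funs M \<Longrightarrow> g \<in> smooth_funs M \<Longrightarrow> (\<lambda>x. s * f x + t * g x) \<in> smooth_funs M"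
  by (intro smooth_funs_add smooth_funs_mult smooth_funs_const)

lemma smooth_funs_at: "smooth_manifold M \<Longrightarrow> f \<in> smooth_funs M \<Longrightarrow> x \<in> points M \<Longrightarrow> smooth_fun_at M f x"
  by (simp add: smooth_funs_iff)

lemma smooth_funs_cong:
  assumes M: "smooth_manifold M" and f: "f \<in> smooth_funs M" and eq: "\<And>x. x \<in> points M \<Longrightarrow> f x = g x"
  shows "g \<in> smooth_funs M"
  unfolding smooth_funs_iff[OF M]
proof
  fix x assume x: "x \<in> points M"
  show "smooth_fun_at M g x"
    by (rule smooth_fun_at_cong[OF M smooth_funs_at[OF M f x] eventually_nhdsinI[OF openin_topspace x eq]])
qed

lemma smooth_funs_compose:
  "smooth_manifold M \<Longrightarrow> smooth_manifold N \<Longrightarrow> smooth_map M N F \<Longrightarrow> f \<in> smooth_funs N \<Longrightarrow> (\<lambda>x. f (F x)) \<in> smooth_funs M"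
  by (simp add: smooth_funs_iff smooth_map_compose_fun smooth_map_points)

lemma tangent_lincomb:
  "v \<in> tangent_space M p \<Longrightarrow> f \<in> smooth_funs M \<Longrightarrow> g \<in> smooth_funs M \<Longrightarrow> v (\<lambda>x. s * f x + t * g x) = s * v f + t * v g"
  by (simp add: tangent_space_def)

lemma tangent_mult:
  "v \<in> tangent_space M p \<Longrightarrow> f \<in> smooth_funs M \<Longrightarrow> g \<in> smooth_funs M \<Longrightarrow> v (\<lambda>x. f x * g x) = f p * v g + g p * v f"
  by (simp add: tangent_space_def)

lemma tangent_not_smooth: "v \<in> tangent_space M p \<Longrightarrow> f \<notin> smooth_funs M \<Longrightarrow> v f = 0"
  by (simp add: tangent_space_def)

lemma tangent_const:
  assumes M: "smooth_manifold M" and v: "v \<in> tangent_space M p"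
  shows "v (\<lambda>x. k) = 0"
proof -
  note o = smooth_funs_const[OF M, of 1]
  have "v (\<lambda>x. 1) = 0" using tangent_mult[OF v o o] by simp
  then show ?thesis using tangent_lincomb[OF v o o, of k 0] by simp
qed

lemma tangent_add:
  "v \<in> tangent_space M p \<Longrightarrow> f \<in> smooth_funs M \<Longrightarrow> g \<in> smooth_funs M \<Longrightarrow> v (\<lambda>x. f x + g x) = v f + v g"
  using tangent_lincomb[of v M p f g 1 1] by simp

lemma tangent_sum:
  assumes M: "smooth_manifold M" and v: "v \<in> tangent_space M p"
    and f: "\<And>i. i \<in> I \<Longrightarrow> f i \<in> smooth_funs M" and I: "finite I"
  shows "v (\<lambda>x. \<Sum>i\<in>I. f i x) = (\<Sum>i\<in>I. v (f i))"
  using I f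
proof (induction I rule: finite_induct)
  case empty
  then show ?case using tangent_const[OF M v, of 0] by simp
next
  case (insert i I)
  have "v (\<lambda>x. f i x + (\<Sum>i\<in>I. f i x)) = v (f i) + v (\<lambda>x. \<Sum>i\<in>I. f i x)"
    by (rule tangent_add[OF v _ smooth_funs_sum[OF M]]) (use insert in auto)
  then show ?case using insert by simp
qed

lemma tangent_zero: "(\<lambda>f. 0) \<in> tangent_space M p"
  by (simp add: tangent_space_def)

lemma tangent_combine:
  assumes M: "smooth_manifold M" and v: "v \<in> tangent_space M p" and w: "w \<in> tangent_space M p"
  shows "(\<lambda>f. s * v f + t * w f) \<in> tangent_space M p"
  using v w unfolding tangent_space_def by (auto simp: algebra_simps)

lemma tangent_space_sum:
  assumes M: "smooth_manifold M" and v: "\<And>i. i \<in> I \<Longrightarrow> v i \<in> tangent_space M p" and I: "finite I"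
  shows "(\<lambda>f. \<Sum>i\<in>I. a i * v i f) \<in> tangent_space M p"
  using I v
proof (induction I rule: finite_induct)
  case empty
  then show ?case by (simp add: tangent_zero)
next
  case (insert i I)
  have "(\<lambda>f. a i * v i f + 1 * (\<Sum>i\<in>I. a i * v i f)) \<in> tangent_space M p"
    by (rule tangent_combine[OF M]) (use insert in auto)
  then show ?case using insert by simp
qed

text \<open>Apply the Leibniz rule to the product of f - g with a bump function that is 1 at p and
  supported where f = g: the product is identically zero and f - g vanishes at p.\<close>

lemma tangent_local:
  assumes M: "smooth_manifold M" and p: "p \<in> points M" and v: "v \<in> tangent_space M p"
    and f: "f \<in> smooth_funs M" and g: "g \<in> smooth_funs M"
    and eq: "eventually (\<lambda>x. f x = g x) (nhdsin (man_top M) p)"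
  shows "v f = v g"
proof -
  obtain W where W: "openin (man_top M) W" "p \<in> W" "\<And>x. x \<in> W \<Longrightarrow> f x = g x"
    using eventually_nhdsinE[OF eq p] by blast
  obtain ch :: "'a \<Rightarrow> real" and A where ch: "ch \<in> smooth_funs M" "eventually (\<lambda>x. ch x = 1) (nhdsin (man_top M) p)"
    "A \<subseteq> W" "\<And>x. x \<notin> A \<Longrightarrow> ch x = 0"
    using manifold_bump_exists[OF M W(1,2)] by metis
  have chp: "ch p = 1" using eventually_nhdsin_self[OF ch(2) p] .
  define h where "h x = 1 * f x + (- 1) * g x" for x
  have h: "h \<in> smooth_funs M" unfolding h_def[abs_def] by (rule smooth_funs_lincomb[OF M f g])
  have "(\<lambda>x. ch x * h x) = (\<lambda>x. 0)"
    using W(3) ch(3,4) by (auto simp: h_def fun_eq_iff)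
  then have "0 = ch p * v h + h p * v ch"
    using tangent_mult[OF v ch(1) h] tangent_const[OF M v, of 0] by simp
  also have "h p = 0" using W by (simp add: h_def)
  finally have "v h = 0" using chp by simp
  then show ?thesis using tangent_lincomb[OF v f g, of 1 "- 1"] by (simp add: h_def[abs_def])
qed

lemma coord_vector_smooth:
  assumes M: "smooth_manifold M" and f: "f \<in> smooth_funs M"
  shows "coord_vector M c p b f = frechet_derivative (local_rep (axes M) c f) (at (snd c p)) b"
  using f by (simp add: coord_vector_def)

lemma coord_vector_tangent:
  assumes M: "smooth_manifold M" and c: "c \<in> atlas M" "p \<in> fst c"
  shows "coord_vector M c p b \<in> tangent_space M p"
proof -
  let ?L = "\<lambda>f. local_rep (axes M) c f" and ?y = "snd c p"
  have d: "(?L f has_derivative frechet_derivative (?L f) (at ?y)) (at ?y)" if "f \<in> smooth_funs M" for f :: "'a \<Rightarrow> real"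
    using smooth_funs_at[OF M that chart_points[OF M c]] smooth_at_has_derivative
    by (simp add: smooth_fun_at_iff[OF M c])
  show ?thesis
    unfolding tangent_space_def
  proof (intro CollectI conjI ballI allI impI)
    fix f g s t assume f: "f \<in> smooth_funs M" and g: "g \<in> smooth_funs M"
    have "((\<lambda>y. s * ?L f y + t * ?L g y) has_derivative
       (\<lambda>b. s * frechet_derivative (?L f) (at ?y) b + t * frechet_derivative (?L g) (at ?y) b)) (at ?y)"
      by (intro has_derivative_add has_derivative_mult_right d f g)
    then have "(?L (\<lambda>x. s * f x + t * g x) has_derivative
       (\<lambda>b. s * frechet_derivative (?L f) (at ?y) b + t * frechet_derivative (?L g) (at ?y) b)) (at ?y)"
      by (simp add: local_rep_def)
    from frechet_derivative_at[OF this, symmetric]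
    show "coord_vector M c p b (\<lambda>x. s * f x + t * g x) = s * coord_vector M c p b f + t * coord_vector M c p b g"
      using f g smooth_funs_lincomb[OF M f g] by (simp add: coord_vector_smooth[OF M])
    have "((\<lambda>y. ?L f y * ?L g y) has_derivative
       (\<lambda>b. ?L f ?y * frechet_derivative (?L g) (at ?y) b + frechet_derivative (?L f) (at ?y) b * ?L g ?y)) (at ?y)"
      by (intro has_derivative_mult d f g)
    then have "(?L (\<lambda>x. f x * g x) has_derivative
       (\<lambda>b. f p * frechet_derivative (?L g) (at ?y) b + frechet_derivative (?L f) (at ?y) b * g p)) (at ?y)"
      using local_rep_chart[OF M c, of f] local_rep_chart[OF M c, of g] by (simp add: local_rep_def)
    from frechet_derivative_at[OF this, symmetric]
    show "coord_vector M c p b (\<lambda>x. f x * g x) = f p * coord_vector M c p b g + g p * coord_vector M c p b f"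
      using f g smooth_funs_mult[OF M f g] by (simp add: coord_vector_smooth[OF M])
  qed (simp add: coord_vector_def)
qed

lemma smooth_fun_at_coord_vector:
  assumes M: "smooth_manifold M" and c: "c \<in> atlas M" "p \<in> fst c" and f: "f \<in> smooth_funs M"
  shows "smooth_fun_at M (\<lambda>q. coord_vector M c q b f) p"
proof -
  have "smooth_at (local_rep (axes M) c f) (snd c p)"
    using smooth_funs_at[OF M f chart_points[OF M c]] by (simp add: smooth_fun_at_iff[OF M c])
  then show ?thesis
    unfolding coord_vector_smooth[OF M f]
    by (intro smooth_fun_at_compose_chart[OF M c] smooth_at_derivative)
qed

text \<open>The finitely many coordinates are extended simultaneously and agree with their
  extensions on a whole neighbourhood W. They thus give the coefficients of tangent vectors at all
  points near p, which is needed to see that coefficients of fields are smooth.\<close>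

lemma coordinate_extension:
  assumes M: "smooth_manifold M" and c: "c \<in> atlas M" "p \<in> fst c"
  obtains E W where "\<And>b. E b \<in> smooth_funs M" "openin (man_top M) W" "p \<in> W" "W \<subseteq> fst c"
    "\<And>b q. b \<in> axes M \<Longrightarrow> q \<in> W \<Longrightarrow> E b q = snd c q \<bullet> b"
proof -
  have "smooth_fun_at M (\<lambda>z. snd c z \<bullet> b) p" for b
    by (rule smooth_fun_at_compose_chart[OF M c]) (intro smooth_intros)
  then have "\<exists>g. g \<in> smooth_funs M \<and> eventually (\<lambda>x. g x = snd c x \<bullet> b) (nhdsin (man_top M) p)" for b
    using extend_germ[OF M] by metis
  then obtain E where E: "\<And>b. E b \<in> smooth_funs M"
    "\<And>b. eventually (\<lambda>x. E b x = snd c x \<bullet> b) (nhdsin (man_top M) p)"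
    by metis
  have "finite (axes M)" using axes_subset[OF M c(1)] finite_subset[OF _ finite_Basis] by blast
  then have "eventually (\<lambda>x. \<forall>b\<in>axes M. E b x = snd c x \<bullet> b) (nhdsin (man_top M) p)"
    using E(2) by (simp add: eventually_ball_finite_distrib)
  then have "eventually (\<lambda>x. x \<in> fst c \<and> (\<forall>b\<in>axes M. E b x = snd c x \<bullet> b)) (nhdsin (man_top M) p)"
    using eventually_in_chart[OF M c] by (simp add: eventually_conj_iff)
  from eventually_nhdsinE[OF this chart_points[OF M c]] obtain W where
    "openin (man_top M) W" "p \<in> W" "\<And>z. z \<in> W \<Longrightarrow> z \<in> fst c \<and> (\<forall>b\<in>axes M. E b z = snd c z \<bullet> b)"
    by blast
  then show ?thesis using that[of E W] E(1) by blast
qed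

lemma coord_vector_coordinate:
  assumes M: "smooth_manifold M" and c: "c \<in> atlas M" "q \<in> fst c"
    and e: "e \<in> smooth_funs M" "eventually (\<lambda>x. e x = snd c x \<bullet> a) (nhdsin (man_top M) q)"
    and b: "b \<in> axes M" and a: "a \<in> axes M"
  shows "coord_vector M c q b e = (if b = a then 1 else 0)"
proof -
  note B = axes_subset[OF M c(1)]
  have 1: "eventually (\<lambda>y. local_rep (axes M) c e y = local_rep (axes M) c (\<lambda>x. snd c x \<bullet> a) y) (nhds (snd c q))"
    by (rule local_rep_cong[OF M c e(2)])
  have "eventually (\<lambda>y. local_rep (axes M) c e y = axes_proj (axes M) y \<bullet> a) (nhds (snd c q))"
    by (rule eventually_elim2[OF 1 eventually_in_chart_dom[OF M c(1) chart_in_dom[OF M c]]])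
       (simp add: local_rep_def chart_param[OF M c(1)])
  then have ev: "eventually (\<lambda>y. local_rep (axes M) c e y = y \<bullet> a) (nhds (snd c q))"
    by (simp add: axes_proj_simps(1)[OF B a])
  then obtain T where T: "open T" "snd c q \<in> T" "\<And>y. y \<in> T \<Longrightarrow> local_rep (axes M) c e y = y \<bullet> a"
    unfolding eventually_nhds by blast
  have "((\<lambda>y. y \<bullet> a) has_derivative (\<lambda>v. v \<bullet> a)) (at (snd c q))" by (auto intro!: derivative_eq_intros)
  then have "(local_rep (axes M) c e has_derivative (\<lambda>v. v \<bullet> a)) (at (snd c q))"
    by (rule has_derivative_transform_within_open[OF _ T(1,2)]) (simp add: T(3))
  from frechet_derivative_at[OF this, symmetric]
  show ?thesis using B a b by (auto simp: coord_vector_smooth[OF M e(1)] inner_Basis subset_eq)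
qed

text \<open>By Hadamard's lemma, f is near p a constant plus the sum of (x_b - p_b) g_b. A
  derivation annihilates the constant, and the Leibniz rule leaves v(x_b) g_b(p), where g_b(p) is a
  partial derivative of f.\<close>

lemma tangent_expansion:
  assumes M: "smooth_manifold M" and c: "c \<in> atlas M" "p \<in> fst c" and v: "v \<in> tangent_space M p"
    and E: "\<And>b. b \<in> axes M \<Longrightarrow> E b \<in> smooth_funs M"
      "\<And>b. b \<in> axes M \<Longrightarrow> eventually (\<lambda>x. E b x = snd c x \<bullet> b) (nhdsin (man_top M) p)"
  shows "v = (\<lambda>f. \<Sum>b\<in>axes M. v (E b) * coord_vector M c p b f)"
proof
  fix f
  note B = axes_subset[OF M c(1)]
  have fin: "finite (axes M)" using B finite_subset[OF _ finite_Basis] by blast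
  have p: "p \<in> points M" by (rule chart_points[OF M c])
  show "v f = (\<Sum>b\<in>axes M. v (E b) * coord_vector M c p b f)"
  proof (cases "f \<in> smooth_funs M")
    case False
    then show ?thesis using tangent_not_smooth[OF v] by (simp add: coord_vector_def)
  next
    case True
    let ?F = "local_rep (axes M) c f" and ?y = "snd c p"
    have "smooth_at ?F ?y"
      using smooth_funs_at[OF M True p] by (simp add: smooth_fun_at_iff[OF M c])
    then obtain g where g: "\<And>b. smooth_at (g b) ?y" "\<And>b. g b ?y = frechet_derivative ?F (at ?y) b"
      "eventually (\<lambda>y. ?F y = ?F ?y + (\<Sum>b\<in>Basis. ((y - ?y) \<bullet> b) * g b y)) (nhds ?y)"
      using hadamard by blast
    have "smooth_fun_at M (\<lambda>z. g b (snd c z)) p" for b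
      by (rule smooth_fun_at_compose_chart[OF M c g(1)])
    then have "\<exists>h. h \<in> smooth_funs M \<and> eventually (\<lambda>x. h x = g b (snd c x)) (nhdsin (man_top M) p)" for b
      using extend_germ[OF M] by metis
    then obtain h where h: "\<And>b. h b \<in> smooth_funs M"
      "\<And>b. eventually (\<lambda>x. h b x = g b (snd c x)) (nhdsin (man_top M) p)"
      by metis
    \<comment> \<open>The coordinate is shifted to vanish at p; this removes one Leibniz term and
      does not change the value of v on it.\<close>
    define k where "k b x = E b x + (- E b p)" for b x
    have k: "k b \<in> smooth_funs M" if "b \<in> axes M" for b
      unfolding k_def[abs_def] by (intro smooth_funs_add[OF M] E(1) that smooth_funs_const[OF M])
    have vk: "v (k b) = v (E b)" if "b \<in> axes M" for b
      unfolding k_def[abs_def] tangent_add[OF v E(1)[OF that] smooth_funs_const[OF M]] tangent_const[OF M v] by simp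
    define f' where "f' x = f p + (\<Sum>b\<in>axes M. k b x * h b x)" for x
    have f': "f' \<in> smooth_funs M"
      unfolding f'_def[abs_def] by (intro smooth_funs_add[OF M] smooth_funs_sum[OF M] smooth_funs_mult[OF M] k h smooth_funs_const[OF M])
    have ev: "eventually (\<lambda>x. (\<forall>b\<in>axes M. E b x = snd c x \<bullet> b \<and> h b x = g b (snd c x)) \<and> x \<in> fst c) (nhdsin (man_top M) p)"
      using E(2) h(2) fin eventually_in_chart[OF M c] by (simp add: eventually_ball_finite_distrib eventually_conj_iff)
    have "eventually (\<lambda>x. f x = f' x) (nhdsin (man_top M) p)"
    proof (rule eventually_elim2[OF ev eventually_chart[OF M c g(3)]])
      fix x assume x: "(\<forall>b\<in>axes M. E b x = snd c x \<bullet> b \<and> h b x = g b (snd c x)) \<and> x \<in> fst c"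
        and eq: "?F (snd c x) = ?F ?y + (\<Sum>b\<in>Basis. ((snd c x - ?y) \<bullet> b) * g b (snd c x))"
      \<comment> \<open>Chart values lie in the span of the axes, so the other coordinates vanish
        and Hadamard's sum over \<open>Basis\<close> shrinks to the axes.\<close>
      have "(snd c z) \<bullet> b = 0" if "b \<in> Basis" "b \<notin> axes M" "z \<in> fst c" for z b
        using axes_proj_simps(2)[OF B that(1,2), of "snd c z"] chart_proj[OF M c(1) that(3)] by simp
      then have "(\<Sum>b\<in>Basis. ((snd c x - ?y) \<bullet> b) * g b (snd c x)) = (\<Sum>b\<in>axes M. ((snd c x - ?y) \<bullet> b) * g b (snd c x))"
        using x c by (intro sum.mono_neutral_right B finite_Basis) (auto simp: inner_diff_left)
      also have "\<dots> = (\<Sum>b\<in>axes M. k b x * h b x)"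
        using x eventually_nhdsin_self[OF E(2) p] by (intro sum.cong) (auto simp: k_def inner_diff_left)
      finally show "f x = f' x"
        using eq x by (simp add: local_rep_chart[OF M c(1)] local_rep_chart[OF M c] f'_def)
    qed
    then have "v f = v f'" by (rule tangent_local[OF M p v True f'])
    also have "\<dots> = v (\<lambda>x. f p) + v (\<lambda>x. \<Sum>b\<in>axes M. k b x * h b x)"
      unfolding f'_def[abs_def]
      by (rule tangent_add[OF v]) (intro smooth_funs_sum[OF M] smooth_funs_mult[OF M] k h smooth_funs_const[OF M])+
    also have "\<dots> = (\<Sum>b\<in>axes M. v (\<lambda>x. k b x * h b x))"
      by (subst tangent_sum[OF M v _ fin]) (auto intro: smooth_funs_mult[OF M] k h simp: tangent_const[OF M v])
    also have "\<dots> = (\<Sum>b\<in>axes M. v (E b) * coord_vector M c p b f)"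
    proof (rule sum.cong[OF refl])
      fix b assume b: "b \<in> axes M"
      have "h b p = g b ?y" using eventually_nhdsin_self[OF h(2) p] .
      moreover have "k b p = 0" by (simp add: k_def)
      ultimately show "v (\<lambda>x. k b x * h b x) = v (E b) * coord_vector M c p b f"
        unfolding tangent_mult[OF v k[OF b] h(1)] vk[OF b] by (simp add: g(2) coord_vector_smooth[OF M True])
    qed
    finally show ?thesis .
  qed
qed

lemma tangent_coefficients:
  assumes M: "smooth_manifold M" and c: "c \<in> atlas M" "p \<in> fst c" and v: "v \<in> tangent_space M p"
  obtains a where "v = (\<lambda>f. \<Sum>b\<in>axes M. a b * coord_vector M c p b f)"
proof -
  obtain E W where E: "\<And>b. E b \<in> smooth_funs M" "openin (man_top M) W" "p \<in> W" "W \<subseteq> fst c"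
    "\<And>b q. b \<in> axes M \<Longrightarrow> q \<in> W \<Longrightarrow> E b q = snd c q \<bullet> b"
    using coordinate_extension[OF M c] by blast
  have "v = (\<lambda>f. \<Sum>b\<in>axes M. v (E b) * coord_vector M c p b f)"
    by (rule tangent_expansion[OF M c v, of E]) (rule E(1), rule eventually_nhdsinI[OF E(2,3)], simp add: E(5))
  then show ?thesis by (rule that)
qed

lemma coord_vector_independent:
  assumes M: "smooth_manifold M" and c: "c \<in> atlas M" "p \<in> fst c"
    and eq: "(\<lambda>f. \<Sum>b\<in>axes M. a b * coord_vector M c p b f) = (\<lambda>f. \<Sum>b\<in>axes M. a' b * coord_vector M c p b f)"
    and b: "b \<in> axes M"
  shows "a b = a' b"
proof -
  obtain E W where E: "\<And>b. E b \<in> smooth_funs M" "openin (man_top M) W" "p \<in> W" "W \<subseteq> fst c"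
    "\<And>b q. b \<in> axes M \<Longrightarrow> q \<in> W \<Longrightarrow> E b q = snd c q \<bullet> b"
    using coordinate_extension[OF M c] by blast
  have fin: "finite (axes M)" using axes_subset[OF M c(1)] finite_subset[OF _ finite_Basis] by blast
  have d: "coord_vector M c p b' (E b) = (if b' = b then 1 else 0)" if "b' \<in> axes M" for b'
    by (rule coord_vector_coordinate[OF M c E(1) _ that b], rule eventually_nhdsinI[OF E(2,3)]) (simp add: E(5) b)
  have "(\<Sum>b'\<in>axes M. k b' * coord_vector M c p b' (E b)) = k b" for k :: "'b \<Rightarrow> real"
    using b fin by (simp add: d if_distrib cong: if_cong sum.cong)
  then show ?thesis using fun_cong[OF eq, of "E b"] by simp
qed

section \<open>Vector fields and covector fields along a map\<close>

text \<open>A description of smooth fields without charts, against which the later constructions are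
  checked. For the direction from right to left, the chart coefficients of V are its values on the
  extended coordinate functions, hence smooth.\<close>

lemma vector_fields_along_iff:
  assumes S: "smooth_manifold S" and M: "smooth_manifold M" and Q: "smooth_map S M Q"
  shows "V \<in> vector_fields_along S M Q \<longleftrightarrow> V \<in> extensional (points S) \<and>
    (\<forall>x\<in>points S. V x \<in> tangent_space M (Q x)) \<and>
    (\<forall>f\<in>smooth_funs M. (\<lambda>x. V x f) \<in> smooth_funs S)"
    (is "_ \<longleftrightarrow> ?R")
proof
  have openQ: "openin (man_top S) {x \<in> points S. Q x \<in> fst c}" if "c \<in> atlas M" for c
    using openin_continuous_map_preimage[OF smooth_map_continuous[OF Q] chart_open[OF M that]] .
  {
    assume V: "V \<in> vector_fields_along S M Q"
    have "smooth_fun_at S (\<lambda>x. V x f) x" if f: "f \<in> smooth_funs M" and x: "x \<in> points S" for f x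
    proof -
      obtain c where c: "c \<in> atlas M" "Q x \<in> fst c" using atlas_cover[OF M smooth_map_points[OF Q x]] .
      obtain w where w: "\<And>b. b \<in> axes M \<Longrightarrow> smooth_fun_on S {x \<in> points S. Q x \<in> fst c} (w b)"
        "\<And>x. x \<in> points S \<Longrightarrow> Q x \<in> fst c \<Longrightarrow> V x = (\<lambda>f. \<Sum>b\<in>axes M. w b x * coord_vector M c (Q x) b f)"
        using V c by (fastforce simp: vector_fields_along_def)
      show ?thesis
      proof (rule smooth_fun_at_cong[OF S])
        show "smooth_fun_at S (\<lambda>x. \<Sum>b\<in>axes M. w b x * coord_vector M c (Q x) b f) x"
        proof (intro smooth_fun_at_sum[OF S x] smooth_fun_at_mult[OF S])
          fix b assume b: "b \<in> axes M"
          show "smooth_fun_at S (w b) x" using w(1)[OF b] x c(2) by (simp add: smooth_fun_on_iff[OF S openQ[OF c(1)]])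
          show "smooth_fun_at S (\<lambda>z. coord_vector M c (Q z) b f) x"
            by (rule smooth_map_compose_fun[OF S M Q x smooth_fun_at_coord_vector[OF M c f]])
        qed
        show "eventually (\<lambda>x. (\<Sum>b\<in>axes M. w b x * coord_vector M c (Q x) b f) = V x f) (nhdsin (man_top S) x)"
          by (rule eventually_mono[OF eventually_nhdsin_in[OF openQ[OF c(1)]]]) (use x c w(2) in auto)
      qed
    qed
    then show ?R using V by (auto simp: vector_fields_along_def smooth_funs_iff[OF S])
  next
    assume R: ?R
    have "\<exists>w. (\<forall>b\<in>axes M. smooth_fun_on S {x \<in> points S. Q x \<in> fst c} (w b)) \<and>
        (\<forall>x\<in>points S. Q x \<in> fst c \<longrightarrow> V x = (\<lambda>f. \<Sum>b\<in>axes M. w b x * coord_vector M c (Q x) b f))"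
      if c: "c \<in> atlas M" for c
    proof -
      have "\<exists>a. V x = (\<lambda>f. \<Sum>b\<in>axes M. a b * coord_vector M c (Q x) b f)" if "x \<in> points S" "Q x \<in> fst c" for x
        using R that tangent_coefficients[OF M c that(2)] by metis
      then obtain a where a: "\<And>x. x \<in> points S \<Longrightarrow> Q x \<in> fst c \<Longrightarrow>
          V x = (\<lambda>f. \<Sum>b\<in>axes M. a x b * coord_vector M c (Q x) b f)"
        by metis
      have "smooth_fun_at S (\<lambda>x. a x b) x" if x: "x \<in> points S" "Q x \<in> fst c" and b: "b \<in> axes M" for x b
      proof -
        obtain E W where E: "\<And>b. E b \<in> smooth_funs M" "openin (man_top M) W" "Q x \<in> W" "W \<subseteq> fst c"
          "\<And>b q. b \<in> axes M \<Longrightarrow> q \<in> W \<Longrightarrow> E b q = snd c q \<bullet> b"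
          using coordinate_extension[OF M c x(2)] by metis
        have "eventually (\<lambda>z. V z (E b) = a z b) (nhdsin (man_top S) x)"
        proof (rule eventually_nhdsinI[OF openin_continuous_map_preimage[OF smooth_map_continuous[OF Q] E(2)]])
          fix z assume z: "z \<in> {x \<in> points S. Q x \<in> W}"
          then have qz: "Q z \<in> fst c" using E(4) by auto
          have evz: "eventually (\<lambda>q. E b' q = snd c q \<bullet> b') (nhdsin (man_top M) (Q z))" if "b' \<in> axes M" for b'
            by (rule eventually_nhdsinI[OF E(2)]) (use z that E(5) in auto)
          have 1: "V z = (\<lambda>f. \<Sum>b\<in>axes M. V z (E b) * coord_vector M c (Q z) b f)"
            by (rule tangent_expansion[OF M c qz _ E(1) evz]) (use R z in auto)
          have 2: "V z = (\<lambda>f. \<Sum>b\<in>axes M. a z b * coord_vector M c (Q z) b f)"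
            using a[of z] qz z by blast
          from trans[OF 1[symmetric] 2]
          have "(\<lambda>f. \<Sum>b\<in>axes M. V z (E b) * coord_vector M c (Q z) b f) =
              (\<lambda>f. \<Sum>b\<in>axes M. a z b * coord_vector M c (Q z) b f)" .
          from coord_vector_independent[OF M c qz this b] show "V z (E b) = a z b" .
        qed (use x E in auto)
        then show ?thesis
          by (rule smooth_fun_at_cong[OF S, rotated]) (use R E(1) x in \<open>auto simp: smooth_funs_iff[OF S]\<close>)
      qed
      then show ?thesis
        by (intro exI[of _ "\<lambda>b x. a x b"]) (use a in \<open>auto simp: smooth_fun_on_iff[OF S openQ[OF c]]\<close>)
    qed
    then show "V \<in> vector_fields_along S M Q" using R by (auto simp: vector_fields_along_def)
  }
qed

text \<open>The coordinate field b, cut off by \<open>ch\<close> and extended by zero. Since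
  \<open>ch\<close> is a parameter, multiplying the field by a further function only changes
  \<open>ch\<close>.\<close>

definition frame_field :: "('a, 'e::euclidean_space) manifold_struct \<Rightarrow> 'a set \<times> ('a \<Rightarrow> 'e) \<Rightarrow> ('a \<Rightarrow> real) \<Rightarrow> 'e \<Rightarrow> 'a \<Rightarrow> 'a tangent" where
  "frame_field M c ch b = (\<lambda>q\<in>points M. if q \<in> fst c then (\<lambda>f. ch q * coord_vector M c q b f) else (\<lambda>f. 0))"

lemma frame_field_in:
  assumes M: "smooth_manifold M" and c: "c \<in> atlas M" and ch: "ch \<in> smooth_funs M"
    and A: "closedin (man_top M) A" "A \<subseteq> fst c" "\<And>x. x \<notin> A \<Longrightarrow> ch x = 0"
  shows "frame_field M c ch b \<in> vector_fields M"
  unfolding vector_fields_along_iff[OF M M smooth_map_id[OF M]]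
proof (intro conjI ballI)
  fix q assume "q \<in> points M"
  then show "frame_field M c ch b q \<in> tangent_space M q"
    using tangent_combine[OF M coord_vector_tangent[OF M c, of q b] tangent_zero, of "ch q" 0]
    by (auto simp: frame_field_def tangent_zero)
next
  fix f assume f: "f \<in> smooth_funs M"
  have "(\<lambda>x. if x \<in> fst c then ch x * coord_vector M c x b f else 0) \<in> smooth_funs M"
    by (rule smooth_extend_by_zero[OF M chart_open[OF M c] _ ch A]) (rule smooth_fun_at_coord_vector[OF M c _ f])
  then show "(\<lambda>x. frame_field M c ch b x f) \<in> smooth_funs M"
    by (rule smooth_funs_cong[OF M]) (simp add: frame_field_def)
qed (simp add: frame_field_def)

lemma vector_field_compose:
  assumes S: "smooth_manifold S" and N: "smooth_manifold N" and M: "smooth_manifold M" and Q: "smooth_map N M Q"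
    and F: "smooth_map S N F" and V: "V \<in> vector_fields_along N M Q"
  shows "(\<lambda>x\<in>points S. V (F x)) \<in> vector_fields_along S M (\<lambda>x. Q (F x))"
  unfolding vector_fields_along_iff[OF S M smooth_map_compose[OF S N M F Q]]
proof (intro conjI ballI)
  fix f assume f: "f \<in> smooth_funs M"
  have "(\<lambda>x. V x f) \<in> smooth_funs N" using V f by (simp add: vector_fields_along_iff[OF N M Q])
  then have "(\<lambda>x. V (F x) f) \<in> smooth_funs S" by (rule smooth_funs_compose[OF S N F])
  then show "(\<lambda>x. (\<lambda>x\<in>points S. V (F x)) x f) \<in> smooth_funs S"
    by (rule smooth_funs_cong[OF S]) simp
qed (use V smooth_map_points[OF F] in \<open>auto simp: vector_fields_along_iff[OF N M Q]\<close>)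

lemma vector_fields_along_cong:
  assumes "\<And>x. x \<in> points S \<Longrightarrow> Q x = Q' x"
  shows "vector_fields_along S M Q = vector_fields_along S M Q'"
  unfolding vector_fields_along_def using assms by (simp cong: conj_cong Collect_cong)

section \<open>Covectors\<close>

lemma cotangent_lincomb:
  "l \<in> cotangent_space M p \<Longrightarrow> v \<in> tangent_space M p \<Longrightarrow> w \<in> tangent_space M p \<Longrightarrow>
    l (\<lambda>f. s * v f + t * w f) = s * l v + t * l w"
  by (simp add: cotangent_space_def)

lemma cotangent_outside: "l \<in> cotangent_space M p \<Longrightarrow> v \<notin> tangent_space M p \<Longrightarrow> l v = 0"
  by (simp add: cotangent_space_def)

lemma cotangent_zero_vector: "l \<in> cotangent_space M p \<Longrightarrow> l (\<lambda>f. 0) = 0"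
  using cotangent_lincomb[of l M p "\<lambda>f. 0" "\<lambda>f. 0" 0 0] by (simp add: tangent_zero)

lemma cotangent_scale: "l \<in> cotangent_space M p \<Longrightarrow> v \<in> tangent_space M p \<Longrightarrow> l (\<lambda>f. s * v f) = s * l v"
  using cotangent_lincomb[of l M p v "\<lambda>f. 0" s 0] by (simp add: tangent_zero)

lemma cotangent_sum:
  assumes M: "smooth_manifold M" and l: "l \<in> cotangent_space M p"
    and v: "\<And>i. i \<in> I \<Longrightarrow> v i \<in> tangent_space M p" and I: "finite I"
  shows "l (\<lambda>f. \<Sum>i\<in>I. a i * v i f) = (\<Sum>i\<in>I. a i * l (v i))"
  using I v
proof (induction I rule: finite_induct)
  case empty
  then show ?case by (simp add: cotangent_zero_vector[OF l])
next
  case (insert i I)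
  have "l (\<lambda>f. a i * v i f + 1 * (\<Sum>i\<in>I. a i * v i f)) = a i * l (v i) + 1 * l (\<lambda>f. \<Sum>i\<in>I. a i * v i f)"
    by (rule cotangent_lincomb[OF l _ tangent_space_sum[OF M]]) (use insert in auto)
  then show ?case using insert by simp
qed

lemma cotangent_nonzero_chart:
  assumes M: "smooth_manifold M" and c: "c \<in> atlas M" "p \<in> fst c" and l: "l \<in> cotangent_space M p" and nz: "l v \<noteq> 0"
  obtains b where "b \<in> axes M" "l (coord_vector M c p b) \<noteq> 0"
proof -
  have fin: "finite (axes M)" using axes_subset[OF M c(1)] finite_subset[OF _ finite_Basis] by blast
  have v: "v \<in> tangent_space M p" using cotangent_outside[OF l] nz by blast
  obtain a where a: "v = (\<lambda>f. \<Sum>b\<in>axes M. a b * coord_vector M c p b f)" using tangent_coefficients[OF M c v] .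
  have "l v = (\<Sum>b\<in>axes M. a b * l (coord_vector M c p b))"
    unfolding a by (rule cotangent_sum[OF M l coord_vector_tangent[OF M c] fin])
  then have "(\<Sum>b\<in>axes M. a b * l (coord_vector M c p b)) \<noteq> 0" using nz by (simp only:) simp
  then obtain b where "b \<in> axes M" "a b * l (coord_vector M c p b) \<noteq> 0" using sum.not_neutral_contains_not_neutral by blast
  then show ?thesis using that by auto
qed

text \<open>The counterpart for covectors. For the direction from right to left, the coordinate
  vector along Q agrees near x with a cut-off frame field, which is a global field along Q and can
  be inserted into P.\<close>

lemma covector_fields_along_iff:
  assumes S: "smooth_manifold S" and M: "smooth_manifold M" and Q: "smooth_map S M Q"
  shows "P \<in> covector_fields_along S M Q \<longleftrightarrow> P \<in> extensional (points S) \<and>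
    (\<forall>x\<in>points S. P x \<in> cotangent_space M (Q x)) \<and>
    (\<forall>V\<in>vector_fields_along S M Q. (\<lambda>x. P x (V x)) \<in> smooth_funs S)"
    (is "_ \<longleftrightarrow> ?R")
proof
  have openQ: "openin (man_top S) {x \<in> points S. Q x \<in> fst c}" if "c \<in> atlas M" for c
    using openin_continuous_map_preimage[OF smooth_map_continuous[OF Q] chart_open[OF M that]] .
  {
    assume P: "P \<in> covector_fields_along S M Q"
    have "smooth_fun_at S (\<lambda>x. P x (V x)) x" if V: "V \<in> vector_fields_along S M Q" and x: "x \<in> points S" for V x
    proof -
      obtain c where c: "c \<in> atlas M" "Q x \<in> fst c" using atlas_cover[OF M smooth_map_points[OF Q x]] .
      have fin: "finite (axes M)" using axes_subset[OF M c(1)] finite_subset[OF _ finite_Basis] by blast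
      obtain w where w: "\<And>b. b \<in> axes M \<Longrightarrow> smooth_fun_on S {x \<in> points S. Q x \<in> fst c} (w b)"
        "\<And>x. x \<in> points S \<Longrightarrow> Q x \<in> fst c \<Longrightarrow> V x = (\<lambda>f. \<Sum>b\<in>axes M. w b x * coord_vector M c (Q x) b f)"
        using V c by (fastforce simp: vector_fields_along_def)
      show ?thesis
      proof (rule smooth_fun_at_cong[OF S])
        show "smooth_fun_at S (\<lambda>x. \<Sum>b\<in>axes M. w b x * P x (coord_vector M c (Q x) b)) x"
        proof (intro smooth_fun_at_sum[OF S x] smooth_fun_at_mult[OF S])
          fix b assume b: "b \<in> axes M"
          show "smooth_fun_at S (w b) x" using w(1)[OF b] x c(2) by (simp add: smooth_fun_on_iff[OF S openQ[OF c(1)]])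
          have "smooth_fun_on S {x \<in> points S. Q x \<in> fst c} (\<lambda>x. P x (coord_vector M c (Q x) b))"
            using P b c by (simp add: covector_fields_along_def)
          then show "smooth_fun_at S (\<lambda>x. P x (coord_vector M c (Q x) b)) x"
            using x c(2) by (simp add: smooth_fun_on_iff[OF S openQ[OF c(1)]])
        qed
        show "eventually (\<lambda>x. (\<Sum>b\<in>axes M. w b x * P x (coord_vector M c (Q x) b)) = P x (V x)) (nhdsin (man_top S) x)"
        proof (rule eventually_mono[OF eventually_nhdsin_in[OF openQ[OF c(1)]]])
          fix z assume z: "z \<in> {x \<in> points S. Q x \<in> fst c}"
          then have l: "P z \<in> cotangent_space M (Q z)" using P by (simp add: covector_fields_along_def)
          show "(\<Sum>b\<in>axes M. w b z * P z (coord_vector M c (Q z) b)) = P z (V z)"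
            using z w(2)[of z] cotangent_sum[OF M l coord_vector_tangent[OF M c(1)] fin, where a = "\<lambda>b. w b z"] by auto
        qed (use x c in auto)
      qed
    qed
    then show ?R using P by (auto simp: covector_fields_along_def smooth_funs_iff[OF S])
  next
    assume R: ?R
    have "smooth_fun_at S (\<lambda>x. P x (coord_vector M c (Q x) b)) x"
      if c: "c \<in> atlas M" and b: "b \<in> axes M" and x: "x \<in> points S" "Q x \<in> fst c" for c b x
    proof -
      obtain ch :: "'c \<Rightarrow> real" and A where ch: "ch \<in> smooth_funs M"
        "eventually (\<lambda>x. ch x = 1) (nhdsin (man_top M) (Q x))"
        "closedin (man_top M) A" "A \<subseteq> fst c" "\<And>x. x \<notin> A \<Longrightarrow> ch x = 0"
        using manifold_bump_exists[OF M chart_open[OF M c] x(2)] by metis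
      let ?V = "\<lambda>x\<in>points S. frame_field M c ch b (Q x)"
      have "?V \<in> vector_fields_along S M Q"
        by (rule vector_field_compose[OF S M M smooth_map_id[OF M] Q frame_field_in[OF M c ch(1,3-5)]])
      then have s: "smooth_fun_at S (\<lambda>x. P x (?V x)) x" using R x by (auto simp: smooth_funs_iff[OF S])
      show ?thesis
      proof (rule smooth_fun_at_cong[OF S s])
        show "eventually (\<lambda>x. P x (?V x) = P x (coord_vector M c (Q x) b)) (nhdsin (man_top S) x)"
          by (rule eventually_elim2[OF eventually_nhdsin_continuous_map[OF smooth_map_continuous[OF Q] x(1) ch(2)]
                eventually_nhdsin_in[OF openQ[OF c]]])
            (use x smooth_map_points[OF Q] in \<open>auto simp: frame_field_def\<close>)
      qed
    qed
    then show "P \<in> covector_fields_along S M Q"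
      using R by (auto simp: covector_fields_along_def smooth_fun_on_iff[OF S openQ])
  }
qed

section \<open>Differentials\<close>

lemma differential_tangent:
  assumes M: "smooth_manifold M" and N: "smooth_manifold N" and F: "smooth_map M N F" and v: "v \<in> tangent_space M p"
  shows "differential N F v \<in> tangent_space N (F p)"
  unfolding tangent_space_def
proof (intro CollectI conjI ballI allI impI)
  fix f g s t assume f: "f \<in> smooth_funs N" and g: "g \<in> smooth_funs N"
  show "differential N F v (\<lambda>x. s * f x + t * g x) = s * differential N F v f + t * differential N F v g"
    using f g smooth_funs_lincomb[OF N f g] smooth_funs_compose[OF M N F]
    by (simp add: differential_def tangent_lincomb[OF v])
  show "differential N F v (\<lambda>x. f x * g x) = f (F p) * differential N F v g + g (F p) * differential N F v f"
    using f g smooth_funs_mult[OF N f g] smooth_funs_compose[OF M N F]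
    by (simp add: differential_def tangent_mult[OF v])
qed (simp add: differential_def)

lemma differential_compose:
  assumes M: "smooth_manifold M" and N: "smooth_manifold N" and G: "smooth_map M N G"
  shows "differential N G (differential M F v) = differential N (\<lambda>x. G (F x)) v"
  using smooth_funs_compose[OF M N G] by (auto simp: differential_def)

text \<open>Functions are total and may differ off the manifold, which no germ at p can see; on
  functions that are not smooth both values are 0. Maps can thus be replaced by their restrictions
  inside a differential.\<close>

lemma tangent_cong_points:
  assumes M: "smooth_manifold M" and p: "p \<in> points M" and v: "v \<in> tangent_space M p"
    and eq: "\<And>x. x \<in> points M \<Longrightarrow> f x = g x"
  shows "v f = v g"
proof -
  have ev: "eventually (\<lambda>x. f x = g x) (nhdsin (man_top M) q)" if "q \<in> points M" for q
    by (rule eventually_nhdsinI[OF openin_topspace that eq])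
  have "f \<in> smooth_funs M \<longleftrightarrow> g \<in> smooth_funs M"
    using smooth_funs_cong[OF M, of f g] smooth_funs_cong[OF M, of g f] eq by auto
  then show ?thesis
    using tangent_local[OF M p v _ _ ev[OF p]] tangent_not_smooth[OF v] by metis
qed

lemma differential_cong_points:
  assumes M: "smooth_manifold M" and p: "p \<in> points M" and v: "v \<in> tangent_space M p"
    and eq: "\<And>x. x \<in> points M \<Longrightarrow> F x = G x"
  shows "differential N F v = differential N G v"
proof
  fix f
  have "v (\<lambda>x. f (F x)) = v (\<lambda>x. f (G x))" by (rule tangent_cong_points[OF M p v]) (simp add: eq)
  then show "differential N F v f = differential N G v f" by (simp add: differential_def)
qed

lemma differential_id:
  assumes "v \<in> tangent_space M p"
  shows "differential M (\<lambda>x. x) v = v"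
  using tangent_not_smooth[OF assms] by (auto simp: differential_def)

lemma differential_combine:
  "differential N F (\<lambda>f. s * v f + t * w f) = (\<lambda>f. s * differential N F v f + t * differential N F w f)"
  by (auto simp: differential_def)

section \<open>Lie groups, diffeomorphisms and the automorphism group\<close>

section \<open>Lie groups\<close>

context
  fixes G :: "('g, 'eg::euclidean_space) lie_struct"
  assumes G: "lie_group G"
begin

lemma lie_group_group: "group G" using G by (simp add: lie_group_def)

lemma lie_group_manifold: "smooth_manifold (lie_man G)" using G by (simp add: lie_group_def)

lemma lie_group_points: "points (lie_man G) = carrier G" using G by (simp add: lie_group_def)

lemma lie_mult_continuous:
  "continuous_map (prod_topology (man_top (lie_man G)) (man_top (lie_man G))) (man_top (lie_man G)) (\<lambda>(g, h). g \<otimes>\<^bsub>G\<^esub> h)"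
  using G by (simp add: lie_group_def smooth_map_def prod_manifold_def)

lemma open_chart_product:
  assumes M: "smooth_manifold M" and N: "smooth_manifold N" and c: "c \<in> atlas M" and d: "d \<in> atlas N"
    and W: "openin (prod_topology (man_top M) (man_top N)) W"
  shows "open {(y, z). y \<in> chart_dom M c \<and> z \<in> chart_dom N d \<and> (param M c y, param N d z) \<in> W}"
proof (subst open_subopen, rule ballI)
  fix p assume "p \<in> {(y, z). y \<in> chart_dom M c \<and> z \<in> chart_dom N d \<and> (param M c y, param N d z) \<in> W}"
  then obtain y z where p: "p = (y, z)" "y \<in> chart_dom M c" "z \<in> chart_dom N d" "(param M c y, param N d z) \<in> W"
    by auto
  obtain U V where UV: "openin (man_top M) U" "openin (man_top N) V" "param M c y \<in> U" "param N d z \<in> V" "U \<times> V \<subseteq> W"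
    using W[unfolded openin_prod_topology_alt, rule_format, OF p(4)] by blast
  let ?T = "{y. axes_proj (axes M) y \<in> snd c ` (fst c \<inter> U)} \<times> {z. axes_proj (axes N) z \<in> snd d ` (fst d \<inter> V)}"
  have "open ?T" by (intro open_Times open_chart_preimage[OF M c UV(1)] open_chart_preimage[OF N d UV(2)])
  moreover have "p \<in> ?T" using p UV by (simp add: chart_preimage_iff[OF M c] chart_preimage_iff[OF N d])
  moreover have "?T \<subseteq> {(y, z). y \<in> chart_dom M c \<and> z \<in> chart_dom N d \<and> (param M c y, param N d z) \<in> W}"
    using UV(5) by (auto simp: chart_preimage_iff[OF M c] chart_preimage_iff[OF N d])
  ultimately show "\<exists>T. open T \<and> p \<in> T \<and>
      T \<subseteq> {(y, z). y \<in> chart_dom M c \<and> z \<in> chart_dom N d \<and> (param M c y, param N d z) \<in> W}" by blast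
qed

lemma prod_axes_proj:
  assumes "finite A" "finite B"
  shows "axes_proj ((\<lambda>b. (b, 0)) ` A \<union> (\<lambda>b. (0, b)) ` B) (y, z) =
    (axes_proj A y, axes_proj B (z::'z::euclidean_space))"
proof -
  let ?t = "\<lambda>b. ((y, z) \<bullet> b) *\<^sub>R b"
  \<comment> \<open>The two families of axes can share at most the zero vector, whose term vanishes,
    so the sum over the union splits.\<close>
  have z: "(\<Sum>b\<in>((\<lambda>b. (b, 0)) ` A) \<inter> ((\<lambda>b. (0, b)) ` B). ?t b) = 0"
    by (rule sum.neutral) auto
  have "axes_proj ((\<lambda>b. (b, 0)) ` A \<union> (\<lambda>b. (0, b)) ` B) (y, z) =
    (\<Sum>b\<in>(\<lambda>b. (b, 0)) ` A. ?t b) + (\<Sum>b\<in>(\<lambda>b. (0, b)) ` B. ?t b)"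
    unfolding axes_proj_def
    using sum.union_inter[of "(\<lambda>b. (b, 0)) ` A" "(\<lambda>b. (0, b)) ` B" ?t] assms z by simp
  also have "(\<Sum>b\<in>(\<lambda>b. (b, 0)) ` A. ?t b) = (axes_proj A y, 0)"
    by (subst sum.reindex) (auto simp: inj_on_def axes_proj_def sum_prod[symmetric] scaleR_Pair intro!: prod_eqI simp: fst_sum snd_sum)
  also have "(\<Sum>b\<in>(\<lambda>b. (0, b)) ` B. ?t b) = (0, axes_proj B z)"
    by (subst sum.reindex) (auto simp: inj_on_def axes_proj_def intro!: prod_eqI simp: fst_sum snd_sum)
  finally show ?thesis by simp
qed

text \<open>Turns smoothness of the multiplication on the product manifold into smoothness of a
  function of two Euclidean variables. The function F covers both uses: a chart, to compose smooth
  maps, and a test function, to differentiate.\<close>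

lemma lie_mult_local:
  fixes F :: "'g \<Rightarrow> 'f::euclidean_space"
  assumes c: "c \<in> atlas (lie_man G)" "g \<in> fst c" and d: "d \<in> atlas (lie_man G)" "h \<in> fst d"
    and F: "smooth_fun_at (lie_man G) F (g \<otimes>\<^bsub>G\<^esub> h)"
  shows "smooth_at (\<lambda>(y, z). F (param (lie_man G) c y \<otimes>\<^bsub>G\<^esub> param (lie_man G) d z)) (snd c g, snd d h)"
proof -
  let ?M = "lie_man G"
  note M = lie_group_manifold
  obtain e where e: "e \<in> atlas ?M" "g \<otimes>\<^bsub>G\<^esub> h \<in> fst e" using F by (auto simp: smooth_fun_at_def)
  let ?P = "prod_manifold ?M ?M" and ?m = "\<lambda>(g, h). g \<otimes>\<^bsub>G\<^esub> h"
  let ?c = "(fst c \<times> fst d, map_prod (snd c) (snd d))"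
  define W where "W = {x \<in> points ?P. ?m x \<in> fst e}"
  have fin: "finite (axes ?M)" using axes_subset[OF M c(1)] finite_subset[OF _ finite_Basis] by blast
  have W: "openin (prod_topology (man_top ?M) (man_top ?M)) W"
    unfolding W_def using openin_continuous_map_preimage[OF lie_mult_continuous chart_open[OF M e(1)]]
    by (simp add: prod_manifold_def)
  have "?c \<in> atlas ?P"
    unfolding prod_manifold_def manifold_struct.simps
    by (rule rev_image_eqI[of "(c, d)"]) (use c d in \<open>simp_all add: case_prod_unfold\<close>)
  moreover have "smooth_fun_on ?P W (snd e \<circ> ?m)"
    using G e(1) unfolding lie_group_def smooth_map_def W_def by (fastforce split: prod.splits)
  ultimately have s: "smooth_on_open {y. axes_proj (axes ?P) y \<in> snd ?c ` (fst ?c \<inter> W)} (local_rep (axes ?P) ?c (snd e \<circ> ?m))"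
    unfolding smooth_fun_on_def smooth_in_chart_def by blast
  have pr: "axes_proj (axes ?P) (y, z) = (axes_proj (axes ?M) y, axes_proj (axes ?M) z)" for y z
    using prod_axes_proj[OF fin fin] by (simp add: prod_manifold_def)
  let ?T = "{(y, z). y \<in> chart_dom ?M c \<and> z \<in> chart_dom ?M d \<and> (param ?M c y, param ?M d z) \<in> W}"
  have oT: "open ?T" by (rule open_chart_product[OF M M c(1) d(1) W])
  have inv: "inv_into (fst c \<times> fst d) (map_prod (snd c) (snd d)) (axes_proj (axes ?P) (y, z)) = (param ?M c y, param ?M d z)"
    if "y \<in> chart_dom ?M c" "z \<in> chart_dom ?M d" for y z
  proof (rule inv_into_f_eq)
    show "inj_on (map_prod (snd c) (snd d)) (fst c \<times> fst d)"
      by (rule map_prod_inj_on[OF chart_inj[OF M c(1)] chart_inj[OF M d(1)]])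
    show "(param ?M c y, param ?M d z) \<in> fst c \<times> fst d" using that param_in[OF M c(1)] param_in[OF M d(1)] by simp
    show "map_prod (snd c) (snd d) (param ?M c y, param ?M d z) = axes_proj (axes ?P) (y, z)"
      using that chart_param[OF M c(1)] chart_param[OF M d(1)] by (simp add: pr)
  qed
  have sub: "?T \<subseteq> {y. axes_proj (axes ?P) y \<in> snd ?c ` (fst ?c \<inter> W)}"
  proof clarify
    fix y z assume yz: "y \<in> chart_dom ?M c" "z \<in> chart_dom ?M d" "(param ?M c y, param ?M d z) \<in> W"
    have "axes_proj (axes ?P) (y, z) = snd ?c (param ?M c y, param ?M d z)"
      using yz chart_param[OF M c(1)] chart_param[OF M d(1)] by (simp add: pr)
    moreover have "(param ?M c y, param ?M d z) \<in> fst ?c \<inter> W"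
      using yz param_in[OF M c(1)] param_in[OF M d(1)] by simp
    ultimately show "axes_proj (axes ?P) (y, z) \<in> snd ?c ` (fst ?c \<inter> W)" by blast
  qed
  have gh: "(snd c g, snd d h) \<in> ?T"
    using c d e chart_in_dom[OF M] param_chart[OF M] chart_points[OF M c] chart_points[OF M d]
    by (simp add: W_def prod_manifold_def)
  let ?L = "local_rep (axes ?P) ?c (snd e \<circ> ?m)"
  have Lval: "?L (y, z) = snd e (param ?M c y \<otimes>\<^bsub>G\<^esub> param ?M d z)" if "(y, z) \<in> ?T" for y z
    using that by (simp add: local_rep_def inv)
  have "smooth_at ?L (snd c g, snd d h)"
    by (rule smooth_atI[OF oT gh C_on_subset[OF _ sub]]) (use s in \<open>simp add: smooth_on_open_def\<close>)
  moreover have "?L (snd c g, snd d h) = snd e (g \<otimes>\<^bsub>G\<^esub> h)"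
    using Lval[OF gh] c d by (simp add: param_chart[OF M])
  ultimately have "smooth_at (\<lambda>p. local_rep (axes ?M) e F (?L p)) (snd c g, snd d h)"
    using F by (intro smooth_at_compose[of "local_rep (axes ?M) e F" ?L]) (simp_all add: smooth_fun_at_iff[OF M e])
  then show ?thesis
  proof (rule smooth_at_cong)
    show "eventually (\<lambda>p. local_rep (axes ?M) e F (?L p) = (case p of (y, z) \<Rightarrow> F (param ?M c y \<otimes>\<^bsub>G\<^esub> param ?M d z))) (nhds (snd c g, snd d h))"
    proof (rule eventually_mono[OF eventually_nhds_in_open[OF oT gh]])
      fix p assume p: "p \<in> ?T"
      then obtain y z where yz: "p = (y, z)" "param ?M c y \<otimes>\<^bsub>G\<^esub> param ?M d z \<in> fst e" by (auto simp: W_def)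
      then show "local_rep (axes ?M) e F (?L p) = (case p of (y, z) \<Rightarrow> F (param ?M c y \<otimes>\<^bsub>G\<^esub> param ?M d z))"
        using Lval[of y z] p by (simp add: local_rep_chart[OF M e(1)])
    qed
  qed
qed

lemma smooth_map_lie_mult:
  assumes S: "smooth_manifold S" and f: "smooth_map S (lie_man G) f" and g: "smooth_map S (lie_man G) g"
  shows "smooth_map S (lie_man G) (\<lambda>x. f x \<otimes>\<^bsub>G\<^esub> g x)"
proof (rule smooth_mapI[OF S lie_group_manifold])
  let ?M = "lie_man G"
  note M = lie_group_manifold
  have "continuous_map (man_top S) (prod_topology (man_top ?M) (man_top ?M)) (\<lambda>x. (f x, g x))"
    using smooth_map_continuous[OF f] smooth_map_continuous[OF g] by (simp add: continuous_map_pairwise o_def)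
  from continuous_map_compose[OF this lie_mult_continuous]
  show "continuous_map (man_top S) (man_top ?M) (\<lambda>x. f x \<otimes>\<^bsub>G\<^esub> g x)" by (simp add: o_def)
  then have pts: "x \<in> points S \<Longrightarrow> f x \<otimes>\<^bsub>G\<^esub> g x \<in> points ?M" for x
    using continuous_map_image_subset_topspace by blast
  fix x assume x: "x \<in> points S"
  obtain e where e: "e \<in> atlas ?M" "f x \<otimes>\<^bsub>G\<^esub> g x \<in> fst e" using atlas_cover[OF M pts[OF x]] .
  obtain c where c: "c \<in> atlas ?M" "f x \<in> fst c" using atlas_cover[OF M smooth_map_points[OF f x]] .
  obtain d where d: "d \<in> atlas ?M" "g x \<in> fst d" using atlas_cover[OF M smooth_map_points[OF g x]] .
  have "smooth_fun_at S (\<lambda>z. (\<lambda>(y, z). snd e (param ?M c y \<otimes>\<^bsub>G\<^esub> param ?M d z)) (snd c (f z), snd d (g z))) x"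
  proof (rule smooth_fun_at_compose[OF S, of "\<lambda>z. (snd c (f z), snd d (g z))"])
    show "smooth_fun_at S (\<lambda>z. (snd c (f z), snd d (g z))) x"
      by (intro smooth_fun_at_Pair[OF S] smooth_map_compose_fun[OF S M f x] smooth_map_compose_fun[OF S M g x]
          smooth_fun_at_chart[OF M c] smooth_fun_at_chart[OF M d])
    show "smooth_at (\<lambda>(y, z). snd e (param ?M c y \<otimes>\<^bsub>G\<^esub> param ?M d z)) (snd c (f x), snd d (g x))"
      by (rule lie_mult_local[OF c d smooth_fun_at_chart[OF M e]])
  qed
  then have "smooth_fun_at S (\<lambda>z. snd e (f z \<otimes>\<^bsub>G\<^esub> g z)) x"
  proof (rule smooth_fun_at_cong[OF S])
    show "eventually (\<lambda>z. (case (snd c (f z), snd d (g z)) of (y, z) \<Rightarrow> snd e (param ?M c y \<otimes>\<^bsub>G\<^esub> param ?M d z)) =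
        snd e (f z \<otimes>\<^bsub>G\<^esub> g z)) (nhdsin (man_top S) x)"
      by (rule eventually_elim2[OF eventually_nhdsin_continuous_map[OF smooth_map_continuous[OF f] x eventually_in_chart[OF M c]]
            eventually_nhdsin_continuous_map[OF smooth_map_continuous[OF g] x eventually_in_chart[OF M d]]])
        (simp add: param_chart[OF M c(1)] param_chart[OF M d(1)])
  qed
  then show "\<exists>c\<in>atlas ?M. f x \<otimes>\<^bsub>G\<^esub> g x \<in> fst c \<and> smooth_fun_at S (\<lambda>z. snd c (f z \<otimes>\<^bsub>G\<^esub> g z)) x"
    using e by blast
qed

lemma smooth_map_lie_inv:
  assumes S: "smooth_manifold S" and f: "smooth_map S (lie_man G) f"
  shows "smooth_map S (lie_man G) (\<lambda>x. inv\<^bsub>G\<^esub> (f x))"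
  using smooth_map_compose[OF S lie_group_manifold lie_group_manifold f] G by (simp add: lie_group_def)

lemma smooth_map_right_mult:
  "h \<in> carrier G \<Longrightarrow> smooth_map (lie_man G) (lie_man G) (\<lambda>k. k \<otimes>\<^bsub>G\<^esub> h)"
  using lie_group_points lie_group_manifold
  by (intro smooth_map_lie_mult smooth_map_id smooth_map_const) auto

lemma right_translate_tangent:
  "h \<in> carrier G \<Longrightarrow> v \<in> tangent_space (lie_man G) g \<Longrightarrow> right_translate G v h \<in> tangent_space (lie_man G) (g \<otimes>\<^bsub>G\<^esub> h)"
  unfolding right_translate_def
  by (rule differential_tangent[OF lie_group_manifold lie_group_manifold smooth_map_right_mult])

lemma right_translate_mult:
  assumes "g \<in> carrier G" "h \<in> carrier G" "k \<in> carrier G" "v \<in> tangent_space (lie_man G) g"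
  shows "right_translate G (right_translate G v h) k = right_translate G v (h \<otimes>\<^bsub>G\<^esub> k)"
  unfolding right_translate_def
    differential_compose[OF lie_group_manifold lie_group_manifold smooth_map_right_mult[OF assms(3)]]
  by (rule differential_cong_points[OF lie_group_manifold _ assms(4)])
    (use assms lie_group_points monoid.m_assoc[OF group.is_monoid[OF lie_group_group]] in auto)

lemma right_translate_one:
  assumes "g \<in> carrier G" "v \<in> tangent_space (lie_man G) g"
  shows "right_translate G v \<one>\<^bsub>G\<^esub> = v"
proof -
  have "right_translate G v \<one>\<^bsub>G\<^esub> = differential (lie_man G) (\<lambda>k. k) v"
    unfolding right_translate_def
    by (rule differential_cong_points[OF lie_group_manifold _ assms(2)])
      (use assms lie_group_points monoid.r_one[OF group.is_monoid[OF lie_group_group]] in auto)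
  then show ?thesis by (simp add: differential_id[OF assms(2)])
qed

lemma right_translate_combine:
  "right_translate G (\<lambda>f. s * v f + t * w f) h = (\<lambda>f. s * right_translate G v h f + t * right_translate G w h f)"
  by (simp add: right_translate_def differential_combine)

text \<open>The translating element b x varies with x, so the differential of one fixed map does not
  suffice. In charts, the translated field applied to f is a sum of smooth coefficients times
  partial derivatives of the smooth function H, evaluated along x \<mapsto> (\<gamma> x, b
  x).\<close>

lemma right_translate_field:
  assumes S: "smooth_manifold S" and \<gamma>: "smooth_map S (lie_man G) \<gamma>" and b: "smooth_map S (lie_man G) b"
    and V: "V \<in> vector_fields_along S (lie_man G) \<gamma>"
  shows "(\<lambda>x\<in>points S. right_translate G (V x) (b x)) \<in> vector_fields_along S (lie_man G) (\<lambda>x. \<gamma> x \<otimes>\<^bsub>G\<^esub> b x)"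
proof -
  let ?M = "lie_man G"
  note M = lie_group_manifold
  have bc: "b x \<in> carrier G" if "x \<in> points S" for x using smooth_map_points[OF b that] lie_group_points by simp
  have V': "\<And>x. x \<in> points S \<Longrightarrow> V x \<in> tangent_space ?M (\<gamma> x)"
    using V by (simp add: vector_fields_along_iff[OF S M \<gamma>])
  have openQ: "openin (man_top S) {x \<in> points S. \<gamma> x \<in> fst c}" if "c \<in> atlas ?M" for c
    using openin_continuous_map_preimage[OF smooth_map_continuous[OF \<gamma>] chart_open[OF M that]] .
  have "smooth_fun_at S (\<lambda>x. V x (\<lambda>k. f (k \<otimes>\<^bsub>G\<^esub> b x))) x" if f: "f \<in> smooth_funs ?M" and x: "x \<in> points S" for f x
  proof -
    obtain c where c: "c \<in> atlas ?M" "\<gamma> x \<in> fst c" using atlas_cover[OF M smooth_map_points[OF \<gamma> x]] .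
    obtain d where d: "d \<in> atlas ?M" "b x \<in> fst d" using atlas_cover[OF M smooth_map_points[OF b x]] .
    obtain w where w: "\<And>b. b \<in> axes ?M \<Longrightarrow> smooth_fun_on S {x \<in> points S. \<gamma> x \<in> fst c} (w b)"
      "\<And>x. x \<in> points S \<Longrightarrow> \<gamma> x \<in> fst c \<Longrightarrow> V x = (\<lambda>f. \<Sum>b\<in>axes ?M. w b x * coord_vector ?M c (\<gamma> x) b f)"
      using V c by (fastforce simp: vector_fields_along_def)
    define H where "H = (\<lambda>(y, z). f (param ?M c y \<otimes>\<^bsub>G\<^esub> param ?M d z))"
    have H: "smooth_at H (snd c g, snd d h)" if "g \<in> fst c" "h \<in> fst d" for g h
      unfolding H_def
    proof (rule lie_mult_local[OF c(1) that(1) d(1) that(2)])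
      have "g \<otimes>\<^bsub>G\<^esub> h \<in> points ?M"
        using that chart_points[OF M c(1)] chart_points[OF M d(1)] lie_group_points
          monoid.m_closed[OF group.is_monoid[OF lie_group_group]] by auto
      then show "smooth_fun_at ?M f (g \<otimes>\<^bsub>G\<^esub> h)" by (rule smooth_funs_at[OF M f])
    qed
    \<comment> \<open>The direction (a, 0) differentiates in the first factor only: the translating
      element is held fixed while the tangent vector acts.\<close>
    let ?K = "\<lambda>a p. frechet_derivative H (at p) (a, 0)"
    have val: "coord_vector ?M c g a (\<lambda>k. f (k \<otimes>\<^bsub>G\<^esub> h)) = ?K a (snd c g, snd d h)"
      if "g \<in> fst c" "h \<in> fst d" for g h a
    proof -
      have hc: "h \<in> carrier G" using chart_points[OF M d(1) that(2)] lie_group_points by simp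
      have "(\<lambda>k. f (k \<otimes>\<^bsub>G\<^esub> h)) \<in> smooth_funs ?M"
        by (rule smooth_funs_compose[OF M M smooth_map_right_mult[OF hc] f])
      then have "coord_vector ?M c g a (\<lambda>k. f (k \<otimes>\<^bsub>G\<^esub> h)) =
          frechet_derivative (\<lambda>y. H (y, snd d h)) (at (snd c g)) a"
        using that by (simp add: coord_vector_smooth[OF M] local_rep_def H_def param_chart[OF M d(1)])
      moreover have "((\<lambda>y. H (y, snd d h)) has_derivative (\<lambda>a. ?K a (snd c g, snd d h))) (at (snd c g))"
      proof -
        have "((\<lambda>y. (y, snd d h)) has_derivative (\<lambda>a. (a, 0))) (at (snd c g))"
          by (intro has_derivative_Pair has_derivative_ident has_derivative_const)
        from has_derivative_compose[OF this smooth_at_has_derivative[OF H[OF that]]] show ?thesis .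
      qed
      ultimately show ?thesis using frechet_derivative_at by metis
    qed
    show ?thesis
    proof (rule smooth_fun_at_cong[OF S])
      show "smooth_fun_at S (\<lambda>x. \<Sum>a\<in>axes ?M. w a x * ?K a (snd c (\<gamma> x), snd d (b x))) x"
      proof (intro smooth_fun_at_sum[OF S x] smooth_fun_at_mult[OF S])
        fix a assume a: "a \<in> axes ?M"
        show "smooth_fun_at S (w a) x" using w(1)[OF a] x c(2) by (simp add: smooth_fun_on_iff[OF S openQ[OF c(1)]])
        have "smooth_fun_at S (\<lambda>x. (snd c (\<gamma> x), snd d (b x))) x"
          by (intro smooth_fun_at_Pair[OF S] smooth_map_compose_fun[OF S M \<gamma> x] smooth_map_compose_fun[OF S M b x]
            smooth_fun_at_chart[OF M c] smooth_fun_at_chart[OF M d])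
        from smooth_fun_at_compose[OF S this smooth_at_derivative[OF H[OF c(2) d(2)]]]
        show "smooth_fun_at S (\<lambda>x. ?K a (snd c (\<gamma> x), snd d (b x))) x" .
      qed
      show "eventually (\<lambda>x. (\<Sum>a\<in>axes ?M. w a x * ?K a (snd c (\<gamma> x), snd d (b x))) = V x (\<lambda>k. f (k \<otimes>\<^bsub>G\<^esub> b x))) (nhdsin (man_top S) x)"
        by (rule eventually_elim2[OF eventually_nhdsin_in[OF openQ[OF c(1)]]
              eventually_nhdsin_continuous_map[OF smooth_map_continuous[OF b] x eventually_in_chart[OF M d]]])
          (use x c in \<open>auto simp: w(2) val\<close>)
    qed
  qed
  then have sm: "(\<lambda>x. V x (\<lambda>k. f (k \<otimes>\<^bsub>G\<^esub> b x))) \<in> smooth_funs S" if "f \<in> smooth_funs ?M" for f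
    using that by (simp add: smooth_funs_iff[OF S])
  show ?thesis
    unfolding vector_fields_along_iff[OF S M smooth_map_lie_mult[OF S \<gamma> b]]
  proof (intro conjI ballI)
    fix f assume f: "f \<in> smooth_funs ?M"
    show "(\<lambda>x. (\<lambda>x\<in>points S. right_translate G (V x) (b x)) x f) \<in> smooth_funs S"
      by (rule smooth_funs_cong[OF S sm[OF f]]) (simp add: right_translate_def differential_def f)
  qed (use V' bc right_translate_tangent in auto)
qed

end

section \<open>Diffeomorphisms and automorphisms\<close>

lemma smooth_maps_restrict:
  assumes S: "smooth_manifold S" and N: "smooth_manifold N" and f: "smooth_map S N f"
  shows "restrict f (points S) \<in> smooth_maps S N"
  unfolding smooth_maps_def using smooth_map_cong[OF S N f, of "restrict f (points S)"] by simp

lemma diffeosD: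
  assumes "\<psi> \<in> diffeos S"
  shows "smooth_map S S \<psi>" "bij_betw \<psi> (points S) (points S)" "smooth_map S S (inv_into (points S) \<psi>)"
    "\<psi> \<in> extensional (points S)"
    "x \<in> points S \<Longrightarrow> \<psi> x \<in> points S" "x \<in> points S \<Longrightarrow> inv_into (points S) \<psi> x \<in> points S"
    "x \<in> points S \<Longrightarrow> \<psi> (inv_into (points S) \<psi> x) = x" "x \<in> points S \<Longrightarrow> inv_into (points S) \<psi> (\<psi> x) = x"
proof -
  show *: "smooth_map S S \<psi>" "bij_betw \<psi> (points S) (points S)" "smooth_map S S (inv_into (points S) \<psi>)"
    "\<psi> \<in> extensional (points S)"
    using assms by (simp_all add: diffeos_def smooth_maps_def)
  show "x \<in> points S \<Longrightarrow> \<psi> x \<in> points S" using smooth_map_points[OF *(1)] .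
  show "x \<in> points S \<Longrightarrow> inv_into (points S) \<psi> x \<in> points S" using smooth_map_points[OF *(3)] .
  show "x \<in> points S \<Longrightarrow> \<psi> (inv_into (points S) \<psi> x) = x" using bij_betw_inv_into_right[OF *(2)] .
  show "x \<in> points S \<Longrightarrow> inv_into (points S) \<psi> (\<psi> x) = x" using bij_betw_inv_into_left[OF *(2)] .
qed

lemma diffeosI:
  assumes S: "smooth_manifold S" and f: "smooth_map S S f" and g: "smooth_map S S g"
    and fg: "\<And>x. x \<in> points S \<Longrightarrow> f (g x) = x" "\<And>x. x \<in> points S \<Longrightarrow> g (f x) = x"
  shows "restrict f (points S) \<in> diffeos S"
proof -
  note pts = smooth_map_points[OF f] smooth_map_points[OF g]
  have bij: "bij_betw f (points S) (points S)"
    by (rule bij_betw_byWitness[where f' = g]) (use fg pts in auto)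
  then have "bij_betw (restrict f (points S)) (points S) (points S)"
    by (simp cong: bij_betw_cong)
  moreover have "inv_into (points S) (restrict f (points S)) x = g x" if "x \<in> points S" for x
    using that fg(1)[OF that] pts(2)[OF that] bij_betw_imp_inj_on[OF bij]
    by (intro inv_into_f_eq) (simp_all add: inj_on_restrict_eq)
  then have "smooth_map S S (inv_into (points S) (restrict f (points S)))"
    by (intro smooth_map_cong[OF S S g]) simp
  ultimately show ?thesis using smooth_maps_restrict[OF S S f] by (simp add: diffeos_def)
qed

lemma diffeo_inverse:
  assumes S: "smooth_manifold S" and \<psi>: "\<psi> \<in> diffeos S"
  shows "restrict (inv_into (points S) \<psi>) (points S) \<in> diffeos S"
  by (rule diffeosI[OF S diffeosD(3,1)[OF \<psi>]]) (use diffeosD[OF \<psi>] in auto)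

lemma diffeo_compose:
  assumes S: "smooth_manifold S" and \<psi>: "\<psi> \<in> diffeos S" and \<phi>: "\<phi> \<in> diffeos S"
  shows "(\<lambda>x\<in>points S. \<psi> (\<phi> x)) \<in> diffeos S"
  by (rule diffeosI[OF S smooth_map_compose[OF S S S diffeosD(1)[OF \<phi>] diffeosD(1)[OF \<psi>]]
        smooth_map_compose[OF S S S diffeosD(3)[OF \<psi>] diffeosD(3)[OF \<phi>]]])
    (use diffeosD[OF \<psi>] diffeosD[OF \<phi>] in auto)

context
  fixes S :: "('s, 'es::euclidean_space) manifold_struct" and G :: "('g, 'eg::euclidean_space) lie_struct"
  assumes S: "smooth_manifold S" and G: "lie_group G"
begin

abbreviation (input) "inv_aut h \<equiv>
  (restrict (inv_into (points S) (fst h)) (points S), \<lambda>x\<in>points S. inv\<^bsub>G\<^esub> (snd h (inv_into (points S) (fst h) x)))"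

lemma smooth_maps_carrier: "b \<in> smooth_maps S (lie_man G) \<Longrightarrow> x \<in> points S \<Longrightarrow> b x \<in> carrier G"
  using smooth_map_points[of S "lie_man G" b x] lie_group_points[OF G] by (simp add: smooth_maps_def)

lemma inv_aut_carrier:
  assumes "h \<in> carrier (aut_group S G)"
  shows "inv_aut h \<in> carrier (aut_group S G)"
proof -
  have h: "fst h \<in> diffeos S" "smooth_map S (lie_man G) (snd h)" using assms by (auto simp: aut_group_def smooth_maps_def)
  show ?thesis
    using diffeo_inverse[OF S h(1)]
      smooth_maps_restrict[OF S lie_group_manifold[OF G] smooth_map_lie_inv[OF G S smooth_map_compose[OF S S lie_group_manifold[OF G] diffeosD(3)[OF h(1)] h(2)]]]
    by (simp add: aut_group_def)
qed

lemma inv_aut_left: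
  assumes "h \<in> carrier (aut_group S G)"
  shows "inv_aut h \<otimes>\<^bsub>aut_group S G\<^esub> h = \<one>\<^bsub>aut_group S G\<^esub>"
proof -
  have h: "fst h \<in> diffeos S" "snd h \<in> smooth_maps S (lie_man G)" using assms by (auto simp: aut_group_def)
  show ?thesis
    using diffeosD[OF h(1)] smooth_maps_carrier[OF h(2)] group.l_inv[OF lie_group_group[OF G]]
    by (auto simp: aut_group_def case_prod_unfold fun_eq_iff restrict_def)
qed

lemma group_aut_group: "group (aut_group S G)"
proof (rule groupI)
  interpret g: group G by (rule lie_group_group[OF G])
  note M = lie_group_manifold[OF G]
  let ?A = "aut_group S G"
  show "x \<otimes>\<^bsub>?A\<^esub> y \<in> carrier ?A" if "x \<in> carrier ?A" "y \<in> carrier ?A" for x y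
  proof -
    have x: "fst x \<in> diffeos S" "smooth_map S (lie_man G) (snd x)"
      and y: "fst y \<in> diffeos S" "smooth_map S (lie_man G) (snd y)"
      using that by (auto simp: aut_group_def smooth_maps_def)
    show ?thesis
      using diffeo_compose[OF S x(1) y(1)]
        smooth_maps_restrict[OF S M smooth_map_lie_mult[OF G S smooth_map_compose[OF S S M diffeosD(1)[OF y(1)] x(2)] y(2)]]
      by (simp add: aut_group_def case_prod_unfold)
  qed
  show "\<one>\<^bsub>?A\<^esub> \<in> carrier ?A"
    using diffeosI[OF S smooth_map_id[OF S] smooth_map_id[OF S]]
      smooth_maps_restrict[OF S M smooth_map_const[OF S M, of "\<one>\<^bsub>G\<^esub>"]] lie_group_points[OF G]
    by (simp add: aut_group_def)
  show "x \<otimes>\<^bsub>?A\<^esub> y \<otimes>\<^bsub>?A\<^esub> z = x \<otimes>\<^bsub>?A\<^esub> (y \<otimes>\<^bsub>?A\<^esub> z)"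
    if "x \<in> carrier ?A" "y \<in> carrier ?A" "z \<in> carrier ?A" for x y z
  proof -
    have *: "fst w \<in> diffeos S" "snd w \<in> smooth_maps S (lie_man G)" if "w \<in> carrier ?A" for w
      using that by (auto simp: aut_group_def)
    show ?thesis
      using diffeosD(5)[OF *(1)[OF that(2)]] diffeosD(5)[OF *(1)[OF that(3)]]
        smooth_maps_carrier[OF *(2)[OF that(1)]] smooth_maps_carrier[OF *(2)[OF that(2)]] smooth_maps_carrier[OF *(2)[OF that(3)]]
      by (auto simp: aut_group_def case_prod_unfold g.m_assoc restrict_def fun_eq_iff)
  qed
  show "\<one>\<^bsub>?A\<^esub> \<otimes>\<^bsub>?A\<^esub> x = x" if "x \<in> carrier ?A" for x
  proof -
    have *: "fst x \<in> diffeos S" "snd x \<in> smooth_maps S (lie_man G)" using that by (auto simp: aut_group_def)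
    show ?thesis
      using diffeosD(4,5)[OF *(1)] smooth_maps_carrier[OF *(2)] *(2)
      by (auto simp: aut_group_def case_prod_unfold smooth_maps_def extensional_def fun_eq_iff restrict_def intro!: prod_eqI)
  qed
  show "\<exists>y\<in>carrier ?A. y \<otimes>\<^bsub>?A\<^esub> x = \<one>\<^bsub>?A\<^esub>" if "x \<in> carrier ?A" for x
    using inv_aut_carrier[OF that] inv_aut_left[OF that] by blast
qed

lemma inv_aut_group:
  assumes "h \<in> carrier (aut_group S G)"
  shows "inv\<^bsub>aut_group S G\<^esub> h = inv_aut h"
  using group.inv_equality[OF group_aut_group inv_aut_left[OF assms] assms inv_aut_carrier[OF assms]] .

end

section \<open>Forms of top degree, the measure of a volume form and Jacobians\<close>

section \<open>Coordinate expressions of differentials and of volume forms\<close>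

text \<open>Near y the map g takes values in a chart image and so coincides with its own projection;
  by uniqueness, so does its derivative.\<close>

lemma chart_derivative_in_span:
  assumes N: "smooth_manifold N" and d: "d \<in> atlas N"
    and der: "(g has_derivative g') (at y)" and ev: "eventually (\<lambda>z. g z \<in> snd d ` fst d) (nhds y)"
  shows "g' b \<in> span (axes N)"
proof -
  note B = axes_subset[OF N d]
  have 1: "((\<lambda>z. axes_proj (axes N) (g z)) has_derivative (\<lambda>b. axes_proj (axes N) (g' b))) (at y)"
    by (rule has_derivative_compose[OF der linear_imp_has_derivative[OF axes_proj_simps(3)[OF B]]])
  obtain T where T: "open T" "y \<in> T" "\<And>z. z \<in> T \<Longrightarrow> g z \<in> snd d ` fst d"
    using ev unfolding eventually_nhds by blast
  have 2: "((\<lambda>z. axes_proj (axes N) (g z)) has_derivative g') (at y)"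
    by (rule has_derivative_transform_within_open[OF der T(1,2)])
      (use T(3) chart_proj[OF N d] in fastforce)
  have "g' b = axes_proj (axes N) (g' b)" using has_derivative_unique[OF 1 2] by metis
  then show ?thesis using axes_proj_simps(5)[OF B] by metis
qed

context
  fixes M :: "('a, 'e::euclidean_space) manifold_struct" and N :: "('b, 'f::euclidean_space) manifold_struct" and F c d x
  assumes M: "smooth_manifold M" and N: "smooth_manifold N" and F: "smooth_map M N F"
    and c: "c \<in> atlas M" "x \<in> fst c" and d: "d \<in> atlas N" "F x \<in> fst d"
begin

lemma transition_smooth: "smooth_at (local_rep (axes M) c (\<lambda>z. snd d (F z))) (snd c x)"
proof -
  have "smooth_fun_at M (\<lambda>z. snd d (F z)) x"
    by (rule smooth_map_compose_fun[OF M N F chart_points[OF M c] smooth_fun_at_chart[OF N d]])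
  then show ?thesis by (simp add: smooth_fun_at_iff[OF M c])
qed

lemma transition_eventually: "eventually (\<lambda>y. F (param M c y) \<in> fst d) (nhds (snd c x))"
proof -
  have "eventually (\<lambda>z. F z \<in> fst d) (nhdsin (man_top M) x)"
    by (rule eventually_nhdsin_continuous_map[OF smooth_map_continuous[OF F] chart_points[OF M c] eventually_in_chart[OF N d]])
  then show ?thesis
    using eventually_param[OF M c(1), of "\<lambda>z. F z \<in> fst d" "snd c x"] chart_in_dom[OF M c] by (simp add: param_chart[OF M c])
qed

lemma transition_derivative_in_span:
  "frechet_derivative (local_rep (axes M) c (\<lambda>z. snd d (F z))) (at (snd c x)) b \<in> span (axes N)"
  by (rule chart_derivative_in_span[OF N d(1) smooth_at_has_derivative[OF transition_smooth]])
    (rule eventually_mono[OF transition_eventually], simp add: local_rep_def)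

lemma differential_coord_vector:
  "differential N F (coord_vector M c x b) = (\<lambda>f. \<Sum>a\<in>axes N.
     (frechet_derivative (local_rep (axes M) c (\<lambda>z. snd d (F z))) (at (snd c x)) b \<bullet> a) * coord_vector N d (F x) a f)"
proof
  fix f
  let ?t = "local_rep (axes M) c (\<lambda>z. snd d (F z))"
  let ?w = "frechet_derivative ?t (at (snd c x)) b"
  note B = axes_subset[OF N d(1)]
  show "differential N F (coord_vector M c x b) f = (\<Sum>a\<in>axes N. (?w \<bullet> a) * coord_vector N d (F x) a f)"
  proof (cases "f \<in> smooth_funs N")
    case False
    then show ?thesis by (simp add: differential_def coord_vector_def)
  next
    case True
    let ?L = "local_rep (axes N) d f"
    have tx: "?t (snd c x) = snd d (F x)" by (simp add: local_rep_chart[OF M c])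
    have Lsm: "smooth_at ?L (?t (snd c x))"
      using smooth_funs_at[OF N True chart_points[OF N d]] by (simp add: tx smooth_fun_at_iff[OF N d])
    obtain T where T: "open T" "snd c x \<in> T" "\<And>y. y \<in> T \<Longrightarrow> F (param M c y) \<in> fst d"
      using transition_eventually unfolding eventually_nhds by blast
    have "((\<lambda>y. ?L (?t y)) has_derivative (\<lambda>b. frechet_derivative ?L (at (?t (snd c x))) (frechet_derivative ?t (at (snd c x)) b))) (at (snd c x))"
      by (rule has_derivative_compose[OF smooth_at_has_derivative[OF transition_smooth] smooth_at_has_derivative[OF Lsm]])
    then have "(local_rep (axes M) c (\<lambda>z. f (F z)) has_derivative
        (\<lambda>b. frechet_derivative ?L (at (?t (snd c x))) (frechet_derivative ?t (at (snd c x)) b))) (at (snd c x))"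
      by (rule has_derivative_transform_within_open[OF _ T(1,2)]) (simp add: local_rep_def param_chart[OF N d(1)] T(3))
    from fun_cong[OF frechet_derivative_at[OF this], of b]
    have "differential N F (coord_vector M c x b) f = frechet_derivative ?L (at (snd d (F x))) ?w"
      using True smooth_funs_compose[OF M N F True] by (simp add: differential_def coord_vector_smooth[OF M] tx)
    also have "\<dots> = frechet_derivative ?L (at (snd d (F x))) (\<Sum>a\<in>axes N. (?w \<bullet> a) *\<^sub>R a)"
      using axes_proj_simps(6)[OF B transition_derivative_in_span] by (simp add: axes_proj_def)
    also have "\<dots> = (\<Sum>a\<in>axes N. (?w \<bullet> a) * frechet_derivative ?L (at (snd d (F x))) a)"
      using has_derivative_linear[OF smooth_at_has_derivative[OF Lsm]] by (simp add: tx linear_sum linear_scale)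
    finally show ?thesis by (simp add: coord_vector_smooth[OF N True])
  qed
qed

end

text \<open>The pointwise algebraic conditions of \<open>volume_form\<close> without non-vanishing.
  They hold for the pullback under any smooth self-map, whose non-vanishing is a separate
  question.\<close>

definition top_form :: "('a, 'e::euclidean_space) manifold_struct \<Rightarrow> 'a \<Rightarrow> (('e \<Rightarrow> 'a tangent) \<Rightarrow> real) \<Rightarrow> bool" where
  "top_form S x \<omega> \<longleftrightarrow>
    (\<forall>v\<in>tangent_tuples S x. \<forall>w\<in>tangent_tuples S x. (\<forall>b\<in>axes S. v b = w b) \<longrightarrow> \<omega> v = \<omega> w) \<and>
    (\<forall>v\<in>tangent_tuples S x. \<forall>b\<in>axes S. \<forall>u\<in>tangent_space S x. \<forall>w\<in>tangent_space S x. \<forall>s t.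
       \<omega> (v(b := (\<lambda>f. s * u f + t * w f))) = s * \<omega> (v(b := u)) + t * \<omega> (v(b := w))) \<and>
    (\<forall>v\<in>tangent_tuples S x. \<forall>b\<in>axes S. \<forall>b'\<in>axes S. b \<noteq> b' \<and> v b = v b' \<longrightarrow> \<omega> v = 0)"

lemma top_form_volume:
  assumes "volume_form S \<mu>" "x \<in> points S" shows "top_form S x (\<mu> x)"
  using assms unfolding volume_form_def top_form_def by blast

text \<open>Expressed through coefficient vectors, \<omega> is an \<open>alternating_form\<close> on
  the axes, and \<open>W_det\<close> identifies it up to its value on the coordinate frame.\<close>

lemma top_form_det:
  fixes S :: "('a, 'e::euclidean_space) manifold_struct"
  assumes S: "smooth_manifold S" and c: "c \<in> atlas S" "x \<in> fst c" and \<omega>: "top_form S x \<omega>"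
  shows "\<omega> (\<lambda>b f. \<Sum>e\<in>axes S. (a b \<bullet> e) * coord_vector S c x e f) = det_axes (axes S) a * \<omega> (coord_vector S c x)"
proof -
  note B = axes_subset[OF S c(1)]
  have fin: "finite (axes S)" using B finite_subset[OF _ finite_Basis] by blast
  \<comment> \<open>T takes a coefficient vector to a tangent vector and ignores the components off
    the axes, which is the assumption \<open>proj\<close> of the locale.\<close>
  define T where "T = (\<lambda>u::'e. \<lambda>f. \<Sum>e\<in>axes S. (u \<bullet> e) * coord_vector S c x e f)"
  have T: "T u \<in> tangent_space S x" for u
    unfolding T_def by (rule tangent_space_sum[OF S coord_vector_tangent[OF S c] fin])
  then have TT: "(\<lambda>b. T (a b)) \<in> tangent_tuples S x" for a by (simp add: tangent_tuples_def)
  have upd: "(\<lambda>b'. T ((a(b := u)) b')) = (\<lambda>b'. T (a b'))(b := T u)" for a b u by auto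
  have lin: "T (s *\<^sub>R u + t *\<^sub>R w) = (\<lambda>f. s * T u f + t * T w f)" for s t u w
    by (simp add: T_def inner_add_left distrib_right sum.distrib sum_distrib_left mult.assoc)
  interpret alternating_form "axes S" "\<lambda>a. \<omega> (\<lambda>b. T (a b))"
  proof
    show "\<omega> (\<lambda>b'. T ((a(b := s *\<^sub>R u + t *\<^sub>R w)) b')) = s * \<omega> (\<lambda>b'. T ((a(b := u)) b')) + t * \<omega> (\<lambda>b'. T ((a(b := w)) b'))"
      if "b \<in> axes S" for a b u w s t
    proof -
      have "\<omega> ((\<lambda>b'. T (a b'))(b := (\<lambda>f. s * T u f + t * T w f))) =
          s * \<omega> ((\<lambda>b'. T (a b'))(b := T u)) + t * \<omega> ((\<lambda>b'. T (a b'))(b := T w))"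
        using \<omega> TT[of a] that T[of u] T[of w] unfolding top_form_def by meson
      then show ?thesis by (simp only: upd lin)
    qed
    show "\<omega> (\<lambda>b. T (a b)) = 0" if "b \<in> axes S" "b' \<in> axes S" "b \<noteq> b'" "a b = a b'" for a b b'
    proof -
      have "T (a b) = T (a b')" using that(4) by simp
      then show ?thesis
        using \<omega>[unfolded top_form_def, THEN conjunct2, THEN conjunct2, rule_format, OF TT[of a] that(1,2)] that(3) by blast
    qed
    show "\<omega> (\<lambda>b. T (a b)) = \<omega> (\<lambda>b. T (a' b))"
      if "\<And>b. b \<in> axes S \<Longrightarrow> axes_proj (axes S) (a b) = axes_proj (axes S) (a' b)" for a a'
    proof -
      have "a b \<bullet> e = a' b \<bullet> e" if "b \<in> axes S" "e \<in> axes S" for b e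
        using \<open>\<And>b. b \<in> axes S \<Longrightarrow> axes_proj (axes S) (a b) = axes_proj (axes S) (a' b)\<close>[OF that(1)]
          axes_proj_simps(1)[OF B that(2)] by metis
      then have "\<forall>b\<in>axes S. T (a b) = T (a' b)" unfolding T_def by simp
      then show ?thesis
        using \<omega>[unfolded top_form_def, THEN conjunct1, rule_format, OF TT[of a] TT[of a']] by blast
    qed
  qed (rule B)
  have "T b = coord_vector S c x b" if "b \<in> axes S" for b
  proof
    fix f
    have "T b f = (\<Sum>e\<in>axes S. if e = b then coord_vector S c x e f else 0)"
      unfolding T_def using B that by (intro sum.cong) (auto simp: inner_Basis subset_eq)
    then show "T b f = coord_vector S c x b f" using fin that by simp
  qed
  moreover have "coord_vector S c x \<in> tangent_tuples S x" by (simp add: tangent_tuples_def coord_vector_tangent[OF S c])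
  ultimately have "\<omega> (\<lambda>b. T b) = \<omega> (coord_vector S c x)"
    using \<omega>[unfolded top_form_def, THEN conjunct1, rule_format, OF TT[of "\<lambda>b. b"]] by blast
  then show ?thesis using W_det[of a] by (simp add: T_def)
qed

text \<open>Every tuple is a matrix combination of the coordinate vectors, so a form that vanishes
  on the coordinate frame vanishes on all tuples.\<close>

lemma top_form_nonzero:
  assumes S: "smooth_manifold S" and c: "c \<in> atlas S" "x \<in> fst c" and \<omega>: "top_form S x \<omega>"
    and v: "v \<in> tangent_tuples S x" "\<omega> v \<noteq> 0"
  shows "\<omega> (coord_vector S c x) \<noteq> 0"
proof -
  note B = axes_subset[OF S c(1)]
  have fin: "finite (axes S)" using B finite_subset[OF _ finite_Basis] by blast
  have "\<exists>a. v b = (\<lambda>f. \<Sum>e\<in>axes S. a e * coord_vector S c x e f)" if "b \<in> axes S" for b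
  proof -
    have "v b \<in> tangent_space S x" using v(1) that by (simp add: tangent_tuples_def)
    then obtain a where "v b = (\<lambda>f. \<Sum>e\<in>axes S. a e * coord_vector S c x e f)" by (rule tangent_coefficients[OF S c])
    then show ?thesis by blast
  qed
  then obtain a where a: "\<And>b. b \<in> axes S \<Longrightarrow> v b = (\<lambda>f. \<Sum>e\<in>axes S. a b e * coord_vector S c x e f)" by metis
  define u where "u b = (\<Sum>e\<in>axes S. a b e *\<^sub>R e)" for b
  have u: "u b \<bullet> e = a b e" if "e \<in> axes S" for b e
    unfolding u_def inner_sum_left inner_scaleR_left using that fin B
    by (subst sum.remove[of _ e]) (auto simp: inner_Basis subset_eq intro!: sum.neutral)
  have "\<omega> v = \<omega> (\<lambda>b f. \<Sum>e\<in>axes S. (u b \<bullet> e) * coord_vector S c x e f)"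
  proof -
    have "(\<lambda>b f. \<Sum>e\<in>axes S. (u b \<bullet> e) * coord_vector S c x e f) \<in> tangent_tuples S x"
      by (simp add: tangent_tuples_def tangent_space_sum[OF S coord_vector_tangent[OF S c] fin])
    moreover have "\<forall>b\<in>axes S. v b = (\<lambda>f. \<Sum>e\<in>axes S. (u b \<bullet> e) * coord_vector S c x e f)" using a u by simp
    ultimately show ?thesis
      using \<omega>[unfolded top_form_def, THEN conjunct1, rule_format, OF v(1)] by blast
  qed
  also have "\<dots> = det_axes (axes S) u * \<omega> (coord_vector S c x)" by (rule top_form_det[OF S c \<omega>])
  finally show ?thesis using v(2) by auto
qed

section \<open>The volume measure\<close>

abbreviation borel_of_man :: "('a, 'e::euclidean_space) manifold_struct \<Rightarrow> 'a measure" where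
  "borel_of_man S \<equiv> sigma (points S) {U. openin (man_top S) U}"

lemma sets_borel_of_man: "sets (borel_of_man S) = sigma_sets (points S) {U. openin (man_top S) U}"
  and space_borel_of_man: "space (borel_of_man S) = points S"
  using openin_subset by (auto simp: subset_eq Pow_def intro!: sets_measure_of space_measure_of)

lemma open_in_borel_of_man: "openin (man_top S) U \<Longrightarrow> U \<in> sets (borel_of_man S)"
  unfolding sets_borel_of_man by (rule sigma_sets.Basic) simp

lemma measurable_continuous_map:
  assumes f: "continuous_map (man_top S) euclidean f"
  shows "f \<in> borel_measurable (borel_of_man S)"
proof (rule borel_measurableI)
  fix U :: "'b set" assume "open U"
  then have "openin (man_top S) {x \<in> points S. f x \<in> U}"
    using openin_continuous_map_preimage[OF f] by simp
  moreover have "f -` U \<inter> space (borel_of_man S) = {x \<in> points S. f x \<in> U}" by (auto simp: space_borel_of_man)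
  ultimately show "f -` U \<inter> space (borel_of_man S) \<in> sets (borel_of_man S)" using open_in_borel_of_man by simp
qed

lemma measurable_smooth:
  "smooth_manifold S \<Longrightarrow> f \<in> smooth_funs S \<Longrightarrow> f \<in> borel_measurable (borel_of_man S)"
  using smooth_imp_continuous_map[of S f] by (intro measurable_continuous_map) (simp add: smooth_funs_iff)

lemma measurable_continuous_map_man:
  assumes f: "continuous_map (man_top S) (man_top N) f"
  shows "f \<in> measurable (borel_of_man S) (borel_of_man N)"
proof (rule measurable_measure_of)
  show "f \<in> space (borel_of_man S) \<rightarrow> points N"
    using f by (auto simp: space_borel_of_man continuous_map_def)
  fix U assume "U \<in> {U. openin (man_top N) U}"
  then have "openin (man_top S) {x \<in> points S. f x \<in> U}" using openin_continuous_map_preimage[OF f] by simp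
  moreover have "f -` U \<inter> space (borel_of_man S) = {x \<in> points S. f x \<in> U}" by (auto simp: space_borel_of_man)
  ultimately show "f -` U \<inter> space (borel_of_man S) \<in> sets (borel_of_man S)" using open_in_borel_of_man by simp
qed (use openin_subset in auto)

text \<open>A finite subcover by sets with property P, made disjoint by removing the earlier sets.
  It reduces statements about measures on a compact manifold to arbitrarily small pieces.\<close>

lemma finite_borel_partition:
  assumes cpt: "compact_space (man_top S)" and P: "\<And>x. x \<in> points S \<Longrightarrow> \<exists>U. openin (man_top S) U \<and> x \<in> U \<and> P U"
  obtains n U D where "\<And>i::nat. i < n \<Longrightarrow> openin (man_top S) (U i) \<and> P (U i)"
    "\<And>i. i < n \<Longrightarrow> D i \<subseteq> U i" "\<And>i. i < n \<Longrightarrow> D i \<in> sets (borel_of_man S)"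
    "disjoint_family_on D {..<n}" "(\<Union>i<n. D i) = points S"
proof -
  let ?C = "{U. openin (man_top S) U \<and> P U}"
  have "points S \<subseteq> \<Union>?C" using P by blast
  then obtain F where F: "finite F" "F \<subseteq> ?C" "points S \<subseteq> \<Union>F"
    using cpt unfolding compact_space_alt by (metis (mono_tags, lifting) mem_Collect_eq)
  obtain U :: "nat \<Rightarrow> _" and n where U: "F = U ` {i. i < n}" using finite_imp_nat_seg_image_inj_on[OF F(1)] by metis
  have UF: "openin (man_top S) (U i) \<and> P (U i)" if "i < n" for i using U F(2) that by blast
  define D where "D i = U i - (\<Union>j<i. U j)" for i
  show ?thesis
  proof (rule that[of n U D])
    show "D i \<in> sets (borel_of_man S)" if "i < n" for i
      unfolding D_def using UF that by (intro sets.Diff sets.finite_UN open_in_borel_of_man) auto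
    show "disjoint_family_on D {..<n}"
      unfolding disjoint_family_on_def D_def by (auto) (metis UN_I lessThan_iff nat_neq_iff)
    have "x \<in> (\<Union>i<n. D i)" if "x \<in> points S" for x
    proof -
      have ex: "\<exists>i. i < n \<and> x \<in> U i" using F(3) U that by auto
      define i where "i = (LEAST i. i < n \<and> x \<in> U i)"
      have i: "i < n" "x \<in> U i" using LeastI_ex[OF ex] by (auto simp: i_def)
      have "x \<notin> U j" if "j < i" for j
        using not_less_Least[of j "\<lambda>i. i < n \<and> x \<in> U i"] that i(1) by (auto simp: i_def)
      then show ?thesis using i by (auto simp: D_def)
    qed
    moreover have "D i \<subseteq> points S" if "i < n" for i using UF[OF that] openin_subset by (auto simp: D_def)
    ultimately show "(\<Union>i<n. D i) = points S" by blast
  qed (use UF in \<open>auto simp: D_def\<close>)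
qed

lemma measure_eq_local:
  assumes cpt: "compact_space (man_top S)" and s1: "sets m1 = sets (borel_of_man S)" and s2: "sets m2 = sets (borel_of_man S)"
    and P: "\<And>x. x \<in> points S \<Longrightarrow> \<exists>U. openin (man_top S) U \<and> x \<in> U \<and>
      (\<forall>A\<in>sets (borel_of_man S). A \<subseteq> U \<longrightarrow> emeasure m1 A = emeasure m2 A)"
  shows "m1 = m2"
proof (rule measure_eqI)
  show "sets m1 = sets m2" using s1 s2 by simp
  fix A assume "A \<in> sets m1"
  then have A: "A \<in> sets (borel_of_man S)" using s1 by simp
  obtain n U D where U: "\<And>i::nat. i < n \<Longrightarrow> openin (man_top S) (U i) \<and>
      (\<forall>A\<in>sets (borel_of_man S). A \<subseteq> U i \<longrightarrow> emeasure m1 A = emeasure m2 A)"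
    and D: "\<And>i. i < n \<Longrightarrow> D i \<subseteq> U i" "\<And>i. i < n \<Longrightarrow> D i \<in> sets (borel_of_man S)"
    "disjoint_family_on D {..<n}" "(\<Union>i<n. D i) = points S"
    using finite_borel_partition[OF cpt P] by metis
  have "A \<subseteq> points S" using sets.sets_into_space[OF A] by (simp add: space_borel_of_man)
  then have eqA: "A = (\<Union>i<n. A \<inter> D i)" using D(4) by blast
  have dis: "disjoint_family_on (\<lambda>i. A \<inter> D i) {..<n}" using D(3) by (auto simp: disjoint_family_on_def)
  have "emeasure m A = (\<Sum>i<n. emeasure m (A \<inter> D i))" if "sets m = sets (borel_of_man S)" for m
    by (subst eqA, rule sum_emeasure[symmetric]) (use A D(2) dis that in auto)
  moreover have "emeasure m1 (A \<inter> D i) = emeasure m2 (A \<inter> D i)" if "i < n" for i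
  proof -
    have "A \<inter> D i \<in> sets (borel_of_man S)" "A \<inter> D i \<subseteq> U i" using A D that by auto
    then show ?thesis using U[OF that] by blast
  qed
  ultimately show "emeasure m1 A = emeasure m2 A" using s1 s2 by simp
qed

text \<open>The gluing device for the volume measure: the summands will be chart measures restricted
  to the pieces of a partition.\<close>

lemma finite_measure_sum_exists:
  assumes s: "\<And>i. i \<in> I \<Longrightarrow> sets (N i) = sets X"
  obtains m where "sets m = sets X" "\<And>A. A \<in> sets X \<Longrightarrow> emeasure m A = (\<Sum>i\<in>I. emeasure (N i) A)"
proof
  let ?m = "measure_of (space X) (sets X) (\<lambda>A. \<Sum>i\<in>I. emeasure (N i) A)"
  show sm: "sets ?m = sets X" by (simp add: sets.space_closed)
  show "emeasure ?m A = (\<Sum>i\<in>I. emeasure (N i) A)" if "A \<in> sets X" for A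
  proof (rule emeasure_measure_of[OF refl sets.space_closed])
    show "countably_additive (sets ?m) (\<lambda>A. \<Sum>i\<in>I. emeasure (N i) A)"
    proof (rule countably_additiveI)
      fix A :: "nat \<Rightarrow> 'b set" assume A: "range A \<subseteq> sets ?m" "disjoint_family A" "(\<Union>i. A i) \<in> sets ?m"
      have "(\<Sum>n. \<Sum>i\<in>I. emeasure (N i) (A n)) = (\<Sum>i\<in>I. \<Sum>n. emeasure (N i) (A n))"
        by (rule suminf_sum) (simp add: summableI)
      also have "\<dots> = (\<Sum>i\<in>I. emeasure (N i) (\<Union>n. A n))"
        by (rule sum.cong[OF refl], rule suminf_emeasure) (use A s sm in auto)
      finally show "(\<Sum>n. \<Sum>i\<in>I. emeasure (N i) (A n)) = (\<Sum>i\<in>I. emeasure (N i) (\<Union>n. A n))" .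
    qed
  qed (use that sm in \<open>auto simp: positive_def\<close>)
qed

definition chart_density :: "('a, 'e::euclidean_space) manifold_struct \<Rightarrow> ('a \<Rightarrow> ('e \<Rightarrow> 'a tangent) \<Rightarrow> real)
    \<Rightarrow> 'a set \<times> ('a \<Rightarrow> 'e) \<Rightarrow> 'e \<Rightarrow> real" where
  "chart_density S \<mu> c y = \<bar>\<mu> (param S c y) (coord_vector S c (param S c y))\<bar>"

text \<open>The measure required on a chart domain, pushed forward to the whole manifold, so that
  the measures of different charts share one \<sigma>-algebra.\<close>

definition chart_measure :: "('a, 'e::euclidean_space) manifold_struct \<Rightarrow> ('a \<Rightarrow> ('e \<Rightarrow> 'a tangent) \<Rightarrow> real)
    \<Rightarrow> 'a set \<times> ('a \<Rightarrow> 'e) \<Rightarrow> 'a measure" where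
  "chart_measure S \<mu> c = distr
    (density (restrict_space (axes_lborel (axes S)) (snd c ` fst c)) (\<lambda>y. ennreal (chart_density S \<mu> c y)))
    (borel_of_man S) (param S c)"

lemma sets_axes_lborel [simp, measurable_cong]: "sets (axes_lborel B) = sets borel"
  and space_axes_lborel [simp]: "space (axes_lborel B) = UNIV"
  by (simp_all add: axes_lborel_def)

lemma chart_image_eq:
  assumes S: "smooth_manifold S" and c: "c \<in> atlas S"
  shows "snd c ` (fst c \<inter> A) = span (axes S) \<inter> {y. axes_proj (axes S) y \<in> snd c ` (fst c \<inter> A)}"
  using chart_span[OF S c] chart_proj[OF S c] axes_proj_simps(6)[OF axes_subset[OF S c]] by fastforce

text \<open>Charts are injective, so images commute with complements and the statement passes
  through the generation of the \<sigma>-algebra. Open sets have relatively open images in a closed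
  subspace.\<close>

lemma chart_image_borel:
  assumes S: "smooth_manifold S" and c: "c \<in> atlas S" and A: "A \<in> sets (borel_of_man S)"
  shows "snd c ` (fst c \<inter> A) \<in> sets borel"
  using A unfolding sets_borel_of_man
proof induction
  case (Basic U)
  then have "open {y. axes_proj (axes S) y \<in> snd c ` (fst c \<inter> U)}" using open_chart_preimage[OF S c] by simp
  moreover have "closed (span (axes S))" by (rule closed_subspace[OF subspace_span])
  ultimately show ?case by (subst chart_image_eq[OF S c]) (intro sets.Int borel_closed borel_open)
next
  case (Compl A)
  have "snd c ` fst c \<in> sets borel"
  proof -
    have "open {y. axes_proj (axes S) y \<in> snd c ` (fst c \<inter> points S)}" using open_chart_preimage[OF S c] by simp
    moreover have "closed (span (axes S))" by (rule closed_subspace[OF subspace_span])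
    ultimately have "span (axes S) \<inter> {y. axes_proj (axes S) y \<in> snd c ` (fst c \<inter> points S)} \<in> sets borel"
      by (intro sets.Int borel_closed borel_open)
    then have "snd c ` (fst c \<inter> points S) \<in> sets borel" by (simp only: chart_image_eq[OF S c, symmetric])
    moreover have "fst c \<inter> points S = fst c" using chart_points[OF S c] by auto
    ultimately show ?thesis by simp
  qed
  moreover have "snd c ` (fst c \<inter> (points S - A)) = snd c ` fst c - snd c ` (fst c \<inter> A)"
    using chart_inj[OF S c] chart_points[OF S c] by (auto simp: inj_on_def)
  ultimately show ?case using Compl by simp
next
  case (Union A)
  have "snd c ` (fst c \<inter> (\<Union>i. A i)) = (\<Union>i. snd c ` (fst c \<inter> A i))" by blast
  then show ?case using Union by simp
qed simp

context
  fixes S :: "('a, 'e::euclidean_space) manifold_struct" and \<mu>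
  assumes S: "smooth_manifold S" and cpt: "compact_space (man_top S)" and \<mu>: "volume_form S \<mu>"
begin

lemma smooth_volume_coefficient:
  assumes c: "c \<in> atlas S" "x \<in> fst c"
  shows "smooth_fun_at S (\<lambda>x. \<mu> x (coord_vector S c x)) x"
proof -
  have "smooth_fun_on S (fst c) (\<lambda>x. \<mu> x (coord_vector S c x))"
    using \<mu> c by (simp add: volume_form_def)
  then show ?thesis using c by (simp add: smooth_fun_on_iff[OF S chart_open[OF S c(1)]])
qed

lemma volume_coefficient_nonzero:
  assumes c: "c \<in> atlas S" "x \<in> fst c"
  shows "\<mu> x (coord_vector S c x) \<noteq> 0"
proof -
  have x: "x \<in> points S" by (rule chart_points[OF S c])
  then obtain v where "v \<in> tangent_tuples S x" "\<mu> x v \<noteq> 0" using \<mu> unfolding volume_form_def by meson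
  then show ?thesis by (rule top_form_nonzero[OF S c top_form_volume[OF \<mu> x]])
qed

lemma chart_image_borel_full:
  assumes c: "c \<in> atlas S" shows "snd c ` fst c \<in> sets borel"
proof -
  have "fst c \<inter> points S = fst c" using chart_points[OF S c] by auto
  then show ?thesis using chart_image_borel[OF S c open_in_borel_of_man[OF openin_topspace]] by simp
qed

lemma chart_density_continuous:
  assumes c: "c \<in> atlas S"
  shows "continuous_on (chart_dom S c) (chart_density S \<mu> c)"
proof (rule continuous_at_imp_continuous_on, rule ballI)
  fix y assume y: "y \<in> chart_dom S c"
  have "smooth_at (local_rep (axes S) c (\<lambda>x. \<mu> x (coord_vector S c x))) (snd c (param S c y))"
    using smooth_volume_coefficient[OF c param_in[OF S c y]] by (simp add: smooth_fun_at_iff[OF S c param_in[OF S c y]])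
  then have "smooth_at (local_rep (axes S) c (\<lambda>x. \<mu> x (coord_vector S c x))) y"
    unfolding chart_param[OF S c y] by (rule smooth_at_local_rep_proj[OF S c])
  then have "isCont (\<lambda>y. \<bar>local_rep (axes S) c (\<lambda>x. \<mu> x (coord_vector S c x)) y\<bar>) y"
    using smooth_at_isCont by (intro continuous_rabs) auto
  then show "isCont (chart_density S \<mu> c) y" unfolding chart_density_def[abs_def] local_rep_def .
qed

lemma chart_image_dom: "c \<in> atlas S \<Longrightarrow> snd c ` fst c \<subseteq> chart_dom S c"
  by (rule image_subsetI) (rule chart_in_dom[OF S])

lemma chart_density_measurable:
  assumes c: "c \<in> atlas S" and A: "A \<in> sets (borel_of_man S)"
  shows "(\<lambda>y. indicator (snd c ` (fst c \<inter> A)) y * chart_density S \<mu> c y) \<in> borel_measurable borel"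
  using borel_measurable_continuous_on_indicator[OF chart_image_borel[OF S c A]
      continuous_on_subset[OF chart_density_continuous[OF c]]] chart_image_dom[OF c] by fastforce

lemma param_measurable:
  assumes c: "c \<in> atlas S"
  shows "param S c \<in> measurable (restrict_space borel (snd c ` fst c)) (borel_of_man S)"
proof (rule measurable_measure_of)
  have dom: "y \<in> chart_dom S c" if "y \<in> snd c ` fst c" for y using that chart_image_dom[OF c] by auto
  show "param S c \<in> space (restrict_space borel (snd c ` fst c)) \<rightarrow> points S"
    using param_in[OF S c dom] chart_points[OF S c] by (auto simp: space_restrict_space)
  fix U assume "U \<in> {U. openin (man_top S) U}"
  then have U: "snd c ` (fst c \<inter> U) \<in> sets borel" using chart_image_borel[OF S c open_in_borel_of_man] by simp
  have "param S c -` U \<inter> space (restrict_space borel (snd c ` fst c)) = snd c ` (fst c \<inter> U)"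
    using param_chart[OF S c] by (auto simp: space_restrict_space)
  also have "\<dots> = snd c ` fst c \<inter> snd c ` (fst c \<inter> U)" by auto
  finally show "param S c -` U \<inter> space (restrict_space borel (snd c ` fst c)) \<in> sets (restrict_space borel (snd c ` fst c))"
    using U by (auto simp: sets_restrict_space)
qed (use openin_subset in auto)

lemma sets_chart_measure: "sets (chart_measure S \<mu> c) = sets (borel_of_man S)"
  by (simp add: chart_measure_def)

lemma nn_integral_chart_measure:
  assumes c: "c \<in> atlas S" and f: "f \<in> borel_measurable (borel_of_man S)"
  shows "(\<integral>\<^sup>+ x. f x \<partial>chart_measure S \<mu> c) =
    (\<integral>\<^sup>+ y. ennreal (chart_density S \<mu> c y) * f (param S c y) * indicator (snd c ` fst c) y \<partial>axes_lborel (axes S))"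
proof -
  let ?R = "restrict_space (axes_lborel (axes S)) (snd c ` fst c)"
  have sR: "sets ?R = sets (restrict_space borel (snd c ` fst c))" by (rule sets_restrict_space_cong) simp
  have pm: "param S c \<in> measurable ?R (borel_of_man S)"
    using param_measurable[OF c] by (simp cong: measurable_cong_sets add: measurable_cong_sets[OF sR])
  have dm: "(\<lambda>y. ennreal (chart_density S \<mu> c y)) \<in> borel_measurable ?R"
  proof -
    have "chart_density S \<mu> c \<in> borel_measurable (restrict_space borel (snd c ` fst c))"
      by (rule borel_measurable_continuous_on_restrict[OF continuous_on_subset[OF chart_density_continuous[OF c] chart_image_dom[OF c]]])
    then show ?thesis by (simp add: measurable_cong_sets[OF sR])
  qed
  have fm: "(\<lambda>y. f (param S c y)) \<in> borel_measurable ?R" using measurable_compose[OF pm f] .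
  have "(\<integral>\<^sup>+ x. f x \<partial>chart_measure S \<mu> c) =
      (\<integral>\<^sup>+ y. f (param S c y) \<partial>density ?R (\<lambda>y. ennreal (chart_density S \<mu> c y)))"
    unfolding chart_measure_def by (rule nn_integral_distr) (use pm f in auto)
  also have "\<dots> = (\<integral>\<^sup>+ y. ennreal (chart_density S \<mu> c y) * f (param S c y) \<partial>?R)"
    by (rule nn_integral_density[OF dm fm])
  also have "\<dots> = (\<integral>\<^sup>+ y. ennreal (chart_density S \<mu> c y) * f (param S c y) * indicator (snd c ` fst c) y \<partial>axes_lborel (axes S))"
    by (rule nn_integral_restrict_space) (use chart_image_borel_full[OF c] in simp)
  finally show ?thesis .
qed

lemma emeasure_chart_measure:
  assumes c: "c \<in> atlas S" and A: "A \<in> sets (borel_of_man S)" "A \<subseteq> fst c"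
  shows "emeasure (chart_measure S \<mu> c) A =
    (\<integral>\<^sup>+ y. ennreal (indicator (snd c ` A) y * chart_density S \<mu> c y) \<partial>axes_lborel (axes S))"
proof -
  have "emeasure (chart_measure S \<mu> c) A = (\<integral>\<^sup>+ x. indicator A x \<partial>chart_measure S \<mu> c)"
    using A by (simp add: sets_chart_measure)
  also have "\<dots> = (\<integral>\<^sup>+ y. ennreal (chart_density S \<mu> c y) * indicator A (param S c y) * indicator (snd c ` fst c) y \<partial>axes_lborel (axes S))"
    by (rule nn_integral_chart_measure[OF c]) (use A in simp)
  also have "\<dots> = (\<integral>\<^sup>+ y. ennreal (indicator (snd c ` A) y * chart_density S \<mu> c y) \<partial>axes_lborel (axes S))"
  proof (rule nn_integral_cong)
    fix y
    show "ennreal (chart_density S \<mu> c y) * indicator A (param S c y) * indicator (snd c ` fst c) y =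
        ennreal (indicator (snd c ` A) y * chart_density S \<mu> c y)"
    proof (cases "y \<in> snd c ` fst c")
      case True
      then obtain x where x: "x \<in> fst c" "y = snd c x" by auto
      have "x \<in> A \<longleftrightarrow> y \<in> snd c ` A" using x A(2) inj_on_image_mem_iff[OF chart_inj[OF S c] x(1) A(2)] by simp
      then show ?thesis using x by (simp add: param_chart[OF S c] indicator_def)
    next
      case False
      then have "y \<notin> snd c ` A" using A(2) by auto
      then show ?thesis using False by simp
    qed
  qed
  finally show ?thesis .
qed

text \<open>On the chart image the projection inside \<open>param\<close> is the identity, so the
  integrand in \<open>volume_measure\<close> and the chart density coincide.\<close>

lemma defining_integral_eq:
  assumes c: "c \<in> atlas S" and A: "A \<in> sets (borel_of_man S)" "A \<subseteq> fst c"
  shows "(\<integral>\<^sup>+ y. ennreal \<bar>let x = inv_into (fst c) (snd c) y in \<mu> x (coord_vector S c x)\<bar> * indicator (snd c ` A) y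
      \<partial>axes_lborel (axes S)) = emeasure (chart_measure S \<mu> c) A"
  unfolding emeasure_chart_measure[OF c A]
proof (rule nn_integral_cong)
  fix y
  show "ennreal \<bar>let x = inv_into (fst c) (snd c) y in \<mu> x (coord_vector S c x)\<bar> * indicator (snd c ` A) y =
      ennreal (indicator (snd c ` A) y * chart_density S \<mu> c y)"
  proof (cases "y \<in> snd c ` A")
    case True
    then have "axes_proj (axes S) y = y" using A(2) chart_proj[OF S c] by auto
    then show ?thesis using True by (simp add: chart_density_def Let_def)
  qed simp
qed

text \<open>The condition under the definite description in \<open>volume_measure\<close>, with its
  integral expressed as a chart measure.\<close>

definition is_volume_measure :: "'a measure \<Rightarrow> bool" where
  "is_volume_measure m \<longleftrightarrow> sets m = sets (borel_of_man S) \<and>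
    (\<forall>c\<in>atlas S. \<forall>A\<in>sets (borel_of_man S). A \<subseteq> fst c \<longrightarrow> emeasure m A = emeasure (chart_measure S \<mu> c) A)"

lemma volume_measure_eq: "volume_measure S \<mu> = (THE m. is_volume_measure m)"
proof -
  have "(sets m = sigma_sets (points S) {U. openin (man_top S) U} \<and>
     (\<forall>(U, \<phi>)\<in>atlas S. \<forall>A\<in>sets m. A \<subseteq> U \<longrightarrow> emeasure m A =
          (\<integral>\<^sup>+ y. ennreal \<bar>let x = inv_into U \<phi> y in \<mu> x (coord_vector S (U, \<phi>) x)\<bar> * indicator (\<phi> ` A) y
             \<partial>axes_lborel (axes S)))) \<longleftrightarrow> is_volume_measure m" for m
  proof (cases "sets m = sets (borel_of_man S)")
    case True
    then show ?thesis
      unfolding is_volume_measure_def sets_borel_of_man[symmetric] case_prod_unfold prod.collapse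
      using defining_integral_eq by simp
  qed (simp add: is_volume_measure_def sets_borel_of_man)
  then show ?thesis unfolding volume_measure_def by simp
qed

lemma volume_pullback_coefficient:
  assumes \<psi>: "smooth_map S S \<psi>" and c: "c \<in> atlas S" "x \<in> fst c" and d: "d \<in> atlas S" "\<psi> x \<in> fst d"
  shows "\<mu> (\<psi> x) (\<lambda>b. differential S \<psi> (coord_vector S c x b)) =
    det_axes (axes S) (frechet_derivative (local_rep (axes S) c (\<lambda>z. snd d (\<psi> z))) (at (snd c x))) *
      \<mu> (\<psi> x) (coord_vector S d (\<psi> x))"
  unfolding differential_coord_vector[OF S S \<psi> c d]
  by (rule top_form_det[OF S d top_form_volume[OF \<mu> chart_points[OF S d]]])

lemma diffeo_image_sets:
  assumes \<psi>: "\<psi> \<in> diffeos S" and A: "A \<in> sets (borel_of_man S)"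
  shows "\<psi> ` A \<in> sets (borel_of_man S)"
proof -
  have sub: "A \<subseteq> points S" using sets.sets_into_space[OF A] by (simp add: space_borel_of_man)
  have "inv_into (points S) \<psi> -` A \<inter> space (borel_of_man S) \<in> sets (borel_of_man S)"
    by (rule measurable_sets[OF measurable_continuous_map_man[OF smooth_map_continuous[OF diffeosD(3)[OF \<psi>]]] A])
  also have "inv_into (points S) \<psi> -` A \<inter> space (borel_of_man S) = \<psi> ` A"
  proof (intro equalityI subsetI)
    fix y assume y: "y \<in> inv_into (points S) \<psi> -` A \<inter> space (borel_of_man S)"
    then have "y = \<psi> (inv_into (points S) \<psi> y)" using diffeosD(7)[OF \<psi>] by (simp add: space_borel_of_man)
    then show "y \<in> \<psi> ` A" using y by blast
  next
    fix y assume "y \<in> \<psi> ` A"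
    then show "y \<in> inv_into (points S) \<psi> -` A \<inter> space (borel_of_man S)"
      using sub diffeosD(5,8)[OF \<psi>] by (auto simp: space_borel_of_man)
  qed
  finally show ?thesis .
qed

text \<open>Change of variables for \<psi> read in the charts c and d: the determinant of the
  coordinate map times the coefficient of \<mu> in d is the coefficient of the pulled-back form in
  c. With \<psi> the identity this gives independence of the chart; in general it gives the Jacobian
  formula.\<close>

lemma emeasure_chart_measure_image:
  assumes \<psi>: "\<psi> \<in> diffeos S" and c: "c \<in> atlas S" and d: "d \<in> atlas S"
    and A: "A \<in> sets (borel_of_man S)" "A \<subseteq> fst c" "\<psi> ` A \<subseteq> fst d"
  shows "emeasure (chart_measure S \<mu> d) (\<psi> ` A) =
    (\<integral>\<^sup>+ y. ennreal (indicator (snd c ` A) y *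
      \<bar>\<mu> (\<psi> (param S c y)) (\<lambda>b. differential S \<psi> (coord_vector S c (param S c y) b))\<bar>) \<partial>axes_lborel (axes S))"
proof -
  note \<psi>s = diffeosD(1)[OF \<psi>]
  let ?t = "local_rep (axes S) c (\<lambda>z. snd d (\<psi> z))"
  let ?D = "\<lambda>y. frechet_derivative ?t (at y)"
  have \<psi>A: "\<psi> ` A \<in> sets (borel_of_man S)" by (rule diffeo_image_sets[OF \<psi> A(1)])
  have tx: "?t (snd c x) = snd d (\<psi> x)" if "x \<in> A" for x
    using that A(2) by (simp add: local_rep_chart[OF S c] subset_eq)
  have im: "?t ` (snd c ` A) = snd d ` (\<psi> ` A)" using tx by (auto simp: image_iff)
  have sm: "smooth_at ?t (snd c x)" if "x \<in> A" for x
    using that A by (intro transition_smooth[OF S S \<psi>s c _ d]) auto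
  have Asub: "A \<subseteq> points S" using A(2) chart_points[OF S c] by auto
  have borel: "snd c ` A \<in> sets borel" "snd d ` (\<psi> ` A) \<in> sets borel"
    using chart_image_borel[OF S c A(1)] chart_image_borel[OF S d \<psi>A] A(2,3) by (simp_all add: Int_absorb1)
  have co: "\<bar>det_axes (axes S) (?D (snd c x))\<bar> * chart_density S \<mu> d (?t (snd c x)) =
      \<bar>\<mu> (\<psi> x) (\<lambda>b. differential S \<psi> (coord_vector S c x b))\<bar>" if x: "x \<in> A" for x
  proof -
    have "x \<in> fst c" "\<psi> x \<in> fst d" using x A by auto
    then show ?thesis
      using volume_pullback_coefficient[OF \<psi>s c _ d, of x]
      by (simp add: tx[OF x] chart_density_def param_chart[OF S d] abs_mult)
  qed
  have "(\<integral>\<^sup>+ y. ennreal (indicator (?t ` (snd c ` A)) y * chart_density S \<mu> d y) \<partial>axes_lborel (axes S)) =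
    (\<integral>\<^sup>+ y. ennreal (indicator (snd c ` A) y * (\<bar>det_axes (axes S) (?D y)\<bar> * chart_density S \<mu> d (?t y))) \<partial>axes_lborel (axes S))"
  proof (rule nn_integral_axes_change_of_variables[OF axes_subset[OF S c] borel(1)])
    show "snd c ` A \<subseteq> span (axes S)" using A(2) chart_span[OF S c] by auto
    show "?t ` snd c ` A \<subseteq> span (axes S)" unfolding im using A(3) chart_span[OF S d] by auto
    show "(?t has_derivative ?D y) (at y)" if "y \<in> snd c ` A" for y
      using that sm smooth_at_has_derivative by auto
    show "inj_on ?t (snd c ` A)"
    proof (rule inj_onI)
      fix y z assume "y \<in> snd c ` A" "z \<in> snd c ` A" "?t y = ?t z"
      then obtain a b where ab: "a \<in> A" "b \<in> A" "y = snd c a" "z = snd c b" "snd d (\<psi> a) = snd d (\<psi> b)"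
        using tx by auto
      then have "\<psi> a = \<psi> b" using A(3) chart_inj[OF S d] by (auto simp: inj_on_def)
      then have "a = b" using ab Asub diffeosD(8)[OF \<psi>] by (metis subsetD)
      then show "y = z" using ab by simp
    qed
    show "?D y b \<in> span (axes S)" if y: "y \<in> snd c ` A" for y b
    proof -
      obtain x where x: "x \<in> A" "y = snd c x" using y by auto
      then have "x \<in> fst c" "\<psi> x \<in> fst d" using A by auto
      then show ?thesis unfolding x(2) by (rule transition_derivative_in_span[OF S S \<psi>s c _ d])
    qed
    show "0 \<le> chart_density S \<mu> d y" for y by (simp add: chart_density_def)
    show "(\<lambda>y. indicator (?t ` snd c ` A) y * chart_density S \<mu> d y) \<in> borel_measurable borel"
      unfolding im using chart_density_measurable[OF d \<psi>A] A(3) by (simp add: Int_absorb1)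
    have "continuous_on (snd c ` A) (\<lambda>y. \<bar>det_axes (axes S) (?D y)\<bar> * chart_density S \<mu> d (?t y))"
    proof (rule continuous_at_imp_continuous_on, rule ballI)
      fix y assume y: "y \<in> snd c ` A"
      have "isCont (\<lambda>y. det_axes (axes S) (?D y)) y"
        unfolding det_axes_def
        by (rule smooth_at_isCont) (use y sm in \<open>auto intro!: smooth_intros smooth_at_derivative\<close>)
      moreover have "isCont (\<lambda>y. chart_density S \<mu> d (?t y)) y"
      proof (rule isCont_o2[where f = ?t and g = "chart_density S \<mu> d"])
        show "isCont ?t y" using y sm smooth_at_isCont by auto
        have "?t y \<in> chart_dom S d" using y im A(3) chart_image_dom[OF d] by blast
        then show "isCont (chart_density S \<mu> d) (?t y)"
          using chart_density_continuous[OF d] open_chart_dom[OF S d] continuous_on_eq_continuous_at by blast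
      qed
      ultimately show "isCont (\<lambda>y. \<bar>det_axes (axes S) (?D y)\<bar> * chart_density S \<mu> d (?t y)) y"
        by (intro continuous_intros)
    qed
    from borel_measurable_continuous_on_indicator[OF borel(1) this]
    show "(\<lambda>y. indicator (snd c ` A) y * (\<bar>det_axes (axes S) (?D y)\<bar> * chart_density S \<mu> d (?t y))) \<in> borel_measurable borel"
      by simp
  qed
  also have "\<dots> = (\<integral>\<^sup>+ y. ennreal (indicator (snd c ` A) y *
      \<bar>\<mu> (\<psi> (param S c y)) (\<lambda>b. differential S \<psi> (coord_vector S c (param S c y) b))\<bar>) \<partial>axes_lborel (axes S))"
  proof (rule nn_integral_cong)
    fix y
    show "ennreal (indicator (snd c ` A) y * (\<bar>det_axes (axes S) (?D y)\<bar> * chart_density S \<mu> d (?t y))) =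
      ennreal (indicator (snd c ` A) y *
      \<bar>\<mu> (\<psi> (param S c y)) (\<lambda>b. differential S \<psi> (coord_vector S c (param S c y) b))\<bar>)"
    proof (cases "y \<in> snd c ` A")
      case True
      then obtain x where x: "x \<in> A" "y = snd c x" by auto
      then have "x \<in> fst c" using A by auto
      then show ?thesis using co[OF x(1)] by (simp add: x(2) param_chart[OF S c])
    qed simp
  qed
  finally show ?thesis unfolding im using emeasure_chart_measure[OF d \<psi>A A(3)] by simp
qed

end

lemma det_axes_smooth:
  assumes "\<And>b. b \<in> B \<Longrightarrow> smooth_at (\<lambda>y. a y b) x"
  shows "smooth_at (\<lambda>y. det_axes B (a y)) x"
  unfolding det_axes_def using assms by (intro smooth_intros) auto

lemma smooth_fun_at_abs:
  fixes f :: "'a \<Rightarrow> real"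
  assumes M: "smooth_manifold M" and f: "smooth_fun_at M f x" "f x \<noteq> 0"
  shows "smooth_fun_at M (\<lambda>z. \<bar>f z\<bar>) x"
  by (rule smooth_fun_at_compose[OF M f(1), of abs]) (rule smooth_at_abs[OF smooth_at_id f(2)])

lemma smooth_fun_at_divide:
  fixes f g :: "'a \<Rightarrow> real"
  assumes M: "smooth_manifold M" and f: "smooth_fun_at M f x" and g: "smooth_fun_at M g x" "g x \<noteq> 0"
  shows "smooth_fun_at M (\<lambda>z. f z / g z) x"
  unfolding divide_inverse
  by (rule smooth_fun_at_mult[OF M f], rule smooth_fun_at_compose[OF M g(1), of inverse],
      rule smooth_at_inverse[OF smooth_at_id g(2)])

text \<open>Read in the whole space, the ball together with the unit cube in the remaining axes fits
  into a box. This makes the volume measure locally finite.\<close>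

lemma emeasure_axes_lborel_bounded:
  fixes B :: "'e::euclidean_space set"
  assumes B: "B \<subseteq> Basis"
  shows "emeasure (axes_lborel B) (ball y r) < \<infinity>"
proof -
  note P = axes_proj_simps[OF B]
  define K where "K = {z :: 'e. \<forall>b\<in>Basis - B. z \<bullet> b \<in> {0..1}}"
  define R where "R = {z. axes_proj B z \<in> ball y r} \<inter> K"
  have "emeasure (axes_lborel B) (ball y r) = (\<integral>\<^sup>+ z. indicator (ball y r) z \<partial>axes_lborel B)" by simp
  also have "\<dots> = (\<integral>\<^sup>+ z. indicator R z \<partial>lborel)"
    unfolding nn_integral_axes_lborel[OF B borel_measurable_indicator[of "ball y r" borel, simplified]] K_def[symmetric] R_def
    by (rule nn_integral_cong) (auto simp: indicator_def)
  \<comment> \<open>The bound \<open>norm y + \<bar>r\<bar> + 1\<close> serves both kinds of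
    coordinates: those along B are bounded by the ball, the others by 1.\<close>
  also have "\<dots> \<le> (\<integral>\<^sup>+ z. indicator (cbox (- (\<Sum>b\<in>Basis. (norm y + \<bar>r\<bar> + 1) *\<^sub>R b)) (\<Sum>b\<in>Basis. (norm y + \<bar>r\<bar> + 1) *\<^sub>R b)) (z :: 'e) \<partial>lborel)"
  proof (rule nn_integral_mono)
    fix z :: 'e
    have "z \<in> cbox (- (\<Sum>b\<in>Basis. (norm y + \<bar>r\<bar> + 1) *\<^sub>R b)) (\<Sum>b\<in>Basis. (norm y + \<bar>r\<bar> + 1) *\<^sub>R b)" if z: "z \<in> R"
    proof -
      have "\<bar>z \<bullet> b\<bar> \<le> norm y + \<bar>r\<bar> + 1" if b: "b \<in> Basis" for b
      proof (cases "b \<in> B")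
        case True
        have "\<bar>z \<bullet> b\<bar> = \<bar>axes_proj B z \<bullet> b\<bar>" by (simp add: P(1)[OF True])
        also have "\<dots> \<le> norm (axes_proj B z)" using b by (rule Basis_le_norm)
        also have "\<dots> \<le> norm y + dist y (axes_proj B z)"
          by (metis dist_norm norm_minus_commute norm_triangle_sub)
        finally have "\<bar>z \<bullet> b\<bar> \<le> norm y + dist y (axes_proj B z)" .
        moreover have "dist y (axes_proj B z) < r" using z by (simp add: R_def)
        ultimately show ?thesis using abs_ge_self[of r] by linarith
      next
        case False
        then have "0 \<le> z \<bullet> b" "z \<bullet> b \<le> 1" using z b by (auto simp: R_def K_def)
        then show ?thesis using norm_ge_zero[of y] abs_ge_zero[of r] by linarith
      qed
      then have "- (norm y + \<bar>r\<bar> + 1) \<le> z \<bullet> b \<and> z \<bullet> b \<le> norm y + \<bar>r\<bar> + 1" if "b \<in> Basis" for b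
        using that by (simp only: abs_le_iff) (meson minus_le_iff)
      then show ?thesis by (simp add: mem_box inner_sum_left_Basis)
    qed
    then show "(indicator R z :: ennreal) \<le> indicator (cbox (- (\<Sum>b\<in>Basis. (norm y + \<bar>r\<bar> + 1) *\<^sub>R b)) (\<Sum>b\<in>Basis. (norm y + \<bar>r\<bar> + 1) *\<^sub>R b)) z"
      by (auto simp: indicator_def)
  qed
  also have "\<dots> < \<infinity>" using emeasure_lborel_cbox_finite by simp
  finally show ?thesis .
qed

text \<open>If the integral were 0, the non-empty open set over T in the whole space would be
  negligible, which is impossible.\<close>

lemma nn_integral_axes_lborel_pos:
  fixes B :: "'e::euclidean_space set" and u :: "'e \<Rightarrow> ennreal"
  assumes B: "B \<subseteq> Basis" and u: "u \<in> borel_measurable borel" and T: "open T" "T \<inter> span B \<noteq> {}"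
    and pos: "\<And>y. y \<in> T \<Longrightarrow> y \<in> span B \<Longrightarrow> u y \<noteq> 0"
  shows "(\<integral>\<^sup>+ y. u y \<partial>axes_lborel B) \<noteq> 0"
proof
  note P = axes_proj_simps[OF B]
  define K where "K = {z :: 'e. \<forall>b\<in>Basis - B. z \<bullet> b \<in> {0..1}}"
  \<comment> \<open>The open cube replaces the closed cube K, so that R is open.\<close>
  define R where "R = axes_proj B -` T \<inter> (\<Inter>b\<in>Basis - B. {z. z \<bullet> b \<in> {0<..<1}})"
  assume "(\<integral>\<^sup>+ y. u y \<partial>axes_lborel B) = 0"
  then have 0: "(\<integral>\<^sup>+ y. u (axes_proj B y) * indicator K y \<partial>lborel) = 0"
    using nn_integral_axes_lborel[OF B u] by (simp add: K_def)
  have Km: "K \<in> sets borel"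
  proof -
    have "K = (\<Inter>b\<in>Basis - B. {y. y \<bullet> b \<in> {0..1}})" by (auto simp: K_def)
    moreover have "closed {y :: 'e. y \<bullet> b \<in> {0..1}}" for b
      using continuous_closed_vimage[of "{0..1::real}" "\<lambda>y. y \<bullet> b"] by (simp add: vimage_def)
    ultimately have "closed K" by auto
    then show ?thesis by (rule borel_closed)
  qed
  have m: "(\<lambda>y. u (axes_proj B y) * indicator K y) \<in> borel_measurable lborel"
    using measurable_compose[OF borel_measurable_axes_proj u] Km by simp
  have AE: "AE y in lborel. u (axes_proj B y) * indicator K y = 0"
    using 0 nn_integral_0_iff_AE[OF m] by simp
  have "continuous_on UNIV (axes_proj B)" using P(3) by (intro linear_continuous_on) (simp add: linear_linear)
  then have o1: "open (axes_proj B -` T)" using T(1) by (simp add: open_vimage)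
  have o2: "open {z :: 'e. z \<bullet> b \<in> {0<..<1}}" for b
  proof -
    have "open ((\<lambda>z. z \<bullet> b) -` {0<..<1::real})" by (rule open_vimage[OF open_greaterThanLessThan]) (intro continuous_intros)
    then show ?thesis by (simp add: vimage_def)
  qed
  have oO: "open R" unfolding R_def using o1 o2 by (intro open_Int open_INT) auto
  have "AE y in lborel. y \<notin> R"
    using AE
  proof eventually_elim
    case (elim y)
    show ?case
    proof
      assume y: "y \<in> R"
      then have "y \<in> K" by (auto simp: R_def K_def less_imp_le)
      moreover have "u (axes_proj B y) \<noteq> 0" using y P(5) by (intro pos) (auto simp: R_def)
      ultimately show False using elim by simp
    qed
  qed
  then have "R \<in> null_sets lborel" using oO by (simp add: AE_iff_null_sets borel_open)
  then have "negligible R" by (simp add: negligible_iff_null_sets null_sets_completionI)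
  moreover have "R \<noteq> {}"
  proof -
    obtain y where y: "y \<in> T" "y \<in> span B" using T(2) by auto
    \<comment> \<open>The centre of the cube, which moves a point of T in the span into R without
      changing its projection.\<close>
    define w where "w = (\<Sum>b\<in>Basis - B. (1/2 :: real) *\<^sub>R b)"
    have w: "w \<bullet> b = (if b \<in> B then 0 else 1/2)" if "b \<in> Basis" for b
    proof (cases "b \<in> B")
      case True
      then show ?thesis unfolding w_def inner_sum_left inner_scaleR_left using that
        by (auto simp: inner_Basis intro!: sum.neutral)
    next
      case False
      then show ?thesis unfolding w_def inner_sum_left inner_scaleR_left using that
        by (subst sum.remove[of _ b]) (auto simp: inner_Basis intro!: sum.neutral)
    qed
    have "axes_proj B w = 0" unfolding axes_proj_def using B w by (intro sum.neutral) auto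
    then have "axes_proj B (y + w) = y" using P(3,6) y(2) by (simp add: linear_add)
    moreover have "y \<bullet> b = 0" if "b \<in> Basis - B" for b using P(2)[of b y] P(6)[OF y(2)] that by auto
    ultimately have "y + w \<in> R" using y w by (auto simp: R_def inner_add_left)
    then show ?thesis by blast
  qed
  ultimately show False using open_not_negligible[OF oO] by blast
qed

context
  fixes S :: "('a, 'e::euclidean_space) manifold_struct" and \<mu>
  assumes S: "smooth_manifold S" and cpt: "compact_space (man_top S)" and \<mu>: "volume_form S \<mu>"
begin

lemma diffeo_id: "(\<lambda>x\<in>points S. x) \<in> diffeos S"
  by (rule diffeosI[OF S smooth_map_id[OF S] smooth_map_id[OF S]]) simp_all

text \<open>The image formula for the identity as a diffeomorphism, read in two charts.\<close>

lemma chart_measure_overlap: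
  assumes c: "c \<in> atlas S" and d: "d \<in> atlas S" and A: "A \<in> sets (borel_of_man S)" "A \<subseteq> fst c" "A \<subseteq> fst d"
  shows "emeasure (chart_measure S \<mu> d) A = emeasure (chart_measure S \<mu> c) A"
proof -
  let ?i = "\<lambda>x\<in>points S. x"
  have sub: "A \<subseteq> points S" using A(2) chart_points[OF S c] by auto
  then have im: "?i ` A = A" by (auto simp: image_iff subset_eq)
  have dif: "differential S ?i (coord_vector S c x b) = coord_vector S c x b" if x: "x \<in> fst c" for x b
  proof -
    note t = coord_vector_tangent[OF S c x, of b]
    have "differential S ?i (coord_vector S c x b) = differential S (\<lambda>x. x) (coord_vector S c x b)"
      by (rule differential_cong_points[OF S chart_points[OF S c x] t]) simp
    then show ?thesis using differential_id[OF t] by simp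
  qed
  have "emeasure (chart_measure S \<mu> d) (?i ` A) = emeasure (chart_measure S \<mu> c) A"
    unfolding emeasure_chart_measure[OF S cpt \<mu> c A(1,2)]
  proof (subst emeasure_chart_measure_image[OF S cpt \<mu> diffeo_id c d A(1,2)], goal_cases)
    case 2
    show ?case
    proof (rule nn_integral_cong)
      fix y
      show "ennreal (indicator (snd c ` A) y * \<bar>\<mu> (?i (param S c y)) (\<lambda>b. differential S ?i (coord_vector S c (param S c y) b))\<bar>) =
        ennreal (indicator (snd c ` A) y * chart_density S \<mu> c y)"
      proof (cases "y \<in> snd c ` A")
        case True
        then obtain x where x: "x \<in> A" "y = snd c x" by auto
        then have "x \<in> fst c" "x \<in> points S" using A(2) sub by auto
        then show ?thesis by (simp add: x(2) param_chart[OF S c] chart_density_def dif)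
      qed simp
    qed
  qed (use A im in simp)
  then show ?thesis using im by simp
qed

lemma is_volume_measure_unique:
  assumes "is_volume_measure S \<mu> m1" "is_volume_measure S \<mu> m2"
  shows "m1 = m2"
proof (rule measure_eq_local[OF cpt])
  show "sets m1 = sets (borel_of_man S)" "sets m2 = sets (borel_of_man S)"
    using assms by (auto simp: is_volume_measure_def[OF S cpt \<mu>])
  fix x assume "x \<in> points S"
  then obtain c where c: "c \<in> atlas S" "x \<in> fst c" using atlas_cover[OF S] by blast
  then show "\<exists>U. openin (man_top S) U \<and> x \<in> U \<and> (\<forall>A\<in>sets (borel_of_man S). A \<subseteq> U \<longrightarrow> emeasure m1 A = emeasure m2 A)"
    using assms chart_open[OF S c(1)] by (intro exI[of _ "fst c"]) (simp add: is_volume_measure_def[OF S cpt \<mu>])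
qed

text \<open>The sum of chart measures restricted to the pieces of a Borel partition subordinate to
  the charts. By the overlap lemma, on each piece the chosen chart may be exchanged for any other
  that contains the set in question.\<close>

lemma is_volume_measure_exists: "\<exists>m. is_volume_measure S \<mu> m"
proof -
  have "\<exists>U. openin (man_top S) U \<and> x \<in> U \<and> (\<exists>c\<in>atlas S. U = fst c)" if x: "x \<in> points S" for x
  proof -
    obtain c where "c \<in> atlas S" "x \<in> fst c" using atlas_cover[OF S x] .
    then show ?thesis using chart_open[OF S] by blast
  qed
  then obtain n U D where U: "\<And>i::nat. i < n \<Longrightarrow> openin (man_top S) (U i) \<and> (\<exists>c\<in>atlas S. U i = fst c)"
    and D: "\<And>i. i < n \<Longrightarrow> D i \<subseteq> U i" "\<And>i. i < n \<Longrightarrow> D i \<in> sets (borel_of_man S)"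
    "disjoint_family_on D {..<n}" "(\<Union>i<n. D i) = points S"
    using finite_borel_partition[OF cpt, of "\<lambda>U. \<exists>c\<in>atlas S. U = fst c"] by metis
  then obtain C where C: "\<And>i. i < n \<Longrightarrow> C i \<in> atlas S" "\<And>i. i < n \<Longrightarrow> U i = fst (C i)" by metis
  let ?N = "\<lambda>i. density (chart_measure S \<mu> (C i)) (indicator (D i))"
  obtain m where m: "sets m = sets (borel_of_man S)"
    "\<And>A. A \<in> sets (borel_of_man S) \<Longrightarrow> emeasure m A = (\<Sum>i<n. emeasure (?N i) A)"
    using finite_measure_sum_exists[of "{..<n}" ?N "borel_of_man S"] by (auto simp: sets_chart_measure[OF S cpt \<mu>])
  have N: "emeasure (?N i) A = emeasure (chart_measure S \<mu> (C i)) (D i \<inter> A)"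
    if "A \<in> sets (borel_of_man S)" "i < n" for A i
    using that D(2)
    by (subst emeasure_density)
      (auto simp: sets_chart_measure[OF S cpt \<mu>] indicator_inter_arith[symmetric] measurable_cong_sets[OF sets_chart_measure[OF S cpt \<mu>] refl])
  have "emeasure m A = emeasure (chart_measure S \<mu> c) A"
    if c: "c \<in> atlas S" and A: "A \<in> sets (borel_of_man S)" "A \<subseteq> fst c" for c A
  proof -
    have sub: "A \<subseteq> points S" using A(2) chart_points[OF S c] by auto
    have "emeasure m A = (\<Sum>i<n. emeasure (chart_measure S \<mu> (C i)) (D i \<inter> A))" using m(2)[OF A(1)] N[OF A(1)] by simp
    also have "\<dots> = (\<Sum>i<n. emeasure (chart_measure S \<mu> c) (D i \<inter> A))"
      by (rule sum.cong[OF refl], rule chart_measure_overlap[OF c C(1)]) (use D C A in auto)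
    also have "\<dots> = emeasure (chart_measure S \<mu> c) (\<Union>i<n. D i \<inter> A)"
    proof (rule sum_emeasure)
      show "disjoint_family_on (\<lambda>i. D i \<inter> A) {..<n}" using D(3) unfolding disjoint_family_on_def by blast
    qed (use D A in \<open>auto simp: sets_chart_measure[OF S cpt \<mu>]\<close>)
    also have "(\<Union>i<n. D i \<inter> A) = A" using D(4) sub by blast
    finally show ?thesis .
  qed
  then have "is_volume_measure S \<mu> m" using m(1) by (simp add: is_volume_measure_def[OF S cpt \<mu>])
  then show ?thesis ..
qed

lemma volume_measure: "is_volume_measure S \<mu> (volume_measure S \<mu>)"
  unfolding volume_measure_eq[OF S cpt \<mu>]
proof -
  obtain m where m: "is_volume_measure S \<mu> m" using is_volume_measure_exists ..
  show "is_volume_measure S \<mu> (THE m. is_volume_measure S \<mu> m)"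
    by (rule theI[of "is_volume_measure S \<mu>", OF m]) (rule is_volume_measure_unique[OF _ m])
qed

lemma sets_volume_measure: "sets (volume_measure S \<mu>) = sets (borel_of_man S)"
  using volume_measure by (simp add: is_volume_measure_def[OF S cpt \<mu>])

lemma space_volume_measure: "space (volume_measure S \<mu>) = points S"
  using sets_eq_imp_space_eq[OF sets_volume_measure] by (simp add: space_borel_of_man)

lemma emeasure_volume_measure:
  "c \<in> atlas S \<Longrightarrow> A \<in> sets (borel_of_man S) \<Longrightarrow> A \<subseteq> fst c \<Longrightarrow>
    emeasure (volume_measure S \<mu>) A = emeasure (chart_measure S \<mu> c) A"
  using volume_measure by (simp add: is_volume_measure_def[OF S cpt \<mu>])

lemma nn_integral_volume_measure_chart:
  assumes c: "c \<in> atlas S" and A: "A \<in> sets (borel_of_man S)" "A \<subseteq> fst c" and f: "f \<in> borel_measurable (borel_of_man S)"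
  shows "(\<integral>\<^sup>+ x. f x * indicator A x \<partial>volume_measure S \<mu>) = (\<integral>\<^sup>+ x. f x * indicator A x \<partial>chart_measure S \<mu> c)"
proof -
  let ?V = "volume_measure S \<mu>" and ?L = "chart_measure S \<mu> c"
  have sL: "sets ?L = sets (borel_of_man S)" by (rule sets_chart_measure[OF S cpt \<mu>])
  have "density ?V (indicator A) = density ?L (indicator A)"
  proof (rule measure_eqI)
    show "sets (density ?V (indicator A)) = sets (density ?L (indicator A))"
      by (simp add: sL sets_volume_measure)
    fix X assume "X \<in> sets (density ?V (indicator A))"
    then have X: "X \<in> sets (borel_of_man S)" by (simp add: sets_volume_measure)
    have *: "emeasure (density m (indicator A)) X = emeasure m (A \<inter> X)" if s: "sets m = sets (borel_of_man S)" for m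
      using X A(1) by (subst emeasure_density) (auto simp: s indicator_inter_arith[symmetric] measurable_cong_sets[OF s refl])
    show "emeasure (density ?V (indicator A)) X = emeasure (density ?L (indicator A)) X"
      unfolding *[OF sL] *[OF sets_volume_measure]
      by (rule emeasure_volume_measure[OF c]) (use X A in auto)
  qed
  moreover have "(\<integral>\<^sup>+ x. f x * indicator A x \<partial>m) = (\<integral>\<^sup>+ x. f x \<partial>density m (indicator A))"
    if s: "sets m = sets (borel_of_man S)" for m
    using f A(1) by (subst nn_integral_density) (auto simp: measurable_cong_sets[OF s refl] mult.commute)
  ultimately show ?thesis using sL sets_volume_measure by simp
qed

text \<open>The density is continuous in a chart, so every point has a neighbourhood of finite
  measure; a finite partition finishes the argument.\<close>

lemma finite_volume_measure: "finite_measure (volume_measure S \<mu>)"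
proof
  let ?V = "volume_measure S \<mu>"
  have "\<exists>U. openin (man_top S) U \<and> x \<in> U \<and> emeasure ?V U < \<infinity>" if x: "x \<in> points S" for x
  proof -
    obtain c where c: "c \<in> atlas S" "x \<in> fst c" using atlas_cover[OF S x] .
    have "isCont (chart_density S \<mu> c) (snd c x)"
      using chart_density_continuous[OF S cpt \<mu> c(1)] open_chart_dom[OF S c(1)] chart_in_dom[OF S c]
        continuous_on_eq_continuous_at by blast
    \<comment> \<open>By continuity, the value at the point plus one bounds the density
      nearby.\<close>
    then have "eventually (\<lambda>y. chart_density S \<mu> c y < chart_density S \<mu> c (snd c x) + 1) (nhds (snd c x))"
      unfolding isCont_def tendsto_at_iff_tendsto_nhds by (rule order_tendstoD) simp
    then obtain T where T: "open T" "snd c x \<in> T" "\<And>y. y \<in> T \<Longrightarrow> chart_density S \<mu> c y < chart_density S \<mu> c (snd c x) + 1"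
      unfolding eventually_nhds by blast
    obtain r where r: "r > 0" "ball (snd c x) r \<subseteq> T" using T openE by blast
    let ?B = "ball (snd c x) r" and ?K = "chart_density S \<mu> c (snd c x) + 1"
    have "eventually (\<lambda>z. z \<in> fst c \<and> snd c z \<in> ?B) (nhdsin (man_top S) x)"
      using eventually_in_chart[OF S c] eventually_chart[OF S c eventually_nhds_in_open[OF open_ball centre_in_ball[THEN iffD2, OF r(1)]]]
      by (rule eventually_conj)
    from eventually_nhdsinE[OF this x] obtain U where
      U: "openin (man_top S) U" "x \<in> U" "\<And>z. z \<in> U \<Longrightarrow> z \<in> fst c \<and> snd c z \<in> ?B" by blast
    have Um: "U \<in> sets (borel_of_man S)" "U \<subseteq> fst c" using open_in_borel_of_man[OF U(1)] U(3) by auto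
    have "emeasure ?V U = (\<integral>\<^sup>+ y. ennreal (indicator (snd c ` U) y * chart_density S \<mu> c y) \<partial>axes_lborel (axes S))"
      using emeasure_volume_measure[OF c(1) Um] emeasure_chart_measure[OF S cpt \<mu> c(1) Um] by simp
    also have "\<dots> \<le> (\<integral>\<^sup>+ y. ennreal ?K * indicator ?B y \<partial>axes_lborel (axes S))"
    proof (rule nn_integral_mono)
      fix y
      show "ennreal (indicator (snd c ` U) y * chart_density S \<mu> c y) \<le> ennreal ?K * indicator ?B y"
      proof (cases "y \<in> snd c ` U")
        case True
        then have "y \<in> ?B" using U(3) by auto
        then have "chart_density S \<mu> c y \<le> ?K" using less_imp_le[OF T(3)[OF subsetD[OF r(2)]]] by blast
        then show ?thesis using \<open>y \<in> ?B\<close> True by (simp add: ennreal_leI)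
      qed simp
    qed
    also have "\<dots> = ennreal ?K * emeasure (axes_lborel (axes S)) ?B" by (rule nn_integral_cmult_indicator) simp
    also have "\<dots> < \<infinity>"
      using emeasure_axes_lborel_bounded[OF axes_subset[OF S c(1)], of "snd c x" r] by (simp add: ennreal_mult_less_top)
    finally show ?thesis using U by blast
  qed
  then obtain n U D where U: "\<And>i::nat. i < n \<Longrightarrow> openin (man_top S) (U i) \<and> emeasure ?V (U i) < \<infinity>"
    and D: "\<And>i. i < n \<Longrightarrow> D i \<subseteq> U i" "\<And>i. i < n \<Longrightarrow> D i \<in> sets (borel_of_man S)"
    "disjoint_family_on D {..<n}" "(\<Union>i<n. D i) = points S"
    using finite_borel_partition[OF cpt, of "\<lambda>U. emeasure ?V U < \<infinity>"] by metis
  have "emeasure ?V (points S) = (\<Sum>i<n. emeasure ?V (D i))"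
    unfolding D(4)[symmetric] by (rule sum_emeasure[symmetric]) (use D in \<open>auto simp: sets_volume_measure\<close>)
  also have "\<dots> < \<infinity>"
  proof -
    have "emeasure ?V (D i) < \<infinity>" if "i < n" for i
    proof -
      have "emeasure ?V (D i) \<le> emeasure ?V (U i)"
        by (rule emeasure_mono[OF D(1)[OF that]]) (use U[OF that] in \<open>simp add: sets_volume_measure open_in_borel_of_man\<close>)
      then show ?thesis using U[OF that] by (meson le_less_trans)
    qed
    then show ?thesis by simp
  qed
  finally show "emeasure ?V (space ?V) \<noteq> \<infinity>" by (simp add: space_volume_measure)
qed

text \<open>The coefficient of \<mu> vanishes nowhere, and the chart image of a non-empty open set
  has positive measure. Localized integrals are non-zero for this reason.\<close>

lemma emeasure_volume_open_pos:
  assumes U: "openin (man_top S) U" "x \<in> U"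
  shows "emeasure (volume_measure S \<mu>) U \<noteq> 0"
proof
  assume z: "emeasure (volume_measure S \<mu>) U = 0"
  have x: "x \<in> points S" using U openin_subset by blast
  obtain c where c: "c \<in> atlas S" "x \<in> fst c" using atlas_cover[OF S x] .
  let ?A = "fst c \<inter> U"
  have oA: "openin (man_top S) ?A" using U(1) chart_open[OF S c(1)] by blast
  then have A: "?A \<in> sets (borel_of_man S)" "?A \<subseteq> fst c" using open_in_borel_of_man by auto
  have "emeasure (volume_measure S \<mu>) ?A \<le> emeasure (volume_measure S \<mu>) U"
    by (rule emeasure_mono) (use U(1) in \<open>auto simp: sets_volume_measure open_in_borel_of_man\<close>)
  then have "emeasure (chart_measure S \<mu> c) ?A = 0" using z emeasure_volume_measure[OF c(1) A] by simp
  moreover have "(\<integral>\<^sup>+ y. ennreal (indicator (snd c ` ?A) y * chart_density S \<mu> c y) \<partial>axes_lborel (axes S)) \<noteq> 0"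
  proof (rule nn_integral_axes_lborel_pos[OF axes_subset[OF S c(1)]])
    let ?T = "{y. axes_proj (axes S) y \<in> snd c ` (fst c \<inter> U)}"
    show "open ?T" by (rule open_chart_preimage[OF S c(1) U(1)])
    show "?T \<inter> span (axes S) \<noteq> {}"
      using c U chart_span[OF S c] chart_proj[OF S c] by blast
    show "(\<lambda>y. ennreal (indicator (snd c ` ?A) y * chart_density S \<mu> c y)) \<in> borel_measurable borel"
      using chart_density_measurable[OF S cpt \<mu> c(1) open_in_borel_of_man[OF U(1)]] by simp
    fix y assume y: "y \<in> ?T" "y \<in> span (axes S)"
    then have "axes_proj (axes S) y = y" using axes_proj_simps(6)[OF axes_subset[OF S c(1)]] by simp
    then obtain z where z: "z \<in> fst c" "z \<in> U" "y = snd c z" using y(1) by auto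
    then show "ennreal (indicator (snd c ` ?A) y * chart_density S \<mu> c y) \<noteq> 0"
      using volume_coefficient_nonzero[OF S cpt \<mu> c(1) z(1)]
      by (simp add: chart_density_def param_chart[OF S c(1)])
  qed
  ultimately show False using emeasure_chart_measure[OF S cpt \<mu> c(1) A] by simp
qed

lemma integrable_smooth:
  assumes f: "f \<in> smooth_funs S"
  shows "integrable (volume_measure S \<mu>) f"
proof -
  interpret finite_measure "volume_measure S \<mu>" by (rule finite_volume_measure)
  have "continuous_map (man_top S) euclidean f"
    by (rule smooth_imp_continuous_map[OF S]) (use f in \<open>simp add: smooth_funs_iff[OF S]\<close>)
  then have "compactin euclidean (f ` points S)"
    using cpt image_compactin compact_space_def by metis
  then have "bounded (f ` points S)" by (simp add: compact_imp_bounded)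
  then obtain k where "\<And>x. x \<in> points S \<Longrightarrow> norm (f x) \<le> k" by (auto simp: bounded_iff)
  moreover have "f \<in> borel_measurable (volume_measure S \<mu>)"
    using measurable_smooth[OF S f] by (simp add: measurable_cong_sets[OF sets_volume_measure refl])
  ultimately show ?thesis
    by (intro integrable_const_bound[of _ k]) (auto simp: space_volume_measure intro!: AE_I2)
qed

lemma form_integral_lincomb:
  assumes "f \<in> smooth_funs S" "g \<in> smooth_funs S"
  shows "form_integral S \<mu> (\<lambda>x. s * f x + t * g x) = s * form_integral S \<mu> f + t * form_integral S \<mu> g"
  unfolding form_integral_def using assms integrable_smooth by simp

lemma form_integral_cong:
  assumes "\<And>x. x \<in> points S \<Longrightarrow> f x = g x"
  shows "form_integral S \<mu> f = form_integral S \<mu> g"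
  unfolding form_integral_def by (rule Bochner_Integration.integral_cong) (auto simp: space_volume_measure assms)

lemma form_integral_pos:
  assumes f: "f \<in> smooth_funs S" and nn: "\<And>x. x \<in> points S \<Longrightarrow> 0 \<le> f x" and x: "x \<in> points S" "f x > 0"
  shows "form_integral S \<mu> f > 0"
proof -
  let ?V = "volume_measure S \<mu>"
  have "form_integral S \<mu> f \<ge> 0"
    unfolding form_integral_def by (rule Bochner_Integration.integral_nonneg) (simp add: nn space_volume_measure)
  moreover have "form_integral S \<mu> f \<noteq> 0"
  proof
    assume "form_integral S \<mu> f = 0"
    moreover have "AE x in ?V. 0 \<le> f x" by (rule AE_I2) (simp add: nn space_volume_measure)
    ultimately have "AE x in ?V. f x = 0"
      using integral_nonneg_eq_0_iff_AE[OF integrable_smooth[OF f]] by (simp add: form_integral_def)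
    moreover let ?U = "{z \<in> points S. f z \<in> {0<..}}"
    have oU: "openin (man_top S) ?U"
      by (rule openin_continuous_map_preimage[OF smooth_imp_continuous_map[OF S]])
        (use f in \<open>simp_all add: smooth_funs_iff[OF S]\<close>)
    ultimately have "AE x in ?V. x \<notin> ?U" by (auto elim: eventually_mono)
    then have "?U \<in> null_sets ?V"
      using open_in_borel_of_man[OF oU] by (subst AE_iff_null_sets) (auto simp: sets_volume_measure)
    then show False using emeasure_volume_open_pos[OF oU, of x] x by auto
  qed
  ultimately show ?thesis by simp
qed

section \<open>Jacobians of diffeomorphisms\<close>

definition pullback_form :: "('a \<Rightarrow> 'a) \<Rightarrow> 'a \<Rightarrow> ('e \<Rightarrow> 'a tangent) \<Rightarrow> real" where
  "pullback_form \<psi> x v = \<mu> (\<psi> x) (\<lambda>b. differential S \<psi> (v b))"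

text \<open>The ratio of the pulled-back form to \<mu>, in a chart picked by \<open>SOME\<close>;
  \<open>jacobian_chart\<close> shows that any chart gives the same value. The absolute values allow
  for diffeomorphisms that reverse orientation.\<close>

definition jacobian :: "('a \<Rightarrow> 'a) \<Rightarrow> 'a \<Rightarrow> real" where
  "jacobian \<psi> x = (let c = (SOME c. c \<in> atlas S \<and> x \<in> fst c) in
     \<bar>pullback_form \<psi> x (coord_vector S c x)\<bar> / \<bar>\<mu> x (coord_vector S c x)\<bar>)"

lemma top_form_pullback:
  assumes \<psi>: "smooth_map S S \<psi>" and x: "x \<in> points S"
  shows "top_form S x (pullback_form \<psi> x)"
proof -
  note \<omega> = top_form_volume[OF \<mu> smooth_map_points[OF \<psi> x]]
  have t: "(\<lambda>b. differential S \<psi> (v b)) \<in> tangent_tuples S (\<psi> x)" if "v \<in> tangent_tuples S x" for v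
    using that differential_tangent[OF S S \<psi>] by (simp add: tangent_tuples_def)
  have upd: "(\<lambda>b'. differential S \<psi> ((v(b := u)) b')) = (\<lambda>b'. differential S \<psi> (v b'))(b := differential S \<psi> u)" for v b u
    by auto
  show ?thesis
    unfolding top_form_def pullback_form_def upd differential_combine
  proof (intro conjI ballI allI impI)
    fix v w assume "v \<in> tangent_tuples S x" "w \<in> tangent_tuples S x" "\<forall>b\<in>axes S. v b = w b"
    then show "\<mu> (\<psi> x) (\<lambda>b. differential S \<psi> (v b)) = \<mu> (\<psi> x) (\<lambda>b. differential S \<psi> (w b))"
      using \<omega>[unfolded top_form_def, THEN conjunct1, rule_format, OF t[of v] t[of w]] by simp
  next
    fix v b u w s k assume "v \<in> tangent_tuples S x" "b \<in> axes S" "u \<in> tangent_space S x" "w \<in> tangent_space S x"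
    then show "\<mu> (\<psi> x) ((\<lambda>b'. differential S \<psi> (v b'))(b := (\<lambda>f. s * differential S \<psi> u f + k * differential S \<psi> w f))) =
        s * \<mu> (\<psi> x) ((\<lambda>b'. differential S \<psi> (v b'))(b := differential S \<psi> u)) +
        k * \<mu> (\<psi> x) ((\<lambda>b'. differential S \<psi> (v b'))(b := differential S \<psi> w))"
      using \<omega>[unfolded top_form_def, THEN conjunct2, THEN conjunct1, rule_format, OF t[of v] _ differential_tangent[OF S S \<psi>, of u x] differential_tangent[OF S S \<psi>, of w x]]
      by simp
  next
    fix v b b' assume "v \<in> tangent_tuples S x" "b \<in> axes S" "b' \<in> axes S" "b \<noteq> b' \<and> v b = v b'"
    then show "\<mu> (\<psi> x) (\<lambda>b. differential S \<psi> (v b)) = 0"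
      using \<omega>[unfolded top_form_def, THEN conjunct2, THEN conjunct2, rule_format, OF t[of v], of b b'] by simp
  qed
qed

text \<open>A tuple at \<psi> x on which \<mu> does not vanish is the image of its own image under
  the differential of the inverse, so the pullback is non-zero on the latter.\<close>

lemma pullback_nonzero:
  assumes \<psi>: "\<psi> \<in> diffeos S" and c: "c \<in> atlas S" "x \<in> fst c"
  shows "pullback_form \<psi> x (coord_vector S c x) \<noteq> 0"
proof -
  note x = chart_points[OF S c]
  let ?i = "inv_into (points S) \<psi>"
  have \<psi>x: "\<psi> x \<in> points S" "?i (\<psi> x) = x" using diffeosD(5,8)[OF \<psi> x] by auto
  obtain v where v: "v \<in> tangent_tuples S (\<psi> x)" "\<mu> (\<psi> x) v \<noteq> 0" using \<mu> \<psi>x(1) unfolding volume_form_def by meson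
  define u where "u b = differential S ?i (v b)" for b
  have u: "u \<in> tangent_tuples S x"
    using v(1) differential_tangent[OF S S diffeosD(3)[OF \<psi>]] \<psi>x(2) unfolding u_def tangent_tuples_def by fastforce
  have du: "differential S \<psi> (u b) = v b" if "b \<in> axes S" for b
  proof -
    have vb: "v b \<in> tangent_space S (\<psi> x)" using v(1) that by (simp add: tangent_tuples_def)
    have "differential S \<psi> (u b) = differential S (\<lambda>z. \<psi> (?i z)) (v b)"
      unfolding u_def by (rule differential_compose[OF S S diffeosD(1)[OF \<psi>]])
    also have "\<dots> = differential S (\<lambda>z. z) (v b)"
      by (rule differential_cong_points[OF S \<psi>x(1) vb]) (rule diffeosD(7)[OF \<psi>])
    finally show ?thesis using differential_id[OF vb] by simp
  qed
  have "(\<lambda>b. differential S \<psi> (u b)) \<in> tangent_tuples S (\<psi> x)"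
    using u differential_tangent[OF S S diffeosD(1)[OF \<psi>]] by (simp add: tangent_tuples_def)
  then have "pullback_form \<psi> x u = \<mu> (\<psi> x) v"
    unfolding pullback_form_def
    using top_form_volume[OF \<mu> \<psi>x(1), unfolded top_form_def, THEN conjunct1, rule_format, OF _ v(1)] du by blast
  then have "pullback_form \<psi> x u \<noteq> 0" using v(2) by simp
  then show ?thesis by (rule top_form_nonzero[OF S c top_form_pullback[OF diffeosD(1)[OF \<psi>] x] u])
qed

text \<open>A change of chart multiplies every form of top degree at x by the same determinant,
  which cancels in the quotient.\<close>

lemma jacobian_chart:
  assumes \<psi>: "smooth_map S S \<psi>" and c: "c \<in> atlas S" "x \<in> fst c"
  shows "jacobian \<psi> x = \<bar>pullback_form \<psi> x (coord_vector S c x)\<bar> / \<bar>\<mu> x (coord_vector S c x)\<bar>"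
proof -
  note x = chart_points[OF S c]
  define d where "d = (SOME c. c \<in> atlas S \<and> x \<in> fst c)"
  have d: "d \<in> atlas S" "x \<in> fst d"
    using someI[of "\<lambda>c. c \<in> atlas S \<and> x \<in> fst c" c] c by (auto simp: d_def)
  let ?a = "frechet_derivative (local_rep (axes S) d (snd c)) (at (snd d x))"
  have co: "coord_vector S d x b = (\<lambda>f. \<Sum>e\<in>axes S. (?a b \<bullet> e) * coord_vector S c x e f)" for b
    using differential_coord_vector[OF S S smooth_map_id[OF S] d c, of b]
      differential_id[OF coord_vector_tangent[OF S d, of b]] by simp
  have tf: "\<omega> (coord_vector S d x) = det_axes (axes S) ?a * \<omega> (coord_vector S c x)" if "top_form S x \<omega>" for \<omega>
  proof -
    have "\<omega> (coord_vector S d x) = \<omega> (\<lambda>b f. \<Sum>e\<in>axes S. (?a b \<bullet> e) * coord_vector S c x e f)"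
      by (rule arg_cong[of _ _ \<omega>]) (rule ext, rule co)
    then show ?thesis using top_form_det[OF S c that, of ?a] by simp
  qed
  have "\<mu> x (coord_vector S d x) \<noteq> 0" by (rule volume_coefficient_nonzero[OF S cpt \<mu> d])
  then show ?thesis
    unfolding jacobian_def d_def[symmetric] Let_def
    using tf[OF top_form_volume[OF \<mu> x]] tf[OF top_form_pullback[OF \<psi> x]] by (simp add: abs_mult)
qed

lemma jacobian_pos:
  assumes \<psi>: "\<psi> \<in> diffeos S" and x: "x \<in> points S"
  shows "jacobian \<psi> x > 0"
proof -
  obtain c where c: "c \<in> atlas S" "x \<in> fst c" using atlas_cover[OF S x] .
  show ?thesis
    unfolding jacobian_chart[OF diffeosD(1)[OF \<psi>] c]
    using pullback_nonzero[OF \<psi> c] volume_coefficient_nonzero[OF S cpt \<mu> c] by simp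
qed

text \<open>Neither the pulled-back form nor \<mu> vanishes on a coordinate frame, so both absolute
  values and the quotient are smooth.\<close>

lemma jacobian_smooth:
  assumes \<psi>: "\<psi> \<in> diffeos S"
  shows "jacobian \<psi> \<in> smooth_funs S"
  unfolding smooth_funs_iff[OF S]
proof
  note \<psi>s = diffeosD(1)[OF \<psi>]
  fix x assume x: "x \<in> points S"
  obtain c where c: "c \<in> atlas S" "x \<in> fst c" using atlas_cover[OF S x] .
  obtain d where d: "d \<in> atlas S" "\<psi> x \<in> fst d" using atlas_cover[OF S smooth_map_points[OF \<psi>s x]] .
  let ?t = "local_rep (axes S) c (\<lambda>z. snd d (\<psi> z))"
  let ?p = "\<lambda>z. det_axes (axes S) (frechet_derivative ?t (at (snd c z))) * \<mu> (\<psi> z) (coord_vector S d (\<psi> z))"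
  have ev: "eventually (\<lambda>z. z \<in> fst c \<and> \<psi> z \<in> fst d) (nhdsin (man_top S) x)"
    by (rule eventually_conj[OF eventually_in_chart[OF S c]
        eventually_nhdsin_continuous_map[OF smooth_map_continuous[OF \<psi>s] x eventually_in_chart[OF S d]]])
  have p: "?p z = pullback_form \<psi> z (coord_vector S c z)" if "z \<in> fst c" "\<psi> z \<in> fst d" for z
    using volume_pullback_coefficient[OF S cpt \<mu> \<psi>s c(1) that(1) d(1) that(2)] by (simp add: pullback_form_def)
  show "smooth_fun_at S (jacobian \<psi>) x"
  proof (rule smooth_fun_at_cong[OF S])
    show "smooth_fun_at S (\<lambda>z. \<bar>?p z\<bar> / \<bar>\<mu> z (coord_vector S c z)\<bar>) x"
    proof (intro smooth_fun_at_divide[OF S] smooth_fun_at_abs[OF S] smooth_fun_at_mult[OF S])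
      show "smooth_fun_at S (\<lambda>z. det_axes (axes S) (frechet_derivative ?t (at (snd c z)))) x"
        by (rule smooth_fun_at_compose_chart[OF S c, of "\<lambda>y. det_axes (axes S) (frechet_derivative ?t (at y))"])
          (intro det_axes_smooth smooth_at_derivative transition_smooth[OF S S \<psi>s c d])
      show "smooth_fun_at S (\<lambda>z. \<mu> (\<psi> z) (coord_vector S d (\<psi> z))) x"
        by (rule smooth_map_compose_fun[OF S S \<psi>s x smooth_volume_coefficient[OF S cpt \<mu> d]])
      show "smooth_fun_at S (\<lambda>z. \<mu> z (coord_vector S c z)) x" by (rule smooth_volume_coefficient[OF S cpt \<mu> c])
      show "?p x \<noteq> 0" unfolding p[OF c(2) d(2)] by (rule pullback_nonzero[OF \<psi> c])
    qed (use volume_coefficient_nonzero[OF S cpt \<mu> c] in auto)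
    show "eventually (\<lambda>z. \<bar>?p z\<bar> / \<bar>\<mu> z (coord_vector S c z)\<bar> = jacobian \<psi> z) (nhdsin (man_top S) x)"
      by (rule eventually_mono[OF ev]) (use p jacobian_chart[OF \<psi>s c(1)] in auto)
  qed
qed

text \<open>The substitution rule on S. It is reduced to an equality of measures, which can be
  verified on small Borel sets.\<close>

lemma form_integral_diffeo:
  assumes \<psi>: "\<psi> \<in> diffeos S" and f: "f \<in> smooth_funs S"
  shows "form_integral S \<mu> (\<lambda>x. jacobian \<psi> x * f (\<psi> x)) = form_integral S \<mu> f"
proof -
  let ?V = "volume_measure S \<mu>" and ?B = "borel_of_man S" and ?J = "jacobian \<psi>" and ?i = "inv_into (points S) \<psi>"
  note \<psi>s = diffeosD(1)[OF \<psi>]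
  note sV = sets_volume_measure
  have Jm: "?J \<in> borel_measurable ?B" by (rule measurable_smooth[OF S jacobian_smooth[OF \<psi>]])
  have im: "?i \<in> measurable ?B ?B" by (rule measurable_continuous_map_man[OF smooth_map_continuous[OF diffeosD(3)[OF \<psi>]]])
  have imV: "?i \<in> measurable ?V ?B" using im by (simp add: measurable_cong_sets[OF sV refl])
  have JV: "?J \<in> borel_measurable ?V" using Jm by (simp add: measurable_cong_sets[OF sV refl])
  \<comment> \<open>The Jacobian is the density of the image of the volume measure under the inverse
    of \<psi>. Near each point, both sides are computed in a chart around x and a chart around
    \<psi> x.\<close>
  have eq: "density ?V (\<lambda>x. ennreal (?J x)) = distr ?V ?B ?i"
  proof (rule measure_eq_local[OF cpt])
    fix x assume x: "x \<in> points S"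
    obtain c where c: "c \<in> atlas S" "x \<in> fst c" using atlas_cover[OF S x] .
    obtain d where d: "d \<in> atlas S" "\<psi> x \<in> fst d" using atlas_cover[OF S smooth_map_points[OF \<psi>s x]] .
    let ?U = "fst c \<inter> {z \<in> points S. \<psi> z \<in> fst d}"
    have "openin (man_top S) ?U"
      using chart_open[OF S c(1)] openin_continuous_map_preimage[OF smooth_map_continuous[OF \<psi>s] chart_open[OF S d(1)]] by blast
    moreover have "emeasure (density ?V (\<lambda>x. ennreal (?J x))) A = emeasure (distr ?V ?B ?i) A"
      if A: "A \<in> sets ?B" "A \<subseteq> ?U" for A
    proof -
      have Ac: "A \<subseteq> fst c" "\<psi> ` A \<subseteq> fst d" using A(2) by auto
      have sub: "A \<subseteq> points S" using Ac(1) chart_points[OF S c(1)] by auto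
      have pre: "?i -` A \<inter> space ?V = \<psi> ` A"
      proof (intro equalityI subsetI)
        fix y assume y: "y \<in> ?i -` A \<inter> space ?V"
        then have "y = \<psi> (?i y)" using diffeosD(7)[OF \<psi>] by (simp add: space_volume_measure)
        then show "y \<in> \<psi> ` A" using y by blast
      next
        fix y assume "y \<in> \<psi> ` A"
        then show "y \<in> ?i -` A \<inter> space ?V" using sub diffeosD(5,8)[OF \<psi>] by (auto simp: space_volume_measure)
      qed
      have "emeasure (distr ?V ?B ?i) A = emeasure ?V (\<psi> ` A)"
        using A(1) by (simp add: emeasure_distr[OF imV] pre)
      also have "\<dots> = emeasure (chart_measure S \<mu> d) (\<psi> ` A)"
        by (rule emeasure_volume_measure[OF d(1) diffeo_image_sets[OF S cpt \<mu> \<psi> A(1)] Ac(2)])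
      also have "\<dots> = (\<integral>\<^sup>+ y. ennreal (indicator (snd c ` A) y * \<bar>pullback_form \<psi> (param S c y) (coord_vector S c (param S c y))\<bar>) \<partial>axes_lborel (axes S))"
        unfolding emeasure_chart_measure_image[OF S cpt \<mu> \<psi> c(1) d(1) A(1) Ac] pullback_form_def ..
      also have "\<dots> = (\<integral>\<^sup>+ y. ennreal (chart_density S \<mu> c y) * (ennreal (?J (param S c y)) * indicator A (param S c y)) * indicator (snd c ` fst c) y \<partial>axes_lborel (axes S))"
      proof (rule nn_integral_cong)
        fix y
        show "ennreal (indicator (snd c ` A) y * \<bar>pullback_form \<psi> (param S c y) (coord_vector S c (param S c y))\<bar>) =
          ennreal (chart_density S \<mu> c y) * (ennreal (?J (param S c y)) * indicator A (param S c y)) * indicator (snd c ` fst c) y"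
        proof (cases "y \<in> snd c ` fst c")
          case True
          then obtain z where z: "z \<in> fst c" "y = snd c z" by auto
          have "z \<in> A \<longleftrightarrow> y \<in> snd c ` A" using z inj_on_image_mem_iff[OF chart_inj[OF S c(1)] z(1) Ac(1)] by simp
          moreover have "\<bar>pullback_form \<psi> z (coord_vector S c z)\<bar> = \<bar>\<mu> z (coord_vector S c z)\<bar> * ?J z"
            unfolding jacobian_chart[OF \<psi>s c(1) z(1)] using volume_coefficient_nonzero[OF S cpt \<mu> c(1) z(1)] by simp
          ultimately show ?thesis
            using z by (simp add: param_chart[OF S c(1)] chart_density_def indicator_def ennreal_mult')
        next
          case False
          then have "y \<notin> snd c ` A" using Ac(1) by auto
          then show ?thesis using False by simp
        qed
      qed
      also have "\<dots> = (\<integral>\<^sup>+ x. ennreal (?J x) * indicator A x \<partial>chart_measure S \<mu> c)"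
        by (rule nn_integral_chart_measure[OF S cpt \<mu> c(1), symmetric]) (use Jm A(1) in measurable)
      also have "\<dots> = (\<integral>\<^sup>+ x. ennreal (?J x) * indicator A x \<partial>?V)"
        by (rule nn_integral_volume_measure_chart[OF c(1) A(1) Ac(1), symmetric]) (use Jm in measurable)
      also have "\<dots> = emeasure (density ?V (\<lambda>x. ennreal (?J x))) A"
        by (rule emeasure_density[symmetric]) (use JV A(1) in \<open>auto simp: sV\<close>)
      finally show ?thesis ..
    qed
    ultimately show "\<exists>U. openin (man_top S) U \<and> x \<in> U \<and>
        (\<forall>A\<in>sets ?B. A \<subseteq> U \<longrightarrow> emeasure (density ?V (\<lambda>x. ennreal (?J x))) A = emeasure (distr ?V ?B ?i) A)"
      using x c d by (intro exI[of _ ?U]) auto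
  qed (simp_all add: sV)
  have fm: "f \<in> borel_measurable ?B" by (rule measurable_smooth[OF S f])
  have \<psi>m: "\<psi> \<in> measurable ?B ?B" by (rule measurable_continuous_map_man[OF smooth_map_continuous[OF \<psi>s]])
  have f\<psi>: "(\<lambda>x. f (\<psi> x)) \<in> borel_measurable ?B" using measurable_compose[OF \<psi>m fm] .
  have "form_integral S \<mu> (\<lambda>x. ?J x * f (\<psi> x)) = (\<integral>x. f (\<psi> x) \<partial>density ?V (\<lambda>x. ennreal (?J x)))"
    unfolding form_integral_def
    by (subst integral_density)
      (use f\<psi> JV jacobian_pos[OF \<psi>] in \<open>auto simp: measurable_cong_sets[OF sV refl] space_volume_measure less_imp_le intro!: AE_I2\<close>)
  also have "\<dots> = (\<integral>x. f (\<psi> (?i x)) \<partial>?V)"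
    unfolding eq by (rule integral_distr[OF imV f\<psi>])
  also have "\<dots> = form_integral S \<mu> f"
    unfolding form_integral_def
    by (rule Bochner_Integration.integral_cong) (simp_all add: space_volume_measure diffeosD(7)[OF \<psi>])
  finally show ?thesis .
qed

end

section \<open>Tangent actions, pairings and localization of the momentum\<close>

section \<open>The actions on the configuration space and its tangent bundle\<close>

lemma embeddingsD:
  assumes "Q \<in> embeddings S M"
  shows "smooth_map S M Q" "Q \<in> extensional (points S)" "embedding_map (man_top S) (man_top M) Q"
    "x \<in> points S \<Longrightarrow> inj_on (differential M Q) (tangent_space S x)"
  using assms by (auto simp: embeddings_def smooth_maps_def)

lemma embedding_inj: "Q \<in> embeddings S M \<Longrightarrow> inj_on Q (points S)"
  using embeddingsD(3)[of Q S M] homeomorphic_imp_injective_map unfolding embedding_map_def by blast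

text \<open>The differential of \<psi> has the differential of the inverse as left inverse, so
  injectivity of the differential of Q survives composition.\<close>

lemma embedding_diffeo:
  assumes S: "smooth_manifold S" and M: "smooth_manifold M" and Q: "Q \<in> embeddings S M" and \<psi>: "\<psi> \<in> diffeos S"
  shows "(\<lambda>x\<in>points S. Q (\<psi> x)) \<in> embeddings S M"
proof -
  note Qs = embeddingsD[OF Q] and \<psi>s = diffeosD[OF \<psi>]
  let ?R = "\<lambda>x\<in>points S. Q (\<psi> x)"
  have sm: "?R \<in> smooth_maps S M" by (rule smooth_maps_restrict[OF S M smooth_map_compose[OF S S M \<psi>s(1) Qs(1)]])
  have "homeomorphic_maps (man_top S) (man_top S) \<psi> (inv_into (points S) \<psi>)"
    unfolding homeomorphic_maps_def
    using smooth_map_continuous[OF \<psi>s(1)] smooth_map_continuous[OF \<psi>s(3)] \<psi>s(7,8) by auto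
  then have "homeomorphic_map (man_top S) (man_top S) \<psi>" unfolding homeomorphic_map_maps by blast
  moreover have "\<psi> ` points S = points S" using \<psi>s(2) by (simp add: bij_betw_def)
  ultimately have "embedding_map (man_top S) (man_top S) \<psi>" by (simp add: embedding_map_def)
  from embedding_map_compose[OF this Qs(3)]
  have emb: "embedding_map (man_top S) (man_top M) ?R"
    by (rule embedding_map_eq) simp
  have "inj_on (differential M ?R) (tangent_space S x)" if x: "x \<in> points S" for x
  proof (rule inj_onI)
    fix v w assume v: "v \<in> tangent_space S x" and w: "w \<in> tangent_space S x" and eq: "differential M ?R v = differential M ?R w"
    have *: "differential M ?R u = differential M Q (differential S \<psi> u)" if "u \<in> tangent_space S x" for u
      unfolding differential_compose[OF S M Qs(1)] by (rule differential_cong_points[OF S x that]) simp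
    have "differential S \<psi> v = differential S \<psi> w"
      using eq Qs(4)[OF \<psi>s(5)[OF x]] differential_tangent[OF S S \<psi>s(1) v] differential_tangent[OF S S \<psi>s(1) w]
      unfolding *[OF v] *[OF w] by (auto dest: inj_onD)
    then have "differential S (inv_into (points S) \<psi>) (differential S \<psi> v) = differential S (inv_into (points S) \<psi>) (differential S \<psi> w)"
      by simp
    moreover have "differential S (inv_into (points S) \<psi>) (differential S \<psi> u) = u" if u: "u \<in> tangent_space S x" for u
    proof -
      have "differential S (inv_into (points S) \<psi>) (differential S \<psi> u) = differential S (\<lambda>x. x) u"
        unfolding differential_compose[OF S S \<psi>s(3)]
        by (rule differential_cong_points[OF S x u]) (rule \<psi>s(8))
      then show ?thesis using differential_id[OF u] by simp
    qed
    ultimately show "v = w" using v w by simp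
  qed
  then show ?thesis using sm emb by (simp add: embeddings_def)
qed

context
  fixes S :: "('s, 'es::euclidean_space) manifold_struct"
    and \<mu> :: "'s \<Rightarrow> ('es \<Rightarrow> 's tangent) \<Rightarrow> real"
    and M :: "('m, 'em::euclidean_space) manifold_struct"
    and G :: "('g, 'eg::euclidean_space) lie_struct"
  assumes S: "smooth_manifold S" and cpt: "compact_space (man_top S)" and \<mu>: "volume_form S \<mu>"
    and M: "smooth_manifold M" and G: "lie_group G"
begin

abbreviation (input) "GM \<equiv> lie_man G"
abbreviation (input) "AUT \<equiv> aut_group S G"

lemma GM: "smooth_manifold GM" by (rule lie_group_manifold[OF G])

lemma aut_carrierD:
  assumes "h \<in> carrier AUT"
  shows "fst h \<in> diffeos S" "snd h \<in> smooth_maps S GM" "smooth_map S GM (snd h)"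
    "x \<in> points S \<Longrightarrow> snd h x \<in> carrier G"
  using assms smooth_maps_carrier[OF S G, of "snd h" x] by (auto simp: aut_group_def smooth_maps_def)

lemma Q_KKD:
  assumes "q \<in> Q_KK S M G"
  shows "fst q \<in> embeddings S M" "smooth_map S M (fst q)" "smooth_map S GM (snd q)"
    "fst q \<in> extensional (points S)" "snd q \<in> extensional (points S)"
    "x \<in> points S \<Longrightarrow> fst q x \<in> points M" "x \<in> points S \<Longrightarrow> snd q x \<in> carrier G"
proof -
  show *: "fst q \<in> embeddings S M" "smooth_map S GM (snd q)" "snd q \<in> extensional (points S)"
    using assms by (auto simp: Q_KK_def smooth_maps_def)
  show "smooth_map S M (fst q)" "fst q \<in> extensional (points S)" using embeddingsD[OF *(1)] by auto
  then show "x \<in> points S \<Longrightarrow> fst q x \<in> points M" using smooth_map_points by metis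
  show "x \<in> points S \<Longrightarrow> snd q x \<in> carrier G" using smooth_map_points[OF *(2)] lie_group_points[OF G] by simp
qed

lemma act_Q_in:
  assumes q: "q \<in> Q_KK S M G" and h: "h \<in> carrier AUT"
  shows "act_Q S G q h \<in> Q_KK S M G"
  using embedding_diffeo[OF S M Q_KKD(1)[OF q] aut_carrierD(1)[OF h]]
    smooth_maps_restrict[OF S GM smooth_map_lie_mult[OF G S smooth_map_compose[OF S S GM diffeosD(1)[OF aut_carrierD(1)[OF h]] Q_KKD(3)[OF q]] aut_carrierD(3)[OF h]]]
  by (simp add: Q_KK_def act_Q_def case_prod_unfold)

lemma act_Q_one: "q \<in> Q_KK S M G \<Longrightarrow> act_Q S G q \<one>\<^bsub>AUT\<^esub> = q"
  using Q_KKD[of q] monoid.r_one[OF group.is_monoid[OF lie_group_group[OF G]]]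
  by (auto simp: act_Q_def aut_group_def case_prod_unfold extensional_def fun_eq_iff intro!: prod_eqI)

lemma act_Q_mult:
  assumes q: "q \<in> Q_KK S M G" and h: "h \<in> carrier AUT" and k: "k \<in> carrier AUT"
  shows "act_Q S G q (h \<otimes>\<^bsub>AUT\<^esub> k) = act_Q S G (act_Q S G q h) k"
  using diffeosD(5)[OF aut_carrierD(1)[OF k]] diffeosD(5)[OF aut_carrierD(1)[OF h]]
    aut_carrierD(4)[OF k] aut_carrierD(4)[OF h] Q_KKD(7)[OF q] monoid.m_assoc[OF group.is_monoid[OF lie_group_group[OF G]]]
  by (auto simp: act_Q_def aut_group_def case_prod_unfold fun_eq_iff)

lemma tangent_QD:
  assumes "v \<in> tangent_Q S M G q"
  shows "fst v \<in> vector_fields_along S M (fst q)" "snd v \<in> vector_fields_along S GM (snd q)"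
    "fst v \<in> extensional (points S)" "snd v \<in> extensional (points S)"
    "x \<in> points S \<Longrightarrow> fst v x \<in> tangent_space M (fst q x)" "x \<in> points S \<Longrightarrow> snd v x \<in> tangent_space GM (snd q x)"
proof -
  show *: "fst v \<in> vector_fields_along S M (fst q)" "snd v \<in> vector_fields_along S GM (snd q)"
    using assms by (auto simp: tangent_Q_def)
  show "fst v \<in> extensional (points S)" "x \<in> points S \<Longrightarrow> fst v x \<in> tangent_space M (fst q x)"
    using *(1) by (simp_all add: vector_fields_along_def)
  show "snd v \<in> extensional (points S)" "x \<in> points S \<Longrightarrow> snd v x \<in> tangent_space GM (snd q x)"
    using *(2) by (simp_all add: vector_fields_along_def)
qed

lemma tangent_act_in:
  assumes q: "q \<in> Q_KK S M G" and v: "v \<in> tangent_Q S M G q" and h: "h \<in> carrier AUT"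
  shows "tangent_act_Q S G v h \<in> tangent_Q S M G (act_Q S G q h)"
proof -
  note hD = aut_carrierD[OF h] and qD = Q_KKD[OF q] and vD = tangent_QD[OF v]
  note \<psi> = diffeosD(1)[OF hD(1)]
  have 1: "(\<lambda>x\<in>points S. fst v (fst h x)) \<in> vector_fields_along S M (\<lambda>x. fst q (fst h x))"
    by (rule vector_field_compose[OF S S M qD(2) \<psi> vD(1)])
  have 2: "(\<lambda>x\<in>points S. snd v (fst h x)) \<in> vector_fields_along S GM (\<lambda>x. snd q (fst h x))"
    by (rule vector_field_compose[OF S S GM qD(3) \<psi> vD(2)])
  have "(\<lambda>x\<in>points S. right_translate G ((\<lambda>x\<in>points S. snd v (fst h x)) x) (snd h x)) \<in>
      vector_fields_along S GM (\<lambda>x. snd q (fst h x) \<otimes>\<^bsub>G\<^esub> snd h x)"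
    by (rule right_translate_field[OF G S smooth_map_compose[OF S S GM \<psi> qD(3)] hD(3) 2])
  moreover have "(\<lambda>x\<in>points S. right_translate G ((\<lambda>x\<in>points S. snd v (fst h x)) x) (snd h x)) =
      (\<lambda>x\<in>points S. right_translate G (snd v (fst h x)) (snd h x))" by auto
  ultimately have 3: "(\<lambda>x\<in>points S. right_translate G (snd v (fst h x)) (snd h x)) \<in>
      vector_fields_along S GM (\<lambda>x. snd q (fst h x) \<otimes>\<^bsub>G\<^esub> snd h x)" by simp
  have e1: "vector_fields_along S M (\<lambda>x. fst q (fst h x)) = vector_fields_along S M (fst (act_Q S G q h))"
    by (rule vector_fields_along_cong) (simp add: act_Q_def case_prod_unfold)
  have e2: "vector_fields_along S GM (\<lambda>x. snd q (fst h x) \<otimes>\<^bsub>G\<^esub> snd h x) = vector_fields_along S GM (snd (act_Q S G q h))"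
    by (rule vector_fields_along_cong) (simp add: act_Q_def case_prod_unfold)
  show ?thesis using 1 3 unfolding e1 e2 by (simp add: tangent_Q_def tangent_act_Q_def case_prod_unfold)
qed

lemma tangent_act_one:
  assumes q: "q \<in> Q_KK S M G" and v: "v \<in> tangent_Q S M G q"
  shows "tangent_act_Q S G v \<one>\<^bsub>AUT\<^esub> = v"
proof -
  have "right_translate G (snd v x) \<one>\<^bsub>G\<^esub> = snd v x" if "x \<in> points S" for x
    by (rule right_translate_one[OF G Q_KKD(7)[OF q that] tangent_QD(6)[OF v that]])
  then show ?thesis
    by (auto simp: tangent_act_Q_def aut_group_def case_prod_unfold
        intro!: prod_eqI extensionalityI[of _ "points S"] tangent_QD(3,4)[OF v])
qed

lemma tangent_act_mult:
  assumes q: "q \<in> Q_KK S M G" and v: "v \<in> tangent_Q S M G q" and h: "h \<in> carrier AUT" and k: "k \<in> carrier AUT"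
  shows "tangent_act_Q S G v (h \<otimes>\<^bsub>AUT\<^esub> k) = tangent_act_Q S G (tangent_act_Q S G v h) k"
proof -
  note pts = diffeosD(5)[OF aut_carrierD(1)[OF k]] diffeosD(5)[OF aut_carrierD(1)[OF h]]
  have "right_translate G (right_translate G (snd v (fst h (fst k x))) (snd h (fst k x))) (snd k x) =
      right_translate G (snd v (fst h (fst k x))) (snd h (fst k x) \<otimes>\<^bsub>G\<^esub> snd k x)" if "x \<in> points S" for x
    using that pts by (intro right_translate_mult[OF G Q_KKD(7)[OF q] aut_carrierD(4)[OF h] aut_carrierD(4)[OF k] tangent_QD(6)[OF v]]) auto
  then show ?thesis
    using pts by (auto simp: tangent_act_Q_def aut_group_def case_prod_unfold intro!: restrict_ext)
qed

section \<open>Pairings and the momentum map\<close>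

lemma cotangent_QD:
  assumes "a \<in> cotangent_Q S M G q"
  shows "fst a \<in> covector_fields_along S M (fst q)" "snd a \<in> covector_fields_along S GM (snd q)"
    "fst a \<in> extensional (points S)" "snd a \<in> extensional (points S)"
    "x \<in> points S \<Longrightarrow> fst a x \<in> cotangent_space M (fst q x)" "x \<in> points S \<Longrightarrow> snd a x \<in> cotangent_space GM (snd q x)"
proof -
  show *: "fst a \<in> covector_fields_along S M (fst q)" "snd a \<in> covector_fields_along S GM (snd q)"
    using assms by (auto simp: cotangent_Q_def)
  show "fst a \<in> extensional (points S)" "x \<in> points S \<Longrightarrow> fst a x \<in> cotangent_space M (fst q x)"
    using *(1) by (simp_all add: covector_fields_along_def)
  show "snd a \<in> extensional (points S)" "x \<in> points S \<Longrightarrow> snd a x \<in> cotangent_space GM (snd q x)"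
    using *(2) by (simp_all add: covector_fields_along_def)
qed

abbreviation (input) "integrand a v \<equiv> \<lambda>x. fst a x (fst v x) + snd a x (snd v x)"

lemma pairing_eq: "pairing_Q S \<mu> a v = form_integral S \<mu> (integrand a v)"
  by (simp add: pairing_Q_def case_prod_unfold)

lemma integrand_smooth:
  assumes q: "q \<in> Q_KK S M G" and a: "a \<in> cotangent_Q S M G q" and v: "v \<in> tangent_Q S M G q"
  shows "integrand a v \<in> smooth_funs S"
  using cotangent_QD(1,2)[OF a] tangent_QD(1,2)[OF v]
  unfolding covector_fields_along_iff[OF S M Q_KKD(2)[OF q]] covector_fields_along_iff[OF S GM Q_KKD(3)[OF q]]
  by (intro smooth_funs_add[OF S]) blast+

text \<open>The tangent vector at \<open>q\<close> generated by an infinitesimal automorphism \<open>(u, \<nu>)\<close> of \<open>M \<times> \<O>\<close>.\<close>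

definition generator :: "('s \<Rightarrow> 'm) \<times> ('s \<Rightarrow> 'g) \<Rightarrow> ('m \<Rightarrow> 'm tangent) \<times> ('m \<Rightarrow> 'g tangent)
    \<Rightarrow> ('s \<Rightarrow> 'm tangent) \<times> ('s \<Rightarrow> 'g tangent)" where
  "generator q w = (\<lambda>x\<in>points S. fst w (fst q x), \<lambda>x\<in>points S. right_translate G (snd w (fst q x)) (snd q x))"

lemma one_in: "\<one>\<^bsub>G\<^esub> \<in> points GM"
  using lie_group_points[OF G] monoid.one_closed[OF group.is_monoid[OF lie_group_group[OF G]]] by simp

lemma one_mult: "g \<in> carrier G \<Longrightarrow> \<one>\<^bsub>G\<^esub> \<otimes>\<^bsub>G\<^esub> g = g"
  using monoid.l_one[OF group.is_monoid[OF lie_group_group[OF G]]] .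

lemma lie_algebra_mapsD:
  assumes "\<nu> \<in> lie_algebra_maps M G" "x \<in> points M"
  shows "\<nu> x \<in> lie_algebra G"
  using assms by (simp add: lie_algebra_maps_def vector_fields_along_def lie_algebra_def)

lemma generator_in:
  assumes q: "q \<in> Q_KK S M G" and w: "w \<in> vector_fields M \<times> lie_algebra_maps M G"
  shows "generator q w \<in> tangent_Q S M G q"
proof -
  note qD = Q_KKD[OF q]
  have 1: "(\<lambda>x\<in>points S. fst w (fst q x)) \<in> vector_fields_along S M (fst q)"
    using vector_field_compose[OF S M M smooth_map_id[OF M] qD(2), of "fst w"] w by auto
  have "(\<lambda>x\<in>points S. snd w (fst q x)) \<in> vector_fields_along S GM (\<lambda>x. \<one>\<^bsub>G\<^esub>)"
    using vector_field_compose[OF S M GM smooth_map_const[OF M GM one_in] qD(2), of "snd w"] w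
    by (auto simp: lie_algebra_maps_def)
  from right_translate_field[OF G S smooth_map_const[OF S GM one_in] qD(3) this]
  have "(\<lambda>x\<in>points S. right_translate G ((\<lambda>x\<in>points S. snd w (fst q x)) x) (snd q x)) \<in>
     vector_fields_along S GM (\<lambda>x. \<one>\<^bsub>G\<^esub> \<otimes>\<^bsub>G\<^esub> snd q x)" .
  moreover have "vector_fields_along S GM (\<lambda>x. \<one>\<^bsub>G\<^esub> \<otimes>\<^bsub>G\<^esub> snd q x) = vector_fields_along S GM (snd q)"
    by (rule vector_fields_along_cong) (simp add: one_mult qD(7))
  moreover have "(\<lambda>x\<in>points S. right_translate G ((\<lambda>x\<in>points S. snd w (fst q x)) x) (snd q x)) =
     (\<lambda>x\<in>points S. right_translate G (snd w (fst q x)) (snd q x))" by auto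
  ultimately show ?thesis using 1 by (simp add: generator_def tangent_Q_def)
qed

text \<open>Right trivialization is adjoint to right translation, so the momentum is the pairing
  with a tangent vector at q. Level sets, invariance and injectivity then all concern this one
  pairing.\<close>

lemma momentum_map_eq:
  assumes q: "q \<in> Q_KK S M G" and w: "w \<in> vector_fields M \<times> lie_algebra_maps M G"
  shows "momentum_map_L S \<mu> M G (q, a) w = pairing_Q S \<mu> a (generator q w)"
proof -
  have "momentum_map_L S \<mu> M G (q, a) w =
      form_integral S \<mu> (\<lambda>x. fst a x (fst w (fst q x)) + right_trivialize G (snd a x) (snd q x) (snd w (fst q x)))"
    using w by (auto simp: momentum_map_L_def case_prod_unfold)
  also have "\<dots> = pairing_Q S \<mu> a (generator q w)"
    unfolding pairing_eq
    by (rule form_integral_cong[OF S cpt \<mu>])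
      (use w Q_KKD(6)[OF q] lie_algebra_mapsD[of "snd w"] in \<open>auto simp: generator_def right_trivialize_def\<close>)
  finally show ?thesis .
qed

lemma momentum_map_eq_iff:
  assumes q: "q \<in> Q_KK S M G" and q': "q' \<in> Q_KK S M G"
  shows "momentum_map_L S \<mu> M G (q, a) = momentum_map_L S \<mu> M G (q', a') \<longleftrightarrow>
    (\<forall>w\<in>vector_fields M \<times> lie_algebra_maps M G. pairing_Q S \<mu> a (generator q w) = pairing_Q S \<mu> a' (generator q' w))"
proof
  assume "momentum_map_L S \<mu> M G (q, a) = momentum_map_L S \<mu> M G (q', a')"
  then show "\<forall>w\<in>vector_fields M \<times> lie_algebra_maps M G. pairing_Q S \<mu> a (generator q w) = pairing_Q S \<mu> a' (generator q' w)"
    using momentum_map_eq[OF q] momentum_map_eq[OF q'] by metis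
next
  assume *: "\<forall>w\<in>vector_fields M \<times> lie_algebra_maps M G. pairing_Q S \<mu> a (generator q w) = pairing_Q S \<mu> a' (generator q' w)"
  show "momentum_map_L S \<mu> M G (q, a) = momentum_map_L S \<mu> M G (q', a')"
  proof
    fix w
    show "momentum_map_L S \<mu> M G (q, a) w = momentum_map_L S \<mu> M G (q', a') w"
    proof (cases "w \<in> vector_fields M \<times> lie_algebra_maps M G")
      case True
      show ?thesis using bspec[OF * True] momentum_map_eq[OF q True] momentum_map_eq[OF q' True] by metis
    next
      case False
      then show ?thesis unfolding momentum_map_L_def case_prod_unfold by (simp only: restrict_apply if_False)
    qed
  qed
qed

text \<open>
  A bump function on \<open>M\<close> concentrated near \<open>q x0\<close> detects the value of a function at \<open>x0\<close>, because \<open>q\<close> is a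
  topological embedding.
\<close>

lemma integral_bump_nonzero:
  assumes Q: "Q \<in> embeddings S M" and c: "c \<in> smooth_funs S" and x0: "x0 \<in> points S" "c x0 \<noteq> 0"
    and W: "openin (man_top M) W" "Q x0 \<in> W"
  obtains ch A where "ch \<in> smooth_funs M" "closedin (man_top M) A" "A \<subseteq> W" "\<And>p. p \<notin> A \<Longrightarrow> ch p = 0"
    "form_integral S \<mu> (\<lambda>x. ch (Q x) * c x) \<noteq> 0"
proof -
  note Qs = embeddingsD[OF Q]
  \<comment> \<open>The neighbourhood of \<open>x0\<close> on which c keeps its sign, so that no
    cancellation can occur in the integral.\<close>
  let ?N = "{x \<in> points S. c x \<in> {y. y * sgn (c x0) > 0}}"
  have cc: "continuous_map (man_top S) euclidean c"
    by (rule smooth_imp_continuous_map[OF S]) (use c in \<open>simp add: smooth_funs_iff[OF S]\<close>)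
  have "open {y :: real. y * sgn (c x0) > 0}"
    by (intro open_Collect_less continuous_intros)
  then have "openin (man_top S) ?N" by (intro openin_continuous_map_preimage[OF cc]) (simp only: open_openin)
  then have "openin (subtopology (man_top M) (Q ` points S)) (Q ` ?N)"
    using Qs(3) homeomorphic_map_openness[of "man_top S" _ Q ?N] unfolding embedding_map_def by auto
  \<comment> \<open>Here the topological embedding enters: the open set W' of M meets the image of Q
    only in the image of \<open>?N\<close>, so other sheets of Q cannot come near
    \<open>Q x0\<close>.\<close>
  then obtain W' where W': "openin (man_top M) W'" "Q ` ?N = W' \<inter> Q ` points S"
    by (auto simp: openin_subtopology)
  have in_N: "x \<in> ?N" if "x \<in> points S" "Q x \<in> W'" for x
  proof -
    have "Q x \<in> Q ` ?N" using W'(2) that by auto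
    then obtain z where "z \<in> ?N" "Q x = Q z" by auto
    then show ?thesis using embedding_inj[OF Q] that(1) by (auto simp: inj_on_def)
  qed
  have "x0 \<in> ?N" using x0 by (auto simp: sgn_if)
  then have "Q x0 \<in> W'" using W'(2) by blast
  then have "Q x0 \<in> W \<inter> W'" using W(2) by blast
  then obtain ch :: "'m \<Rightarrow> real" and A where ch: "ch \<in> smooth_funs M" "\<And>p. 0 \<le> ch p" "eventually (\<lambda>p. ch p = 1) (nhdsin (man_top M) (Q x0))"
    "closedin (man_top M) A" "A \<subseteq> W \<inter> W'" "\<And>p. p \<notin> A \<Longrightarrow> ch p = 0"
    using manifold_bump_exists[OF M openin_Int[OF W(1) W'(1)]] by metis
  have sm: "(\<lambda>x. ch (Q x) * c x) \<in> smooth_funs S"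
    by (rule smooth_funs_mult[OF S smooth_funs_compose[OF S M Qs(1) ch(1)] c])
  \<comment> \<open>The sign makes the integrand nonnegative. The summand with coefficient 0 only
    brings it into the form of \<open>form_integral_lincomb\<close>.\<close>
  have "form_integral S \<mu> (\<lambda>x. sgn (c x0) * (ch (Q x) * c x) + 0 * (ch (Q x) * c x)) > 0"
  proof (rule form_integral_pos[OF S cpt \<mu> smooth_funs_lincomb[OF S sm sm] _ x0(1)])
    fix x assume x: "x \<in> points S"
    show "0 \<le> sgn (c x0) * (ch (Q x) * c x) + 0 * (ch (Q x) * c x)"
    proof (cases "Q x \<in> A")
      case True
      then have "c x * sgn (c x0) > 0" using in_N[OF x] ch(5) by auto
      then have "0 \<le> ch (Q x) * (c x * sgn (c x0))" by (intro mult_nonneg_nonneg[OF ch(2)] less_imp_le)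
      moreover have "sgn (c x0) * (ch (Q x) * c x) + 0 * (ch (Q x) * c x) = ch (Q x) * (c x * sgn (c x0))"
        by (simp add: mult_ac)
      ultimately show ?thesis by (simp only:)
    qed (simp add: ch(6))
  next
    have "ch (Q x0) = 1" by (rule eventually_nhdsin_self[OF ch(3) smooth_map_points[OF Qs(1) x0(1)]])
    then show "0 < sgn (c x0) * (ch (Q x0) * c x0) + 0 * (ch (Q x0) * c x0)" using x0(2) by (simp add: sgn_if)
  qed
  then have "form_integral S \<mu> (\<lambda>x. ch (Q x) * c x) \<noteq> 0"
    unfolding form_integral_lincomb[OF S cpt \<mu> sm sm] by auto
  then show ?thesis using that[of ch A] ch by blast
qed

text \<open>A constant direction \<xi> with a scalar coefficient, so smoothness is that of
  \<open>ch\<close>. The coefficient is specialized to 0, to 1 and to a bump function.\<close>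

lemma constant_field:
  assumes \<xi>: "\<xi> \<in> tangent_space GM \<one>\<^bsub>G\<^esub>" and N: "smooth_manifold N" and ch: "ch \<in> smooth_funs N"
  shows "(\<lambda>x\<in>points N. \<lambda>f. ch x * \<xi> f) \<in> vector_fields_along N GM (\<lambda>x. \<one>\<^bsub>G\<^esub>)"
  unfolding vector_fields_along_iff[OF N GM smooth_map_const[OF N GM one_in]]
proof (intro conjI ballI)
  fix x assume "x \<in> points N"
  then show "(\<lambda>x\<in>points N. \<lambda>f. ch x * \<xi> f) x \<in> tangent_space GM \<one>\<^bsub>G\<^esub>"
    using tangent_combine[OF GM \<xi> tangent_zero, of "ch x" 0] by simp
next
  fix f assume "f \<in> smooth_funs GM"
  have "(\<lambda>x. ch x * \<xi> f) \<in> smooth_funs N" by (rule smooth_funs_mult[OF N ch smooth_funs_const[OF N]])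
  then show "(\<lambda>x. (\<lambda>x\<in>points N. \<lambda>f. ch x * \<xi> f) x f) \<in> smooth_funs N"
    by (rule smooth_funs_cong[OF N]) simp
qed simp

text \<open>A non-zero component in M is detected by a cut-off coordinate field, a non-zero
  component in the group by a constant Lie algebra element. Multiplying the test pair by a bump
  function multiplies the integrand by it, and \<open>integral_bump_nonzero\<close> applies.\<close>

lemma momentum_local_nonzero:
  assumes q: "q \<in> Q_KK S M G" and a: "a \<in> cotangent_Q S M G q" and x0: "x0 \<in> points S"
    and nz: "fst a x0 \<noteq> (\<lambda>_. 0) \<or> snd a x0 \<noteq> (\<lambda>_. 0)" and W: "openin (man_top M) W" "fst q x0 \<in> W"
  obtains w where "w \<in> vector_fields M \<times> lie_algebra_maps M G" "pairing_Q S \<mu> a (generator q w) \<noteq> 0"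
    "\<And>p. p \<in> points M \<Longrightarrow> p \<notin> W \<Longrightarrow> fst w p = (\<lambda>f. 0) \<and> snd w p = (\<lambda>f. 0)"
proof -
  note qD = Q_KKD[OF q] and aD = cotangent_QD[OF a]
  note Qx0 = qD(6)[OF x0]
  have zero_la: "(\<lambda>x\<in>points M. \<lambda>f. 0) \<in> lie_algebra_maps M G"
    using constant_field[OF tangent_zero M smooth_funs_const[OF M, of 0]] by (simp add: lie_algebra_maps_def)
  have zero_vf: "(\<lambda>x\<in>points M. \<lambda>f. 0) \<in> vector_fields M"
    unfolding vector_fields_along_iff[OF M M smooth_map_id[OF M]]
    using smooth_funs_cong[OF M smooth_funs_const[OF M, of 0]] by (auto simp: tangent_zero)
  have rt0: "right_translate G (\<lambda>f. 0) g = (\<lambda>f. 0)" for g by (auto simp: right_translate_def differential_def)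
  show ?thesis
  proof (cases "fst a x0 = (\<lambda>_. 0)")
    case False
    then obtain v where "fst a x0 v \<noteq> 0" by auto
    obtain e where e: "e \<in> atlas M" "fst q x0 \<in> fst e" using atlas_cover[OF M Qx0] .
    obtain b where b: "b \<in> axes M" "fst a x0 (coord_vector M e (fst q x0) b) \<noteq> 0"
      using cotangent_nonzero_chart[where l = "fst a x0" and v = v, OF M e aD(5)[OF x0] \<open>fst a x0 v \<noteq> 0\<close>] .
    obtain ch1 :: "'m \<Rightarrow> real" and A1 where ch1: "ch1 \<in> smooth_funs M" "eventually (\<lambda>x. ch1 x = 1) (nhdsin (man_top M) (fst q x0))"
      "closedin (man_top M) A1" "A1 \<subseteq> fst e" "\<And>x. x \<notin> A1 \<Longrightarrow> ch1 x = 0"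
      using manifold_bump_exists[OF M chart_open[OF M e(1)] e(2)] by metis
    let ?F = "frame_field M e ch1 b"
    have F: "?F \<in> vector_fields M" by (rule frame_field_in[OF M e(1) ch1(1,3-5)])
    \<comment> \<open>The integrand before localization, to which the bump function will be
      applied.\<close>
    define c where "c x = fst a x ((\<lambda>x\<in>points S. ?F (fst q x)) x)" for x
    have c: "c \<in> smooth_funs S"
      using aD(1) vector_field_compose[OF S M M smooth_map_id[OF M] qD(2) F]
      unfolding covector_fields_along_iff[OF S M qD(2)] c_def[abs_def] by blast
    have "ch1 (fst q x0) = 1" by (rule eventually_nhdsin_self[OF ch1(2) Qx0])
    then have "c x0 \<noteq> 0" using b e x0 Qx0 by (simp add: c_def frame_field_def)
    then obtain ch A where ch: "ch \<in> smooth_funs M" "closedin (man_top M) A" "A \<subseteq> W" "\<And>p. p \<notin> A \<Longrightarrow> ch p = 0"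
      "form_integral S \<mu> (\<lambda>x. ch (fst q x) * c x) \<noteq> 0"
      using integral_bump_nonzero[OF qD(1) c x0 _ W] by metis
    \<comment> \<open>\<open>ch1\<close> makes the coordinate field global, and \<open>ch\<close>
      confines it to W and controls the sign of the integrand.\<close>
    define w where "w = (frame_field M e (\<lambda>p. ch p * ch1 p) b, \<lambda>x\<in>points M. (\<lambda>f. 0) :: 'g tangent)"
    have w_in: "w \<in> vector_fields M \<times> lie_algebra_maps M G"
      unfolding w_def using frame_field_in[OF M e(1) smooth_funs_mult[OF M ch(1) ch1(1)] ch1(3,4), of b] ch1(5) zero_la by simp
    have "pairing_Q S \<mu> a (generator q w) = form_integral S \<mu> (\<lambda>x. ch (fst q x) * c x)"
      unfolding pairing_eq
    proof (rule form_integral_cong[OF S cpt \<mu>])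
      fix x assume x: "x \<in> points S"
      have F': "?F (fst q x) \<in> tangent_space M (fst q x)"
        using F qD(6)[OF x] by (simp add: vector_fields_along_def)
      have "fst w (fst q x) = (\<lambda>f. ch (fst q x) * ?F (fst q x) f)"
        using qD(6)[OF x] by (auto simp: w_def frame_field_def fun_eq_iff)
      then have "fst a x (fst w (fst q x)) = ch (fst q x) * fst a x (?F (fst q x))"
        using cotangent_scale[OF aD(5)[OF x] F'] by simp
      moreover have "snd a x (\<lambda>f. 0) = 0" by (rule cotangent_zero_vector[OF aD(6)[OF x]])
      ultimately show "integrand a (generator q w) x = ch (fst q x) * c x"
        using x qD(6)[OF x] by (simp add: generator_def c_def w_def rt0)
    qed
    then have "pairing_Q S \<mu> a (generator q w) \<noteq> 0" using ch(5) by simp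
    moreover have "fst w p = (\<lambda>f. 0) \<and> snd w p = (\<lambda>f. 0)" if "p \<in> points M" "p \<notin> W" for p
    proof -
      have "ch p = 0" using ch(3,4) that by blast
      then show ?thesis using that by (auto simp: w_def frame_field_def)
    qed
    ultimately show ?thesis using that[OF w_in] by blast
  next
    case True
    then obtain v where v: "snd a x0 v \<noteq> 0" using nz by auto
    then have vT: "v \<in> tangent_space GM (snd q x0)" using cotangent_outside[OF aD(6)[OF x0]] by blast
    let ?g = "snd q x0"
    have g: "?g \<in> carrier G" by (rule qD(7)[OF x0])
    have gi: "inv\<^bsub>G\<^esub> ?g \<in> carrier G" using g group.inv_closed[OF lie_group_group[OF G]] by blast
    \<comment> \<open>The vector v is moved to the identity, so that right translation by
      \<open>snd q x0\<close> returns it and the covector is non-zero on the generator at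
      \<open>x0\<close>.\<close>
    define \<xi> where "\<xi> = right_translate G v (inv\<^bsub>G\<^esub> ?g)"
    have \<xi>: "\<xi> \<in> tangent_space GM \<one>\<^bsub>G\<^esub>"
      using right_translate_tangent[OF G gi vT] group.r_inv[OF lie_group_group[OF G] g] by (simp add: \<xi>_def)
    have \<xi>v: "right_translate G \<xi> ?g = v"
      unfolding \<xi>_def right_translate_mult[OF G g gi g vT] group.l_inv[OF lie_group_group[OF G] g]
      by (rule right_translate_one[OF G g vT])
    have la: "(\<lambda>x\<in>points M. \<lambda>f. ch x * \<xi> f) \<in> lie_algebra_maps M G" if "ch \<in> smooth_funs M" for ch
      using constant_field[OF \<xi> M that] by (simp add: lie_algebra_maps_def)
    define w1 where "w1 = (\<lambda>x\<in>points M. (\<lambda>f. 0) :: 'm tangent, \<lambda>x\<in>points M. \<lambda>f. 1 * \<xi> f)"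
    have w1: "w1 \<in> vector_fields M \<times> lie_algebra_maps M G"
      using zero_vf la[OF smooth_funs_const[OF M, of 1]] by (simp add: w1_def)
    define c where "c = integrand a (generator q w1)"
    have c: "c \<in> smooth_funs S" unfolding c_def by (rule integrand_smooth[OF q a generator_in[OF q w1]])
    have c_eq: "c x = snd a x (right_translate G \<xi> (snd q x))" if x: "x \<in> points S" for x
      using qD(6)[OF x] x cotangent_zero_vector[OF aD(5)[OF x]] by (simp add: c_def generator_def w1_def)
    then have "c x0 \<noteq> 0" using v x0 by (simp add: \<xi>v)
    then obtain ch A where ch: "ch \<in> smooth_funs M" "closedin (man_top M) A" "A \<subseteq> W" "\<And>p. p \<notin> A \<Longrightarrow> ch p = 0"
      "form_integral S \<mu> (\<lambda>x. ch (fst q x) * c x) \<noteq> 0"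
      using integral_bump_nonzero[OF qD(1) c x0 _ W] by metis
    define w where "w = (\<lambda>x\<in>points M. (\<lambda>f. 0) :: 'm tangent, \<lambda>x\<in>points M. \<lambda>f. ch x * \<xi> f)"
    have w_in: "w \<in> vector_fields M \<times> lie_algebra_maps M G" using zero_vf la[OF ch(1)] by (simp add: w_def)
    have "pairing_Q S \<mu> a (generator q w) = form_integral S \<mu> (\<lambda>x. ch (fst q x) * c x)"
      unfolding pairing_eq
    proof (rule form_integral_cong[OF S cpt \<mu>])
      fix x assume x: "x \<in> points S"
      have T: "right_translate G \<xi> (snd q x) \<in> tangent_space GM (snd q x)"
        using right_translate_tangent[OF G qD(7)[OF x] \<xi>] one_mult[OF qD(7)[OF x]] by simp
      have "right_translate G (\<lambda>f. ch (fst q x) * \<xi> f) (snd q x) = (\<lambda>f. ch (fst q x) * right_translate G \<xi> (snd q x) f)"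
        using right_translate_combine[OF G, of "ch (fst q x)" \<xi> 0 "\<lambda>f. 0"] by simp
      then have "snd a x (right_translate G (\<lambda>f. ch (fst q x) * \<xi> f) (snd q x)) = ch (fst q x) * c x"
        using cotangent_scale[OF aD(6)[OF x] T] by (simp add: c_eq[OF x])
      then show "integrand a (generator q w) x = ch (fst q x) * c x"
        using x qD(6)[OF x] cotangent_zero_vector[OF aD(5)[OF x]] by (simp add: generator_def w_def)
    qed
    then have "pairing_Q S \<mu> a (generator q w) \<noteq> 0" using ch(5) by simp
    moreover have "fst w p = (\<lambda>f. 0) \<and> snd w p = (\<lambda>f. 0)" if "p \<in> points M" "p \<notin> W" for p
    proof -
      have "ch p = 0" using ch(3,4) that by blast
      then show ?thesis using that by (auto simp: w_def)
    qed
    ultimately show ?thesis using that[OF w_in] by blast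
  qed
qed

lemma covector_fields_difference:
  assumes N: "smooth_manifold N" and Q: "smooth_map S N Q"
    and P: "P \<in> covector_fields_along S N Q" and P': "P' \<in> covector_fields_along S N Q"
  shows "(\<lambda>x\<in>points S. \<lambda>v. P x v - P' x v) \<in> covector_fields_along S N Q"
  unfolding covector_fields_along_iff[OF S N Q]
proof (intro conjI ballI)
  fix x assume "x \<in> points S"
  then have "P x \<in> cotangent_space N (Q x)" "P' x \<in> cotangent_space N (Q x)"
    using P P' by (auto simp: covector_fields_along_def)
  then show "(\<lambda>x\<in>points S. \<lambda>v. P x v - P' x v) x \<in> cotangent_space N (Q x)"
    using \<open>x \<in> points S\<close> by (auto simp: cotangent_space_def algebra_simps)
next
  fix V assume "V \<in> vector_fields_along S N Q"
  then have "(\<lambda>x. P x (V x)) \<in> smooth_funs S" "(\<lambda>x. P' x (V x)) \<in> smooth_funs S"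
    using P P' by (auto simp: covector_fields_along_iff[OF S N Q])
  then have "(\<lambda>x. 1 * P x (V x) + (- 1) * P' x (V x)) \<in> smooth_funs S" by (rule smooth_funs_lincomb[OF S])
  then show "(\<lambda>x. (\<lambda>x\<in>points S. \<lambda>v. P x v - P' x v) x (V x)) \<in> smooth_funs S"
    by (rule smooth_funs_cong[OF S]) simp
qed simp

text \<open>The difference of the two covector fields is again a regular covector field at q. Were
  it non-zero at some point, a test pair would detect it; no localization in M is required, so W is
  the whole manifold.\<close>

lemma momentum_injective:
  assumes q: "q \<in> Q_KK S M G" and a: "a \<in> cotangent_Q S M G q" and a': "a' \<in> cotangent_Q S M G q"
    and eq: "\<And>w. w \<in> vector_fields M \<times> lie_algebra_maps M G \<Longrightarrow>
      pairing_Q S \<mu> a (generator q w) = pairing_Q S \<mu> a' (generator q w)"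
  shows "a = a'"
proof (rule ccontr)
  assume ne: "a \<noteq> a'"
  note qD = Q_KKD[OF q] and aD = cotangent_QD[OF a] and a'D = cotangent_QD[OF a']
  define d where "d = (\<lambda>x\<in>points S. \<lambda>v. fst a x v - fst a' x v, \<lambda>x\<in>points S. \<lambda>v. snd a x v - snd a' x v)"
  have d: "d \<in> cotangent_Q S M G q"
    using covector_fields_difference[OF M qD(2) aD(1) a'D(1)] covector_fields_difference[OF GM qD(3) aD(2) a'D(2)]
    by (simp add: d_def cotangent_Q_def)
  have "\<exists>x\<in>points S. fst a x \<noteq> fst a' x \<or> snd a x \<noteq> snd a' x"
  proof (rule ccontr)
    assume "\<not> ?thesis"
    then have "fst a = fst a'" "snd a = snd a'"
      using extensionalityI[OF aD(3) a'D(3)] extensionalityI[OF aD(4) a'D(4)] by auto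
    then show False using ne by (simp add: prod_eq_iff)
  qed
  then obtain x0 where x0: "x0 \<in> points S" "fst a x0 \<noteq> fst a' x0 \<or> snd a x0 \<noteq> snd a' x0" by blast
  then have "fst d x0 \<noteq> (\<lambda>_. 0) \<or> snd d x0 \<noteq> (\<lambda>_. 0)" by (auto simp: d_def fun_eq_iff)
  then obtain w where w: "w \<in> vector_fields M \<times> lie_algebra_maps M G" "pairing_Q S \<mu> d (generator q w) \<noteq> 0"
    using momentum_local_nonzero[OF q d x0(1) _ openin_topspace qD(6)[OF x0(1)]] by metis
  note gw = generator_in[OF q w(1)]
  have "pairing_Q S \<mu> d (generator q w) =
      form_integral S \<mu> (\<lambda>x. 1 * integrand a (generator q w) x + (- 1) * integrand a' (generator q w) x)"
    unfolding pairing_eq by (rule form_integral_cong[OF S cpt \<mu>]) (simp add: d_def)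
  also have "\<dots> = 0"
    unfolding form_integral_lincomb[OF S cpt \<mu> integrand_smooth[OF q a gw] integrand_smooth[OF q a' gw]]
    using eq[OF w(1)] by (simp add: pairing_eq)
  finally show False using w(2) by simp
qed

text \<open>Generators are particular tangent vectors at q. This is the uniqueness behind the
  definite description of the lifted covector.\<close>

lemma pairing_nondegenerate:
  assumes q: "q \<in> Q_KK S M G" and a: "a \<in> cotangent_Q S M G q" and a': "a' \<in> cotangent_Q S M G q"
    and eq: "\<And>v. v \<in> tangent_Q S M G q \<Longrightarrow> pairing_Q S \<mu> a v = pairing_Q S \<mu> a' v"
  shows "a = a'"
  by (rule momentum_injective[OF q a a' eq]) (rule generator_in[OF q])

text \<open>The image of S under the second embedding is compact, hence closed in the Hausdorff
  space M. A point of the first image outside it has a test pair supported in the complement, which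
  the second covector cannot see but the first one can.\<close>

lemma momentum_image_subset:
  assumes q: "q \<in> Q_KK S M G" and a: "a \<in> cotangent_Q S M G q"
    and nz: "\<And>x. x \<in> points S \<Longrightarrow> fst a x \<noteq> (\<lambda>_. 0) \<or> snd a x \<noteq> (\<lambda>_. 0)"
    and q': "q' \<in> Q_KK S M G" and a': "a' \<in> cotangent_Q S M G q'"
    and eq: "\<And>w. w \<in> vector_fields M \<times> lie_algebra_maps M G \<Longrightarrow>
      pairing_Q S \<mu> a (generator q w) = pairing_Q S \<mu> a' (generator q' w)"
  shows "fst q ` points S \<subseteq> fst q' ` points S"
proof (rule ccontr)
  assume "\<not> ?thesis"
  then obtain x0 where x0: "x0 \<in> points S" "fst q x0 \<notin> fst q' ` points S" by auto
  note qD = Q_KKD[OF q] and q'D = Q_KKD[OF q'] and a'D = cotangent_QD[OF a']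
  have "compactin (man_top M) (fst q' ` points S)"
    using cpt image_compactin[OF _ smooth_map_continuous[OF q'D(2)]] by (simp add: compact_space_def)
  then have "closedin (man_top M) (fst q' ` points S)"
    using M compactin_imp_closedin by (auto simp: smooth_manifold_def)
  then have W: "openin (man_top M) (points M - fst q' ` points S)" by (simp add: openin_diff)
  have "fst q x0 \<in> points M - fst q' ` points S" using x0 qD(6) by auto
  then obtain w where w: "w \<in> vector_fields M \<times> lie_algebra_maps M G" "pairing_Q S \<mu> a (generator q w) \<noteq> 0"
    "\<And>p. p \<in> points M \<Longrightarrow> p \<notin> points M - fst q' ` points S \<Longrightarrow> fst w p = (\<lambda>f. 0) \<and> snd w p = (\<lambda>f. 0)"
    using momentum_local_nonzero[OF q a x0(1) nz[OF x0(1)] W] by metis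
  have "pairing_Q S \<mu> a' (generator q' w) = form_integral S \<mu> (\<lambda>x. 0)"
    unfolding pairing_eq
  proof (rule form_integral_cong[OF S cpt \<mu>])
    fix x assume x: "x \<in> points S"
    have "fst w (fst q' x) = (\<lambda>f. 0)" "snd w (fst q' x) = (\<lambda>f. 0)" using w(3)[of "fst q' x"] q'D(6)[OF x] x by auto
    moreover have "right_translate G (\<lambda>f. 0) g = (\<lambda>f. 0)" for g by (auto simp: right_translate_def differential_def)
    ultimately show "integrand a' (generator q' w) x = 0"
      using x cotangent_zero_vector[OF a'D(5)[OF x]] cotangent_zero_vector[OF a'D(6)[OF x]] by (simp add: generator_def)
  qed
  then have "pairing_Q S \<mu> a' (generator q' w) = 0" by (simp add: form_integral_def)
  then show False using w(2) eq[OF w(1)] by simp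
qed

end

section \<open>Comparing two embeddings, the lifted action and its orbits\<close>

section \<open>Smoothness of maps into an embedded submanifold\<close>

text \<open>Embeddings are defined by injectivity on derivations. A coordinate vector in the kernel
  of the derivative gives a derivation with zero image, and independence of the coordinate vectors
  makes its coefficients vanish.\<close>

lemma embedding_derivative_injective:
  assumes S: "smooth_manifold S" and M: "smooth_manifold M" and Q: "Q \<in> embeddings S M"
    and c: "c \<in> atlas S" "y \<in> fst c" and d: "d \<in> atlas M" "Q y \<in> fst d"
    and v: "v \<in> span (axes S)" "frechet_derivative (local_rep (axes S) c (\<lambda>z. snd d (Q z))) (at (snd c y)) v = 0"
  shows "v = 0"
proof -
  note Qs = embeddingsD[OF Q]
  note B = axes_subset[OF S c(1)]
  have fin: "finite (axes S)" using B finite_subset[OF _ finite_Basis] by blast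
  let ?L = "frechet_derivative (local_rep (axes S) c (\<lambda>z. snd d (Q z))) (at (snd c y))"
  have lin: "linear ?L"
    using has_derivative_linear[OF smooth_at_has_derivative[OF transition_smooth[OF S M Qs(1) c d]]] .
  have vsum: "v = (\<Sum>b\<in>axes S. (v \<bullet> b) *\<^sub>R b)" using axes_proj_simps(6)[OF B v(1)] by (simp add: axes_proj_def)
  have "?L v = (\<Sum>b\<in>axes S. (v \<bullet> b) *\<^sub>R ?L b)" by (subst vsum) (simp add: linear_sum[OF lin] linear_scale[OF lin])
  then have "(\<Sum>b\<in>axes S. (v \<bullet> b) *\<^sub>R ?L b) = 0" using v(2) by (simp only:)
  from arg_cong[OF this, of "\<lambda>u. u \<bullet> _"] have zero: "(\<Sum>b\<in>axes S. (v \<bullet> b) * (?L b \<bullet> a)) = 0" for a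
    by (simp add: inner_sum_left)
  define t where "t = (\<lambda>f. \<Sum>b\<in>axes S. (v \<bullet> b) * coord_vector S c y b f)"
  have t: "t \<in> tangent_space S y" unfolding t_def by (rule tangent_space_sum[OF S coord_vector_tangent[OF S c] fin])
  have "differential M Q t = (\<lambda>f. \<Sum>b\<in>axes S. (v \<bullet> b) * differential M Q (coord_vector S c y b) f)"
    by (auto simp: differential_def t_def)
  also have "\<dots> = (\<lambda>f. \<Sum>b\<in>axes S. (v \<bullet> b) * (\<Sum>a\<in>axes M. (?L b \<bullet> a) * coord_vector M d (Q y) a f))"
    unfolding differential_coord_vector[OF S M Qs(1) c d] ..
  also have "\<dots> = (\<lambda>f. \<Sum>a\<in>axes M. (\<Sum>b\<in>axes S. (v \<bullet> b) * (?L b \<bullet> a)) * coord_vector M d (Q y) a f)"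
    unfolding sum_distrib_left sum_distrib_right mult.assoc by (rule ext, rule sum.swap)
  also have "\<dots> = (\<lambda>f. 0)" by (simp add: zero)
  also have "\<dots> = differential M Q (\<lambda>f. 0)" by (auto simp: differential_def)
  finally have "t = (\<lambda>f. 0)"
    using inj_onD[OF Qs(4)[OF chart_points[OF S c]]] t tangent_zero[of S y] by blast
  then have "(\<lambda>f. \<Sum>b\<in>axes S. (v \<bullet> b) * coord_vector S c y b f) = (\<lambda>f. \<Sum>b\<in>axes S. 0 * coord_vector S c y b f)"
    by (simp add: t_def)
  from coord_vector_independent[OF S c this] have "v \<bullet> b = 0" if "b \<in> axes S" for b using that by blast
  then show ?thesis by (subst vsum) simp
qed

text \<open>
  In charts, a left inverse of the derivative turns \<open>Q\<close> into a map with invertible derivative, and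
  the inverse function theorem provides a smooth local left inverse of \<open>Q\<close>.
\<close>

lemma smooth_map_into_embedded:
  assumes T: "smooth_manifold T" and S: "smooth_manifold S" and M: "smooth_manifold M" and Q: "Q \<in> embeddings S M"
    and f: "continuous_map (man_top T) (man_top S) f" and Qf: "smooth_map T M (\<lambda>x. Q (f x))"
  shows "smooth_map T S f"
proof (rule smooth_mapI[OF T S f])
  note Qs = embeddingsD[OF Q]
  fix x assume x: "x \<in> points T"
  have fx: "f x \<in> points S" using f x continuous_map_image_subset_topspace by blast
  obtain c where c: "c \<in> atlas S" "f x \<in> fst c" using atlas_cover[OF S fx] .
  obtain d where d: "d \<in> atlas M" "Q (f x) \<in> fst d" using atlas_cover[OF M smooth_map_points[OF Qs(1) fx]] .
  note B = axes_subset[OF S c(1)]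
  note P = axes_proj_simps[OF B]
  let ?p = "axes_proj (axes S)" and ?y = "snd c (f x)"
  define t where "t = local_rep (axes S) c (\<lambda>z. snd d (Q z))"
  define L where "L = frechet_derivative t (at ?y)"
  have tsm: "smooth_at t ?y" unfolding t_def by (rule transition_smooth[OF S M Qs(1) c d])
  have dt: "(t has_derivative L) (at ?y)" unfolding L_def by (rule smooth_at_has_derivative[OF tsm])
  have linL: "linear L" by (rule has_derivative_linear[OF dt])
  have dp: "(?p has_derivative ?p) F" for F by (rule linear_imp_has_derivative[OF P(3)])
  have py: "?p ?y = ?y" by (rule chart_proj[OF S c])
  have tp: "t (?p z) = t z" for z unfolding t_def by (rule local_rep_proj[OF S c(1)])
  have Lp: "L (?p v) = L v" for v
  proof -
    have "((\<lambda>z. t (?p z)) has_derivative (\<lambda>v. L (?p v))) (at ?y)"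
      by (rule has_derivative_compose[OF dp]) (simp add: py dt)
    then have "(t has_derivative (\<lambda>v. L (?p v))) (at ?y)" by (simp add: tp)
    from has_derivative_unique[OF this dt] show ?thesis by metis
  qed
  have "inj_on L (span (axes S))"
    using linear_injective_on_subspace_0[OF linL subspace_span]
      embedding_derivative_injective[OF S M Q c d] unfolding L_def t_def by blast
  \<comment> \<open>L is injective only on the span of the axes, because the local representative is
    constant in the complementary directions; K inverts it there.\<close>
  then obtain K where K: "linear K" "\<And>v. v \<in> span (axes S) \<Longrightarrow> K (L v) = v"
    using linear_exists_left_inverse_on[OF linL subspace_span] by blast
  define \<Theta> where "\<Theta> z = ?p (K (t z)) + (z - ?p z)" for z
  have smK: "smooth_at (\<lambda>z. ?p (K z)) w" for w
    using bounded_linear_compose[of ?p K] K(1) P(3) by (intro smooth_at_bounded_linear) (simp add: linear_linear)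
  have \<Theta>sm: "smooth_at \<Theta> ?y"
    unfolding \<Theta>_def[abs_def]
    by (intro smooth_at_add smooth_at_diff smooth_at_id smooth_at_proj[OF S c(1)]
        smooth_at_compose[where g = "\<lambda>z. ?p (K z)" and f = t] smK tsm)
  have "(\<Theta> has_derivative (\<lambda>v. ?p (K (L v)) + (v - ?p v))) (at ?y)"
    unfolding \<Theta>_def[abs_def]
    by (intro has_derivative_add has_derivative_diff has_derivative_ident dp
        has_derivative_compose[OF has_derivative_compose[OF dt linear_imp_has_derivative[OF K(1)]] dp])
  moreover have "(\<lambda>v. ?p (K (L v)) + (v - ?p v)) = id"
  proof
    fix v
    have "K (L v) = ?p v" using K(2)[OF P(5)[of v]] Lp[of v] by simp
    then show "?p (K (L v)) + (v - ?p v) = id v" by (simp add: P(4))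
  qed
  ultimately have "(\<Theta> has_derivative id) (at ?y)" by simp
  then obtain g where g: "smooth_at g (\<Theta> ?y)" "eventually (\<lambda>z. g (\<Theta> z) = z) (nhds ?y)"
    using smooth_local_inverse[OF \<Theta>sm] by blast
  have \<Theta>c: "\<Theta> (snd c z) = ?p (K (snd d (Q z)))" if "z \<in> fst c" for z
    using that by (simp add: \<Theta>_def t_def local_rep_chart[OF S c(1)] chart_proj[OF S c(1)])
  \<comment> \<open>In coordinates, f is recovered from the smooth composite of Q with f by the map
    K, the projection and the local inverse g.\<close>
  have "smooth_fun_at T (\<lambda>z. g (?p (K (snd d (Q (f z)))))) x"
  proof (rule smooth_fun_at_compose[OF T, of "\<lambda>z. ?p (K (snd d (Q (f z))))" x g])
    show "smooth_fun_at T (\<lambda>z. ?p (K (snd d (Q (f z))))) x"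
      by (rule smooth_fun_at_compose[OF T, of "\<lambda>z. snd d (Q (f z))" x "\<lambda>w. ?p (K w)"])
        (use Qf x d smK in \<open>auto simp: smooth_map_iff[OF T M]\<close>)
    show "smooth_at g (?p (K (snd d (Q (f x)))))" using g(1) \<Theta>c[OF c(2)] by simp
  qed
  then have "smooth_fun_at T (\<lambda>z. snd c (f z)) x"
  proof (rule smooth_fun_at_cong[OF T])
    have "eventually (\<lambda>w. g (\<Theta> (snd c w)) = snd c w \<and> w \<in> fst c) (nhdsin (man_top S) (f x))"
      using eventually_conj[OF eventually_chart[OF S c g(2)] eventually_in_chart[OF S c]] .
    from eventually_nhdsin_continuous_map[OF f x this]
    show "eventually (\<lambda>z. g (?p (K (snd d (Q (f z))))) = snd c (f z)) (nhdsin (man_top T) x)"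
      by (rule eventually_mono) (metis \<Theta>c)
  qed
  then show "\<exists>c\<in>atlas S. f x \<in> fst c \<and> smooth_fun_at T (\<lambda>z. snd c (f z)) x" using c by blast
qed

text \<open>Continuity comes from the inverse homeomorphism on the image of Q. Smoothness can then
  be tested after composing with Q, which gives back Q'.\<close>

lemma embedding_quotient_smooth:
  assumes S: "smooth_manifold S" and M: "smooth_manifold M" and Q: "Q \<in> embeddings S M" and Q': "Q' \<in> embeddings S M"
    and sub: "Q' ` points S \<subseteq> Q ` points S"
  shows "smooth_map S S (\<lambda>x. inv_into (points S) Q (Q' x))"
proof (rule smooth_map_into_embedded[OF S S M Q])
  note Qs = embeddingsD[OF Q] and Q's = embeddingsD[OF Q']
  have QQ: "Q (inv_into (points S) Q (Q' x)) = Q' x" if "x \<in> points S" for x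
    using sub that by (intro f_inv_into_f) auto
  obtain g where g: "homeomorphic_maps (man_top S) (subtopology (man_top M) (Q ` points S)) Q g"
    using Qs(3) unfolding embedding_map_def homeomorphic_map_maps by blast
  have "continuous_map (man_top S) (subtopology (man_top M) (Q ` points S)) Q'"
    using smooth_map_continuous[OF Q's(1)] sub by (auto simp: continuous_map_in_subtopology)
  then have "continuous_map (man_top S) (man_top S) (\<lambda>x. g (Q' x))"
    using continuous_map_compose[of "man_top S" _ Q' "man_top S" g] g by (simp add: homeomorphic_maps_def o_def)
  moreover have "g (Q' x) = inv_into (points S) Q (Q' x)" if x: "x \<in> points S" for x
  proof -
    obtain z where z: "z \<in> points S" "Q' x = Q z" using sub x by auto
    then have "g (Q z) = z" using g by (simp add: homeomorphic_maps_def)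
    then show ?thesis using z embedding_inj[OF Q] by simp
  qed
  ultimately show "continuous_map (man_top S) (man_top S) (\<lambda>x. inv_into (points S) Q (Q' x))"
    by (rule continuous_map_eq)
  show "smooth_map S M (\<lambda>x. Q (inv_into (points S) Q (Q' x)))"
    by (rule smooth_map_cong[OF S M Q's(1)]) (simp add: QQ)
qed

section \<open>The cotangent lifted action\<close>

context
  fixes S :: "('s, 'es::euclidean_space) manifold_struct"
    and \<mu> :: "'s \<Rightarrow> ('es \<Rightarrow> 's tangent) \<Rightarrow> real"
    and M :: "('m, 'em::euclidean_space) manifold_struct"
    and G :: "('g, 'eg::euclidean_space) lie_struct"
  assumes S: "smooth_manifold S" and cpt: "compact_space (man_top S)" and \<mu>: "volume_form S \<mu>"
    and M: "smooth_manifold M" and G: "lie_group G"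
begin

text \<open>
  Moving the action from the tangent vector to the covector changes variables in the integral over
  \<open>S\<close> and therefore produces the Jacobian.
\<close>

definition cotangent_lift :: "('s \<Rightarrow> 'm) \<times> ('s \<Rightarrow> 'g) \<Rightarrow> ('s \<Rightarrow> 'm cotangent) \<times> ('s \<Rightarrow> 'g cotangent)
    \<Rightarrow> ('s \<Rightarrow> 's) \<times> ('s \<Rightarrow> 'g) \<Rightarrow> ('s \<Rightarrow> 'm cotangent) \<times> ('s \<Rightarrow> 'g cotangent)" where
  "cotangent_lift q a h =
    (\<lambda>x\<in>points S. \<lambda>v. jacobian S \<mu> (fst h) x * fst a (fst h x) v,
     \<lambda>x\<in>points S. \<lambda>v. if v \<in> tangent_space (lie_man G) (snd q (fst h x) \<otimes>\<^bsub>G\<^esub> snd h x)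
       then jacobian S \<mu> (fst h) x * snd a (fst h x) (right_translate G v (inv\<^bsub>G\<^esub> (snd h x))) else 0)"

lemma act_inverse:
  assumes q: "q \<in> Q_KK S M G" and h: "h \<in> carrier (aut_group S G)"
  shows "act_Q S G (act_Q S G q h) (inv\<^bsub>aut_group S G\<^esub> h) = q"
proof -
  interpret group "aut_group S G" by (rule group_aut_group[OF S G])
  show ?thesis
    using act_Q_mult[OF S cpt \<mu> M G q h inv_closed[OF h]] act_Q_one[OF S cpt \<mu> M G q] r_inv[OF h] by simp
qed

lemma tangent_act_inverse_in:
  assumes q: "q \<in> Q_KK S M G" and h: "h \<in> carrier (aut_group S G)" and v: "v \<in> tangent_Q S M G (act_Q S G q h)"
  shows "tangent_act_Q S G v (inv\<^bsub>aut_group S G\<^esub> h) \<in> tangent_Q S M G q"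
proof -
  interpret group "aut_group S G" by (rule group_aut_group[OF S G])
  show ?thesis
    using tangent_act_in[OF S cpt \<mu> M G act_Q_in[OF S cpt \<mu> M G q h] v inv_closed[OF h]] act_inverse[OF q h] by simp
qed

lemma lift_integrand:
  assumes q: "q \<in> Q_KK S M G" and a: "a \<in> cotangent_Q S M G q" and h: "h \<in> carrier (aut_group S G)"
    and v: "v \<in> tangent_Q S M G (act_Q S G q h)" and x: "x \<in> points S"
  shows "fst (cotangent_lift q a h) x (fst v x) = jacobian S \<mu> (fst h) x * fst a (fst h x) (fst (tangent_act_Q S G v (inv\<^bsub>aut_group S G\<^esub> h)) (fst h x))"
    "snd (cotangent_lift q a h) x (snd v x) = jacobian S \<mu> (fst h) x * snd a (fst h x) (snd (tangent_act_Q S G v (inv\<^bsub>aut_group S G\<^esub> h)) (fst h x))"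
proof -
  note hD = aut_carrierD[OF S cpt \<mu> M G h]
  note \<psi> = diffeosD[OF hD(1)]
  have "snd v x \<in> tangent_space (lie_man G) (snd q (fst h x) \<otimes>\<^bsub>G\<^esub> snd h x)"
    using tangent_QD(6)[OF S cpt \<mu> M G v x] x by (simp add: act_Q_def case_prod_unfold)
  then show "fst (cotangent_lift q a h) x (fst v x) = jacobian S \<mu> (fst h) x * fst a (fst h x) (fst (tangent_act_Q S G v (inv\<^bsub>aut_group S G\<^esub> h)) (fst h x))"
    "snd (cotangent_lift q a h) x (snd v x) = jacobian S \<mu> (fst h) x * snd a (fst h x) (snd (tangent_act_Q S G v (inv\<^bsub>aut_group S G\<^esub> h)) (fst h x))"
    using x \<psi>(5)[OF x] \<psi>(8)[OF x]
    by (simp_all add: cotangent_lift_def inv_aut_group[OF S G h] tangent_act_Q_def case_prod_unfold)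
qed

lemma pairing_cotangent_lift:
  assumes q: "q \<in> Q_KK S M G" and a: "a \<in> cotangent_Q S M G q" and h: "h \<in> carrier (aut_group S G)"
    and v: "v \<in> tangent_Q S M G (act_Q S G q h)"
  shows "pairing_Q S \<mu> (cotangent_lift q a h) v = pairing_Q S \<mu> a (tangent_act_Q S G v (inv\<^bsub>aut_group S G\<^esub> h))"
proof -
  note hD = aut_carrierD[OF S cpt \<mu> M G h]
  let ?F = "\<lambda>x. fst a x (fst (tangent_act_Q S G v (inv\<^bsub>aut_group S G\<^esub> h)) x) + snd a x (snd (tangent_act_Q S G v (inv\<^bsub>aut_group S G\<^esub> h)) x)"
  have F: "?F \<in> smooth_funs S" by (rule integrand_smooth[OF S cpt \<mu> M G q a tangent_act_inverse_in[OF q h v]])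
  have "pairing_Q S \<mu> (cotangent_lift q a h) v = form_integral S \<mu> (\<lambda>x. jacobian S \<mu> (fst h) x * ?F (fst h x))"
    unfolding pairing_eq[OF S cpt \<mu> M G]
    by (rule form_integral_cong[OF S cpt \<mu>]) (simp add: lift_integrand[OF q a h v] distrib_left)
  then show ?thesis
    unfolding form_integral_diffeo[OF S cpt \<mu> hD(1) F] pairing_eq[OF S cpt \<mu> M G] .
qed

lemma zero_field_in:
  assumes N: "smooth_manifold N" and Q: "smooth_map S N Q"
  shows "(\<lambda>x\<in>points S. \<lambda>f. 0) \<in> vector_fields_along S N Q"
  unfolding vector_fields_along_iff[OF S N Q]
  using smooth_funs_cong[OF S smooth_funs_const[OF S, of 0]] by (auto simp: tangent_zero)

lemma cotangent_lift_in:
  assumes q: "q \<in> Q_KK S M G" and a: "a \<in> cotangent_Q S M G q" and h: "h \<in> carrier (aut_group S G)"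
  shows "cotangent_lift q a h \<in> cotangent_Q S M G (act_Q S G q h)"
proof -
  note hD = aut_carrierD[OF S cpt \<mu> M G h]
  note \<psi> = diffeosD[OF hD(1)]
  note q' = act_Q_in[OF S cpt \<mu> M G q h]
  note q'D = Q_KKD[OF S cpt \<mu> M G q'] and qD = Q_KKD[OF S cpt \<mu> M G q] and aD = cotangent_QD[OF S cpt \<mu> M G a]
  note GMm = lie_group_manifold[OF G]
  have J: "jacobian S \<mu> (fst h) \<in> smooth_funs S" by (rule jacobian_smooth[OF S cpt \<mu> hD(1)])
  have q'v: "fst (act_Q S G q h) x = fst q (fst h x)" "snd (act_Q S G q h) x = snd q (fst h x) \<otimes>\<^bsub>G\<^esub> snd h x" if "x \<in> points S" for x
    using that by (simp_all add: act_Q_def case_prod_unfold)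
  have ci: "inv\<^bsub>G\<^esub> (snd h x) \<in> carrier G" "snd q (fst h x) \<otimes>\<^bsub>G\<^esub> snd h x \<otimes>\<^bsub>G\<^esub> inv\<^bsub>G\<^esub> (snd h x) = snd q (fst h x)"
    if x: "x \<in> points S" for x
  proof -
    interpret g: group G by (rule lie_group_group[OF G])
    show "inv\<^bsub>G\<^esub> (snd h x) \<in> carrier G" using hD(4)[OF x] by simp
    show "snd q (fst h x) \<otimes>\<^bsub>G\<^esub> snd h x \<otimes>\<^bsub>G\<^esub> inv\<^bsub>G\<^esub> (snd h x) = snd q (fst h x)"
      using hD(4)[OF x] qD(7)[OF \<psi>(5)[OF x]] by (simp add: g.m_assoc)
  qed
  have "fst (cotangent_lift q a h) \<in> covector_fields_along S M (fst (act_Q S G q h))"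
    unfolding covector_fields_along_iff[OF S M q'D(2)]
  proof (intro conjI ballI)
    fix x assume x: "x \<in> points S"
    show "fst (cotangent_lift q a h) x \<in> cotangent_space M (fst (act_Q S G q h) x)"
      using aD(5)[OF \<psi>(5)[OF x]] x by (auto simp: cotangent_lift_def q'v cotangent_space_def algebra_simps)
  next
    fix V assume V: "V \<in> vector_fields_along S M (fst (act_Q S G q h))"
    \<comment> \<open>The other component is set to zero, so that the action on pairs yields the
      smoothness of this component alone.\<close>
    let ?v = "(V, \<lambda>x\<in>points S. \<lambda>f. 0) :: ('s \<Rightarrow> 'm tangent) \<times> ('s \<Rightarrow> 'g tangent)"
    have v: "?v \<in> tangent_Q S M G (act_Q S G q h)"
      using V zero_field_in[OF GMm q'D(3)] by (simp add: tangent_Q_def)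
    have "(\<lambda>x. fst a x (fst (tangent_act_Q S G ?v (inv\<^bsub>aut_group S G\<^esub> h)) x)) \<in> smooth_funs S"
      using aD(1) tangent_QD(1)[OF S cpt \<mu> M G tangent_act_inverse_in[OF q h v]]
      unfolding covector_fields_along_iff[OF S M qD(2)] by blast
    from smooth_funs_mult[OF S J smooth_funs_compose[OF S S \<psi>(1) this]]
    show "(\<lambda>x. fst (cotangent_lift q a h) x (V x)) \<in> smooth_funs S"
      by (rule smooth_funs_cong[OF S]) (use lift_integrand(1)[OF q a h v] in simp)
  qed (simp add: cotangent_lift_def)
  moreover have "snd (cotangent_lift q a h) \<in> covector_fields_along S (lie_man G) (snd (act_Q S G q h))"
    unfolding covector_fields_along_iff[OF S GMm q'D(3)]
  proof (intro conjI ballI)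
    fix x assume x: "x \<in> points S"
    have l: "snd a (fst h x) \<in> cotangent_space (lie_man G) (snd q (fst h x))" by (rule aD(6)[OF \<psi>(5)[OF x]])
    have rt: "right_translate G v (inv\<^bsub>G\<^esub> (snd h x)) \<in> tangent_space (lie_man G) (snd q (fst h x))"
      if "v \<in> tangent_space (lie_man G) (snd q (fst h x) \<otimes>\<^bsub>G\<^esub> snd h x)" for v
      using right_translate_tangent[OF G ci(1)[OF x] that] ci(2)[OF x] by simp
    show "snd (cotangent_lift q a h) x \<in> cotangent_space (lie_man G) (snd (act_Q S G q h) x)"
      unfolding cotangent_space_def q'v(2)[OF x]
    proof (intro CollectI conjI ballI allI impI)
      fix v w s t
      assume v: "v \<in> tangent_space (lie_man G) (snd q (fst h x) \<otimes>\<^bsub>G\<^esub> snd h x)"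
        and w: "w \<in> tangent_space (lie_man G) (snd q (fst h x) \<otimes>\<^bsub>G\<^esub> snd h x)"
      show "snd (cotangent_lift q a h) x (\<lambda>f. s * v f + t * w f) =
          s * snd (cotangent_lift q a h) x v + t * snd (cotangent_lift q a h) x w"
        using x v w tangent_combine[OF GMm v w, of s t] cotangent_lincomb[OF l rt[OF v] rt[OF w], of s t]
        by (simp add: cotangent_lift_def right_translate_combine[OF G] algebra_simps)
    qed (simp add: cotangent_lift_def x)
  next
    fix V assume V: "V \<in> vector_fields_along S (lie_man G) (snd (act_Q S G q h))"
    let ?v = "(\<lambda>x\<in>points S. \<lambda>f. 0, V) :: ('s \<Rightarrow> 'm tangent) \<times> ('s \<Rightarrow> 'g tangent)"
    have v: "?v \<in> tangent_Q S M G (act_Q S G q h)"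
      using V zero_field_in[OF M q'D(2)] by (simp add: tangent_Q_def)
    have "(\<lambda>x. snd a x (snd (tangent_act_Q S G ?v (inv\<^bsub>aut_group S G\<^esub> h)) x)) \<in> smooth_funs S"
      using aD(2)[unfolded covector_fields_along_iff[OF S GMm qD(3)], THEN conjunct2, THEN conjunct2]
        tangent_QD(2)[OF S cpt \<mu> M G tangent_act_inverse_in[OF q h v]] by (rule bspec)
    from smooth_funs_mult[OF S J smooth_funs_compose[OF S S \<psi>(1) this]]
    show "(\<lambda>x. snd (cotangent_lift q a h) x (V x)) \<in> smooth_funs S"
      by (rule smooth_funs_cong[OF S]) (use lift_integrand(2)[OF q a h v] in simp)
  qed (simp add: cotangent_lift_def)
  ultimately show ?thesis by (simp add: cotangent_Q_def mem_Times_iff)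
qed

text \<open>Any regular covector with the prescribed pairings is the value of the action. It is used
  with three witnesses: the explicit lift, the covector itself for the identity, and the iterated
  lift for a product.\<close>

lemma cotangent_act_unique:
  assumes q: "q \<in> Q_KK S M G" and h: "h \<in> carrier (aut_group S G)"
    and a': "a' \<in> cotangent_Q S M G (act_Q S G q h)"
    and eq: "\<And>v. v \<in> tangent_Q S M G (act_Q S G q h) \<Longrightarrow> pairing_Q S \<mu> a' v = pairing_Q S \<mu> a (tangent_act_Q S G v (inv\<^bsub>aut_group S G\<^esub> h))"
  shows "cotangent_act_Q S \<mu> M G (q, a) h = (act_Q S G q h, a')"
proof -
  have "(THE a'. a' \<in> cotangent_Q S M G (act_Q S G q h) \<and>
      (\<forall>v\<in>tangent_Q S M G (act_Q S G q h). pairing_Q S \<mu> a' v = pairing_Q S \<mu> a (tangent_act_Q S G v (inv\<^bsub>aut_group S G\<^esub> h)))) = a'"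
  proof (rule the_equality)
    show "a' \<in> cotangent_Q S M G (act_Q S G q h) \<and>
      (\<forall>v\<in>tangent_Q S M G (act_Q S G q h). pairing_Q S \<mu> a' v = pairing_Q S \<mu> a (tangent_act_Q S G v (inv\<^bsub>aut_group S G\<^esub> h)))" using a' eq by blast
    fix a'' assume "a'' \<in> cotangent_Q S M G (act_Q S G q h) \<and>
      (\<forall>v\<in>tangent_Q S M G (act_Q S G q h). pairing_Q S \<mu> a'' v = pairing_Q S \<mu> a (tangent_act_Q S G v (inv\<^bsub>aut_group S G\<^esub> h)))"
    then show "a'' = a'"
      using eq by (intro pairing_nondegenerate[OF S cpt \<mu> M G act_Q_in[OF S cpt \<mu> M G q h] _ a']) auto
  qed
  then show ?thesis by (simp add: cotangent_act_Q_def)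
qed

lemma cotangent_act_eq_lift:
  assumes q: "q \<in> Q_KK S M G" and a: "a \<in> cotangent_Q S M G q" and h: "h \<in> carrier (aut_group S G)"
  shows "cotangent_act_Q S \<mu> M G (q, a) h = (act_Q S G q h, cotangent_lift q a h)"
  by (rule cotangent_act_unique[OF q h cotangent_lift_in[OF q a h] pairing_cotangent_lift[OF q a h]])

text \<open>The Jacobian is positive and right translation by \<open>snd h x\<close> is invertible,
  so a vector detected before the lift has a counterpart detected after it.\<close>

lemma cotangent_lift_nonzero:
  assumes q: "q \<in> Q_KK S M G" and a: "a \<in> cotangent_Q S M G q" and h: "h \<in> carrier (aut_group S G)"
    and x: "x \<in> points S" and nz: "fst a (fst h x) \<noteq> (\<lambda>_. 0) \<or> snd a (fst h x) \<noteq> (\<lambda>_. 0)"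
  shows "fst (cotangent_lift q a h) x \<noteq> (\<lambda>_. 0) \<or> snd (cotangent_lift q a h) x \<noteq> (\<lambda>_. 0)"
proof -
  note hD = aut_carrierD[OF S cpt \<mu> M G h]
  note \<psi>x = diffeosD(5)[OF hD(1) x]
  interpret g: group G by (rule lie_group_group[OF G])
  have J: "jacobian S \<mu> (fst h) x \<noteq> 0" using jacobian_pos[OF S cpt \<mu> hD(1) x] by simp
  show ?thesis
  proof (cases "fst a (fst h x) = (\<lambda>_. 0)")
    case False
    then obtain v where "fst a (fst h x) v \<noteq> 0" by auto
    then have "fst (cotangent_lift q a h) x v \<noteq> 0" using J x by (simp add: cotangent_lift_def)
    then show ?thesis by auto
  next
    case True
    then obtain w where w: "snd a (fst h x) w \<noteq> 0" using nz by auto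
    have l: "snd a (fst h x) \<in> cotangent_space (lie_man G) (snd q (fst h x))"
      by (rule cotangent_QD(6)[OF S cpt \<mu> M G a \<psi>x])
    have wT: "w \<in> tangent_space (lie_man G) (snd q (fst h x))" using cotangent_outside[OF l] w by blast
    have gq: "snd q (fst h x) \<in> carrier G" by (rule Q_KKD(7)[OF S cpt \<mu> M G q \<psi>x])
    have gb: "snd h x \<in> carrier G" by (rule hD(4)[OF x])
    define v where "v = right_translate G w (snd h x)"
    have vT: "v \<in> tangent_space (lie_man G) (snd q (fst h x) \<otimes>\<^bsub>G\<^esub> snd h x)"
      unfolding v_def by (rule right_translate_tangent[OF G gb wT])
    have "right_translate G v (inv\<^bsub>G\<^esub> (snd h x)) = w"
      unfolding v_def right_translate_mult[OF G gq gb g.inv_closed[OF gb] wT] g.r_inv[OF gb]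
      by (rule right_translate_one[OF G gq wT])
    then have "snd (cotangent_lift q a h) x v \<noteq> 0" using J x vT w by (simp add: cotangent_lift_def)
    then show ?thesis by auto
  qed
qed

text \<open>Generators multiply the group component from the left of \<open>snd q\<close>, the
  automorphism from its right; associativity makes the two operations commute.\<close>

lemma tangent_act_generator:
  assumes q: "q \<in> Q_KK S M G" and w: "w \<in> vector_fields M \<times> lie_algebra_maps M G" and h: "h \<in> carrier (aut_group S G)"
  shows "tangent_act_Q S G (generator S G q w) h = generator S G (act_Q S G q h) w"
proof -
  note hD = aut_carrierD[OF S cpt \<mu> M G h] and qD = Q_KKD[OF S cpt \<mu> M G q]
  note pts = diffeosD(5)[OF hD(1)]
  have one: "\<one>\<^bsub>G\<^esub> \<in> carrier G" using monoid.one_closed[OF group.is_monoid[OF lie_group_group[OF G]]] .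
  have "right_translate G (right_translate G (snd w (fst q (fst h x))) (snd q (fst h x))) (snd h x) =
      right_translate G (snd w (fst q (fst h x))) (snd q (fst h x) \<otimes>\<^bsub>G\<^esub> snd h x)" if x: "x \<in> points S" for x
  proof (rule right_translate_mult[OF G one qD(7)[OF pts[OF x]] hD(4)[OF x]])
    show "snd w (fst q (fst h x)) \<in> tangent_space (lie_man G) \<one>\<^bsub>G\<^esub>"
      using lie_algebra_mapsD[OF S cpt \<mu> M G, of "snd w" "fst q (fst h x)"] w qD(6)[OF pts[OF x]]
      by (auto simp: lie_algebra_def)
  qed
  then show ?thesis
    using pts by (auto simp: generator_def[OF S cpt \<mu> M G] tangent_act_Q_def act_Q_def case_prod_unfold intro!: restrict_ext)
qed

text \<open>Moving the action to the other side of the pairing brings the generator at q h back to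
  the generator at q. This is the invariance of the momentum.\<close>

lemma pairing_lift_generator:
  assumes q: "q \<in> Q_KK S M G" and a: "a \<in> cotangent_Q S M G q" and h: "h \<in> carrier (aut_group S G)"
    and w: "w \<in> vector_fields M \<times> lie_algebra_maps M G"
  shows "pairing_Q S \<mu> (cotangent_lift q a h) (generator S G (act_Q S G q h) w) = pairing_Q S \<mu> a (generator S G q w)"
proof -
  interpret group "aut_group S G" by (rule group_aut_group[OF S G])
  note q' = act_Q_in[OF S cpt \<mu> M G q h]
  show ?thesis
    unfolding pairing_cotangent_lift[OF q a h generator_in[OF S cpt \<mu> M G q' w]]
      tangent_act_generator[OF q' w inv_closed[OF h]] act_inverse[OF q h] ..
qed

lemma momentum_cotangent_lift:
  assumes q: "q \<in> Q_KK S M G" and a: "a \<in> cotangent_Q S M G q" and h: "h \<in> carrier (aut_group S G)"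
  shows "momentum_map_L S \<mu> M G (act_Q S G q h, cotangent_lift q a h) = momentum_map_L S \<mu> M G (q, a)"
  unfolding momentum_map_eq_iff[OF S cpt \<mu> M G act_Q_in[OF S cpt \<mu> M G q h] q]
  using pairing_lift_generator[OF q a h] by blast

lemma nz_bundleD:
  "(q, a) \<in> cotangent_bundle_Q_nz S M G \<longleftrightarrow> q \<in> Q_KK S M G \<and> a \<in> cotangent_Q S M G q \<and>
    (\<forall>x\<in>points S. fst a x \<noteq> (\<lambda>_. 0) \<or> snd a x \<noteq> (\<lambda>_. 0))"
  by (cases a) (auto simp: cotangent_bundle_Q_nz_def cotangent_bundle_Q_def)

text \<open>Closedness combines invariance of the momentum with preservation of non-vanishing. The
  unit and product laws follow from uniqueness, because the tangent action already satisfies the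
  corresponding laws.\<close>

lemma right_action_level_set:
  "right_action (aut_group S G) {\<alpha> \<in> cotangent_bundle_Q_nz S M G. momentum_map_L S \<mu> M G \<alpha> = J}
     (cotangent_act_Q S \<mu> M G)"
  unfolding right_action_def
proof (intro conjI ballI)
  interpret A: group "aut_group S G" by (rule group_aut_group[OF S G])
  show "group (aut_group S G)" by (rule group_aut_group[OF S G])
  let ?X = "{\<alpha> \<in> cotangent_bundle_Q_nz S M G. momentum_map_L S \<mu> M G \<alpha> = J}"
  let ?act = "cotangent_act_Q S \<mu> M G"
  {
    fix \<alpha> h assume \<alpha>: "\<alpha> \<in> ?X" and h: "h \<in> carrier (aut_group S G)"
    obtain q a where qa: "\<alpha> = (q, a)" by (cases \<alpha>)
    have q: "q \<in> Q_KK S M G" and a: "a \<in> cotangent_Q S M G q"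
      and nz: "\<And>x. x \<in> points S \<Longrightarrow> fst a x \<noteq> (\<lambda>_. 0) \<or> snd a x \<noteq> (\<lambda>_. 0)"
      using \<alpha> by (auto simp: qa nz_bundleD)
    note pts = diffeosD(5)[OF aut_carrierD(1)[OF S cpt \<mu> M G h]]
    show "?act \<alpha> h \<in> ?X"
      unfolding qa cotangent_act_eq_lift[OF q a h]
      using act_Q_in[OF S cpt \<mu> M G q h] cotangent_lift_in[OF q a h] cotangent_lift_nonzero[OF q a h _ nz[OF pts]]
        momentum_cotangent_lift[OF q a h] \<alpha>
      by (simp add: nz_bundleD qa)
  }
  {
    fix \<alpha> assume \<alpha>: "\<alpha> \<in> ?X"
    obtain q a where qa: "\<alpha> = (q, a)" by (cases \<alpha>)
    have q: "q \<in> Q_KK S M G" and a: "a \<in> cotangent_Q S M G q" using \<alpha> by (auto simp: qa nz_bundleD)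
    have q1: "act_Q S G q \<one>\<^bsub>aut_group S G\<^esub> = q" by (rule act_Q_one[OF S cpt \<mu> M G q])
    have "?act (q, a) \<one>\<^bsub>aut_group S G\<^esub> = (act_Q S G q \<one>\<^bsub>aut_group S G\<^esub>, a)"
      by (rule cotangent_act_unique[OF q A.one_closed])
        (simp_all add: q1 a tangent_act_one[OF S cpt \<mu> M G q])
    then show "?act \<alpha> \<one>\<^bsub>aut_group S G\<^esub> = \<alpha>" by (simp add: qa q1)
  }
  {
    fix \<alpha> h k assume \<alpha>: "\<alpha> \<in> ?X" and h: "h \<in> carrier (aut_group S G)" and k: "k \<in> carrier (aut_group S G)"
    obtain q a where qa: "\<alpha> = (q, a)" by (cases \<alpha>)
    have q: "q \<in> Q_KK S M G" and a: "a \<in> cotangent_Q S M G q" using \<alpha> by (auto simp: qa nz_bundleD)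
    note q' = act_Q_in[OF S cpt \<mu> M G q h] and a' = cotangent_lift_in[OF q a h]
    have m: "act_Q S G q (h \<otimes>\<^bsub>aut_group S G\<^esub> k) = act_Q S G (act_Q S G q h) k" by (rule act_Q_mult[OF S cpt \<mu> M G q h k])
    have "?act (q, a) (h \<otimes>\<^bsub>aut_group S G\<^esub> k) = (act_Q S G q (h \<otimes>\<^bsub>aut_group S G\<^esub> k), cotangent_lift (act_Q S G q h) (cotangent_lift q a h) k)"
    proof (rule cotangent_act_unique[OF q A.m_closed[OF h k]])
      show "cotangent_lift (act_Q S G q h) (cotangent_lift q a h) k \<in> cotangent_Q S M G (act_Q S G q (h \<otimes>\<^bsub>aut_group S G\<^esub> k))"
        unfolding m by (rule cotangent_lift_in[OF q' a' k])
      fix v assume "v \<in> tangent_Q S M G (act_Q S G q (h \<otimes>\<^bsub>aut_group S G\<^esub> k))"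
      then have v: "v \<in> tangent_Q S M G (act_Q S G (act_Q S G q h) k)" by (simp add: m)
      \<comment> \<open>The iterated lift has the pairings required for the product: the two inverse
        tangent actions compose to the action of the inverse of h k. The uniqueness lemma thus
        identifies it without computing the Jacobian of a composite.\<close>
      have "pairing_Q S \<mu> (cotangent_lift (act_Q S G q h) (cotangent_lift q a h) k) v =
          pairing_Q S \<mu> a (tangent_act_Q S G (tangent_act_Q S G v (inv\<^bsub>aut_group S G\<^esub> k)) (inv\<^bsub>aut_group S G\<^esub> h))"
        unfolding pairing_cotangent_lift[OF q' a' k v]
        by (rule pairing_cotangent_lift[OF q a h tangent_act_inverse_in[OF q' k v]])
      also have "tangent_act_Q S G (tangent_act_Q S G v (inv\<^bsub>aut_group S G\<^esub> k)) (inv\<^bsub>aut_group S G\<^esub> h) = tangent_act_Q S G v (inv\<^bsub>aut_group S G\<^esub> (h \<otimes>\<^bsub>aut_group S G\<^esub> k))"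
        unfolding A.inv_mult_group[OF h k]
        by (rule tangent_act_mult[OF S cpt \<mu> M G act_Q_in[OF S cpt \<mu> M G q' k] v A.inv_closed[OF k] A.inv_closed[OF h], symmetric])
      finally show "pairing_Q S \<mu> (cotangent_lift (act_Q S G q h) (cotangent_lift q a h) k) v =
          pairing_Q S \<mu> a (tangent_act_Q S G v (inv\<^bsub>aut_group S G\<^esub> (h \<otimes>\<^bsub>aut_group S G\<^esub> k)))" .
    qed
    then show "?act \<alpha> (h \<otimes>\<^bsub>aut_group S G\<^esub> k) = ?act (?act \<alpha> h) k"
      unfolding qa cotangent_act_eq_lift[OF q a h] cotangent_act_eq_lift[OF q' a' k] m .
  }
qed

text \<open>The image inclusion is used in both directions, which gives smooth maps \<psi> and
  \<phi> between the two parametrizations; injectivity of the embeddings makes them inverse to each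
  other. The momentum then fixes the covector over the common base point.\<close>

lemma transitive_level_set:
  assumes \<alpha>: "(q, a) \<in> cotangent_bundle_Q_nz S M G" and \<alpha>': "(q', a') \<in> cotangent_bundle_Q_nz S M G"
    and eq: "momentum_map_L S \<mu> M G (q, a) = momentum_map_L S \<mu> M G (q', a')"
  shows "\<exists>h\<in>carrier (aut_group S G). cotangent_act_Q S \<mu> M G (q, a) h = (q', a')"
proof -
  interpret g: group G by (rule lie_group_group[OF G])
  note GMm = lie_group_manifold[OF G]
  have q: "q \<in> Q_KK S M G" and a: "a \<in> cotangent_Q S M G q"
    and nz: "\<And>x. x \<in> points S \<Longrightarrow> fst a x \<noteq> (\<lambda>_. 0) \<or> snd a x \<noteq> (\<lambda>_. 0)"
    and q': "q' \<in> Q_KK S M G" and a': "a' \<in> cotangent_Q S M G q'"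
    and nz': "\<And>x. x \<in> points S \<Longrightarrow> fst a' x \<noteq> (\<lambda>_. 0) \<or> snd a' x \<noteq> (\<lambda>_. 0)"
    using \<alpha> \<alpha>' by (auto simp: nz_bundleD)
  note qD = Q_KKD[OF S cpt \<mu> M G q] and q'D = Q_KKD[OF S cpt \<mu> M G q']
  have peq: "pairing_Q S \<mu> a (generator S G q w) = pairing_Q S \<mu> a' (generator S G q' w)"
    if "w \<in> vector_fields M \<times> lie_algebra_maps M G" for w
    using eq that unfolding momentum_map_eq_iff[OF S cpt \<mu> M G q q'] by blast
  have sub1: "fst q ` points S \<subseteq> fst q' ` points S"
    by (rule momentum_image_subset[OF S cpt \<mu> M G q a nz q' a' peq])
  have sub2: "fst q' ` points S \<subseteq> fst q ` points S"
    by (rule momentum_image_subset[OF S cpt \<mu> M G q' a' nz' q a peq[symmetric]])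
  let ?i = "inv_into (points S) (fst q)" and ?i' = "inv_into (points S) (fst q')"
  define \<psi> where "\<psi> = (\<lambda>x. ?i (fst q' x))"
  define \<phi> where "\<phi> = (\<lambda>x. ?i' (fst q x))"
  have \<psi>s: "smooth_map S S \<psi>" unfolding \<psi>_def by (rule embedding_quotient_smooth[OF S M qD(1) q'D(1) sub2])
  have \<phi>s: "smooth_map S S \<phi>" unfolding \<phi>_def by (rule embedding_quotient_smooth[OF S M q'D(1) qD(1) sub1])
  have Q\<psi>: "fst q (\<psi> x) = fst q' x" if "x \<in> points S" for x
    unfolding \<psi>_def using sub2 that by (intro f_inv_into_f) auto
  have Q\<phi>: "fst q' (\<phi> x) = fst q x" if "x \<in> points S" for x
    unfolding \<phi>_def using sub1 that by (intro f_inv_into_f) auto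
  note \<psi>p = smooth_map_points[OF \<psi>s] and \<phi>p = smooth_map_points[OF \<phi>s]
  have "\<psi> (\<phi> x) = x" if x: "x \<in> points S" for x
    using Q\<psi>[OF \<phi>p[OF x]] Q\<phi>[OF x] embedding_inj[OF qD(1)] \<psi>p[OF \<phi>p[OF x]] x by (auto simp: inj_on_def)
  moreover have "\<phi> (\<psi> x) = x" if x: "x \<in> points S" for x
    using Q\<phi>[OF \<psi>p[OF x]] Q\<psi>[OF x] embedding_inj[OF q'D(1)] \<phi>p[OF \<psi>p[OF x]] x by (auto simp: inj_on_def)
  ultimately have \<psi>d: "restrict \<psi> (points S) \<in> diffeos S" by (intro diffeosI[OF S \<psi>s \<phi>s])
  define b where "b = (\<lambda>x. inv\<^bsub>G\<^esub> (snd q (\<psi> x)) \<otimes>\<^bsub>G\<^esub> snd q' x)"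
  have bs: "smooth_map S (lie_man G) b"
    unfolding b_def
    by (rule smooth_map_lie_mult[OF G S smooth_map_lie_inv[OF G S smooth_map_compose[OF S S GMm \<psi>s qD(3)]] q'D(3)])
  define h where "h = (restrict \<psi> (points S), restrict b (points S))"
  have h: "h \<in> carrier (aut_group S G)"
    using \<psi>d smooth_maps_restrict[OF S GMm bs] by (simp add: h_def aut_group_def)
  have "snd q (\<psi> x) \<otimes>\<^bsub>G\<^esub> b x = snd q' x" if x: "x \<in> points S" for x
    using qD(7)[OF \<psi>p[OF x]] q'D(7)[OF x] by (simp add: b_def g.m_assoc[symmetric])
  then have qh: "act_Q S G q h = q'"
    unfolding h_def act_Q_def case_prod_unfold
    by (intro prod_eqI extensionalityI[of _ "points S"]) (auto simp: Q\<psi> q'D(4,5))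
  have "cotangent_lift q a h = a'"
  proof (rule momentum_injective[OF S cpt \<mu> M G q' _ a'])
    show "cotangent_lift q a h \<in> cotangent_Q S M G q'" using cotangent_lift_in[OF q a h] by (simp add: qh)
    show "pairing_Q S \<mu> (cotangent_lift q a h) (generator S G q' w) = pairing_Q S \<mu> a' (generator S G q' w)"
      if w: "w \<in> vector_fields M \<times> lie_algebra_maps M G" for w
      using pairing_lift_generator[OF q a h w] peq[OF w] by (simp add: qh)
  qed
  then show ?thesis using cotangent_act_eq_lift[OF q a h] h qh by auto
qed

end

theorem proposition3p3:
  fixes S :: "('s, 'es::euclidean_space) manifold_struct"
    and \<mu> :: "'s \<Rightarrow> ('es \<Rightarrow> 's tangent) \<Rightarrow> real"
    and M :: "('m, 'em::euclidean_space) manifold_struct"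
    and G :: "('g, 'eg::euclidean_space) lie_struct"
  assumes "smooth_manifold S" and "compact_space (man_top S)" and "volume_form S \<mu>"
    and "smooth_manifold M" and "man_dim S \<le> man_dim M"
    and "lie_group G" and "compact_space (man_top (lie_man G))"
  shows "\<forall>J. transitive_right_action (aut_group S G)
           {\<alpha> \<in> cotangent_bundle_Q_nz S M G. momentum_map_L S \<mu> M G \<alpha> = J}
           (cotangent_act_Q S \<mu> M G)"
  unfolding transitive_right_action_def
  using right_action_level_set[OF assms(1-4,6)] transitive_level_set[OF assms(1-4,6)] by force

end
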